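(* Let $s$ be a positive integer and let $$B=A_{0}\subseteq A_{1}\subseteq\cdots\subseteq A_{s-1}\subseteq A_{s}=A$$ be a chain of subalgebras (all with the same identity) of an Artin algebra $A$ such that $\mathrm{rad}(A_{i-1})$ is a left ideal of $A_{i}$ for all $1\leq i\leq s$ and such that $A$ is 1-syzygy-finite. Then the finitistic dimension of $B$ is finite provided one of the following conditions is satisfied: (1) $B/\mathrm{rad}(A_{s-1})\cdots\mathrm{rad}(A_{1})\,\mathrm{rad}(A_{0})$ is $B$-syzygy-finite (for example, $B/\mathrm{rad}(A_{s-1})\cdots\mathrm{rad}(A_{1})\,\mathrm{rad}(A_{0})$ is representation-finite). (2) $A_{1}/\mathrm{rad}(A_{s-1})\cdots\mathrm{rad}(A_{1})$ is $B$-syzygy-finite (for example, $A_{1}/\mathrm{rad}(A_{s-1})\cdots\mathrm{rad}(A_{1})$ is representation-finite).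
   Context: All algebras are Artin $R$-algebras over a commutative Artin ring $R$; all modules are finitely generated left modules; $\mathrm{rad}$ denotes the Jacobson radical. The finitistic dimension of $B$ is the supremum of the projective dimensions of those $B$-modules that have finite projective dimension. An Artin algebra is representation-finite if it has only finitely many isomorphism classes of indecomposable modules. $\Omega_A^i(M)$ is the $i$-th syzygy of $M$ (via projective covers), with $\Omega_A^0(M)=M$, and $\mathrm{add}({}_AN)$ is the class of direct summands of finite direct sums of copies of $N$. $A$ is 1-syzygy-finite if there is an $A$-module $N$ with $\Omega_A^1(X)\in\mathrm{add}({}_AN)$ for every $A$-module $X$. For an Artin algebra $C$ and a homomorphism of algebras $B\to C$ preserving identities, $C$-modules are regarded as $B$-modules via this homomorphism, and $C$ is called $B$-syzygy-finite if there are an integer $n\ge 0$ and a $B$-module $N$ such that $\Omega_B^n(X)\in\mathrm{add}({}_BN)$ for every $C$-module $X$. Here the quotient algebras receive the natural homomorphisms from $B$. When $s=1$, the algebra $A_1/\mathrm{rad}(A_{s-1})\cdots\mathrm{rad}(A_1)$ in (2) is understood to be $0$, so that condition (2) holds automatically. *)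

theory Defs
  imports
    "HOL-Algebra.Module"
    "HOL-Algebra.Subrings"
    "HOL-Algebra.QuotRing"
    "HOL-Algebra.Ideal_Product"
    "HOL-Library.Extended_Nat"
begin

section \<open>Left modules over a (non-commutative) ring\<close>

text \<open>
  The library locale \<open>module\<close> requires a commutative ring of scalars; the
  axioms below are the same over an arbitrary ring. As in the library, the record fields
  \<open>mult\<close> and \<open>one\<close> of a module carry no meaning.
\<close>

locale left_module = R?: ring R + M?: abelian_group M
  for R :: "('a, 'x) ring_scheme" (structure) and M :: "('a, 'm) module" (structure) +
  assumes smult_closed [simp, intro]:
      "\<lbrakk> a \<in> carrier R; x \<in> carrier M \<rbrakk> \<Longrightarrow> a \<odot>\<^bsub>M\<^esub> x \<in> carrier M"
    and smult_l_distr: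
      "\<lbrakk> a \<in> carrier R; b \<in> carrier R; x \<in> carrier M \<rbrakk> \<Longrightarrow>
        (a \<oplus> b) \<odot>\<^bsub>M\<^esub> x = a \<odot>\<^bsub>M\<^esub> x \<oplus>\<^bsub>M\<^esub> b \<odot>\<^bsub>M\<^esub> x"
    and smult_r_distr:
      "\<lbrakk> a \<in> carrier R; x \<in> carrier M; y \<in> carrier M \<rbrakk> \<Longrightarrow>
        a \<odot>\<^bsub>M\<^esub> (x \<oplus>\<^bsub>M\<^esub> y) = a \<odot>\<^bsub>M\<^esub> x \<oplus>\<^bsub>M\<^esub> a \<odot>\<^bsub>M\<^esub> y"
    and smult_assoc1:
      "\<lbrakk> a \<in> carrier R; b \<in> carrier R; x \<in> carrier M \<rbrakk> \<Longrightarrow>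
        (a \<otimes> b) \<odot>\<^bsub>M\<^esub> x = a \<odot>\<^bsub>M\<^esub> (b \<odot>\<^bsub>M\<^esub> x)"
    and smult_one [simp]:
      "x \<in> carrier M \<Longrightarrow> \<one> \<odot>\<^bsub>M\<^esub> x = x"

definition finitely_generated :: "('a, 'x) ring_scheme \<Rightarrow> ('a, 'm) module \<Rightarrow> bool" where
  "finitely_generated R M \<longleftrightarrow>
     (\<exists>S. finite S \<and> S \<subseteq> carrier M \<and> (\<forall>U. submodule U R M \<and> S \<subseteq> U \<longrightarrow> U = carrier M))"

definition fg_module :: "('a, 'x) ring_scheme \<Rightarrow> ('a, 'm) module \<Rightarrow> bool" where
  "fg_module R M \<longleftrightarrow> left_module R M \<and> finitely_generated R M"

definition mod_hom ::
    "('a, 'x) ring_scheme \<Rightarrow> ('a, 'm) module \<Rightarrow> ('a, 'n) module \<Rightarrow> ('m \<Rightarrow> 'n) set" where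
  "mod_hom R M N = {f \<in> carrier M \<rightarrow> carrier N.
     (\<forall>x\<in>carrier M. \<forall>y\<in>carrier M. f (x \<oplus>\<^bsub>M\<^esub> y) = f x \<oplus>\<^bsub>N\<^esub> f y) \<and>
     (\<forall>a\<in>carrier R. \<forall>x\<in>carrier M. f (a \<odot>\<^bsub>M\<^esub> x) = a \<odot>\<^bsub>N\<^esub> f x)}"

definition mod_iso :: "('a, 'x) ring_scheme \<Rightarrow> ('a, 'm) module \<Rightarrow> ('a, 'n) module \<Rightarrow> bool" where
  "mod_iso R M N \<longleftrightarrow> (\<exists>f\<in>mod_hom R M N. bij_betw f (carrier M) (carrier N))"

definition internal_direct_sum ::
    "('a, 'x) ring_scheme \<Rightarrow> ('a, 'm) module \<Rightarrow> 'm set \<Rightarrow> 'm set \<Rightarrow> bool" where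
  "internal_direct_sum R M U V \<longleftrightarrow> submodule U R M \<and> submodule V R M \<and>
     U <+>\<^bsub>M\<^esub> V = carrier M \<and> U \<inter> V = {\<zero>\<^bsub>M\<^esub>}"

definition indecomposable :: "('a, 'x) ring_scheme \<Rightarrow> ('a, 'm) module \<Rightarrow> bool" where
  "indecomposable R M \<longleftrightarrow> left_module R M \<and> carrier M \<noteq> {\<zero>\<^bsub>M\<^esub>} \<and>
     (\<forall>U V. internal_direct_sum R M U V \<longrightarrow> U = {\<zero>\<^bsub>M\<^esub>} \<or> V = {\<zero>\<^bsub>M\<^esub>})"

definition module_power :: "nat \<Rightarrow> ('a, 'm) module \<Rightarrow> ('a, nat \<Rightarrow> 'm) module" where
  "module_power n M =
     \<lparr>carrier = (\<Pi>\<^sub>E i\<in>{..<n}. carrier M),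
      mult = (\<lambda>x y. undefined), one = undefined,
      zero = (\<lambda>i\<in>{..<n}. \<zero>\<^bsub>M\<^esub>),
      add = (\<lambda>x y. \<lambda>i\<in>{..<n}. x i \<oplus>\<^bsub>M\<^esub> y i),
      smult = (\<lambda>a x. \<lambda>i\<in>{..<n}. a \<odot>\<^bsub>M\<^esub> x i)\<rparr>"

definition in_add :: "('a, 'x) ring_scheme \<Rightarrow> ('a, 'm) module \<Rightarrow> ('a, 'n) module \<Rightarrow> bool" where
  "in_add R N X \<longleftrightarrow> (\<exists>n U V. internal_direct_sum R (module_power n N) U V \<and>
     mod_iso R X ((module_power n N)\<lparr>carrier := U\<rparr>))"

definition restrict_scalars :: "('b \<Rightarrow> 'c) \<Rightarrow> ('c, 'm) module \<Rightarrow> ('b, 'm) module" where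
  "restrict_scalars \<phi> M =
     \<lparr>carrier = carrier M, mult = mult M, one = one M, zero = zero M, add = add M,
      smult = (\<lambda>b x. \<phi> b \<odot>\<^bsub>M\<^esub> x)\<rparr>"


section \<open>A universe of finitely generated modules\<close>

text \<open>
  HOL cannot quantify over modules with carriers in arbitrary types. Every finitely generated
  left \<open>R\<close>-module is a quotient of some \<open>R\<^sup>n\<close>, so up to isomorphism it has
  cosets of vectors, i.e. sets of functions \<open>nat \<Rightarrow> 'a\<close>, as elements. Quantifiers
  over ``all modules'' below therefore range over modules with carrier in this type; lemma
  \<open>fg_module_in_universe\<close> shows that no isomorphism class is lost.
\<close>

type_synonym 'a carr = "(nat \<Rightarrow> 'a) set"

lemma left_module_transport:
  fixes M :: "('a, 'm) module" and g :: "'m \<Rightarrow> 'u"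
  assumes M: "left_module R M" and inj: "inj_on g (carrier M)"
  shows "\<exists>M' :: ('a, 'u) module. left_module R M' \<and> mod_iso R M M'"
proof -
  interpret left_module R M by (rule M)
  define h where "h = inv_into (carrier M) g"
  have hg [simp]: "h (g x) = x" if "x \<in> carrier M" for x
    using that inj by (simp add: h_def)
  define M' :: "('a, 'u) module" where "M' =
    \<lparr>carrier = g ` carrier M, mult = (\<lambda>x y. undefined), one = undefined, zero = g \<zero>\<^bsub>M\<^esub>,
     add = (\<lambda>u v. g (h u \<oplus>\<^bsub>M\<^esub> h v)), smult = (\<lambda>a u. g (a \<odot>\<^bsub>M\<^esub> h u))\<rparr>"
  have "abelian_group M'"
  proof (rule abelian_groupI)
    fix x assume "x \<in> carrier M'"
    then obtain m where m: "m \<in> carrier M" "x = g m" by (auto simp: M'_def)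
    then have "g (\<ominus>\<^bsub>M\<^esub> m) \<oplus>\<^bsub>M'\<^esub> x = \<zero>\<^bsub>M'\<^esub>"
      by (simp add: M'_def M.l_neg)
    with m show "\<exists>y\<in>carrier M'. y \<oplus>\<^bsub>M'\<^esub> x = \<zero>\<^bsub>M'\<^esub>"
      by (auto simp: M'_def)
  qed (auto simp: M'_def M.a_ac)
  then have "left_module R M'"
    by (intro left_module.intro left_module_axioms.intro R.ring_axioms)
      (auto simp: M'_def smult_l_distr smult_r_distr smult_assoc1)
  moreover have "mod_iso R M M'"
    unfolding mod_iso_def mod_hom_def
    using inj by (intro bexI[of _ g]) (auto simp: M'_def bij_betw_def)
  ultimately show ?thesis by blast
qed

lemma fg_module_embeds:
  fixes M :: "('a, 'm) module"
  assumes fg: "fg_module R M"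
  shows "\<exists>g :: 'm \<Rightarrow> 'a carr. inj_on g (carrier M)"
proof -
  interpret left_module R M using fg by (simp add: fg_module_def)
  obtain S where S: "finite S" "S \<subseteq> carrier M"
    and gen: "\<And>U. submodule U R M \<Longrightarrow> S \<subseteq> U \<Longrightarrow> U = carrier M"
    using fg unfolding fg_module_def finitely_generated_def by blast
  obtain e where e: "bij_betw e {0..<card S} S"
    using S(1) ex_bij_betw_nat_finite by blast
  define n where "n = card S"
  have eM [simp, intro]: "e i \<in> carrier M" if "i < n" for i
    using that e S(2) by (force simp: n_def bij_betw_def)
  define X where "X = {x :: nat \<Rightarrow> 'a. \<forall>i<n. x i \<in> carrier R}"
  define \<pi> where "\<pi> x = (\<Oplus>\<^bsub>M\<^esub>i\<in>{..<n}. x i \<odot>\<^bsub>M\<^esub> e i)" for x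
  have \<pi>_closed: "\<pi> x \<in> carrier M" if "x \<in> X" for x
    using that unfolding \<pi>_def X_def by (intro M.finsum_closed) auto
  have smult_zero_l: "\<zero>\<^bsub>R\<^esub> \<odot>\<^bsub>M\<^esub> m = \<zero>\<^bsub>M\<^esub>" if "m \<in> carrier M" for m
  proof -
    have "\<zero>\<^bsub>R\<^esub> \<odot>\<^bsub>M\<^esub> m \<oplus>\<^bsub>M\<^esub> \<zero>\<^bsub>R\<^esub> \<odot>\<^bsub>M\<^esub> m = \<zero>\<^bsub>R\<^esub> \<odot>\<^bsub>M\<^esub> m"
      using smult_l_distr[of "\<zero>\<^bsub>R\<^esub>" "\<zero>\<^bsub>R\<^esub>" m] that by simp
    then show ?thesis using that by (metis M.add.l_cancel_one R.zero_closed smult_closed)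
  qed
  have smult_zero_r: "a \<odot>\<^bsub>M\<^esub> \<zero>\<^bsub>M\<^esub> = \<zero>\<^bsub>M\<^esub>" if "a \<in> carrier R" for a
  proof -
    have "a \<odot>\<^bsub>M\<^esub> \<zero>\<^bsub>M\<^esub> \<oplus>\<^bsub>M\<^esub> a \<odot>\<^bsub>M\<^esub> \<zero>\<^bsub>M\<^esub> = a \<odot>\<^bsub>M\<^esub> \<zero>\<^bsub>M\<^esub>"
      using smult_r_distr[of a "\<zero>\<^bsub>M\<^esub>" "\<zero>\<^bsub>M\<^esub>"] that by simp
    then show ?thesis using that by (metis M.add.l_cancel_one M.zero_closed smult_closed)
  qed
  have \<pi>_add: "\<pi> (\<lambda>i. x i \<oplus>\<^bsub>R\<^esub> y i) = \<pi> x \<oplus>\<^bsub>M\<^esub> \<pi> y" if "x \<in> X" "y \<in> X" for x y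
  proof -
    have "\<pi> (\<lambda>i. x i \<oplus>\<^bsub>R\<^esub> y i) = (\<Oplus>\<^bsub>M\<^esub>i\<in>{..<n}. x i \<odot>\<^bsub>M\<^esub> e i \<oplus>\<^bsub>M\<^esub> y i \<odot>\<^bsub>M\<^esub> e i)"
      unfolding \<pi>_def using that
      by (intro M.finsum_cong') (auto simp: X_def smult_l_distr)
    also have "\<dots> = \<pi> x \<oplus>\<^bsub>M\<^esub> \<pi> y"
      unfolding \<pi>_def using that by (intro M.finsum_addf) (auto simp: X_def)
    finally show ?thesis .
  qed
  have smult_finsum: "a \<odot>\<^bsub>M\<^esub> finsum M f I = (\<Oplus>\<^bsub>M\<^esub>i\<in>I. a \<odot>\<^bsub>M\<^esub> f i)"
    if "finite I" "a \<in> carrier R" "f \<in> I \<rightarrow> carrier M" for a f and I :: "nat set"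
    using that
  proof (induction I rule: finite_induct)
    case empty
    then show ?case by (simp add: smult_zero_r)
  next
    case (insert i I)
    then have "f i \<in> carrier M" "f \<in> I \<rightarrow> carrier M" by auto
    with insert show ?case
      by (subst M.finsum_insert, simp, simp, simp, simp, subst M.finsum_insert)
        (auto simp: smult_r_distr M.finsum_closed)
  qed
  have \<pi>_smult: "\<pi> (\<lambda>i. a \<otimes>\<^bsub>R\<^esub> x i) = a \<odot>\<^bsub>M\<^esub> \<pi> x" if "x \<in> X" "a \<in> carrier R" for a x
  proof -
    have "\<pi> (\<lambda>i. a \<otimes>\<^bsub>R\<^esub> x i) = (\<Oplus>\<^bsub>M\<^esub>i\<in>{..<n}. a \<odot>\<^bsub>M\<^esub> (x i \<odot>\<^bsub>M\<^esub> e i))"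
      unfolding \<pi>_def using that
      by (intro M.finsum_cong') (auto simp: X_def smult_assoc1)
    also have "\<dots> = a \<odot>\<^bsub>M\<^esub> \<pi> x"
      unfolding \<pi>_def using that by (subst smult_finsum) (auto simp: X_def)
    finally show ?thesis .
  qed
  have minus: "\<ominus>\<^bsub>M\<^esub> m = (\<ominus>\<^bsub>R\<^esub> \<one>\<^bsub>R\<^esub>) \<odot>\<^bsub>M\<^esub> m" if "m \<in> carrier M" for m
  proof -
    have "(\<ominus>\<^bsub>R\<^esub> \<one>\<^bsub>R\<^esub>) \<odot>\<^bsub>M\<^esub> m \<oplus>\<^bsub>M\<^esub> m = \<zero>\<^bsub>M\<^esub>"
      using smult_l_distr[of "\<ominus>\<^bsub>R\<^esub> \<one>\<^bsub>R\<^esub>" "\<one>\<^bsub>R\<^esub>" m] that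
      by (simp add: R.l_neg smult_zero_l)
    then show ?thesis using that by (intro M.minus_equality) auto
  qed
  have sub: "submodule (\<pi> ` X) R M"
  proof (intro submodule.intro subgroup.intro submodule_axioms.intro)
    show "\<pi> ` X \<subseteq> carrier (add_monoid M)" using \<pi>_closed by auto
    show "x \<otimes>\<^bsub>add_monoid M\<^esub> y \<in> \<pi> ` X" if "x \<in> \<pi> ` X" "y \<in> \<pi> ` X" for x y
    proof -
      from that obtain x' y' where xy: "x' \<in> X" "y' \<in> X" "x = \<pi> x'" "y = \<pi> y'"
        by blast
      have "(\<lambda>i. x' i \<oplus>\<^bsub>R\<^esub> y' i) \<in> X" using xy by (auto simp: X_def)
      from imageI[OF this, of \<pi>] show ?thesis using \<pi>_add[OF xy(1,2)] xy(3,4) by simp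
    qed
    have sm: "a \<odot>\<^bsub>M\<^esub> x \<in> \<pi> ` X" if "a \<in> carrier R" "x \<in> \<pi> ` X" for a x
    proof -
      from that obtain x' where x: "x' \<in> X" "x = \<pi> x'" by blast
      have "(\<lambda>i. a \<otimes>\<^bsub>R\<^esub> x' i) \<in> X" using x that by (auto simp: X_def)
      from imageI[OF this, of \<pi>] show ?thesis using \<pi>_smult[OF x(1) that(1)] x(2) by simp
    qed
    then show "a \<odot>\<^bsub>M\<^esub> x \<in> \<pi> ` X" if "a \<in> carrier R" "x \<in> \<pi> ` X" for a x
      using that .
    have "\<pi> (\<lambda>i. \<zero>\<^bsub>R\<^esub>) \<in> \<pi> ` X" by (rule imageI) (simp add: X_def)
    moreover have "\<pi> (\<lambda>i. \<zero>\<^bsub>R\<^esub>) = \<zero>\<^bsub>M\<^esub>"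
      unfolding \<pi>_def by (rule M.add.finprod_one_eqI) (auto simp: smult_zero_l)
    ultimately show "\<one>\<^bsub>add_monoid M\<^esub> \<in> \<pi> ` X" by simp
    show "inv\<^bsub>add_monoid M\<^esub> x \<in> \<pi> ` X" if "x \<in> \<pi> ` X" for x
      using that sm[of "\<ominus>\<^bsub>R\<^esub> \<one>\<^bsub>R\<^esub>" x] minus[of x] \<pi>_closed
      by (auto simp: a_inv_def)
  qed
  have "S \<subseteq> \<pi> ` X"
  proof
    fix s assume "s \<in> S"
    then have "s \<in> e ` {0..<n}" using e by (simp add: n_def bij_betw_def)
    then obtain j where j: "j < n" "s = e j" by auto
    define x where "x i = (if i = j then \<one>\<^bsub>R\<^esub> else \<zero>\<^bsub>R\<^esub>)" for i
    have "x \<in> X" by (simp add: X_def x_def)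
    moreover have "\<pi> x = (\<Oplus>\<^bsub>M\<^esub>i\<in>{..<n}. if j = i then e i else \<zero>\<^bsub>M\<^esub>)"
      unfolding \<pi>_def by (intro M.finsum_cong') (auto simp: x_def smult_zero_l)
    moreover have "\<dots> = e j"
      using j(1) by (intro M.finsum_singleton) auto
    ultimately show "s \<in> \<pi> ` X" using j(2) by (metis imageI)
  qed
  then have onto: "\<pi> ` X = carrier M" using gen[OF sub] by simp
  have "inj_on (\<lambda>m. {x \<in> X. \<pi> x = m}) (carrier M)"
  proof (rule inj_onI)
    fix m m' assume m: "m \<in> carrier M" and eq: "{x \<in> X. \<pi> x = m} = {x \<in> X. \<pi> x = m'}"
    from m have "m \<in> \<pi> ` X" by (simp only: onto)
    then obtain x where "x \<in> X" "\<pi> x = m" by (elim imageE) simp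
    then have "x \<in> {x \<in> X. \<pi> x = m}" by simp
    then have "x \<in> {x \<in> X. \<pi> x = m'}" by (simp only: eq)
    then show "m = m'" using \<open>\<pi> x = m\<close> by simp
  qed
  then show ?thesis by blast
qed

lemma finitely_generated_iso:
  assumes M: "left_module R M" and N: "left_module R N"
    and iso: "mod_iso R M N" and fg: "finitely_generated R M"
  shows "finitely_generated R N"
proof -
  interpret M: left_module R M by (rule M)
  interpret N: left_module R N by (rule N)
  obtain f where f: "f \<in> mod_hom R M N" and bij: "bij_betw f (carrier M) (carrier N)"
    using iso unfolding mod_iso_def by blast
  obtain S where S: "finite S" "S \<subseteq> carrier M"
    and gen: "\<And>U. submodule U R M \<Longrightarrow> S \<subseteq> U \<Longrightarrow> U = carrier M"
    using fg unfolding finitely_generated_def by blast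
  have fc: "f x \<in> carrier N" if "x \<in> carrier M" for x
    using f that by (auto simp: mod_hom_def)
  have fadd: "f (x \<oplus>\<^bsub>M\<^esub> y) = f x \<oplus>\<^bsub>N\<^esub> f y" if "x \<in> carrier M" "y \<in> carrier M" for x y
    using f that by (auto simp: mod_hom_def)
  have fsm: "f (a \<odot>\<^bsub>M\<^esub> x) = a \<odot>\<^bsub>N\<^esub> f x" if "a \<in> carrier R" "x \<in> carrier M" for a x
    using f that by (auto simp: mod_hom_def)
  interpret hom: abelian_group_hom M N f
    by (intro abelian_group_homI M.M.abelian_group_axioms N.M.abelian_group_axioms
        group_hom.intro group_hom_axioms.intro M.M.a_group N.M.a_group)
      (auto simp: hom_def fc fadd)
  have "U = carrier N" if U: "submodule U R N" "f ` S \<subseteq> U" for U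
  proof -
    interpret U: submodule U R N by (rule U)
    have "submodule {x \<in> carrier M. f x \<in> U} R M"
    proof (intro submodule.intro subgroup.intro submodule_axioms.intro)
      show "inv\<^bsub>add_monoid M\<^esub> x \<in> {x \<in> carrier M. f x \<in> U}" if "x \<in> {x \<in> carrier M. f x \<in> U}" for x
        using that hom.hom_a_inv[of x] U.m_inv_closed[of "f x"] M.M.a_inv_closed[of x]
        by (simp add: a_inv_def)
    qed (use U.subset U.m_closed U.one_closed hom.hom_zero in \<open>auto simp: fadd fsm\<close>)
    then have "{x \<in> carrier M. f x \<in> U} = carrier M"
      using gen U(2) S(2) by blast
    then have "f ` carrier M \<subseteq> U" by blast
    then have "carrier N \<subseteq> U" using bij by (simp add: bij_betw_def)
    with U.subset show ?thesis by auto
  qed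
  then show ?thesis unfolding finitely_generated_def
    using S fc by (intro exI[of _ "f ` S"]) auto
qed

lemma fg_module_in_universe:
  fixes M :: "('a, 'm) module"
  assumes "fg_module R M"
  shows "\<exists>M' :: ('a, 'a carr) module. fg_module R M' \<and> mod_iso R M M'"
proof -
  from fg_module_embeds[OF assms] obtain g :: "'m \<Rightarrow> 'a carr" where g: "inj_on g (carrier M)"
    by blast
  have M: "left_module R M" "finitely_generated R M"
    using assms by (simp_all add: fg_module_def)
  from left_module_transport[OF M(1) g] obtain M' :: "('a, 'a carr) module"
    where M': "left_module R M'" "mod_iso R M M'" by blast
  with finitely_generated_iso[OF M(1) M' M(2)] show ?thesis
    unfolding fg_module_def by blast
qed

text \<open>
  The same type suffices for the modules over any ring \<open>C\<close> that receives a
  homomorphism \<open>\<phi>\<close> from \<open>B\<close>, as long as they are finitely generated over \<open>B\<close>; this is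
  automatic when \<open>B\<close> and \<open>C\<close> are Artin algebras.
\<close>

lemma restricted_module_in_universe:
  fixes X :: "('c, 'm) module" and B :: "('b, 'x) ring_scheme"
  assumes "fg_module C X" and "fg_module B (restrict_scalars \<phi> X)"
  shows "\<exists>X' :: ('c, 'b carr) module. fg_module C X' \<and> mod_iso C X X'"
proof -
  from fg_module_embeds[OF assms(2)] obtain g :: "'m \<Rightarrow> 'b carr"
    where g: "inj_on g (carrier X)"
    unfolding restrict_scalars_def by auto
  have X: "left_module C X" "finitely_generated C X"
    using assms(1) by (simp_all add: fg_module_def)
  from left_module_transport[OF X(1) g] obtain X' :: "('c, 'b carr) module"
    where X': "left_module C X'" "mod_iso C X X'" by blast
  with finitely_generated_iso[OF X(1) X' X(2)] show ?thesis
    unfolding fg_module_def by blast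
qed


section \<open>Projective modules, syzygies and finitistic dimension\<close>

definition fg_projective :: "('a, 'x) ring_scheme \<Rightarrow> ('a, 'a carr) module \<Rightarrow> bool" where
  "fg_projective R P \<longleftrightarrow> fg_module R P \<and>
     (\<forall>(X :: ('a, 'a carr) module) (Y :: ('a, 'a carr) module) f g.
        fg_module R X \<and> fg_module R Y \<and> f \<in> mod_hom R P Y \<and>
        g \<in> mod_hom R X Y \<and> g ` carrier X = carrier Y \<longrightarrow>
        (\<exists>h\<in>mod_hom R P X. \<forall>p\<in>carrier P. g (h p) = f p))"

definition projective_resolution ::
    "('a, 'x) ring_scheme \<Rightarrow> (nat \<Rightarrow> ('a, 'a carr) module) \<Rightarrow> (nat \<Rightarrow> 'a carr \<Rightarrow> 'a carr) \<Rightarrow>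
     ('a carr \<Rightarrow> 'a carr) \<Rightarrow> ('a, 'a carr) module \<Rightarrow> bool" where
  "projective_resolution R P d \<epsilon> M \<longleftrightarrow>
     (\<forall>i. fg_projective R (P i)) \<and>
     \<epsilon> \<in> mod_hom R (P 0) M \<and> \<epsilon> ` carrier (P 0) = carrier M \<and>
     (\<forall>i. d i \<in> mod_hom R (P (Suc i)) (P i)) \<and>
     d 0 ` carrier (P (Suc 0)) = a_kernel (P 0) M \<epsilon> \<and>
     (\<forall>i. d (Suc i) ` carrier (P (Suc (Suc i))) = a_kernel (P (Suc i)) (P i) (d i))"

text \<open>As an \<open>Inf\<close> in \<open>enat\<close>, the projective dimension is \<open>\<infinity>\<close> if there is no finite
  projective resolution, and it is \<open>0\<close> (rather than \<open>-\<infinity>\<close>) for the zero module.\<close>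

definition proj_dim :: "('a, 'x) ring_scheme \<Rightarrow> ('a, 'a carr) module \<Rightarrow> enat" where
  "proj_dim R M = (INF n \<in> {n. \<exists>P d \<epsilon>. projective_resolution R P d \<epsilon> M \<and>
     (\<forall>i>n. carrier (P i) = {\<zero>\<^bsub>P i\<^esub>})}. enat n)"

definition finitistic_dim :: "('a, 'x) ring_scheme \<Rightarrow> enat" where
  "finitistic_dim R =
     (SUP M \<in> {M :: ('a, 'a carr) module. fg_module R M \<and> proj_dim R M < \<infinity>}. proj_dim R M)"

definition superfluous :: "('a, 'x) ring_scheme \<Rightarrow> ('a, 'm) module \<Rightarrow> 'm set \<Rightarrow> bool" where
  "superfluous R M K \<longleftrightarrow> submodule K R M \<and>
     (\<forall>U. submodule U R M \<and> U <+>\<^bsub>M\<^esub> K = carrier M \<longrightarrow> U = carrier M)"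

definition projective_cover ::
    "('a, 'x) ring_scheme \<Rightarrow> ('a, 'a carr) module \<Rightarrow> ('a carr \<Rightarrow> 'a carr) \<Rightarrow>
     ('a, 'a carr) module \<Rightarrow> bool" where
  "projective_cover R P f M \<longleftrightarrow> fg_projective R P \<and> f \<in> mod_hom R P M \<and>
     f ` carrier P = carrier M \<and> superfluous R P (a_kernel P M f)"

text \<open>Projective covers exist over Artin algebras and are unique up to isomorphism, so the
  syzygy, defined by choosing a cover, is well defined up to isomorphism.\<close>

definition syzygy ::
    "('a, 'x) ring_scheme \<Rightarrow> ('a, 'a carr) module \<Rightarrow> ('a, 'a carr) module" where
  "syzygy R M = (let (P, f) = (SOME (P, f). projective_cover R P f M)
     in P\<lparr>carrier := a_kernel P M f\<rparr>)"


section \<open>Finiteness conditions on algebras\<close>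

definition one_syzygy_finite :: "('a, 'x) ring_scheme \<Rightarrow> bool" where
  "one_syzygy_finite R \<longleftrightarrow> (\<exists>N :: ('a, 'a carr) module. fg_module R N \<and>
     (\<forall>X :: ('a, 'a carr) module. fg_module R X \<longrightarrow> in_add R N (syzygy R X)))"

text \<open>\<open>syzygy_finite_over B \<phi> C\<close>: the algebra \<open>C\<close> is \<open>B\<close>-syzygy-finite along
  \<open>\<phi> : B \<rightarrow> C\<close>.\<close>

definition syzygy_finite_over ::
    "('b, 'x) ring_scheme \<Rightarrow> ('b \<Rightarrow> 'c) \<Rightarrow> ('c, 'y) ring_scheme \<Rightarrow> bool" where
  "syzygy_finite_over B \<phi> C \<longleftrightarrow> (\<exists>n. \<exists>N :: ('b, 'b carr) module. fg_module B N \<and>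
     (\<forall>X :: ('c, 'b carr) module. fg_module C X \<longrightarrow>
        in_add B N ((syzygy B ^^ n) (restrict_scalars \<phi> X))))"

definition representation_finite :: "('a, 'x) ring_scheme \<Rightarrow> bool" where
  "representation_finite R \<longleftrightarrow> (\<exists>\<M> :: ('a, 'a carr) module set. finite \<M> \<and>
     (\<forall>X :: ('a, 'a carr) module. fg_module R X \<and> indecomposable R X \<longrightarrow>
        (\<exists>Y\<in>\<M>. mod_iso R X Y)))"


section \<open>Artin algebras and the Jacobson radical\<close>

definition artinian :: "('a, 'x) ring_scheme \<Rightarrow> bool" where
  "artinian R \<longleftrightarrow> (\<forall>I :: nat \<Rightarrow> 'a set.
     (\<forall>n. ideal (I n) R \<and> I (Suc n) \<subseteq> I n) \<longrightarrow> (\<exists>m. \<forall>n\<ge>m. I n = I m))"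

text \<open>Two-sided ideals suffice here since \<^const>\<open>artinian\<close> is only used for the commutative
  base ring. The library locale \<open>algebra\<close> is not applicable: it requires \<open>A\<close> to be
  commutative.\<close>

locale artin_algebra = module R A + A?: ring A
  for R :: "('r, 'x) ring_scheme" (structure) and A :: "('r, 'a) module" (structure) +
  assumes smult_assoc_l: "\<lbrakk> r \<in> carrier R; x \<in> carrier A; y \<in> carrier A \<rbrakk> \<Longrightarrow>
        (r \<odot>\<^bsub>A\<^esub> x) \<otimes>\<^bsub>A\<^esub> y = r \<odot>\<^bsub>A\<^esub> (x \<otimes>\<^bsub>A\<^esub> y)"
    and smult_assoc_r: "\<lbrakk> r \<in> carrier R; x \<in> carrier A; y \<in> carrier A \<rbrakk> \<Longrightarrow>
        x \<otimes>\<^bsub>A\<^esub> (r \<odot>\<^bsub>A\<^esub> y) = r \<odot>\<^bsub>A\<^esub> (x \<otimes>\<^bsub>A\<^esub> y)"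
    and artinian_base: "artinian R"
    and finitely_generated: "finitely_generated R A"

definition unital_subalgebra :: "('r, 'x) ring_scheme \<Rightarrow> ('r, 'a) module \<Rightarrow> 'a set \<Rightarrow> bool" where
  "unital_subalgebra R A U \<longleftrightarrow> subring U A \<and> submodule U R A"

definition left_ideal :: "'a set \<Rightarrow> ('a, 'x) ring_scheme \<Rightarrow> bool" where
  "left_ideal I R \<longleftrightarrow> additive_subgroup I R \<and>
     (\<forall>a\<in>carrier R. \<forall>x\<in>I. a \<otimes>\<^bsub>R\<^esub> x \<in> I)"

definition maximal_left_ideal :: "'a set \<Rightarrow> ('a, 'x) ring_scheme \<Rightarrow> bool" where
  "maximal_left_ideal I R \<longleftrightarrow> left_ideal I R \<and> I \<noteq> carrier R \<and>
     (\<forall>J. left_ideal J R \<and> I \<subseteq> J \<longrightarrow> J = I \<or> J = carrier R)"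

definition jacobson_radical :: "('a, 'x) ring_scheme \<Rightarrow> 'a set" where
  "jacobson_radical R = carrier R \<inter> \<Inter> {I. maximal_left_ideal I R}"

text \<open>
  \<open>rad_product A S i k\<close> is the product \<open>rad(S (i+k-1)) \<cdots> rad(S (i+1)) rad(S i)\<close> of \<open>k\<close> radicals of
  subalgebras \<open>S j\<close> of \<open>A\<close>. The empty product is the unit ideal of \<open>S i\<close>, so that the
  quotient of \<open>S i\<close> by it is the zero algebra.
\<close>

fun rad_product ::
    "('a, 'x) ring_scheme \<Rightarrow> (nat \<Rightarrow> 'a set) \<Rightarrow> nat \<Rightarrow> nat \<Rightarrow> 'a set" where
  "rad_product A S i 0 = S i"
| "rad_product A S i (Suc 0) = jacobson_radical (A\<lparr>carrier := S i\<rparr>)"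
| "rad_product A S i (Suc (Suc k)) =
     ideal_prod A (jacobson_radical (A\<lparr>carrier := S (i + Suc k)\<rparr>)) (rad_product A S i (Suc k))"

end

theory Submission
  imports Defs "HOL-Library.Multiset"
begin

text \<open>
  Write \<open>B = A\<^sub>0\<close>. If syzygies over \<open>B\<close> are computed inside free modules, a second syzygy \<open>K\<close> lies in some \<open>rad(B)\<^sup>n\<close> and is
  cut out there by equations that make sense in \<open>A\<^sup>n\<close>; as \<open>rad(B)\<close> is a left ideal of \<open>A\<^sub>1\<close>, it is an \<open>A\<^sub>1\<close>-submodule of
  \<open>A\<^sup>n\<close>. Let \<open>C\<close> be \<open>A\<^sub>0\<close> or \<open>A\<^sub>1\<close>, and \<open>I\<close> the product of the radicals from \<open>rad(C)\<close> upwards. This ideal of \<open>C\<close> is a left ideal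
  of \<open>A\<close>. Hence \<open>I K\<close> is an \<open>A\<close>-submodule of \<open>A\<^sup>n\<close>, that is, a first syzygy over \<open>A\<close>, and \<open>K / I K\<close> is a \<open>C / I\<close>-module.
  Rotating \<open>0 \<rightarrow> I K \<rightarrow> K \<rightarrow> K / I K \<rightarrow> 0\<close> gives \<open>0 \<rightarrow> \<Omega>(K / I K) \<rightarrow> I K \<oplus> P \<rightarrow> K \<rightarrow> 0\<close> with \<open>P\<close> projective, and after finitely many
  further syzygies only finitely many nonprojective indecomposables occur in the first two terms, whatever \<open>K\<close> is. The
  theorem of Igusa and Todorov then bounds the projective dimension of the last term whenever it is finite.
\<close>

text \<open>A first syzygy does not suffice: its relations take values in an arbitrary
  \<open>B\<close>-module, on which \<open>A\<close> does not act. Those of a second syzygy take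
  values in a free module, so they are matrices over \<open>B\<close>, which act on
  \<open>A^n\<close> as well; minimality of the cover puts the entries of its elements into rad(B),
  so that multiplication by \<open>A_1\<close> stays inside \<open>B^n\<close>.

  The sequence is rotated because the Igusa-Todorov bound controls the last term by the first two,
  whereas \<open>K\<close> is the unknown. The summands of \<open>I K\<close> come from finitely
  many indecomposable \<open>A\<close>-modules restricted to \<open>B\<close>; syzygy finiteness
  takes care of \<open>K / I K\<close>.

  A choice of representatives turns isomorphism classes into values, and the Krull-Schmidt theorem
  turns modules into multisets of them. Syzygies become an additive operator on multisets without
  projective entries, and sequences are taken up to projective summands. For Igusa-Todorov this
  operator is a matrix with natural entries, so its kernels stabilise in a rational vector
  space.\<close>

hide_const (open) Multiset.mult

section \<open>Modules and homomorphisms\<close>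

abbreviation sub :: "('a, 'm) module \<Rightarrow> 'm set \<Rightarrow> ('a, 'm) module" where
  "sub M U \<equiv> M\<lparr>carrier := U\<rparr>"

lemma left_moduleD:
  assumes "left_module R M" shows "ring R" "abelian_group M"
proof -
  interpret left_module R M by fact
  show "ring R" "abelian_group M" by unfold_locales
qed

context left_module
begin

lemma smult_zero_l: "m \<in> carrier M \<Longrightarrow> \<zero>\<^bsub>R\<^esub> \<odot>\<^bsub>M\<^esub> m = \<zero>\<^bsub>M\<^esub>"
  using smult_l_distr[of "\<zero>\<^bsub>R\<^esub>" "\<zero>\<^bsub>R\<^esub>" m]
  by (metis M.add.l_cancel_one R.zero_closed R.r_zero smult_closed)

lemma smult_zero_r: "a \<in> carrier R \<Longrightarrow> a \<odot>\<^bsub>M\<^esub> \<zero>\<^bsub>M\<^esub> = \<zero>\<^bsub>M\<^esub>"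
  using smult_r_distr[of a "\<zero>\<^bsub>M\<^esub>" "\<zero>\<^bsub>M\<^esub>"]
  by (metis M.add.l_cancel_one M.zero_closed M.r_zero smult_closed)

lemma minus_eq_smult: "m \<in> carrier M \<Longrightarrow> \<ominus>\<^bsub>M\<^esub> m = (\<ominus>\<^bsub>R\<^esub> \<one>\<^bsub>R\<^esub>) \<odot>\<^bsub>M\<^esub> m"
proof -
  assume m: "m \<in> carrier M"
  have "(\<ominus>\<^bsub>R\<^esub> \<one>\<^bsub>R\<^esub>) \<odot>\<^bsub>M\<^esub> m \<oplus>\<^bsub>M\<^esub> m = \<zero>\<^bsub>M\<^esub>"
    using smult_l_distr[of "\<ominus>\<^bsub>R\<^esub> \<one>\<^bsub>R\<^esub>" "\<one>\<^bsub>R\<^esub>" m] m by (simp add: R.l_neg smult_zero_l)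
  then show ?thesis using m by (intro M.minus_equality) auto
qed

lemma smult_minus_r: "a \<in> carrier R \<Longrightarrow> m \<in> carrier M \<Longrightarrow> a \<odot>\<^bsub>M\<^esub> (\<ominus>\<^bsub>M\<^esub> m) = \<ominus>\<^bsub>M\<^esub> (a \<odot>\<^bsub>M\<^esub> m)"
  by (rule M.minus_equality[symmetric])
     (simp_all add: smult_r_distr[symmetric] M.l_neg smult_zero_r)

lemma smult_minus_l: "a \<in> carrier R \<Longrightarrow> m \<in> carrier M \<Longrightarrow> (\<ominus>\<^bsub>R\<^esub> a) \<odot>\<^bsub>M\<^esub> m = \<ominus>\<^bsub>M\<^esub> (a \<odot>\<^bsub>M\<^esub> m)"
  by (rule M.minus_equality[symmetric])
     (simp_all add: smult_l_distr[symmetric] R.l_neg smult_zero_l)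

lemma submodule_iff:
  "submodule U R M \<longleftrightarrow> U \<subseteq> carrier M \<and> \<zero>\<^bsub>M\<^esub> \<in> U \<and> (\<forall>x\<in>U. \<forall>y\<in>U. x \<oplus>\<^bsub>M\<^esub> y \<in> U) \<and>
     (\<forall>a\<in>carrier R. \<forall>x\<in>U. a \<odot>\<^bsub>M\<^esub> x \<in> U)" (is "_ \<longleftrightarrow> ?r")
proof
  assume "submodule U R M"
  then interpret submodule U R M .
  show ?r using subset m_closed one_closed by auto
next
  assume r: ?r
  show "submodule U R M"
  proof (intro submodule.intro subgroup.intro submodule_axioms.intro)
    fix x assume "x \<in> U"
    then have "\<ominus>\<^bsub>M\<^esub> x \<in> U" using r minus_eq_smult[of x] by auto
    then show "inv\<^bsub>add_monoid M\<^esub> x \<in> U" by (simp add: a_inv_def)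
  qed (use r in auto)
qed

lemma submodule_minus: "submodule U R M \<Longrightarrow> x \<in> U \<Longrightarrow> \<ominus>\<^bsub>M\<^esub> x \<in> U"
  using minus_eq_smult[of x] by (auto simp: submodule_iff)

lemma submodule_diff: "submodule U R M \<Longrightarrow> x \<in> U \<Longrightarrow> y \<in> U \<Longrightarrow> x \<ominus>\<^bsub>M\<^esub> y \<in> U"
  using submodule_minus[of U y] by (auto simp: submodule_iff a_minus_def)

lemma carrier_submodule: "submodule (carrier M) R M" by (simp add: submodule_iff)
lemma zero_submodule: "submodule {\<zero>\<^bsub>M\<^esub>} R M" by (simp add: submodule_iff smult_zero_r)

lemma Int_submodule: "submodule U R M \<Longrightarrow> submodule V R M \<Longrightarrow> submodule (U \<inter> V) R M"
  by (auto simp: submodule_iff)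

lemma Inter_submodule:
  "\<U> \<noteq> {} \<Longrightarrow> (\<And>U. U \<in> \<U> \<Longrightarrow> submodule U R M) \<Longrightarrow> submodule (\<Inter>\<U>) R M"
  unfolding submodule_iff by blast

lemma sum_submodule:
  assumes U: "submodule U R M" and V: "submodule V R M"
  shows "submodule (U <+>\<^bsub>M\<^esub> V) R M"
proof -
  have UV: "U \<subseteq> carrier M" "V \<subseteq> carrier M" using U V by (auto simp: submodule_iff)
  show ?thesis
    unfolding submodule_iff set_add_def'
  proof (intro conjI ballI)
    show "\<zero>\<^bsub>M\<^esub> \<in> (\<Union>h\<in>U. \<Union>k\<in>V. {h \<oplus>\<^bsub>M\<^esub> k})"
    proof -
      have "\<zero>\<^bsub>M\<^esub> \<in> U" "\<zero>\<^bsub>M\<^esub> \<in> V" "\<zero>\<^bsub>M\<^esub> = \<zero>\<^bsub>M\<^esub> \<oplus>\<^bsub>M\<^esub> \<zero>\<^bsub>M\<^esub>" using U V by (simp_all add: submodule_iff)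
      then show ?thesis by blast
    qed
    show "(\<Union>h\<in>U. \<Union>k\<in>V. {h \<oplus>\<^bsub>M\<^esub> k}) \<subseteq> carrier M" using UV by auto
  next
    fix x y assume "x \<in> (\<Union>h\<in>U. \<Union>k\<in>V. {h \<oplus>\<^bsub>M\<^esub> k})" "y \<in> (\<Union>h\<in>U. \<Union>k\<in>V. {h \<oplus>\<^bsub>M\<^esub> k})"
    then obtain u v u' v' where *: "u \<in> U" "v \<in> V" "u' \<in> U" "v' \<in> V" "x = u \<oplus>\<^bsub>M\<^esub> v" "y = u' \<oplus>\<^bsub>M\<^esub> v'"
      by auto
    then have c: "u \<in> carrier M" "v \<in> carrier M" "u' \<in> carrier M" "v' \<in> carrier M" using UV by auto
    have "x \<oplus>\<^bsub>M\<^esub> y = (u \<oplus>\<^bsub>M\<^esub> u') \<oplus>\<^bsub>M\<^esub> (v \<oplus>\<^bsub>M\<^esub> v')" using c * by (simp add: M.a_ac)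
    moreover have "u \<oplus>\<^bsub>M\<^esub> u' \<in> U" "v \<oplus>\<^bsub>M\<^esub> v' \<in> V" using * U V by (auto simp: submodule_iff)
    ultimately show "x \<oplus>\<^bsub>M\<^esub> y \<in> (\<Union>h\<in>U. \<Union>k\<in>V. {h \<oplus>\<^bsub>M\<^esub> k})" by auto
  next
    fix a x assume "a \<in> carrier R" "x \<in> (\<Union>h\<in>U. \<Union>k\<in>V. {h \<oplus>\<^bsub>M\<^esub> k})"
    then obtain u v where *: "a \<in> carrier R" "u \<in> U" "v \<in> V" "x = u \<oplus>\<^bsub>M\<^esub> v" by auto
    then have "a \<odot>\<^bsub>M\<^esub> x = a \<odot>\<^bsub>M\<^esub> u \<oplus>\<^bsub>M\<^esub> a \<odot>\<^bsub>M\<^esub> v" using UV smult_r_distr[of a u v] by blast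
    moreover have "a \<odot>\<^bsub>M\<^esub> u \<in> U" "a \<odot>\<^bsub>M\<^esub> v \<in> V" using * U V by (auto simp: submodule_iff)
    ultimately show "a \<odot>\<^bsub>M\<^esub> x \<in> (\<Union>h\<in>U. \<Union>k\<in>V. {h \<oplus>\<^bsub>M\<^esub> k})" by auto
  qed
qed

lemma sum_upper:
  assumes U: "submodule U R M" and V: "submodule V R M"
  shows "U \<subseteq> U <+>\<^bsub>M\<^esub> V" "V \<subseteq> U <+>\<^bsub>M\<^esub> V"
proof -
  have UV: "U \<subseteq> carrier M" "V \<subseteq> carrier M" "\<zero>\<^bsub>M\<^esub> \<in> U" "\<zero>\<^bsub>M\<^esub> \<in> V" using U V by (auto simp: submodule_iff)
  show "U \<subseteq> U <+>\<^bsub>M\<^esub> V"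
  proof
    fix x assume "x \<in> U"
    then have "x = x \<oplus>\<^bsub>M\<^esub> \<zero>\<^bsub>M\<^esub>" using UV by auto
    then show "x \<in> U <+>\<^bsub>M\<^esub> V" using \<open>x \<in> U\<close> UV unfolding set_add_def' by blast
  qed
  show "V \<subseteq> U <+>\<^bsub>M\<^esub> V"
  proof
    fix x assume "x \<in> V"
    then have "x = \<zero>\<^bsub>M\<^esub> \<oplus>\<^bsub>M\<^esub> x" using UV by auto
    then show "x \<in> U <+>\<^bsub>M\<^esub> V" using \<open>x \<in> V\<close> UV unfolding set_add_def' by blast
  qed
qed

lemma sub_left_module: "submodule U R M \<Longrightarrow> left_module R (sub M U)"
proof (intro left_module.intro left_module_axioms.intro R.ring_axioms abelian_groupI)
  assume U: "submodule U R M"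
  then have UM: "x \<in> U \<Longrightarrow> x \<in> carrier M" for x by (auto simp: submodule_iff)
  fix x assume x: "x \<in> carrier (sub M U)"
  show "\<exists>y\<in>carrier (sub M U). y \<oplus>\<^bsub>sub M U\<^esub> x = \<zero>\<^bsub>sub M U\<^esub>"
    using x UM submodule_minus[OF U] by (intro bexI[of _ "\<ominus>\<^bsub>M\<^esub> x"]) (auto simp: M.l_neg)
next
  fix x y assume U: "submodule U R M" and "x \<in> carrier (sub M U)" "y \<in> carrier (sub M U)"
  then show "x \<oplus>\<^bsub>sub M U\<^esub> y = y \<oplus>\<^bsub>sub M U\<^esub> x"
    using M.a_comm[of x y] by (auto simp: submodule_iff subset_iff)
qed (auto simp: submodule_iff subset_iff M.a_assoc smult_l_distr smult_r_distr smult_assoc1)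

lemma submodule_sub_iff:
  assumes "submodule U R M"
  shows "submodule V R (sub M U) \<longleftrightarrow> submodule V R M \<and> V \<subseteq> U"
proof -
  interpret S: left_module R "sub M U" using assms by (rule sub_left_module)
  show ?thesis using assms unfolding S.submodule_iff submodule_iff by auto
qed

lemma diff_eq_zero_iff: "x \<in> carrier M \<Longrightarrow> y \<in> carrier M \<Longrightarrow> x \<ominus>\<^bsub>M\<^esub> y = \<zero>\<^bsub>M\<^esub> \<longleftrightarrow> x = y"
  by (metis M.minus_eq M.r_neg M.add.inv_equality M.a_inv_closed M.minus_minus)

lemma diff_add_cancel: "x \<in> carrier M \<Longrightarrow> y \<in> carrier M \<Longrightarrow> (x \<ominus>\<^bsub>M\<^esub> y) \<oplus>\<^bsub>M\<^esub> y = x"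
  by (simp add: M.minus_eq M.a_assoc M.l_neg)

lemma add_diff_cancel: "x \<in> carrier M \<Longrightarrow> y \<in> carrier M \<Longrightarrow> (x \<oplus>\<^bsub>M\<^esub> y) \<ominus>\<^bsub>M\<^esub> y = x"
  by (simp add: M.minus_eq M.a_assoc M.r_neg)

lemma diff_eq_iff: "x \<in> carrier M \<Longrightarrow> y \<in> carrier M \<Longrightarrow> z \<in> carrier M \<Longrightarrow> x \<ominus>\<^bsub>M\<^esub> y = z \<longleftrightarrow> x = z \<oplus>\<^bsub>M\<^esub> y"
  using diff_add_cancel add_diff_cancel by metis

lemma diff_closed: "x \<in> carrier M \<Longrightarrow> y \<in> carrier M \<Longrightarrow> x \<ominus>\<^bsub>M\<^esub> y \<in> carrier M"
  by simp

end

lemma mod_homI: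
  assumes "\<And>x. x \<in> carrier M \<Longrightarrow> f x \<in> carrier N"
    and "\<And>x y. x \<in> carrier M \<Longrightarrow> y \<in> carrier M \<Longrightarrow> f (x \<oplus>\<^bsub>M\<^esub> y) = f x \<oplus>\<^bsub>N\<^esub> f y"
    and "\<And>a x. a \<in> carrier R \<Longrightarrow> x \<in> carrier M \<Longrightarrow> f (a \<odot>\<^bsub>M\<^esub> x) = a \<odot>\<^bsub>N\<^esub> f x"
  shows "f \<in> mod_hom R M N"
  using assms by (auto simp: mod_hom_def)

lemma mod_homD:
  assumes "f \<in> mod_hom R M N"
  shows hom_closed: "x \<in> carrier M \<Longrightarrow> f x \<in> carrier N"
    and hom_add: "x \<in> carrier M \<Longrightarrow> y \<in> carrier M \<Longrightarrow> f (x \<oplus>\<^bsub>M\<^esub> y) = f x \<oplus>\<^bsub>N\<^esub> f y"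
    and hom_smult: "a \<in> carrier R \<Longrightarrow> x \<in> carrier M \<Longrightarrow> f (a \<odot>\<^bsub>M\<^esub> x) = a \<odot>\<^bsub>N\<^esub> f x"
  using assms by (auto simp: mod_hom_def)

lemma hom_id: "(\<lambda>x. x) \<in> mod_hom R M M" by (auto intro: mod_homI)

lemma hom_comp: "f \<in> mod_hom R M N \<Longrightarrow> g \<in> mod_hom R N K \<Longrightarrow> (\<lambda>x. g (f x)) \<in> mod_hom R M K"
  by (auto simp: mod_hom_def Pi_iff)

lemma hom_restrict: "f \<in> mod_hom R M N \<Longrightarrow> U \<subseteq> carrier M \<Longrightarrow> f \<in> mod_hom R (sub M U) N"
  by (auto simp: mod_hom_def Pi_iff subset_iff)

lemma hom_into_sub: "f \<in> mod_hom R M N \<Longrightarrow> f ` carrier M \<subseteq> V \<Longrightarrow> f \<in> mod_hom R M (sub N V)"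
  by (auto simp: mod_hom_def Pi_iff)

lemma hom_from_sub: "f \<in> mod_hom R M (sub N V) \<Longrightarrow> V \<subseteq> carrier N \<Longrightarrow> f \<in> mod_hom R M N"
  by (auto simp: mod_hom_def Pi_iff)

lemma mod_iso_refl: "mod_iso R M M"
  unfolding mod_iso_def by (intro bexI[of _ "\<lambda>x. x"]) (auto simp: bij_betw_def hom_id)

lemma mod_iso_trans: "mod_iso R M N \<Longrightarrow> mod_iso R N K \<Longrightarrow> mod_iso R M K"
  unfolding mod_iso_def using hom_comp bij_betw_trans unfolding comp_def by blast

lemma inv_hom:
  assumes M: "left_module R M" and f: "f \<in> mod_hom R M N" "bij_betw f (carrier M) (carrier N)"
  shows "inv_into (carrier M) f \<in> mod_hom R N M"
proof -
  interpret left_module R M by fact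
  note hD = mod_homD[OF f(1)]
  let ?g = "inv_into (carrier M) f"
  have g: "?g y \<in> carrier M" "f (?g y) = y" if "y \<in> carrier N" for y
    using that f(2) by (simp_all add: bij_betw_def inv_into_into f_inv_into_f)
  have gf: "?g (f x) = x" if "x \<in> carrier M" for x using that f(2) by (simp add: bij_betw_def)
  show ?thesis
  proof (rule mod_homI)
    fix x y assume xy: "x \<in> carrier N" "y \<in> carrier N"
    have "x \<oplus>\<^bsub>N\<^esub> y = f (?g x \<oplus>\<^bsub>M\<^esub> ?g y)" using xy g hD by simp
    then show "?g (x \<oplus>\<^bsub>N\<^esub> y) = ?g x \<oplus>\<^bsub>M\<^esub> ?g y" using gf xy g by simp
  next
    fix a x assume xy: "a \<in> carrier R" "x \<in> carrier N"
    have "a \<odot>\<^bsub>N\<^esub> x = f (a \<odot>\<^bsub>M\<^esub> ?g x)" using xy g hD by simp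
    then show "?g (a \<odot>\<^bsub>N\<^esub> x) = a \<odot>\<^bsub>M\<^esub> ?g x" using gf xy g by simp
  qed (use g in auto)
qed

lemma mod_iso_sym:
  assumes "left_module R M" "mod_iso R M N" shows "mod_iso R N M"
proof -
  obtain f where f: "f \<in> mod_hom R M N" "bij_betw f (carrier M) (carrier N)"
    using assms unfolding mod_iso_def by blast
  then show ?thesis unfolding mod_iso_def
    using inv_hom[OF assms(1) f] bij_betw_inv_into[OF f(2)] by blast
qed

lemma hom_zero:
  assumes "left_module R M" "left_module R N" "f \<in> mod_hom R M N"
  shows "f \<zero>\<^bsub>M\<^esub> = \<zero>\<^bsub>N\<^esub>"
proof -
  interpret M: left_module R M by fact
  interpret N: left_module R N by fact
  have "f (\<zero>\<^bsub>R\<^esub> \<odot>\<^bsub>M\<^esub> \<zero>\<^bsub>M\<^esub>) = \<zero>\<^bsub>R\<^esub> \<odot>\<^bsub>N\<^esub> f \<zero>\<^bsub>M\<^esub>"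
    using hom_smult[OF assms(3)] by simp
  then show ?thesis using hom_closed[OF assms(3)] by (simp add: M.smult_zero_l N.smult_zero_l)
qed

lemma hom_neg:
  assumes "left_module R M" "left_module R N" "f \<in> mod_hom R M N" "x \<in> carrier M"
  shows "f (\<ominus>\<^bsub>M\<^esub> x) = \<ominus>\<^bsub>N\<^esub> (f x)"
proof -
  interpret M: left_module R M by fact
  interpret N: left_module R N by fact
  show ?thesis using assms(4) hom_smult[OF assms(3)] hom_closed[OF assms(3)]
    by (simp add: M.minus_eq_smult N.minus_eq_smult)
qed

lemma hom_diff:
  assumes "left_module R M" "left_module R N" "f \<in> mod_hom R M N" "x \<in> carrier M" "y \<in> carrier M"
  shows "f (x \<ominus>\<^bsub>M\<^esub> y) = f x \<ominus>\<^bsub>N\<^esub> f y"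
proof -
  interpret M: left_module R M by fact
  show ?thesis using assms(4,5) hom_neg[OF assms(1-3,5)] hom_add[OF assms(3)]
    by (simp add: a_minus_def)
qed

abbreviation "ker \<equiv> a_kernel"

lemma ker_iff: "x \<in> ker M N f \<longleftrightarrow> x \<in> carrier M \<and> f x = \<zero>\<^bsub>N\<^esub>"
  by (simp add: a_kernel_def')

lemma preimage_submodule:
  assumes "left_module R M" "left_module R N" "f \<in> mod_hom R M N" "submodule V R N"
  shows "submodule {x \<in> carrier M. f x \<in> V} R M"
proof -
  interpret M: left_module R M by fact
  interpret N: left_module R N by fact
  show ?thesis using assms(4) mod_homD[OF assms(3)] hom_zero[OF assms(1-3)]
    unfolding M.submodule_iff N.submodule_iff by auto
qed

lemma ker_submodule:
  assumes "left_module R M" "left_module R N" "f \<in> mod_hom R M N"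
  shows "submodule (ker M N f) R M"
proof -
  interpret N: left_module R N by fact
  have "ker M N f = {x \<in> carrier M. f x \<in> {\<zero>\<^bsub>N\<^esub>}}" by (auto simp: ker_iff)
  then show ?thesis using preimage_submodule[OF assms N.zero_submodule] by simp
qed

lemma image_submodule:
  assumes "left_module R M" "left_module R N" "f \<in> mod_hom R M N" "submodule U R M"
  shows "submodule (f ` U) R N"
proof -
  interpret M: left_module R M by fact
  interpret N: left_module R N by fact
  have UM: "U \<subseteq> carrier M" "\<zero>\<^bsub>M\<^esub> \<in> U" "\<And>x y. x \<in> U \<Longrightarrow> y \<in> U \<Longrightarrow> x \<oplus>\<^bsub>M\<^esub> y \<in> U"
    "\<And>a x. a \<in> carrier R \<Longrightarrow> x \<in> U \<Longrightarrow> a \<odot>\<^bsub>M\<^esub> x \<in> U" using assms(4) by (auto simp: M.submodule_iff)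
  note hD = mod_homD[OF assms(3)]
  show ?thesis unfolding N.submodule_iff
  proof (intro conjI ballI)
    show "f ` U \<subseteq> carrier N" using UM hD by auto
    show "\<zero>\<^bsub>N\<^esub> \<in> f ` U" using UM(2) hom_zero[OF assms(1-3)] by (metis imageI)
    fix x y assume "x \<in> f ` U" "y \<in> f ` U"
    then obtain u v where "u \<in> U" "v \<in> U" "x = f u" "y = f v" by auto
    then show "x \<oplus>\<^bsub>N\<^esub> y \<in> f ` U" using UM hD(2)[of u v] by (metis imageI subsetD)
  next
    fix a x assume "a \<in> carrier R" "x \<in> f ` U"
    then obtain u where "u \<in> U" "x = f u" by auto
    then show "a \<odot>\<^bsub>N\<^esub> x \<in> f ` U" using UM hD(3)[of a u] \<open>a \<in> carrier R\<close> by (metis imageI subsetD)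
  qed
qed

lemma hom_inj_iff:
  assumes "left_module R M" "left_module R N" "f \<in> mod_hom R M N"
  shows "inj_on f (carrier M) \<longleftrightarrow> (\<forall>x\<in>carrier M. f x = \<zero>\<^bsub>N\<^esub> \<longrightarrow> x = \<zero>\<^bsub>M\<^esub>)"
proof -
  interpret M: left_module R M by fact
  interpret N: left_module R N by fact
  show ?thesis
  proof
    assume "inj_on f (carrier M)"
    then show "\<forall>x\<in>carrier M. f x = \<zero>\<^bsub>N\<^esub> \<longrightarrow> x = \<zero>\<^bsub>M\<^esub>"
      using hom_zero[OF assms] M.zero_closed by (metis inj_onD)
  next
    assume r: "\<forall>x\<in>carrier M. f x = \<zero>\<^bsub>N\<^esub> \<longrightarrow> x = \<zero>\<^bsub>M\<^esub>"
    show "inj_on f (carrier M)"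
    proof (rule inj_onI)
      fix x y assume xy: "x \<in> carrier M" "y \<in> carrier M" "f x = f y"
      then have "f (x \<ominus>\<^bsub>M\<^esub> y) = \<zero>\<^bsub>N\<^esub>"
        using hom_diff[OF assms xy(1,2)] hom_closed[OF assms(3)] N.diff_eq_zero_iff by simp
      then show "x = y" using r xy M.diff_eq_zero_iff by auto
    qed
  qed
qed

text \<open>Biproducts, described by their structure maps so that all carrier types may differ.\<close>

definition is_dsum :: "('a, 'x) ring_scheme \<Rightarrow> ('a, 'd) module \<Rightarrow> ('a, 'm) module \<Rightarrow> ('a, 'n) module \<Rightarrow> bool" where
  "is_dsum R D X Y \<longleftrightarrow> (\<exists>i1\<in>mod_hom R X D. \<exists>i2\<in>mod_hom R Y D. \<exists>p1\<in>mod_hom R D X. \<exists>p2\<in>mod_hom R D Y.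
     (\<forall>x\<in>carrier X. p1 (i1 x) = x \<and> p2 (i1 x) = \<zero>\<^bsub>Y\<^esub>) \<and>
     (\<forall>y\<in>carrier Y. p1 (i2 y) = \<zero>\<^bsub>X\<^esub> \<and> p2 (i2 y) = y) \<and>
     (\<forall>d\<in>carrier D. d = i1 (p1 d) \<oplus>\<^bsub>D\<^esub> i2 (p2 d)))"

lemma is_dsumI:
  assumes "i1 \<in> mod_hom R X D" "i2 \<in> mod_hom R Y D" "p1 \<in> mod_hom R D X" "p2 \<in> mod_hom R D Y"
    "\<And>x. x \<in> carrier X \<Longrightarrow> p1 (i1 x) = x" "\<And>x. x \<in> carrier X \<Longrightarrow> p2 (i1 x) = \<zero>\<^bsub>Y\<^esub>"
    "\<And>y. y \<in> carrier Y \<Longrightarrow> p1 (i2 y) = \<zero>\<^bsub>X\<^esub>" "\<And>y. y \<in> carrier Y \<Longrightarrow> p2 (i2 y) = y"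
    "\<And>d. d \<in> carrier D \<Longrightarrow> d = i1 (p1 d) \<oplus>\<^bsub>D\<^esub> i2 (p2 d)"
  shows "is_dsum R D X Y"
  unfolding is_dsum_def using assms by blast

lemma is_dsumE:
  assumes "is_dsum R D X Y"
  obtains i1 i2 p1 p2 where
    "i1 \<in> mod_hom R X D" "i2 \<in> mod_hom R Y D" "p1 \<in> mod_hom R D X" "p2 \<in> mod_hom R D Y"
    "\<And>x. x \<in> carrier X \<Longrightarrow> p1 (i1 x) = x" "\<And>x. x \<in> carrier X \<Longrightarrow> p2 (i1 x) = \<zero>\<^bsub>Y\<^esub>"
    "\<And>y. y \<in> carrier Y \<Longrightarrow> p1 (i2 y) = \<zero>\<^bsub>X\<^esub>" "\<And>y. y \<in> carrier Y \<Longrightarrow> p2 (i2 y) = y"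
    "\<And>d. d \<in> carrier D \<Longrightarrow> d = i1 (p1 d) \<oplus>\<^bsub>D\<^esub> i2 (p2 d)"
  using assms unfolding is_dsum_def by blast

lemma is_dsum_comm:
  assumes "left_module R D" "is_dsum R D X Y" shows "is_dsum R D Y X"
proof -
  interpret D: left_module R D by fact
  from assms(2) obtain i1 i2 p1 p2 where d:
    "i1 \<in> mod_hom R X D" "i2 \<in> mod_hom R Y D" "p1 \<in> mod_hom R D X" "p2 \<in> mod_hom R D Y"
    "\<And>x. x \<in> carrier X \<Longrightarrow> p1 (i1 x) = x" "\<And>x. x \<in> carrier X \<Longrightarrow> p2 (i1 x) = \<zero>\<^bsub>Y\<^esub>"
    "\<And>y. y \<in> carrier Y \<Longrightarrow> p1 (i2 y) = \<zero>\<^bsub>X\<^esub>" "\<And>y. y \<in> carrier Y \<Longrightarrow> p2 (i2 y) = y"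
    "\<And>d. d \<in> carrier D \<Longrightarrow> d = i1 (p1 d) \<oplus>\<^bsub>D\<^esub> i2 (p2 d)" by (erule is_dsumE)
  show ?thesis
  proof (rule is_dsumI[OF d(2,1,4,3,8,7,6,5)])
    fix x assume x: "x \<in> carrier D"
    from d(9)[OF x] show "x = i2 (p2 x) \<oplus>\<^bsub>D\<^esub> i1 (p1 x)"
      using x hom_closed[OF d(1)] hom_closed[OF d(2)] hom_closed[OF d(3)] hom_closed[OF d(4)]
        D.M.a_comm[of "i1 (p1 x)" "i2 (p2 x)"] by simp
  qed
qed

lemma is_dsum_iso:
  assumes D: "left_module R D" and X: "left_module R X" "left_module R Y" and d: "is_dsum R D X Y"
    and "mod_iso R D D'" "mod_iso R X X'" "mod_iso R Y Y'"
    and X': "left_module R X'" "left_module R Y'"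
  shows "is_dsum R D' X' Y'"
proof -
  interpret D: left_module R D by fact
  from d obtain i1 i2 p1 p2 where d:
    "i1 \<in> mod_hom R X D" "i2 \<in> mod_hom R Y D" "p1 \<in> mod_hom R D X" "p2 \<in> mod_hom R D Y"
    "\<And>x. x \<in> carrier X \<Longrightarrow> p1 (i1 x) = x" "\<And>x. x \<in> carrier X \<Longrightarrow> p2 (i1 x) = \<zero>\<^bsub>Y\<^esub>"
    "\<And>y. y \<in> carrier Y \<Longrightarrow> p1 (i2 y) = \<zero>\<^bsub>X\<^esub>" "\<And>y. y \<in> carrier Y \<Longrightarrow> p2 (i2 y) = y"
    "\<And>d. d \<in> carrier D \<Longrightarrow> d = i1 (p1 d) \<oplus>\<^bsub>D\<^esub> i2 (p2 d)" by (erule is_dsumE)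
  obtain f where f: "f \<in> mod_hom R D D'" "bij_betw f (carrier D) (carrier D')" using assms by (auto simp: mod_iso_def)
  obtain g where g: "g \<in> mod_hom R X X'" "bij_betw g (carrier X) (carrier X')" using assms by (auto simp: mod_iso_def)
  obtain h where h: "h \<in> mod_hom R Y Y'" "bij_betw h (carrier Y) (carrier Y')" using assms by (auto simp: mod_iso_def)
  let ?f = "inv_into (carrier D) f" and ?g = "inv_into (carrier X) g" and ?h = "inv_into (carrier Y) h"
  have i: "?f \<in> mod_hom R D' D" "?g \<in> mod_hom R X' X" "?h \<in> mod_hom R Y' Y"
    using inv_hom[OF D f] inv_hom[OF X(1) g] inv_hom[OF X(2) h] by auto
  note c = mod_homD[OF f(1)] mod_homD[OF g(1)] mod_homD[OF h(1)] hom_closed[OF i(1)] hom_closed[OF i(2)] hom_closed[OF i(3)]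
    hom_closed[OF d(1)] hom_closed[OF d(2)] hom_closed[OF d(3)] hom_closed[OF d(4)]
  have e: "\<And>x. x \<in> carrier D \<Longrightarrow> ?f (f x) = x" "\<And>x. x \<in> carrier X \<Longrightarrow> ?g (g x) = x" "\<And>x. x \<in> carrier Y \<Longrightarrow> ?h (h x) = x"
      "\<And>x. x \<in> carrier D' \<Longrightarrow> f (?f x) = x" "\<And>x. x \<in> carrier X' \<Longrightarrow> g (?g x) = x" "\<And>x. x \<in> carrier Y' \<Longrightarrow> h (?h x) = x"
    using f(2) g(2) h(2) by (auto simp: bij_betw_def f_inv_into_f)
  show ?thesis
  proof (rule is_dsumI)
    show "(\<lambda>x. f (i1 (?g x))) \<in> mod_hom R X' D'" by (intro hom_comp[OF _ f(1)] hom_comp[OF _ d(1)] i)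
    show "(\<lambda>x. f (i2 (?h x))) \<in> mod_hom R Y' D'" by (intro hom_comp[OF _ f(1)] hom_comp[OF _ d(2)] i)
    show "(\<lambda>x. g (p1 (?f x))) \<in> mod_hom R D' X'" by (intro hom_comp[OF _ g(1)] hom_comp[OF _ d(3)] i)
    show "(\<lambda>x. h (p2 (?f x))) \<in> mod_hom R D' Y'" by (intro hom_comp[OF _ h(1)] hom_comp[OF _ d(4)] i)
    fix x assume x: "x \<in> carrier D'"
    show "x = f (i1 (?g (g (p1 (?f x))))) \<oplus>\<^bsub>D'\<^esub> f (i2 (?h (h (p2 (?f x)))))"
      using hom_add[OF f(1), of "i1 (p1 (?f x))" "i2 (p2 (?f x))"] d(9)[of "?f x", symmetric] x c e by simp
  qed (use c e d(5-8) hom_zero[OF X(1) X'(1) g(1)] hom_zero[OF X(2) X'(2) h(1)] in auto)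
qed

lemma internal_dsum:
  assumes D: "left_module R D" and UV: "internal_direct_sum R D U V"
  shows "is_dsum R D (sub D U) (sub D V)"
proof -
  interpret D: left_module R D by fact
  have U: "submodule U R D" and V: "submodule V R D" and s: "U <+>\<^bsub>D\<^esub> V = carrier D" and i: "U \<inter> V = {\<zero>\<^bsub>D\<^esub>}"
    using UV by (auto simp: internal_direct_sum_def)
  have UD: "u \<in> U \<Longrightarrow> u \<in> carrier D" "v \<in> V \<Longrightarrow> v \<in> carrier D" "\<zero>\<^bsub>D\<^esub> \<in> U" "\<zero>\<^bsub>D\<^esub> \<in> V" for u v
    using U V by (auto simp: D.submodule_iff)
  have ex: "\<exists>u v. u \<in> U \<and> v \<in> V \<and> d = u \<oplus>\<^bsub>D\<^esub> v" if "d \<in> carrier D" for d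
    using that unfolding s[symmetric] set_add_def' by blast
  have un: "u = u' \<and> v = v'" if "u \<in> U" "u' \<in> U" "v \<in> V" "v' \<in> V" "u \<oplus>\<^bsub>D\<^esub> v = u' \<oplus>\<^bsub>D\<^esub> v'" for u v u' v'
  proof -
    have c: "u \<in> carrier D" "v \<in> carrier D" "u' \<in> carrier D" "v' \<in> carrier D" using that UD by auto
    have "u \<ominus>\<^bsub>D\<^esub> u' = (u \<oplus>\<^bsub>D\<^esub> v) \<oplus>\<^bsub>D\<^esub> ((\<ominus>\<^bsub>D\<^esub> u') \<oplus>\<^bsub>D\<^esub> (\<ominus>\<^bsub>D\<^esub> v))"
    proof -
      have "(u \<oplus>\<^bsub>D\<^esub> v) \<oplus>\<^bsub>D\<^esub> ((\<ominus>\<^bsub>D\<^esub> u') \<oplus>\<^bsub>D\<^esub> (\<ominus>\<^bsub>D\<^esub> v)) = (u \<oplus>\<^bsub>D\<^esub> (\<ominus>\<^bsub>D\<^esub> u')) \<oplus>\<^bsub>D\<^esub> (v \<oplus>\<^bsub>D\<^esub> (\<ominus>\<^bsub>D\<^esub> v))"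
        using c by (simp add: D.M.a_ac)
      then show ?thesis using c by (simp add: D.M.minus_eq D.M.r_neg)
    qed
    also have "\<dots> = v' \<ominus>\<^bsub>D\<^esub> v"
    proof -
      have "(u' \<oplus>\<^bsub>D\<^esub> v') \<oplus>\<^bsub>D\<^esub> ((\<ominus>\<^bsub>D\<^esub> u') \<oplus>\<^bsub>D\<^esub> (\<ominus>\<^bsub>D\<^esub> v)) = (u' \<oplus>\<^bsub>D\<^esub> (\<ominus>\<^bsub>D\<^esub> u')) \<oplus>\<^bsub>D\<^esub> (v' \<oplus>\<^bsub>D\<^esub> (\<ominus>\<^bsub>D\<^esub> v))"
        using c by (simp add: D.M.a_ac)
      then show ?thesis using c by (simp add: that(5) D.M.minus_eq D.M.r_neg)
    qed
    finally have *: "u \<ominus>\<^bsub>D\<^esub> u' = v' \<ominus>\<^bsub>D\<^esub> v" .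
    moreover have "u \<ominus>\<^bsub>D\<^esub> u' \<in> U" "v' \<ominus>\<^bsub>D\<^esub> v \<in> V" using that U V D.submodule_diff by auto
    ultimately have "u \<ominus>\<^bsub>D\<^esub> u' = \<zero>\<^bsub>D\<^esub>" "v' \<ominus>\<^bsub>D\<^esub> v = \<zero>\<^bsub>D\<^esub>" using i by (metis IntI singletonD)+
    then show ?thesis using c D.diff_eq_zero_iff by auto
  qed
  define p1 where "p1 d = (SOME u. u \<in> U \<and> (\<exists>v\<in>V. d = u \<oplus>\<^bsub>D\<^esub> v))" for d
  define p2 where "p2 d = (SOME v. v \<in> V \<and> (\<exists>u\<in>U. d = u \<oplus>\<^bsub>D\<^esub> v))" for d
  have p: "p1 (u \<oplus>\<^bsub>D\<^esub> v) = u" "p2 (u \<oplus>\<^bsub>D\<^esub> v) = v" if "u \<in> U" "v \<in> V" for u v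
    using that un unfolding p1_def p2_def by (auto intro!: some_equality)
  have pa: "p1 (d \<oplus>\<^bsub>D\<^esub> e) = p1 d \<oplus>\<^bsub>D\<^esub> p1 e \<and> p2 (d \<oplus>\<^bsub>D\<^esub> e) = p2 d \<oplus>\<^bsub>D\<^esub> p2 e"
    if de: "d \<in> carrier D" "e \<in> carrier D" for d e
  proof -
    obtain u v u' v' where x: "u \<in> U" "v \<in> V" "d = u \<oplus>\<^bsub>D\<^esub> v" "u' \<in> U" "v' \<in> V" "e = u' \<oplus>\<^bsub>D\<^esub> v'"
      using ex[OF de(1)] ex[OF de(2)] by blast
    have "d \<oplus>\<^bsub>D\<^esub> e = (u \<oplus>\<^bsub>D\<^esub> u') \<oplus>\<^bsub>D\<^esub> (v \<oplus>\<^bsub>D\<^esub> v')" using x UD by (simp add: D.M.a_ac)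
    moreover have "u \<oplus>\<^bsub>D\<^esub> u' \<in> U" "v \<oplus>\<^bsub>D\<^esub> v' \<in> V" using x U V by (auto simp: D.submodule_iff)
    ultimately show ?thesis using p x by simp
  qed
  have ps: "p1 (a \<odot>\<^bsub>D\<^esub> d) = a \<odot>\<^bsub>D\<^esub> p1 d \<and> p2 (a \<odot>\<^bsub>D\<^esub> d) = a \<odot>\<^bsub>D\<^esub> p2 d"
    if de: "a \<in> carrier R" "d \<in> carrier D" for a d
  proof -
    obtain u v where x: "u \<in> U" "v \<in> V" "d = u \<oplus>\<^bsub>D\<^esub> v" using ex[OF de(2)] by blast
    have "a \<odot>\<^bsub>D\<^esub> d = (a \<odot>\<^bsub>D\<^esub> u) \<oplus>\<^bsub>D\<^esub> (a \<odot>\<^bsub>D\<^esub> v)" using x UD de by (simp add: D.smult_r_distr)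
    moreover have "a \<odot>\<^bsub>D\<^esub> u \<in> U" "a \<odot>\<^bsub>D\<^esub> v \<in> V" using x U V de by (auto simp: D.submodule_iff)
    ultimately show ?thesis using p x by simp
  qed
  have pc: "p1 d \<in> U" "p2 d \<in> V" "d = p1 d \<oplus>\<^bsub>D\<^esub> p2 d" if "d \<in> carrier D" for d
    using ex[OF that] p by auto
  show ?thesis
  proof (rule is_dsumI)
    show "(\<lambda>x. x) \<in> mod_hom R (sub D U) D" "(\<lambda>x. x) \<in> mod_hom R (sub D V) D"
      using UD by (auto simp: mod_hom_def)
    show "p1 \<in> mod_hom R D (sub D U)" "p2 \<in> mod_hom R D (sub D V)"
      using pa ps pc(1,2) by (auto intro!: mod_homI)
    fix x assume "x \<in> carrier (sub D U)"
    then show "p1 x = x" "p2 x = \<zero>\<^bsub>sub D V\<^esub>" using p[of x "\<zero>\<^bsub>D\<^esub>"] UD by auto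
  next
    fix x assume "x \<in> carrier (sub D V)"
    then show "p2 x = x" "p1 x = \<zero>\<^bsub>sub D U\<^esub>" using p[of "\<zero>\<^bsub>D\<^esub>" x] UD by auto
  qed (rule pc(3))
qed

section \<open>Modules of finite length\<close>

text \<open>Its submodules are the left ideals of \<open>R\<close>, so that left ideals, finite
  length of the ring and free modules are all treated in the language of modules.\<close>

definition reg :: "('a, 'x) ring_scheme \<Rightarrow> ('a, 'a) module" where
  "reg R = \<lparr>carrier = carrier R, mult = mult R, one = one R, zero = zero R, add = add R, smult = mult R\<rparr>"

lemma reg_simps [simp]:
  "carrier (reg R) = carrier R" "zero (reg R) = zero R" "add (reg R) = add R" "smult (reg R) = mult R"
  by (simp_all add: reg_def)

lemma (in ring) reg_left_module: "left_module R (reg R)"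
proof (intro left_module.intro left_module_axioms.intro ring_axioms abelian_groupI)
  fix x assume "x \<in> carrier (reg R)"
  then show "\<exists>y\<in>carrier (reg R). y \<oplus>\<^bsub>reg R\<^esub> x = \<zero>\<^bsub>reg R\<^esub>" by (auto intro!: bexI[of _ "\<ominus> x"] simp: l_neg)
qed (auto simp: a_ac l_distr r_distr m_assoc)

lemma (in ring) a_inv_reg: "x \<in> carrier R \<Longrightarrow> a_inv (reg R) x = \<ominus> x"
proof -
  interpret L: left_module R "reg R" by (rule reg_left_module)
  show "x \<in> carrier R \<Longrightarrow> a_inv (reg R) x = \<ominus> x"
    by (intro L.M.minus_equality) (auto simp: l_neg)
qed

lemma (in ring) left_ideal_iff: "left_ideal I R \<longleftrightarrow> submodule I R (reg R)"
proof -
  interpret L: left_module R "reg R" by (rule reg_left_module)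
  show ?thesis
  proof
    assume l: "left_ideal I R"
    then interpret additive_subgroup I R by (simp add: left_ideal_def)
    show "submodule I R (reg R)" using l a_subset by (auto simp: L.submodule_iff left_ideal_def)
  next
    assume s: "submodule I R (reg R)"
    then have "additive_subgroup I R" using L.submodule_minus[OF s] a_inv_reg
      by (intro additive_subgroup.intro subgroup.intro) (auto simp: L.submodule_iff a_inv_def subset_iff)
    then show "left_ideal I R" using s by (auto simp: L.submodule_iff left_ideal_def)
  qed
qed

lemma (in cring) ideal_iff_submodule: "ideal I R \<longleftrightarrow> submodule I R (reg R)"
proof
  assume "ideal I R"
  then interpret ideal I R .
  have "left_ideal I R" using I_l_closed additive_subgroup_axioms by (auto simp: left_ideal_def)
  then show "submodule I R (reg R)" by (simp add: left_ideal_iff)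
next
  assume "submodule I R (reg R)"
  then have "left_ideal I R" by (simp add: left_ideal_iff)
  then interpret additive_subgroup I R by (simp add: left_ideal_def)
  have l: "x \<otimes> a \<in> I" if "a \<in> I" "x \<in> carrier R" for a x
    using \<open>left_ideal I R\<close> that by (auto simp: left_ideal_def)
  moreover have "a \<otimes> x \<in> I" if "a \<in> I" "x \<in> carrier R" for a x
    using l[OF that] m_comm[of a x] that a_subset by auto
  ultimately show "ideal I R" by (intro idealI ring_axioms a_subgroup)
qed

definition span :: "('a, 'x) ring_scheme \<Rightarrow> ('a, 'm) module \<Rightarrow> 'm set \<Rightarrow> 'm set" where
  "span R M S = \<Inter>{U. submodule U R M \<and> S \<subseteq> U}"

text \<open>Finite length is expressed by a rank that increases strictly along inclusions of submodules.\<close>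

definition finite_len_between :: "('a, 'x) ring_scheme \<Rightarrow> ('a, 'm) module \<Rightarrow> 'm set \<Rightarrow> 'm set \<Rightarrow> bool" where
  "finite_len_between R M V W \<longleftrightarrow> (\<exists>\<rho> :: 'm set \<Rightarrow> nat. \<forall>U U'. submodule U R M \<and> submodule U' R M \<and>
     V \<subseteq> U \<and> U \<subset> U' \<and> U' \<subseteq> W \<longrightarrow> \<rho> U < \<rho> U')"

definition finite_len :: "('a, 'x) ring_scheme \<Rightarrow> ('a, 'm) module \<Rightarrow> bool" where
  "finite_len R M \<longleftrightarrow> (\<exists>\<rho> :: 'm set \<Rightarrow> nat. \<forall>U U'. submodule U R M \<and> submodule U' R M \<and> U \<subset> U' \<longrightarrow> \<rho> U < \<rho> U')"

context left_module
begin

lemma span_submodule: "S \<subseteq> carrier M \<Longrightarrow> submodule (span R M S) R M"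
  unfolding span_def using carrier_submodule by (intro Inter_submodule) auto

lemma span_superset: "S \<subseteq> span R M S" unfolding span_def by auto

lemma span_least: "submodule U R M \<Longrightarrow> S \<subseteq> U \<Longrightarrow> span R M S \<subseteq> U" unfolding span_def by auto

lemma span_mono: "S \<subseteq> T \<Longrightarrow> span R M S \<subseteq> span R M T" unfolding span_def by blast

lemma fg_iff: "finitely_generated R M \<longleftrightarrow> (\<exists>S. finite S \<and> S \<subseteq> carrier M \<and> span R M S = carrier M)"
proof
  assume "finitely_generated R M"
  then obtain S where S: "finite S" "S \<subseteq> carrier M" "\<And>U. submodule U R M \<Longrightarrow> S \<subseteq> U \<Longrightarrow> U = carrier M"
    unfolding finitely_generated_def by blast
  then show "\<exists>S. finite S \<and> S \<subseteq> carrier M \<and> span R M S = carrier M"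
    using span_submodule[OF S(2)] span_superset[of S] by blast
next
  assume "\<exists>S. finite S \<and> S \<subseteq> carrier M \<and> span R M S = carrier M"
  then obtain S where S: "finite S" "S \<subseteq> carrier M" "span R M S = carrier M" by blast
  show "finitely_generated R M" unfolding finitely_generated_def
  proof (intro exI[of _ S] conjI S allI impI)
    fix U assume "submodule U R M \<and> S \<subseteq> U"
    then show "U = carrier M" using span_least[of U S] S(3) by (auto simp: submodule_iff)
  qed
qed

text \<open>The submodule \<open>R x + V\<close>, described by elements. It serves the induction
  over generators as well as the maximality arguments for left ideals.\<close>

lemma cyclic_add_submodule:
  assumes x: "x \<in> carrier M" and V: "submodule V R M"
  shows "submodule {a \<odot>\<^bsub>M\<^esub> x \<oplus>\<^bsub>M\<^esub> y | a y. a \<in> carrier R \<and> y \<in> V} R M" (is "submodule ?T R M")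
proof -
  have V': "V \<subseteq> carrier M" "\<zero>\<^bsub>M\<^esub> \<in> V" "\<And>x y. x \<in> V \<Longrightarrow> y \<in> V \<Longrightarrow> x \<oplus>\<^bsub>M\<^esub> y \<in> V"
    "\<And>a x. a \<in> carrier R \<Longrightarrow> x \<in> V \<Longrightarrow> a \<odot>\<^bsub>M\<^esub> x \<in> V" using V by (auto simp: submodule_iff)
  show ?thesis unfolding submodule_iff
  proof (intro conjI ballI)
    show "?T \<subseteq> carrier M" using x V' by auto
    have "\<zero>\<^bsub>M\<^esub> = \<zero>\<^bsub>R\<^esub> \<odot>\<^bsub>M\<^esub> x \<oplus>\<^bsub>M\<^esub> \<zero>\<^bsub>M\<^esub>" using x by (simp add: smult_zero_l)
    then show "\<zero>\<^bsub>M\<^esub> \<in> ?T" using V' by blast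
    fix u v assume "u \<in> ?T" "v \<in> ?T"
    then obtain a b y z where *: "a \<in> carrier R" "b \<in> carrier R" "y \<in> V" "z \<in> V"
      "u = a \<odot>\<^bsub>M\<^esub> x \<oplus>\<^bsub>M\<^esub> y" "v = b \<odot>\<^bsub>M\<^esub> x \<oplus>\<^bsub>M\<^esub> z" by auto
    moreover have "y \<in> carrier M" "z \<in> carrier M" using * V' by auto
    ultimately have "u \<oplus>\<^bsub>M\<^esub> v = (a \<oplus>\<^bsub>R\<^esub> b) \<odot>\<^bsub>M\<^esub> x \<oplus>\<^bsub>M\<^esub> (y \<oplus>\<^bsub>M\<^esub> z)"
      using x by (simp add: smult_l_distr M.a_ac)
    then show "u \<oplus>\<^bsub>M\<^esub> v \<in> ?T" using * V' by blast
  next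
    fix c u assume "c \<in> carrier R" "u \<in> ?T"
    then obtain a y where *: "c \<in> carrier R" "a \<in> carrier R" "y \<in> V" "u = a \<odot>\<^bsub>M\<^esub> x \<oplus>\<^bsub>M\<^esub> y" by auto
    moreover have "y \<in> carrier M" using * V' by auto
    ultimately have "c \<odot>\<^bsub>M\<^esub> u = (c \<otimes>\<^bsub>R\<^esub> a) \<odot>\<^bsub>M\<^esub> x \<oplus>\<^bsub>M\<^esub> (c \<odot>\<^bsub>M\<^esub> y)"
      using x by (simp add: smult_r_distr smult_assoc1)
    then show "c \<odot>\<^bsub>M\<^esub> u \<in> ?T" using * V' by blast
  qed
qed

lemma cyclic_add_upper:
  assumes x: "x \<in> carrier M" and V: "submodule V R M"
  shows "insert x V \<subseteq> {a \<odot>\<^bsub>M\<^esub> x \<oplus>\<^bsub>M\<^esub> y | a y. a \<in> carrier R \<and> y \<in> V}" (is "_ \<subseteq> ?T")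
proof -
  have V': "V \<subseteq> carrier M" "\<zero>\<^bsub>M\<^esub> \<in> V" using V by (auto simp: submodule_iff)
  have "x = \<one>\<^bsub>R\<^esub> \<odot>\<^bsub>M\<^esub> x \<oplus>\<^bsub>M\<^esub> \<zero>\<^bsub>M\<^esub>" using x by simp
  then have "x \<in> ?T" using V' by blast
  moreover have "y \<in> ?T" if "y \<in> V" for y
  proof -
    have "y = \<zero>\<^bsub>R\<^esub> \<odot>\<^bsub>M\<^esub> x \<oplus>\<^bsub>M\<^esub> y" using that V' x by (auto simp: smult_zero_l)
    then show ?thesis using that by blast
  qed
  ultimately show ?thesis by auto
qed

lemma span_insert:
  assumes "x \<in> carrier M" "S \<subseteq> carrier M"
  shows "span R M (insert x S) \<subseteq> {a \<odot>\<^bsub>M\<^esub> x \<oplus>\<^bsub>M\<^esub> y | a y. a \<in> carrier R \<and> y \<in> span R M S}"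
  using cyclic_add_submodule[OF assms(1) span_submodule[OF assms(2)]]
    cyclic_add_upper[OF assms(1) span_submodule[OF assms(2)]] span_superset[of S]
  by (intro span_least) auto

lemma finite_len_iff: "finite_len R M \<longleftrightarrow> finite_len_between R M {\<zero>\<^bsub>M\<^esub>} (carrier M)"
proof -
  have "submodule U R M \<Longrightarrow> {\<zero>\<^bsub>M\<^esub>} \<subseteq> U" "submodule U R M \<Longrightarrow> U \<subseteq> carrier M" for U
    by (simp_all add: submodule_iff)
  then show ?thesis unfolding finite_len_def finite_len_between_def by meson
qed

lemma finite_len_between_refl: "finite_len_between R M V V" unfolding finite_len_between_def by blast

text \<open>By the modular law, a submodule that grows strictly must grow strictly in its
  intersection with \<open>W\<close> or in its sum with \<open>W\<close>. Adding the ranks of these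
  two therefore gives a rank on the whole interval.\<close>

lemma finite_len_between_trans:
  assumes W: "submodule W R M" and "V \<subseteq> W" "W \<subseteq> X" and "finite_len_between R M V W" "finite_len_between R M W X"
    and V: "submodule V R M" and X: "submodule X R M"
  shows "finite_len_between R M V X"
proof -
  obtain \<rho> :: "'m set \<Rightarrow> nat" where r0: "\<forall>U U'. submodule U R M \<and> submodule U' R M \<and> V \<subseteq> U \<and> U \<subset> U' \<and> U' \<subseteq> W \<longrightarrow> \<rho> U < \<rho> U'"
    using assms(4) unfolding finite_len_between_def by (rule exE)
  have r: "\<And>U U'. submodule U R M \<Longrightarrow> submodule U' R M \<Longrightarrow>
     V \<subseteq> U \<Longrightarrow> U \<subset> U' \<Longrightarrow> U' \<subseteq> W \<Longrightarrow> \<rho> U < \<rho> U'"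
    using r0 by simp
  obtain \<sigma> :: "'m set \<Rightarrow> nat" where s0: "\<forall>U U'. submodule U R M \<and> submodule U' R M \<and> W \<subseteq> U \<and> U \<subset> U' \<and> U' \<subseteq> X \<longrightarrow> \<sigma> U < \<sigma> U'"
    using assms(5) unfolding finite_len_between_def by (rule exE)
  have s: "\<And>U U'. submodule U R M \<Longrightarrow> submodule U' R M \<Longrightarrow>
     W \<subseteq> U \<Longrightarrow> U \<subset> U' \<Longrightarrow> U' \<subseteq> X \<Longrightarrow> \<sigma> U < \<sigma> U'"
    using s0 by simp
  show ?thesis unfolding finite_len_between_def
  proof (intro exI[of _ "\<lambda>U. \<rho> (U \<inter> W) + \<sigma> (U <+>\<^bsub>M\<^esub> W)"] allI impI, elim conjE)
    fix U U' assume U: "submodule U R M" "submodule U' R M" "V \<subseteq> U" "U \<subset> U'" "U' \<subseteq> X"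
    let ?A = "U \<inter> W" and ?A' = "U' \<inter> W" and ?B = "U <+>\<^bsub>M\<^esub> W" and ?B' = "U' <+>\<^bsub>M\<^esub> W"
    have sm: "submodule ?A R M" "submodule ?A' R M" "submodule ?B R M" "submodule ?B' R M"
      using U W Int_submodule sum_submodule by auto
    have AA: "?A \<subseteq> ?A'" "V \<subseteq> ?A" "?A' \<subseteq> W" using U assms by auto
    have BB: "?B \<subseteq> ?B'" using U unfolding set_add_def' by blast
    have WB: "W \<subseteq> ?B" using sum_upper[OF U(1) W] by auto
    have BX: "?B' \<subseteq> X" using U(5) assms(3) X unfolding set_add_def' submodule_iff by blast
    have ne: "?A \<noteq> ?A' \<or> ?B \<noteq> ?B'"
    proof (rule ccontr)
      assume "\<not> ?thesis"
      then have eq: "?A = ?A'" "?B = ?B'" by auto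
      have "U' \<subseteq> U"
      proof
        fix x assume x: "x \<in> U'"
        then have "x \<in> ?B" using sum_upper(1)[OF U(2) W] eq by auto
        then obtain u w where uw: "u \<in> U" "w \<in> W" "x = u \<oplus>\<^bsub>M\<^esub> w" by (auto simp: set_add_def')
        have c: "u \<in> carrier M" "w \<in> carrier M" using uw U(1) W by (auto simp: submodule_iff)
        have "x \<ominus>\<^bsub>M\<^esub> u = w" using uw c add_diff_cancel[of w u] M.a_comm[of u w] by simp
        moreover have "x \<ominus>\<^bsub>M\<^esub> u \<in> U'" using x uw U submodule_diff[OF U(2)] by auto
        ultimately have "w \<in> U" using uw eq by auto
        then show "x \<in> U" using uw U(1) by (auto simp: submodule_iff)
      qed
      then show False using U by auto
    qed
    have "\<rho> ?A \<le> \<rho> ?A'" "?A \<noteq> ?A' \<Longrightarrow> \<rho> ?A < \<rho> ?A'"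
      using r[OF sm(1,2) AA(2) _ AA(3)] AA(1) by (cases "?A = ?A'"; auto)+
    moreover have "\<sigma> ?B \<le> \<sigma> ?B'" "?B \<noteq> ?B' \<Longrightarrow> \<sigma> ?B < \<sigma> ?B'"
      using s[OF sm(3,4) WB _ BX] BB by (cases "?B = ?B'"; auto)+
    ultimately show "\<rho> ?A + \<sigma> ?B < \<rho> ?A' + \<sigma> ?B'" using ne by linarith
  qed
qed

text \<open>One generator \<open>x\<close> is adjoined at a time. A submodule \<open>U\<close>
  between the two spans is determined by the left ideal of all \<open>a\<close> with
  \<open>a x\<close> in \<open>U\<close>, so the rank of the regular module can be pulled
  back.\<close>

lemma finite_len_between_span:
  assumes R: "finite_len R (reg R)" and S: "finite S" "S \<subseteq> carrier M"
  shows "finite_len_between R M {\<zero>\<^bsub>M\<^esub>} (span R M S)"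
  using S
proof (induction S)
  case empty
  have "span R M {} \<subseteq> {\<zero>\<^bsub>M\<^esub>}" using span_least[OF zero_submodule] by simp
  then have "span R M {} = {\<zero>\<^bsub>M\<^esub>}" using span_submodule[of "{}"] by (auto simp: submodule_iff)
  then show ?case using finite_len_between_refl by simp
next
  case (insert x S)
  obtain \<rho> where r0: "\<forall>U U'. submodule U R (reg R) \<and> submodule U' R (reg R) \<and> U \<subset> U' \<longrightarrow> \<rho> U < (\<rho> U' :: nat)"
    using R unfolding finite_len_def by (rule exE)
  have r: "\<And>U U'. submodule U R (reg R) \<Longrightarrow> submodule U' R (reg R) \<Longrightarrow> U \<subset> U' \<Longrightarrow> \<rho> U < (\<rho> U' :: nat)"
    using r0 by simp
  have xc: "x \<in> carrier M" and Sc: "S \<subseteq> carrier M" using insert by auto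
  let ?V = "span R M S"
  interpret L: left_module R "reg R" by (rule R.reg_left_module)
  define J where "J U = {a \<in> carrier R. a \<odot>\<^bsub>M\<^esub> x \<in> U}" for U
  have J: "submodule (J U) R (reg R)" if "submodule U R M" for U
    using that xc unfolding L.submodule_iff J_def submodule_iff
    by (auto simp: smult_zero_l smult_l_distr smult_assoc1)
  have "finite_len_between R M ?V (span R M (insert x S))"
    unfolding finite_len_between_def
  proof (intro exI[of _ "\<lambda>U. \<rho> (J U)"] allI impI, elim conjE)
    fix U U' assume U: "submodule U R M" "submodule U' R M" "?V \<subseteq> U" "U \<subset> U'" "U' \<subseteq> span R M (insert x S)"
    have "J U \<subseteq> J U'" using U by (auto simp: J_def)
    moreover have "J U \<noteq> J U'"
    proof
      assume eq: "J U = J U'"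
      obtain u where u: "u \<in> U'" "u \<notin> U" using U by auto
      then have "u \<in> span R M (insert x S)" using U by auto
      then obtain a y where ay: "a \<in> carrier R" "y \<in> ?V" "u = a \<odot>\<^bsub>M\<^esub> x \<oplus>\<^bsub>M\<^esub> y"
        using span_insert[OF xc Sc] by blast
      have yc: "y \<in> U" "y \<in> U'" "y \<in> carrier M" using ay U by (auto simp: submodule_iff)
      have "a \<odot>\<^bsub>M\<^esub> x = u \<ominus>\<^bsub>M\<^esub> y" using ay yc xc by (simp add: add_diff_cancel)
      then have "a \<odot>\<^bsub>M\<^esub> x \<in> U'" using submodule_diff[OF U(2) u(1) yc(2)] by simp
      then have "a \<in> J U" using ay eq by (auto simp: J_def)
      then have "u \<in> U" using ay yc U(1) by (auto simp: J_def submodule_iff)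
      then show False using u by simp
    qed
    ultimately have "J U \<subset> J U'" by auto
    then show "\<rho> (J U) < \<rho> (J U')" by (rule r[OF J[OF U(1)] J[OF U(2)]])
  qed
  moreover have "{\<zero>\<^bsub>M\<^esub>} \<subseteq> ?V" using span_submodule[OF Sc] by (simp add: submodule_iff)
  ultimately show ?case
    using insert.IH[OF Sc] span_mono[of S "insert x S"]
    by (intro finite_len_between_trans[OF span_submodule[OF Sc] _ _ _ _ zero_submodule span_submodule[OF insert.prems]]) auto
qed

lemma fg_finite_len:
  assumes "finite_len R (reg R)" "finitely_generated R M" shows "finite_len R M"
proof -
  obtain S where "finite S" "S \<subseteq> carrier M" "span R M S = carrier M" using assms(2) fg_iff by auto
  then show ?thesis using finite_len_between_span[OF assms(1), of S] by (simp add: finite_len_iff)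
qed

lemma finite_len_min:
  assumes "finite_len R M" "\<S> \<noteq> {}" "\<forall>U\<in>\<S>. submodule U R M"
  shows "\<exists>U\<in>\<S>. \<forall>V\<in>\<S>. V \<subseteq> U \<longrightarrow> V = U"
proof -
  obtain \<rho> :: "'m set \<Rightarrow> nat" where r0: "\<forall>U U'. submodule U R M \<and> submodule U' R M \<and> U \<subset> U' \<longrightarrow> \<rho> U < \<rho> U'"
    using assms(1) unfolding finite_len_def by (rule exE)
  have r: "\<And>U U'. submodule U R M \<Longrightarrow> submodule U' R M \<Longrightarrow> U \<subset> U' \<Longrightarrow> \<rho> U < \<rho> U'"
    using r0 by simp
  obtain U0 where "U0 \<in> \<S>" using assms by auto
  then obtain U where U: "U \<in> \<S>" "\<And>V. V \<in> \<S> \<Longrightarrow> \<rho> U \<le> \<rho> V"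
    using ex_has_least_nat[of "\<lambda>U. U \<in> \<S>" U0 \<rho>] by blast
  show ?thesis
  proof (intro bexI[of _ U] ballI impI U(1))
    fix V assume "V \<in> \<S>" "V \<subseteq> U"
    have "\<not> V \<subset> U"
    proof
      assume "V \<subset> U"
      then have "\<rho> V < \<rho> U" using r[of V U] assms(3) U(1) \<open>V \<in> \<S>\<close> by blast
      then show False using U(2)[OF \<open>V \<in> \<S>\<close>] by simp
    qed
    then show "V = U" using \<open>V \<subseteq> U\<close> by auto
  qed
qed

lemma finite_len_max:
  assumes "finite_len R M" "\<S> \<noteq> {}" "\<forall>U\<in>\<S>. submodule U R M"
  shows "\<exists>U\<in>\<S>. \<forall>V\<in>\<S>. U \<subseteq> V \<longrightarrow> V = U"
proof -
  obtain \<rho> :: "'m set \<Rightarrow> nat" where r0: "\<forall>U U'. submodule U R M \<and> submodule U' R M \<and> U \<subset> U' \<longrightarrow> \<rho> U < \<rho> U'"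
    using assms(1) unfolding finite_len_def by (rule exE)
  have r: "\<And>U U'. submodule U R M \<Longrightarrow> submodule U' R M \<Longrightarrow> U \<subset> U' \<Longrightarrow> \<rho> U < \<rho> U'"
    using r0 by simp
  obtain U0 where U0: "U0 \<in> \<S>" using assms by auto
  have bd: "\<rho> V \<le> \<rho> (carrier M)" if "V \<in> \<S>" for V
    using r[of V "carrier M"] carrier_submodule bspec[OF assms(3) that]
    by (cases "V = carrier M") (auto simp: submodule_iff psubset_eq less_imp_le)
  then obtain U where U: "U \<in> \<S>" "\<And>V. V \<in> \<S> \<Longrightarrow> \<rho> V \<le> \<rho> U"
    using ex_has_greatest_nat[of "\<lambda>U. U \<in> \<S>" U0 \<rho> "Suc (\<rho> (carrier M))"] U0 bd
    by (auto simp: less_Suc_eq_le)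
  show ?thesis
  proof (intro bexI[of _ U] ballI impI U(1))
    fix V assume "V \<in> \<S>" "U \<subseteq> V"
    have "\<not> U \<subset> V"
    proof
      assume "U \<subset> V"
      then have "\<rho> U < \<rho> V" using r[of U V] assms(3) U(1) \<open>V \<in> \<S>\<close> by blast
      then show False using U(2)[OF \<open>V \<in> \<S>\<close>] by simp
    qed
    then show "V = U" using \<open>U \<subseteq> V\<close> by auto
  qed
qed

text \<open>A maximal submodule among the spans of finite sets absorbs every further
  element.\<close>

lemma finite_len_fg:
  assumes "finite_len R M" shows "finitely_generated R M"
proof -
  let ?S = "span R M ` {S. finite S \<and> S \<subseteq> carrier M}"
  have ne: "?S \<noteq> {}" and sm: "\<forall>U\<in>?S. submodule U R M" using span_submodule by auto
  obtain U where U0: "U \<in> ?S" "\<forall>V\<in>?S. U \<subseteq> V \<longrightarrow> V = U"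
    using finite_len_max[OF assms ne sm] by (elim bexE) (rule that)
  have U: "U \<in> ?S" "\<And>V. V \<in> ?S \<Longrightarrow> U \<subseteq> V \<Longrightarrow> V = U" by (rule U0(1), rule U0(2)[rule_format])
  then obtain S where S: "finite S" "S \<subseteq> carrier M" "U = span R M S" by auto
  have "x \<in> U" if "x \<in> carrier M" for x
  proof -
    have "span R M (insert x S) = U" using U(2)[of "span R M (insert x S)"] S that span_mono[of S "insert x S"] by auto
    then show ?thesis using span_superset[of "insert x S"] by auto
  qed
  then have "U = carrier M" using span_submodule[OF S(2)] S(3) by (auto simp: submodule_iff)
  then show ?thesis using S fg_iff by auto
qed

lemma finite_len_sub:
  assumes "finite_len R M" "submodule U R M" shows "finite_len R (sub M U)"
proof -
  obtain \<rho> :: "'m set \<Rightarrow> nat" where r0: "\<forall>U U'. submodule U R M \<and> submodule U' R M \<and> U \<subset> U' \<longrightarrow> \<rho> U < \<rho> U'"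
    using assms(1) unfolding finite_len_def by (rule exE)
  have r: "\<And>U U'. submodule U R M \<Longrightarrow> submodule U' R M \<Longrightarrow> U \<subset> U' \<Longrightarrow> \<rho> U < \<rho> U'"
    using r0 by simp
  show ?thesis unfolding finite_len_def submodule_sub_iff[OF assms(2)]
    by (intro exI[of _ \<rho>] allI impI r) auto
qed

end

text \<open>Only the lattices of submodules matter, so ring and module may both change. This covers
  the passage to subalgebras and to quotient rings.\<close>

lemma finite_len_embed:
  assumes "finite_len R M"
    and "\<And>U. submodule U R' M' \<Longrightarrow> submodule (\<phi> U) R M"
    and "\<And>U V. submodule U R' M' \<Longrightarrow> submodule V R' M' \<Longrightarrow> U \<subset> V \<Longrightarrow> \<phi> U \<subset> \<phi> V"
  shows "finite_len R' M'"
proof -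
  obtain \<rho> where r0: "\<forall>U U'. submodule U R M \<and> submodule U' R M \<and> U \<subset> U' \<longrightarrow> \<rho> U < (\<rho> U'::nat)"
    using assms(1) unfolding finite_len_def by (rule exE)
  have r: "\<And>U U'. submodule U R M \<Longrightarrow> submodule U' R M \<Longrightarrow> U \<subset> U' \<Longrightarrow> \<rho> U < (\<rho> U'::nat)"
    using r0 by simp
  show ?thesis unfolding finite_len_def
    by (intro exI[of _ "\<lambda>U. \<rho> (\<phi> U)"] allI impI r assms(2,3)) auto
qed

lemma fg_image:
  assumes M: "left_module R M" and N: "left_module R N" and f: "f \<in> mod_hom R M N" "f ` carrier M = carrier N"
    and fg: "finitely_generated R M"
  shows "finitely_generated R N"
proof -
  interpret M: left_module R M by fact
  interpret N: left_module R N by fact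
  obtain S where S: "finite S" "S \<subseteq> carrier M" "span R M S = carrier M" using fg M.fg_iff by auto
  have "U = carrier N" if U: "submodule U R N" "f ` S \<subseteq> U" for U
  proof -
    have "span R M S \<subseteq> {x \<in> carrier M. f x \<in> U}"
      using U S by (intro M.span_least preimage_submodule[OF M N f(1)]) auto
    then have "f ` carrier M \<subseteq> U" using S by auto
    then show ?thesis using f(2) U(1) unfolding N.submodule_iff by auto
  qed
  then show ?thesis unfolding finitely_generated_def using S f(2) hom_closed[OF f(1)] by (intro exI[of _ "f ` S"]) auto
qed

section \<open>Maximal left ideals and Zorn's lemma\<close>

context ring
begin

lemma chain_Union_submodule:
  assumes "left_module R M" "\<C> \<noteq> {}" "\<And>U V. U \<in> \<C> \<Longrightarrow> V \<in> \<C> \<Longrightarrow> U \<subseteq> V \<or> V \<subseteq> U"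
    and "\<And>U. U \<in> \<C> \<Longrightarrow> submodule U R M"
  shows "submodule (\<Union>\<C>) R M"
proof -
  interpret M: left_module R M by fact
  have s: "\<And>U. U \<in> \<C> \<Longrightarrow> U \<subseteq> carrier M \<and> \<zero>\<^bsub>M\<^esub> \<in> U \<and> (\<forall>x\<in>U. \<forall>y\<in>U. x \<oplus>\<^bsub>M\<^esub> y \<in> U) \<and>
     (\<forall>a\<in>carrier R. \<forall>x\<in>U. a \<odot>\<^bsub>M\<^esub> x \<in> U)" using assms(4) by (simp add: M.submodule_iff)
  show ?thesis unfolding M.submodule_iff
  proof (intro conjI ballI)
    fix x y assume "x \<in> \<Union>\<C>" "y \<in> \<Union>\<C>"
    then obtain U V where *: "U \<in> \<C>" "V \<in> \<C>" "x \<in> U" "y \<in> V" by auto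
    then show "x \<oplus>\<^bsub>M\<^esub> y \<in> \<Union>\<C>" using assms(3)[OF *(1,2)] s by (meson UnionI subsetD)
  qed (use assms(2) s in blast)+
qed

text \<open>Properness in the form that \<open>\<one>\<close> is missing survives unions of chains,
  as Zorn's lemma requires.\<close>

lemma maximal_left_ideal_iff:
  "maximal_left_ideal I R \<longleftrightarrow> submodule I R (reg R) \<and> \<one> \<notin> I \<and>
     (\<forall>J. submodule J R (reg R) \<longrightarrow> I \<subseteq> J \<longrightarrow> \<one> \<notin> J \<longrightarrow> J = I)"
proof -
  interpret L: left_module R "reg R" by (rule reg_left_module)
  have *: "\<one> \<in> J \<longleftrightarrow> J = carrier R" if J: "submodule J R (reg R)" for J
  proof
    assume "\<one> \<in> J"
    then have "x \<in> J" if "x \<in> carrier R" for x using J that r_one[OF that] unfolding L.submodule_iff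
      by (metis reg_simps(4))
    then show "J = carrier R" using J by (auto simp: L.submodule_iff)
  qed simp
  show ?thesis unfolding maximal_left_ideal_def left_ideal_iff using * by blast
qed

lemma exists_maximal_left_ideal:
  assumes "submodule I R (reg R)" "\<one> \<notin> I"
  obtains J where "maximal_left_ideal J R" "I \<subseteq> J"
proof -
  let ?A = "{J. submodule J R (reg R) \<and> I \<subseteq> J \<and> \<one> \<notin> J}"
  have "\<exists>J\<in>?A. \<forall>X\<in>?A. J \<subseteq> X \<longrightarrow> X = J"
  proof (rule subset_Zorn_nonempty)
    show "?A \<noteq> {}" using assms by auto
    fix \<C> assume C: "\<C> \<noteq> {}" "subset.chain ?A \<C>"
    then have "submodule (\<Union>\<C>) R (reg R)"
      by (intro chain_Union_submodule reg_left_module) (auto simp: subset_chain_def subset_iff)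
    then show "\<Union>\<C> \<in> ?A" using C by (auto simp: subset_chain_def)
  qed
  then obtain J where J: "J \<in> ?A" "\<And>X. X \<in> ?A \<Longrightarrow> J \<subseteq> X \<Longrightarrow> X = J" by auto
  have "maximal_left_ideal J R"
    unfolding maximal_left_ideal_iff using J by (auto intro!: J(2))
  then show ?thesis using that J(1) by simp
qed

text \<open>Maximality forces the left ideal generated by \<open>r\<close> and \<open>I\<close> to
  contain \<open>\<one>\<close>, so \<open>r\<close> has a left inverse modulo
  \<open>I\<close>.\<close>

lemma maximal_left_ideal_inv:
  assumes "maximal_left_ideal I R" "r \<in> carrier R" "r \<notin> I"
  obtains s m where "s \<in> carrier R" "m \<in> I" "\<one> = s \<otimes> r \<oplus> m"
proof -
  interpret L: left_module R "reg R" by (rule reg_left_module)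
  have I: "submodule I R (reg R)" using assms by (simp add: maximal_left_ideal_iff)
  let ?T = "{s \<odot>\<^bsub>reg R\<^esub> r \<oplus>\<^bsub>reg R\<^esub> y | s y. s \<in> carrier R \<and> y \<in> I}"
  have T: "submodule ?T R (reg R)" "insert r I \<subseteq> ?T"
    using L.cyclic_add_submodule[OF _ I, of r] L.cyclic_add_upper[OF _ I, of r] assms by auto
  have "\<one> \<in> ?T"
  proof (rule ccontr)
    assume "\<one> \<notin> ?T"
    moreover have "I \<subseteq> ?T" using T(2) by blast
    ultimately have "?T = I" using assms(1) T(1) unfolding maximal_left_ideal_iff by (elim conjE allE) (drule mp, assumption, drule mp, assumption, drule mp, assumption, assumption)
    then show False using T(2) assms(3) by blast
  qed
  then show ?thesis using that by auto
qed

end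

section \<open>Commutative artinian rings have finite length\<close>

context cring
begin

text \<open>\<open>artinian\<close> speaks of descending chains; without a minimal member, dependent
  choice would produce a strictly descending one.\<close>

lemma artinian_min:
  assumes "artinian R" "\<S> \<noteq> {}" "\<forall>I\<in>\<S>. ideal I R"
  shows "\<exists>I\<in>\<S>. \<forall>J\<in>\<S>. J \<subseteq> I \<longrightarrow> J = I"
proof -
  show "\<exists>I\<in>\<S>. \<forall>J\<in>\<S>. J \<subseteq> I \<longrightarrow> J = I"
  proof (rule ccontr)
    assume "\<not> (\<exists>I\<in>\<S>. \<forall>J\<in>\<S>. J \<subseteq> I \<longrightarrow> J = I)"
    then have "\<forall>I\<in>\<S>. \<exists>J. J \<in> \<S> \<and> J \<subset> I" by auto
    then obtain nx where nx: "\<And>I. I \<in> \<S> \<Longrightarrow> nx I \<in> \<S> \<and> nx I \<subset> I" by metis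
    obtain I0 where I0: "I0 \<in> \<S>" using assms by auto
    define I where "I n = (nx ^^ n) I0" for n
    have IS: "I n \<in> \<S>" for n using I0 nx by (induction n) (auto simp: I_def)
    have I_step: "I (Suc n) \<subset> I n" for n using nx[OF IS[of n]] by (simp add: I_def)
    have "ideal (I n) R \<and> I (Suc n) \<subseteq> I n" for n using IS[of n] I_step[of n] assms(3) by auto
    then have "\<forall>n. ideal (I n) R \<and> I (Suc n) \<subseteq> I n" by (rule allI)
    then have "\<exists>m. \<forall>n. m \<le> n \<longrightarrow> I n = I m" by (rule assms(1)[unfolded artinian_def, THEN spec[where x = I], THEN mp])
    then obtain m where m: "\<forall>n. m \<le> n \<longrightarrow> I n = I m" by (rule exE)
    have "I (Suc m) = I m" using m[THEN spec[where x = "Suc m"]] by simp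
    then show False using I_step[of m] by simp
  qed
qed

text \<open>\<open>K / m K\<close> is a vector space over the field \<open>R / m\<close> with
  descending chain condition, hence finite-dimensional. In terms of ideals: \<open>W\<close> is
  minimal such that the interval from \<open>W\<close> to \<open>K\<close> has finite length. If
  \<open>W\<close> were larger than \<open>m K\<close>, an ideal \<open>V\<close> maximal among
  those between \<open>m K\<close> and \<open>W\<close> that miss a given \<open>x\<close> would
  make \<open>W / V\<close> simple, and \<open>V\<close> would contradict the choice of
  \<open>W\<close>.\<close>

lemma finite_len_between_maximal_prod:
  assumes art: "artinian R" and m: "maximal_left_ideal m R" and K: "ideal K R"
  shows "finite_len_between R (reg R) (m \<cdot> K) K"
proof -
  interpret L: left_module R "reg R" by (rule reg_left_module)
  have mi: "ideal m R" using m by (simp add: maximal_left_ideal_iff ideal_iff_submodule)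
  have mK: "ideal (m \<cdot> K) R" "m \<cdot> K \<subseteq> K" using ideal_prod_is_ideal[OF mi K] ideal_prod_inter[OF mi K] by auto
  let ?S = "{W. ideal W R \<and> m \<cdot> K \<subseteq> W \<and> W \<subseteq> K \<and> finite_len_between R (reg R) W K}"
  have "K \<in> ?S" using K mK L.finite_len_between_refl by auto
  then have "?S \<noteq> {}" by (metis emptyE)
  have idS: "\<forall>I\<in>?S. ideal I R" by simp
  obtain W where W0: "W \<in> ?S" "\<forall>J\<in>?S. J \<subseteq> W \<longrightarrow> J = W"
    using artinian_min[OF art \<open>?S \<noteq> {}\<close> idS] by (elim bexE) (rule that)
  have W: "W \<in> ?S" "\<And>J. J \<in> ?S \<Longrightarrow> J \<subseteq> W \<Longrightarrow> J = W" by (rule W0(1), rule W0(2)[rule_format])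
  have Ws: "submodule W R (reg R)" "ideal W R" "m \<cdot> K \<subseteq> W" "W \<subseteq> K" "finite_len_between R (reg R) W K" using W by (auto simp: ideal_iff_submodule)
  show ?thesis
  proof (cases "W = m \<cdot> K")
    case True then show ?thesis using W by auto
  next
    case False
    then obtain x where x: "x \<in> W" "x \<notin> m \<cdot> K" using Ws by auto
    let ?A = "{V. submodule V R (reg R) \<and> m \<cdot> K \<subseteq> V \<and> V \<subseteq> W \<and> x \<notin> V}"
    have "\<exists>V\<in>?A. \<forall>X\<in>?A. V \<subseteq> X \<longrightarrow> X = V"
    proof (rule subset_Zorn_nonempty)
      show "?A \<noteq> {}" using mK Ws x by (auto simp: ideal_iff_submodule)
      fix \<C> assume C: "\<C> \<noteq> {}" "subset.chain ?A \<C>"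
      then have "submodule (\<Union>\<C>) R (reg R)"
        by (intro chain_Union_submodule reg_left_module) (auto simp: subset_chain_def subset_iff)
      then show "\<Union>\<C> \<in> ?A" using C by (auto simp: subset_chain_def)
    qed
    then obtain V where V: "V \<in> ?A" "\<And>X. X \<in> ?A \<Longrightarrow> V \<subseteq> X \<Longrightarrow> X = V" by auto
    have Vs: "submodule V R (reg R)" "m \<cdot> K \<subseteq> V" "V \<subseteq> W" "x \<notin> V" using V by auto
    have Wc: "W \<subseteq> carrier R" using Ws(1) by (simp add: L.submodule_iff)
    \<comment> \<open>By maximality of \<open>V\<close> the ideal \<open>R y + V\<close> contains
      \<open>x\<close>. The coefficient of \<open>y\<close> lies outside \<open>m\<close>, since
      \<open>m y\<close> is inside \<open>m K\<close> and hence inside \<open>V\<close>.\<close>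
    have key: "\<exists>r v. r \<in> carrier R \<and> r \<notin> m \<and> v \<in> V \<and> x = r \<otimes> y \<oplus> v" if y: "y \<in> W" "y \<notin> V" for y
    proof -
      have yc: "y \<in> carrier (reg R)" using y Wc by auto
      let ?T = "{a \<odot>\<^bsub>reg R\<^esub> y \<oplus>\<^bsub>reg R\<^esub> v | a v. a \<in> carrier R \<and> v \<in> V}"
      have T: "submodule ?T R (reg R)" "insert y V \<subseteq> ?T"
        using L.cyclic_add_submodule[OF yc Vs(1)] L.cyclic_add_upper[OF yc Vs(1)] by auto
      have "?T \<subseteq> W" using y Vs(3) Ws(1) unfolding L.submodule_iff by auto
      have "x \<in> ?T"
      proof (rule ccontr)
        assume "x \<notin> ?T"
        then have "?T \<in> ?A" using \<open>?T \<subseteq> W\<close> T(1) T(2) Vs(2) by (simp only: mem_Collect_eq) auto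
        moreover have "V \<subseteq> ?T" using T(2) by (rule subset_trans[OF subset_insertI])
        ultimately have "?T = V" by (rule V(2))
        then show False using T(2) y(2) by blast
      qed
      then obtain r v where rv: "r \<in> carrier R" "v \<in> V" "x = r \<otimes> y \<oplus> v" by auto
      have "r \<notin> m"
      proof
        assume "r \<in> m"
        then have "r \<otimes> y \<in> m \<cdot> K" using y Ws by (intro ideal_prod.prod) auto
        then have "x \<in> V" using rv Vs by (auto simp: L.submodule_iff)
        then show False using Vs by simp
      qed
      then show ?thesis using rv by blast
    qed
    \<comment> \<open>A coefficient outside \<open>m\<close> can be inverted modulo
      \<open>m\<close>, so every \<open>z\<close> in \<open>W\<close> outside \<open>V\<close> is
      recovered from \<open>x\<close>, which any larger \<open>U\<close> contains.\<close>
    have simple: "U = W" if U: "submodule U R (reg R)" "V \<subset> U" "U \<subseteq> W" for U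
    proof -
      obtain y where y: "y \<in> U" "y \<notin> V" using U by auto
      then obtain r v where rv: "r \<in> carrier R" "v \<in> V" "x = r \<otimes> y \<oplus> v" using key[of y] U by auto
      then have xU: "x \<in> U" using y U by (auto simp: L.submodule_iff)
      have "z \<in> U" if z: "z \<in> W" for z
      proof (cases "z \<in> V")
        case True then show ?thesis using U by auto
      next
        case False
        then obtain r v where rv: "r \<in> carrier R" "r \<notin> m" "v \<in> V" "x = r \<otimes> z \<oplus> v" using key[OF z] by auto
        obtain s n where s: "s \<in> carrier R" "n \<in> m" "\<one> = s \<otimes> r \<oplus> n" using maximal_left_ideal_inv[OF m rv(1,2)] .
        have c: "z \<in> carrier R" "n \<in> carrier R" "v \<in> carrier R" "x \<in> carrier R"
          using z Wc s rv Vs x ideal.Icarr[OF mi] by auto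
        have "r \<otimes> z = x \<ominus>\<^bsub>reg R\<^esub> v" using rv c by (simp add: L.add_diff_cancel[simplified])
        moreover have "x \<ominus>\<^bsub>reg R\<^esub> v \<in> U" using L.submodule_diff[OF U(1) xU] rv U by auto
        ultimately have 1: "s \<otimes> (r \<otimes> z) \<in> U" using U(1) s by (auto simp: L.submodule_iff)
        have 2: "n \<otimes> z \<in> U" using s z Ws Vs U by (meson ideal_prod.prod psubsetD subsetD)
        have "z = \<one> \<otimes> z" using c by simp
        also have "\<dots> = s \<otimes> (r \<otimes> z) \<oplus> n \<otimes> z" using c s rv by (simp add: l_distr m_assoc)
        finally have "z = s \<otimes> (r \<otimes> z) \<oplus> n \<otimes> z" .
        moreover have "s \<otimes> (r \<otimes> z) \<oplus> n \<otimes> z \<in> U" using 1 2 U(1) unfolding L.submodule_iff by auto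
        ultimately show ?thesis by simp
      qed
      then show ?thesis using U by auto
    qed
    have "finite_len_between R (reg R) V W" unfolding finite_len_between_def
    proof (intro exI[of _ "\<lambda>U. if U = V then 0 else 1"] allI impI, elim conjE)
      fix U U' assume U: "submodule U R (reg R)" "submodule U' R (reg R)" "V \<subseteq> U" "U \<subset> U'" "U' \<subseteq> W"
      then have "U = V" using simple[of U] by auto
      then show "(if U = V then 0 else 1) < (if U' = V then 0 else 1 :: nat)" using U by auto
    qed
    then have "finite_len_between R (reg R) V K"
      using Ws Vs K by (intro L.finite_len_between_trans[OF Ws(1) Vs(3) Ws(4) _ Ws(5) Vs(1)]) (auto simp: ideal_iff_submodule)
    then have "V = W" using W(2)[of V] Vs Ws by (auto simp: ideal_iff_submodule)
    then show ?thesis using Vs x by auto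
  qed
qed

text \<open>Finite products of maximal ideals with repetitions, the empty one being the unit ideal.
  The quotient by each of them has finite length, and a minimal one will be shown to be
  zero.\<close>

inductive_set max_prods :: "'a set set" where
  base: "carrier R \<in> max_prods"
| step: "maximal_left_ideal m R \<Longrightarrow> T \<in> max_prods \<Longrightarrow> m \<cdot> T \<in> max_prods"

lemma max_prods_ideal: "T \<in> max_prods \<Longrightarrow> ideal T R"
  by (induction rule: max_prods.induct)
    (auto intro!: oneideal ideal_prod_is_ideal simp: maximal_left_ideal_iff ideal_iff_submodule[symmetric])

lemma max_prods_fl:
  assumes "artinian R" "T \<in> max_prods" shows "finite_len_between R (reg R) T (carrier R)"
  using assms(2)
proof (induction rule: max_prods.induct)
  case base
  interpret L: left_module R "reg R" by (rule reg_left_module)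
  show ?case by (rule L.finite_len_between_refl)
next
  case (step m T)
  interpret L: left_module R "reg R" by (rule reg_left_module)
  have i: "ideal T R" "ideal m R" using max_prods_ideal step by (auto simp: maximal_left_ideal_iff ideal_iff_submodule)
  have "m \<cdot> T \<subseteq> T" using ideal_prod_inter[OF i(2,1)] by auto
  moreover have "T \<subseteq> carrier R" using ideal.Icarr[OF i(1)] by auto
  moreover have "submodule T R (reg R)" "submodule (m \<cdot> T) R (reg R)" "submodule (carrier R) R (reg R)"
    using i(1) ideal_prod_is_ideal[OF i(2,1)] oneideal by (simp_all add: ideal_iff_submodule)
  ultimately show ?case
    using L.finite_len_between_trans finite_len_between_maximal_prod[OF assms(1) step(1) i(1)] step.IH by blast
qed

lemma max_prods_mult:
  assumes "T \<in> max_prods" "U \<in> max_prods" shows "T \<cdot> U \<in> max_prods"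
  using assms(1)
proof (induction rule: max_prods.induct)
  case base
  have "carrier R \<cdot> U = U" using ideal_prod_one[OF max_prods_ideal[OF assms(2)]] ideal_prod_commute[OF max_prods_ideal[OF assms(2)] oneideal] by simp
  then show ?case using assms by simp
next
  case (step m T)
  have "ideal m R" using step by (auto simp: maximal_left_ideal_iff ideal_iff_submodule)
  then show ?case using max_prods.step[OF step(1) step(3)] max_prods_ideal step assms
    by (simp add: ideal_prod_assoc)
qed

text \<open>A minimal product \<open>T\<close> of maximal ideals is idempotent and lies in every
  maximal ideal. If it were nonzero, there would be a minimal ideal \<open>L\<close> that
  \<open>T\<close> does not annihilate; an argument in the style of Nakayama's lemma excludes this.
  So \<open>T\<close> is zero, and the chain of partial products has factors of finite
  length.\<close>

theorem artinian_finite_len: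
  assumes art: "artinian R" shows "finite_len R (reg R)"
proof -
  interpret L: left_module R "reg R" by (rule reg_left_module)
  have "max_prods \<noteq> {}" using max_prods.base by auto
  moreover have "\<forall>I\<in>max_prods. ideal I R" using max_prods_ideal by simp
  ultimately have "\<exists>I\<in>max_prods. \<forall>J\<in>max_prods. J \<subseteq> I \<longrightarrow> J = I" by (rule artinian_min[OF art])
  then obtain T where T0: "T \<in> max_prods" "\<forall>J\<in>max_prods. J \<subseteq> T \<longrightarrow> J = T"
    by (elim bexE) (rule that)
  have T: "T \<in> max_prods" "\<And>J. J \<in> max_prods \<Longrightarrow> J \<subseteq> T \<Longrightarrow> J = T" by (rule T0(1), rule T0(2)[rule_format])
  have Ti: "ideal T R" using max_prods_ideal T by auto
  interpret T: ideal T R by fact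
  have TT: "T \<cdot> T = T" using T max_prods_mult ideal_prod_inter[OF Ti Ti] by auto
  have Tm: "T \<subseteq> m" if m: "maximal_left_ideal m R" for m
  proof -
    have mi: "ideal m R" using m by (auto simp: maximal_left_ideal_iff ideal_iff_submodule)
    have "m \<cdot> T = T" using T max_prods.step[OF m T(1)] ideal_prod_inter[OF mi Ti] by auto
    then show ?thesis using ideal_prod_inter[OF mi Ti] by auto
  qed
  have "T \<subseteq> {\<zero>}"
  proof (rule ccontr)
    assume "\<not> T \<subseteq> {\<zero>}"
    then have "\<exists>x\<in>T. \<exists>t\<in>T. x \<otimes> t \<noteq> \<zero>"
    proof -
      have "s = \<zero>" if "s \<in> T \<cdot> T" "\<forall>x\<in>T. \<forall>t\<in>T. x \<otimes> t = \<zero>" for s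
        using that by (induction rule: ideal_prod.induct) auto
      then show ?thesis using TT \<open>\<not> T \<subseteq> {\<zero>}\<close> by blast
    qed
    then have ne: "T \<in> {L. ideal L R \<and> (\<exists>x\<in>L. \<exists>t\<in>T. x \<otimes> t \<noteq> \<zero>)}" (is "_ \<in> ?S") using Ti by auto
    then have "?S \<noteq> {}" by (metis emptyE)
    have idS: "\<forall>I\<in>?S. ideal I R" by simp
    obtain L where L0: "L \<in> ?S" "\<forall>J\<in>?S. J \<subseteq> L \<longrightarrow> J = L"
      using artinian_min[OF art \<open>?S \<noteq> {}\<close> idS] by (elim bexE) (rule that)
    have L: "L \<in> ?S" "\<And>J. J \<in> ?S \<Longrightarrow> J \<subseteq> L \<Longrightarrow> J = L" by (rule L0(1), rule L0(2)[rule_format])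
    then obtain x t where x: "x \<in> L" "t \<in> T" "x \<otimes> t \<noteq> \<zero>" by auto
    have Li: "ideal L R" using L by auto
    interpret Li: ideal L R by fact
    have xc: "x \<in> carrier R" "t \<in> carrier R" using x by auto
    \<comment> \<open>This is the ideal \<open>x T\<close>. It lies in \<open>L\<close> and, as
      \<open>T\<close> is idempotent, is not annihilated by \<open>T\<close> either. Minimality
      gives \<open>X = L\<close>, whence \<open>x = x a\<close> with \<open>a\<close> in
      \<open>T\<close>.\<close>
    define X where "X = {x \<otimes> t | t. t \<in> T}"
    have "ideal X R" unfolding ideal_iff_submodule L.submodule_iff
    proof (intro conjI ballI)
      show "X \<subseteq> carrier (reg R)" using xc by (auto simp: X_def)
      show "\<zero>\<^bsub>reg R\<^esub> \<in> X" using xc by (auto simp: X_def intro!: exI[of _ \<zero>])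
      fix u v assume "u \<in> X" "v \<in> X"
      then obtain a b where *: "a \<in> T" "b \<in> T" "u = x \<otimes> a" "v = x \<otimes> b" by (auto simp: X_def)
      then have "u \<oplus> v = x \<otimes> (a \<oplus> b)" using xc by (simp add: r_distr)
      then show "u \<oplus>\<^bsub>reg R\<^esub> v \<in> X" using * by (auto simp: X_def)
    next
      fix c u assume "c \<in> carrier R" "u \<in> X"
      then obtain a where *: "a \<in> T" "u = x \<otimes> a" "c \<in> carrier R" by (auto simp: X_def)
      then have "c \<otimes> u = x \<otimes> (c \<otimes> a)" using xc by (simp add: m_lcomm)
      then show "c \<odot>\<^bsub>reg R\<^esub> u \<in> X" using * T.I_l_closed by (auto simp: X_def)
    qed
    moreover have "X \<subseteq> L" using x Li.I_r_closed by (auto simp: X_def)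
    moreover have "\<exists>y\<in>X. \<exists>s\<in>T. y \<otimes> s \<noteq> \<zero>"
    proof (rule ccontr)
      assume "\<not> ?thesis"
      then have z: "x \<otimes> a \<otimes> b = \<zero>" if "a \<in> T" "b \<in> T" for a b using that by (auto simp: X_def)
      have "s \<in> T \<and> x \<otimes> s = \<zero>" if "s \<in> T \<cdot> T" for s
        using that
      proof (induction rule: ideal_prod.induct)
        case (prod i j) then show ?case using z[of i j] xc by (auto simp: m_assoc T.I_l_closed)
      next
        case (sum s1 s2) then show ?case using xc by (auto simp: r_distr)
      qed
      then show False using x TT by auto
    qed
    ultimately have "X = L" using L(2)[of X] by auto
    then obtain a where a: "a \<in> T" "x = x \<otimes> a" using x by (auto simp: X_def)
    have ac: "a \<in> carrier R" using a by simp
    have "submodule {r \<otimes> (\<one> \<ominus> a) | r. r \<in> carrier R} R (reg R)" (is "submodule ?K R _")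
      using cgenideal_ideal[of "\<one> \<ominus> a"] ac unfolding cgenideal_def ideal_iff_submodule by simp
    \<comment> \<open>Since \<open>a\<close> lies in every maximal ideal,
      \<open>\<one> \<ominus> a\<close> lies in none, so it is a unit.\<close>
    have "\<one> \<in> ?K"
    proof (rule ccontr)
      assume "\<one> \<notin> ?K"
      then obtain m where m: "maximal_left_ideal m R" "?K \<subseteq> m" by (rule exists_maximal_left_ideal[OF \<open>submodule ?K R _\<close>])
      have mi: "ideal m R" using m by (auto simp: maximal_left_ideal_iff ideal_iff_submodule)
      have "\<one> \<ominus> a = \<one> \<otimes> (\<one> \<ominus> a)" using ac by simp
      then have "\<one> \<ominus> a \<in> m" using m(2) by blast
      moreover have "a \<in> m" using Tm[OF m(1)] a by auto
      ultimately have "(\<one> \<ominus> a) \<oplus> a \<in> m" using mi by (simp add: additive_subgroup.a_closed ideal.axioms(1))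
      then show False using ac m by (simp add: minus_eq a_assoc l_neg maximal_left_ideal_iff)
    qed
    then obtain r where r: "r \<in> carrier R" "\<one> = r \<otimes> (\<one> \<ominus> a)" by auto
    have "x \<otimes> (\<one> \<ominus> a) = \<zero>" using a(2) xc ac by (simp add: minus_eq r_distr r_minus r_neg)
    then have "r \<otimes> (x \<otimes> (\<one> \<ominus> a)) = \<zero>" using r by simp
    then have "x \<otimes> (r \<otimes> (\<one> \<ominus> a)) = \<zero>" using m_lcomm[of x r "\<one> \<ominus> a"] r(1) xc ac by simp
    then have "x \<otimes> \<one> = \<zero>" unfolding r(2)[symmetric] .
    then have "x = \<zero>" using xc by simp
    then show False using x xc by simp
  qed
  then have "T = {\<zero>}" by auto
  then show ?thesis using max_prods_fl[OF art T(1)] by (simp add: L.finite_len_iff)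
qed

end

section \<open>Direct sums\<close>

text \<open>The same notion as \<open>is_dsum\<close>, with the structure maps as parameters so that
  proofs can compose them.\<close>

definition bip :: "('a, 'x) ring_scheme \<Rightarrow> ('a, 'd) module \<Rightarrow> ('a, 'm) module \<Rightarrow> ('a, 'n) module \<Rightarrow>
    ('m \<Rightarrow> 'd) \<Rightarrow> ('n \<Rightarrow> 'd) \<Rightarrow> ('d \<Rightarrow> 'm) \<Rightarrow> ('d \<Rightarrow> 'n) \<Rightarrow> bool" where
  "bip R D X Y i1 i2 p1 p2 \<longleftrightarrow> i1 \<in> mod_hom R X D \<and> i2 \<in> mod_hom R Y D \<and> p1 \<in> mod_hom R D X \<and> p2 \<in> mod_hom R D Y \<and>
     (\<forall>x\<in>carrier X. p1 (i1 x) = x \<and> p2 (i1 x) = \<zero>\<^bsub>Y\<^esub>) \<and>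
     (\<forall>y\<in>carrier Y. p1 (i2 y) = \<zero>\<^bsub>X\<^esub> \<and> p2 (i2 y) = y) \<and>
     (\<forall>d\<in>carrier D. d = i1 (p1 d) \<oplus>\<^bsub>D\<^esub> i2 (p2 d))"

lemma is_dsum_bip: "is_dsum R D X Y \<longleftrightarrow> (\<exists>i1 i2 p1 p2. bip R D X Y i1 i2 p1 p2)"
  unfolding is_dsum_def bip_def by blast

lemma bipD:
  assumes "bip R D X Y i1 i2 p1 p2"
  shows "i1 \<in> mod_hom R X D" "i2 \<in> mod_hom R Y D" "p1 \<in> mod_hom R D X" "p2 \<in> mod_hom R D Y"
    "\<And>x. x \<in> carrier X \<Longrightarrow> p1 (i1 x) = x" "\<And>x. x \<in> carrier X \<Longrightarrow> p2 (i1 x) = \<zero>\<^bsub>Y\<^esub>"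
    "\<And>y. y \<in> carrier Y \<Longrightarrow> p1 (i2 y) = \<zero>\<^bsub>X\<^esub>" "\<And>y. y \<in> carrier Y \<Longrightarrow> p2 (i2 y) = y"
    "\<And>d. d \<in> carrier D \<Longrightarrow> i1 (p1 d) \<oplus>\<^bsub>D\<^esub> i2 (p2 d) = d"
    "\<And>x. x \<in> carrier X \<Longrightarrow> i1 x \<in> carrier D" "\<And>y. y \<in> carrier Y \<Longrightarrow> i2 y \<in> carrier D"
    "\<And>d. d \<in> carrier D \<Longrightarrow> p1 d \<in> carrier X" "\<And>d. d \<in> carrier D \<Longrightarrow> p2 d \<in> carrier Y"
  using assms unfolding bip_def by (auto dest: hom_closed)

lemma bipI:
  assumes "i1 \<in> mod_hom R X D" "i2 \<in> mod_hom R Y D" "p1 \<in> mod_hom R D X" "p2 \<in> mod_hom R D Y"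
    "\<And>x. x \<in> carrier X \<Longrightarrow> p1 (i1 x) = x" "\<And>x. x \<in> carrier X \<Longrightarrow> p2 (i1 x) = \<zero>\<^bsub>Y\<^esub>"
    "\<And>y. y \<in> carrier Y \<Longrightarrow> p1 (i2 y) = \<zero>\<^bsub>X\<^esub>" "\<And>y. y \<in> carrier Y \<Longrightarrow> p2 (i2 y) = y"
    "\<And>d. d \<in> carrier D \<Longrightarrow> i1 (p1 d) \<oplus>\<^bsub>D\<^esub> i2 (p2 d) = d"
  shows "bip R D X Y i1 i2 p1 p2"
  using assms by (simp add: bip_def)

lemma bip_dsum: "bip R D X Y i1 i2 p1 p2 \<Longrightarrow> is_dsum R D X Y"
  unfolding is_dsum_bip by blast

lemma hom_minus:
  assumes "left_module R M" "left_module R N" "f \<in> mod_hom R M N" "g \<in> mod_hom R M N"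
  shows "(\<lambda>x. f x \<ominus>\<^bsub>N\<^esub> g x) \<in> mod_hom R M N"
proof -
  interpret M: left_module R M by fact
  interpret N: left_module R N by fact
  note h = mod_homD[OF assms(3)] mod_homD[OF assms(4)]
  show ?thesis
    by (rule mod_homI) (simp_all add: h N.M.minus_eq N.smult_r_distr N.smult_minus_r N.M.minus_add N.M.a_ac)
qed

lemma hom_plus:
  assumes "left_module R M" "left_module R N" "f \<in> mod_hom R M N" "g \<in> mod_hom R M N"
  shows "(\<lambda>x. f x \<oplus>\<^bsub>N\<^esub> g x) \<in> mod_hom R M N"
proof -
  interpret M: left_module R M by fact
  interpret N: left_module R N by fact
  note h = mod_homD[OF assms(3)] mod_homD[OF assms(4)]
  show ?thesis
    by (rule mod_homI) (simp_all add: h N.smult_r_distr N.M.a_ac)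
qed

lemma zero_hom:
  assumes "left_module R N" shows "(\<lambda>x. \<zero>\<^bsub>N\<^esub>) \<in> mod_hom R M N"
proof -
  interpret N: left_module R N by fact
  show ?thesis by (rule mod_homI) (simp_all add: N.smult_zero_r)
qed

lemma incl_hom: "submodule U R M \<Longrightarrow> left_module R M \<Longrightarrow> (\<lambda>x. x) \<in> mod_hom R (sub M U) M"
  by (auto simp: mod_hom_def left_module.submodule_iff)

lemma split_bip:
  assumes D: "left_module R D" and X: "left_module R X" and f: "f \<in> mod_hom R D X" and s: "s \<in> mod_hom R X D"
    and fs: "\<And>x. x \<in> carrier X \<Longrightarrow> f (s x) = x"
  shows "bip R D X (sub D (ker D X f)) s (\<lambda>x. x) f (\<lambda>d. d \<ominus>\<^bsub>D\<^esub> s (f d))"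
proof -
  interpret D: left_module R D by fact
  interpret X: left_module R X by fact
  note c = hom_closed[OF f] hom_closed[OF s]
  have K: "submodule (ker D X f) R D" by (rule ker_submodule[OF D X f])
  have *: "f (d \<ominus>\<^bsub>D\<^esub> s (f d)) = \<zero>\<^bsub>X\<^esub>" if "d \<in> carrier D" for d
    using that c fs by (simp add: hom_diff[OF D X f] X.diff_eq_zero_iff)
  show ?thesis
  proof (rule bipI)
    show "(\<lambda>d. d \<ominus>\<^bsub>D\<^esub> s (f d)) \<in> mod_hom R D (sub D (ker D X f))"
      using * c by (intro hom_into_sub hom_minus D hom_id hom_comp[OF f s]) (auto simp: ker_iff)
    show "(\<lambda>x. x) \<in> mod_hom R (sub D (ker D X f)) D" by (rule incl_hom[OF K D])
    fix d assume "d \<in> carrier D"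
    then show "s (f d) \<oplus>\<^bsub>D\<^esub> (d \<ominus>\<^bsub>D\<^esub> s (f d)) = d" using c D.diff_add_cancel[of d "s (f d)"] D.M.a_comm by simp
  next
    fix x assume x: "x \<in> carrier X"
    then show "s x \<ominus>\<^bsub>D\<^esub> s (f (s x)) = \<zero>\<^bsub>sub D (ker D X f)\<^esub>" using c fs D.diff_eq_zero_iff by simp
  next
    fix x assume x: "x \<in> carrier (sub D (ker D X f))"
    then show "f x = \<zero>\<^bsub>X\<^esub>" "x \<ominus>\<^bsub>D\<^esub> s (f x) = x"
      using hom_zero[OF X D s] by (auto simp: ker_iff D.M.minus_eq)
  qed (use f s fs in auto)
qed

lemma split_internal:
  assumes D: "left_module R D" and X: "left_module R X" and f: "f \<in> mod_hom R D X" and s: "s \<in> mod_hom R X D"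
    and fs: "\<And>x. x \<in> carrier X \<Longrightarrow> f (s x) = x"
  shows "internal_direct_sum R D (s ` carrier X) (ker D X f)"
proof -
  interpret D: left_module R D by fact
  interpret X: left_module R X by fact
  have "bip R D X (sub D (ker D X f)) s (\<lambda>x. x) f (\<lambda>d. d \<ominus>\<^bsub>D\<^esub> s (f d))"
    by (rule split_bip[OF D X f s]) (rule fs)
  note b = bipD[OF this]
  have S: "submodule (s ` carrier X) R D" "submodule (ker D X f) R D"
    using image_submodule[OF X D s X.carrier_submodule] ker_submodule[OF D X f] by auto
  have "d \<in> s ` carrier X <+>\<^bsub>D\<^esub> ker D X f" if "d \<in> carrier D" for d
    using b(9)[OF that] b(13)[OF that] b(12)[OF that] unfolding set_add_def' by force
  moreover have "s ` carrier X <+>\<^bsub>D\<^esub> ker D X f \<subseteq> carrier D"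
    using D.sum_submodule[OF S] by (simp add: D.submodule_iff)
  moreover have "s ` carrier X \<inter> ker D X f = {\<zero>\<^bsub>D\<^esub>}"
  proof
    show "s ` carrier X \<inter> ker D X f \<subseteq> {\<zero>\<^bsub>D\<^esub>}"
      using fs hom_zero[OF X D s] by (auto simp: ker_iff)
    show "{\<zero>\<^bsub>D\<^esub>} \<subseteq> s ` carrier X \<inter> ker D X f" using S by (auto simp: D.submodule_iff)
  qed
  ultimately show ?thesis unfolding internal_direct_sum_def using S by auto
qed

text \<open>The kernels of \<open>p\<close> and \<open>q\<close> are both complements of the image
  of \<open>U\<close>, and any two complements are isomorphic. The isomorphism is the projection
  onto the second kernel along that image.\<close>

lemma ker_iso:
  assumes D: "left_module R D" and U: "left_module R U" "left_module R V" "left_module R W"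
    and i: "i \<in> mod_hom R U D" and p: "p \<in> mod_hom R D V" and q: "q \<in> mod_hom R D W"
    and pi: "bij_betw (\<lambda>x. p (i x)) (carrier U) (carrier V)"
    and qi: "bij_betw (\<lambda>x. q (i x)) (carrier U) (carrier W)"
  shows "mod_iso R (sub D (ker D V p)) (sub D (ker D W q))"
proof -
  interpret D: left_module R D by fact
  interpret U: left_module R U by fact
  interpret V: left_module R V by fact
  interpret W: left_module R W by fact
  define a where "a = inv_into (carrier U) (\<lambda>x. p (i x))"
  define b where "b = inv_into (carrier U) (\<lambda>x. q (i x))"
  have a: "a \<in> mod_hom R V U" "\<And>x. x \<in> carrier U \<Longrightarrow> a (p (i x)) = x" "\<And>x. x \<in> carrier V \<Longrightarrow> p (i (a x)) = x"
    using inv_hom[OF U(1) hom_comp[OF i p] pi] pi by (auto simp: a_def bij_betw_def f_inv_into_f[of _ "\<lambda>x. p (i x)"] inv_into_f_f[of "\<lambda>x. p (i x)"])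
  have b: "b \<in> mod_hom R W U" "\<And>x. x \<in> carrier U \<Longrightarrow> b (q (i x)) = x" "\<And>x. x \<in> carrier W \<Longrightarrow> q (i (b x)) = x"
    using inv_hom[OF U(1) hom_comp[OF i q] qi] qi by (auto simp: b_def bij_betw_def f_inv_into_f[of _ "\<lambda>x. q (i x)"] inv_into_f_f[of "\<lambda>x. q (i x)"])
  note c = hom_closed[OF i] hom_closed[OF p] hom_closed[OF q] hom_closed[OF a(1)] hom_closed[OF b(1)]
  have Kp: "submodule (ker D V p) R D" and Kq: "submodule (ker D W q) R D"
    using ker_submodule D U p q by auto
  define f where "f d = d \<ominus>\<^bsub>D\<^esub> i (b (q d))" for d
  have f: "f \<in> mod_hom R D D" unfolding f_def
    by (intro hom_minus D hom_id hom_comp[OF hom_comp[OF q b(1)] i])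
  have fk: "f d \<in> ker D W q" if "d \<in> carrier D" for d
    using that c b(3) by (simp add: f_def ker_iff hom_diff[OF D U(3) q] W.diff_eq_zero_iff)
  have fh: "f \<in> mod_hom R (sub D (ker D V p)) (sub D (ker D W q))"
    using fk by (intro hom_into_sub hom_restrict f) (auto simp: ker_iff)
  have "bij_betw f (ker D V p) (ker D W q)" unfolding bij_betw_def
  proof
    have "inj_on f (carrier (sub D (ker D V p)))"
    proof (subst hom_inj_iff[OF _ _ fh])
      show "left_module R (sub D (ker D V p))" "left_module R (sub D (ker D W q))" using D.sub_left_module Kp Kq by auto
      show "\<forall>x\<in>carrier (sub D (ker D V p)). f x = \<zero>\<^bsub>sub D (ker D W q)\<^esub> \<longrightarrow> x = \<zero>\<^bsub>sub D (ker D V p)\<^esub>"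
      proof (intro ballI impI)
        fix x assume x: "x \<in> carrier (sub D (ker D V p))" "f x = \<zero>\<^bsub>sub D (ker D W q)\<^esub>"
        then have xc: "x \<in> carrier D" "p x = \<zero>\<^bsub>V\<^esub>" by (auto simp: ker_iff)
        then have *: "x = i (b (q x))" using x(2) c D.diff_eq_zero_iff by (simp add: f_def)
        then have "p (i (b (q x))) = \<zero>\<^bsub>V\<^esub>" using xc by simp
        then have "b (q x) = a \<zero>\<^bsub>V\<^esub>" using a(2)[of "b (q x)"] c xc by simp
        then have "b (q x) = \<zero>\<^bsub>U\<^esub>" using hom_zero[OF U(2,1) a(1)] by simp
        then show "x = \<zero>\<^bsub>sub D (ker D V p)\<^esub>" using * hom_zero[OF U(1) D i] by simp
      qed
    qed
    then show "inj_on f (ker D V p)" by simp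
    show "f ` ker D V p = ker D W q"
    proof
      show "f ` ker D V p \<subseteq> ker D W q" using fk by (auto simp: ker_iff)
      show "ker D W q \<subseteq> f ` ker D V p"
      proof
        fix w assume w: "w \<in> ker D W q"
        then have wc: "w \<in> carrier D" "q w = \<zero>\<^bsub>W\<^esub>" by (auto simp: ker_iff)
        define u where "u = a (p w)"
        have u: "u \<in> carrier U" using wc c by (simp add: u_def)
        define v where "v = w \<ominus>\<^bsub>D\<^esub> i u"
        have v: "v \<in> ker D V p" using wc u c a(3) by (simp add: ker_iff v_def hom_diff[OF D U(2) p] u_def V.diff_eq_zero_iff)
        have "q v = \<ominus>\<^bsub>W\<^esub> q (i u)" using wc u c by (simp add: v_def hom_diff[OF D U(3) q] W.M.minus_eq)
        also have "\<dots> = q (i (\<ominus>\<^bsub>U\<^esub> u))" using u hom_neg[OF U(1) U(3) hom_comp[OF i q]] by simp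
        finally have "b (q v) = \<ominus>\<^bsub>U\<^esub> u" using u b(2) by simp
        then have "f v = v \<oplus>\<^bsub>D\<^esub> i u" using u c hom_neg[OF U(1) D i u] by (simp add: f_def D.M.minus_eq)
        then have "f v = w" using wc u c D.diff_add_cancel by (simp add: v_def)
        then show "w \<in> f ` ker D V p" using v by auto
      qed
    qed
  qed
  then show ?thesis unfolding mod_iso_def using fh by (intro bexI[of _ f]) auto
qed

lemma bip_ker_iso:
  assumes D: "left_module R D" and X: "left_module R X" "left_module R Y" and b: "bip R D X Y i1 i2 p1 p2"
  shows "mod_iso R Y (sub D (ker D X p1))"
proof -
  note b = bipD[OF b]
  interpret D: left_module R D by fact
  have h: "i2 \<in> mod_hom R Y (sub D (ker D X p1))" using b by (intro hom_into_sub) (auto simp: ker_iff)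
  have "bij_betw i2 (carrier Y) (ker D X p1)" unfolding bij_betw_def
  proof
    show "inj_on i2 (carrier Y)" using b(8) by (metis inj_onI)
    have "d \<in> i2 ` carrier Y" if "d \<in> ker D X p1" for d
    proof -
      have d: "d \<in> carrier D" "p1 d = \<zero>\<^bsub>X\<^esub>" using that by (auto simp: ker_iff)
      then have "d = i2 (p2 d)" using b(9)[OF d(1)] hom_zero[OF X(1) D b(1)] b by simp
      then show ?thesis using b d by auto
    qed
    then show "i2 ` carrier Y = ker D X p1" using b by (auto simp: ker_iff)
  qed
  then show ?thesis unfolding mod_iso_def using h by auto
qed

lemma dsum_unique:
  assumes D: "left_module R D" "left_module R D'" "left_module R X'" "left_module R Y'"
    and X: "left_module R X" "left_module R Y"
    and d: "is_dsum R D X Y" "is_dsum R D' X' Y'" and iso: "mod_iso R X X'" "mod_iso R Y Y'"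
  shows "mod_iso R D D'"
proof -
  interpret D: left_module R D by fact
  interpret D': left_module R D' by fact
  obtain i1 i2 p1 p2 where b: "bip R D X Y i1 i2 p1 p2" using d(1) unfolding is_dsum_bip by blast
  obtain j1 j2 q1 q2 where b': "bip R D' X' Y' j1 j2 q1 q2" using d(2) unfolding is_dsum_bip by blast
  note b = bipD[OF b] and b' = bipD[OF b']
  obtain f where f: "f \<in> mod_hom R X X'" "bij_betw f (carrier X) (carrier X')" using iso by (auto simp: mod_iso_def)
  obtain g where g: "g \<in> mod_hom R Y Y'" "bij_betw g (carrier Y) (carrier Y')" using iso by (auto simp: mod_iso_def)
  define h where "h d = j1 (f (p1 d)) \<oplus>\<^bsub>D'\<^esub> j2 (g (p2 d))" for d
  have h: "h \<in> mod_hom R D D'" unfolding h_def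
    by (intro hom_plus D hom_comp[OF hom_comp[OF b(3) f(1)] b'(1)] hom_comp[OF hom_comp[OF b(4) g(1)] b'(2)])
  note c = hom_closed[OF f(1)] hom_closed[OF g(1)]
  have q: "q1 (h d) = f (p1 d)" "q2 (h d) = g (p2 d)" if "d \<in> carrier D" for d
  proof -
    interpret X': left_module R X' by fact
    interpret Y': left_module R Y' by fact
    show "q1 (h d) = f (p1 d)" "q2 (h d) = g (p2 d)"
      using that b b' c hom_add[OF b'(3)] hom_add[OF b'(4)] by (simp_all add: h_def)
  qed
  have "bij_betw h (carrier D) (carrier D')" unfolding bij_betw_def
  proof
    show "inj_on h (carrier D)"
    proof (rule inj_onI)
      fix x y assume xy: "x \<in> carrier D" "y \<in> carrier D" "h x = h y"
      then have "f (p1 x) = f (p1 y)" "g (p2 x) = g (p2 y)" using q by metis+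
      then have "p1 x = p1 y" "p2 x = p2 y" using f(2) g(2) b(12,13) xy unfolding bij_betw_def by (metis inj_onD)+
      then show "x = y" using b(9) xy by metis
    qed
    show "h ` carrier D = carrier D'"
    proof
      show "h ` carrier D \<subseteq> carrier D'" using hom_closed[OF h] by auto
      show "carrier D' \<subseteq> h ` carrier D"
      proof
        fix d assume d: "d \<in> carrier D'"
        obtain x where x: "x \<in> carrier X" "f x = q1 d" using f(2) b'(12)[OF d] unfolding bij_betw_def by (metis imageE)
        obtain y where y: "y \<in> carrier Y" "g y = q2 d" using g(2) b'(13)[OF d] unfolding bij_betw_def by (metis imageE)
        interpret X: left_module R X by fact
        interpret Y: left_module R Y by fact
        have p: "p1 (i1 x \<oplus>\<^bsub>D\<^esub> i2 y) = x" "p2 (i1 x \<oplus>\<^bsub>D\<^esub> i2 y) = y"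
          using x y b hom_add[OF b(3)] hom_add[OF b(4)] by simp_all
        have "h (i1 x \<oplus>\<^bsub>D\<^esub> i2 y) = d" unfolding h_def p x(2) y(2) using b'(9)[OF d] .
        then show "d \<in> h ` carrier D" using x y b by (metis D.M.a_closed imageI)
      qed
    qed
  qed
  then show ?thesis unfolding mod_iso_def using h by auto
qed

text \<open>The new summand is realised as a kernel inside \<open>D\<close>, so its carrier keeps
  the type of that of \<open>D\<close>.\<close>

lemma dsum_assoc:
  assumes D: "left_module R D" and X: "left_module R X" "left_module R Y" "left_module R U" "left_module R X1"
    and d: "is_dsum R D X Y" "is_dsum R X U X1"
  shows "\<exists>L. submodule L R D \<and> is_dsum R D U (sub D L) \<and> is_dsum R (sub D L) X1 Y"
proof -
  interpret D: left_module R D by fact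
  interpret X: left_module R X by fact
  obtain i1 i2 p1 p2 where b: "bip R D X Y i1 i2 p1 p2" using d(1) unfolding is_dsum_bip by blast
  obtain j1 j2 q1 q2 where b': "bip R X U X1 j1 j2 q1 q2" using d(2) unfolding is_dsum_bip by blast
  note b = bipD[OF b] and b' = bipD[OF b']
  let ?f = "\<lambda>d. q1 (p1 d)"
  have f: "?f \<in> mod_hom R D U" by (rule hom_comp[OF b(3) b'(3)])
  have s: "(\<lambda>u. i1 (j1 u)) \<in> mod_hom R U D" by (rule hom_comp[OF b'(1) b(1)])
  let ?L = "ker D U ?f"
  have L: "submodule ?L R D" by (rule ker_submodule[OF D X(3) f])
  have 1: "is_dsum R D U (sub D ?L)"
    using split_bip[OF D X(3) f s] b b' by (auto intro: bip_dsum)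
  have "bip R (sub D ?L) X1 Y (\<lambda>x. i1 (j2 x)) i2 (\<lambda>d. q2 (p1 d)) p2"
  proof (rule bipI)
    show "(\<lambda>x. i1 (j2 x)) \<in> mod_hom R X1 (sub D ?L)"
      using b b' by (intro hom_into_sub hom_comp[OF b'(2) b(1)]) (auto simp: ker_iff)
    show "i2 \<in> mod_hom R Y (sub D ?L)"
      using b b' hom_zero[OF X(1) X(3) b'(3)] by (intro hom_into_sub b(2)) (auto simp: ker_iff)
    show "(\<lambda>d. q2 (p1 d)) \<in> mod_hom R (sub D ?L) X1" by (intro hom_restrict hom_comp[OF b(3) b'(4)]) (auto simp: ker_iff)
    show "p2 \<in> mod_hom R (sub D ?L) Y" by (intro hom_restrict b(4)) (auto simp: ker_iff)
    fix d assume "d \<in> carrier (sub D ?L)"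
    then have d: "d \<in> carrier D" "q1 (p1 d) = \<zero>\<^bsub>U\<^esub>" by (auto simp: ker_iff)
    have "j2 (q2 (p1 d)) = p1 d" using b'(9)[OF b(12)[OF d(1)]] d hom_zero[OF X(3) X(1) b'(1)] b b' by simp
    then show "i1 (j2 (q2 (p1 d))) \<oplus>\<^bsub>sub D ?L\<^esub> i2 (p2 d) = d" using b(9)[OF d(1)] by simp
  next
    fix y assume "y \<in> carrier Y"
    then show "q2 (p1 (i2 y)) = \<zero>\<^bsub>X1\<^esub>" using b hom_zero[OF X(1) X(4) b'(4)] by simp
  qed (use b b' in auto)
  then show ?thesis using L 1 by (auto intro: bip_dsum)
qed

lemma dsum_zero:
  assumes D: "left_module R D" and Z: "left_module R Z" "carrier Z = {\<zero>\<^bsub>Z\<^esub>}"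
  shows "is_dsum R D D Z"
proof -
  interpret D: left_module R D by fact
  interpret Z: left_module R Z by fact
  show ?thesis
    by (rule is_dsumI[of "\<lambda>x. x" _ _ _ "\<lambda>x. \<zero>\<^bsub>D\<^esub>" _ "\<lambda>x. x" "\<lambda>x. \<zero>\<^bsub>Z\<^esub>"])
      (use Z zero_hom[OF D] zero_hom[OF Z(1)] hom_id in auto)
qed

lemma dsum_zero_iso:
  assumes D: "left_module R D" and Z: "left_module R Z" "carrier Z = {\<zero>\<^bsub>Z\<^esub>}" and d: "is_dsum R D Z Y" and Y: "left_module R Y"
  shows "mod_iso R Y D"
  using dsum_unique[OF D Y Z(1) Y Z(1) Y d is_dsum_comm[OF Y dsum_zero[OF Y Z]] mod_iso_refl mod_iso_refl]
    mod_iso_sym[OF D] by blast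

definition prod_module :: "('a, 'm) module \<Rightarrow> ('a, 'n) module \<Rightarrow> ('a, 'm \<times> 'n) module" where
  "prod_module X Y = \<lparr>carrier = carrier X \<times> carrier Y, mult = (\<lambda>x y. undefined), one = undefined,
     zero = (\<zero>\<^bsub>X\<^esub>, \<zero>\<^bsub>Y\<^esub>), add = (\<lambda>(x, y) (x', y'). (x \<oplus>\<^bsub>X\<^esub> x', y \<oplus>\<^bsub>Y\<^esub> y')),
     smult = (\<lambda>a (x, y). (a \<odot>\<^bsub>X\<^esub> x, a \<odot>\<^bsub>Y\<^esub> y))\<rparr>"

lemma prod_module:
  assumes X: "left_module R X" and Y: "left_module R Y"
  shows "left_module R (prod_module X Y)" "is_dsum R (prod_module X Y) X Y"
proof -
  interpret X: left_module R X by fact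
  interpret Y: left_module R Y by fact
  show 1: "left_module R (prod_module X Y)"
  proof (intro left_module.intro left_module_axioms.intro X.R.ring_axioms abelian_groupI)
    fix x assume "x \<in> carrier (prod_module X Y)"
    then show "\<exists>y\<in>carrier (prod_module X Y). y \<oplus>\<^bsub>prod_module X Y\<^esub> x = \<zero>\<^bsub>prod_module X Y\<^esub>"
      by (intro bexI[of _ "(\<ominus>\<^bsub>X\<^esub> fst x, \<ominus>\<^bsub>Y\<^esub> snd x)"]) (auto simp: prod_module_def X.M.l_neg Y.M.l_neg)
  qed (auto simp: prod_module_def X.M.a_ac Y.M.a_ac X.smult_l_distr Y.smult_l_distr X.smult_r_distr Y.smult_r_distr
        X.smult_assoc1 Y.smult_assoc1)
  show "is_dsum R (prod_module X Y) X Y"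
    by (rule is_dsumI[of "\<lambda>x. (x, \<zero>\<^bsub>Y\<^esub>)" _ _ _ "\<lambda>y. (\<zero>\<^bsub>X\<^esub>, y)" _ fst snd])
      (auto intro!: mod_homI simp: prod_module_def X.smult_zero_r Y.smult_zero_r)
qed

lemma dsum_fg:
  assumes D: "left_module R D" and d: "is_dsum R D X Y" and X: "fg_module R X" and Y: "fg_module R Y"
  shows "fg_module R D"
proof -
  interpret D: left_module R D by fact
  have XY: "left_module R X" "left_module R Y" using X Y by (auto simp: fg_module_def)
  obtain i1 i2 p1 p2 where b: "bip R D X Y i1 i2 p1 p2" using d(1) unfolding is_dsum_bip by blast
  note b = bipD[OF b]
  obtain S where S: "finite S" "S \<subseteq> carrier X" "\<And>U. submodule U R X \<Longrightarrow> S \<subseteq> U \<Longrightarrow> U = carrier X"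
    using X unfolding fg_module_def finitely_generated_def by blast
  obtain T where T: "finite T" "T \<subseteq> carrier Y" "\<And>U. submodule U R Y \<Longrightarrow> T \<subseteq> U \<Longrightarrow> U = carrier Y"
    using Y unfolding fg_module_def finitely_generated_def by blast
  have "U = carrier D" if U: "submodule U R D" "i1 ` S \<union> i2 ` T \<subseteq> U" for U
  proof -
    have *: "{x \<in> carrier X. i1 x \<in> U} = carrier X"
      by (rule S(3)[OF preimage_submodule[OF XY(1) D b(1) U(1)]]) (use U S in auto)
    have **: "{x \<in> carrier Y. i2 x \<in> U} = carrier Y"
      by (rule T(3)[OF preimage_submodule[OF XY(2) D b(2) U(1)]]) (use U T in auto)
    have "i1 (p1 d) \<oplus>\<^bsub>D\<^esub> i2 (p2 d) \<in> U" if "d \<in> carrier D" for d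
    proof -
      have "i1 (p1 d) \<in> U" "i2 (p2 d) \<in> U" using * ** b(12,13)[OF that] by auto
      then show ?thesis using U(1) unfolding D.submodule_iff by blast
    qed
    then have "d \<in> U" if "d \<in> carrier D" for d using b(9)[OF that] that by metis
    moreover have "U \<subseteq> carrier D" using U(1) by (simp add: D.submodule_iff)
    ultimately show ?thesis by blast
  qed
  then show ?thesis unfolding fg_module_def finitely_generated_def
    using S T D b by (intro conjI exI[of _ "i1 ` S \<union> i2 ` T"]) auto
qed

lemma dsum_fg_left:
  assumes D: "fg_module R D" and d: "is_dsum R D X Y" and X: "left_module R X"
  shows "fg_module R X"
proof -
  obtain i1 i2 p1 p2 where b: "bip R D X Y i1 i2 p1 p2" using d(1) unfolding is_dsum_bip by blast
  note b = bipD[OF b]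
  have "p1 ` carrier D = carrier X" using b by force
  then show ?thesis using fg_image[OF _ X b(3)] D X by (auto simp: fg_module_def)
qed

section \<open>The Krull--Schmidt theorem\<close>

text \<open>Unital subalgebras of an Artin algebra and their quotients by ideals are of this kind.
  The Krull-Schmidt theorem and the homological theory are developed at this level, so that they
  apply to all rings of the tower alike.\<close>

locale fl_ring = ring R for R (structure) +
  assumes fl: "finite_len R (reg R)"

lemma funpow_hom: "f \<in> mod_hom R M M \<Longrightarrow> (f ^^ n) \<in> mod_hom R M M"
proof (induction n)
  case 0 show ?case using hom_id[of R M] by (simp add: id_def)
next
  case (Suc n)
  then show ?case using hom_comp[OF Suc.IH[OF Suc.prems] Suc.prems] by (simp add: comp_def)
qed

context left_module
begin

text \<open>The kernels of the powers ascend, the images descend, and finite length makes both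
  stationary. At a stationary \<open>n\<close>, \<open>(f ^^ n) x\<close> equals
  \<open>(f ^^ (n + n)) y\<close> for some \<open>y\<close>, and \<open>x\<close> is split by
  subtracting \<open>(f ^^ n) y\<close>.\<close>

lemma fitting:
  assumes fl: "finite_len R M" and f: "f \<in> mod_hom R M M"
  shows "\<exists>n>0. internal_direct_sum R M (ker M M (f ^^ n)) ((f ^^ n) ` carrier M)"
proof -
  have M: "left_module R M" by unfold_locales
  have fn: "(f ^^ n) \<in> mod_hom R M M" for n by (rule funpow_hom[OF f])
  have K: "submodule (ker M M (f ^^ n)) R M" for n by (rule ker_submodule[OF M M fn])
  have I: "submodule ((f ^^ n) ` carrier M) R M" for n by (rule image_submodule[OF M M fn carrier_submodule])
  note c = hom_closed[OF fn]
  have Kmono: "ker M M (f ^^ n) \<subseteq> ker M M (f ^^ m)" if "n \<le> m" for n m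
  proof -
    have "f ^^ m = f ^^ (m - n) \<circ> f ^^ n" using that by (simp add: funpow_add[symmetric])
    then show ?thesis using hom_zero[OF M M fn] by (auto simp: ker_iff)
  qed
  have Imono: "(f ^^ m) ` carrier M \<subseteq> (f ^^ n) ` carrier M" if "n \<le> m" for n m
  proof -
    have "f ^^ m = f ^^ n \<circ> f ^^ (m - n)" using that by (simp add: funpow_add[symmetric])
    then show ?thesis using c by auto
  qed
  have "\<exists>U\<in>range (\<lambda>n. ker M M (f ^^ n)). \<forall>V\<in>range (\<lambda>n. ker M M (f ^^ n)). U \<subseteq> V \<longrightarrow> V = U"
    by (rule finite_len_max[OF fl]) (use K in auto)
  then obtain n1 where n1: "\<And>m. ker M M (f ^^ n1) \<subseteq> ker M M (f ^^ m) \<Longrightarrow> ker M M (f ^^ m) = ker M M (f ^^ n1)"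
    by auto
  have "\<exists>U\<in>range (\<lambda>n. (f ^^ n) ` carrier M). \<forall>V\<in>range (\<lambda>n. (f ^^ n) ` carrier M). V \<subseteq> U \<longrightarrow> V = U"
    by (rule finite_len_min[OF fl]) (use I in auto)
  then obtain n2 where n2: "\<And>m. (f ^^ m) ` carrier M \<subseteq> (f ^^ n2) ` carrier M \<Longrightarrow> (f ^^ m) ` carrier M = (f ^^ n2) ` carrier M"
    by auto
  \<comment> \<open>The successor makes \<open>n\<close> positive; later arguments split a factor
    \<open>f\<close> off from \<open>f ^^ n\<close>.\<close>
  define n where "n = Suc (max n1 n2)"
  have kk: "ker M M (f ^^ (n + n)) = ker M M (f ^^ n)"
    using n1[OF Kmono, of "n + n"] n1[OF Kmono, of n] by (simp add: n_def)
  have ii: "(f ^^ (n + n)) ` carrier M = (f ^^ n) ` carrier M"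
    using n2[OF Imono, of "n + n"] n2[OF Imono, of n] by (simp add: n_def)
  have nn: "(f ^^ (n + n)) x = (f ^^ n) ((f ^^ n) x)" for x by (simp add: funpow_add)
  have "x \<in> ker M M (f ^^ n) <+>\<^bsub>M\<^esub> (f ^^ n) ` carrier M" if x: "x \<in> carrier M" for x
  proof -
    have "(f ^^ n) x \<in> (f ^^ (n + n)) ` carrier M" using x ii by auto
    then obtain y where y: "y \<in> carrier M" "(f ^^ n) x = (f ^^ n) ((f ^^ n) y)" using nn by auto
    have "x \<ominus>\<^bsub>M\<^esub> (f ^^ n) y \<in> ker M M (f ^^ n)"
      using x y c by (simp add: ker_iff hom_diff[OF M M fn] diff_eq_zero_iff)
    moreover have "x = (x \<ominus>\<^bsub>M\<^esub> (f ^^ n) y) \<oplus>\<^bsub>M\<^esub> (f ^^ n) y" using x y c diff_add_cancel by simp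
    ultimately show ?thesis unfolding set_add_def' using y(1) by blast
  qed
  moreover have "ker M M (f ^^ n) <+>\<^bsub>M\<^esub> (f ^^ n) ` carrier M \<subseteq> carrier M"
    using sum_submodule[OF K I] by (simp add: submodule_iff)
  moreover have "ker M M (f ^^ n) \<inter> (f ^^ n) ` carrier M = {\<zero>\<^bsub>M\<^esub>}"
  proof
    show "{\<zero>\<^bsub>M\<^esub>} \<subseteq> ker M M (f ^^ n) \<inter> (f ^^ n) ` carrier M" using K[of n] I[of n] by (simp add: submodule_iff)
    show "ker M M (f ^^ n) \<inter> (f ^^ n) ` carrier M \<subseteq> {\<zero>\<^bsub>M\<^esub>}"
    proof
      fix x assume "x \<in> ker M M (f ^^ n) \<inter> (f ^^ n) ` carrier M"
      then obtain y where y: "y \<in> carrier M" "x = (f ^^ n) y" "(f ^^ n) x = \<zero>\<^bsub>M\<^esub>" by (auto simp: ker_iff)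
      then have "y \<in> ker M M (f ^^ (n + n))" by (simp add: ker_iff nn)
      then have "y \<in> ker M M (f ^^ n)" using kk by simp
      then show "x \<in> {\<zero>\<^bsub>M\<^esub>}" using y by (simp add: ker_iff)
    qed
  qed
  ultimately have "internal_direct_sum R M (ker M M (f ^^ n)) ((f ^^ n) ` carrier M)"
    unfolding internal_direct_sum_def using K I by auto
  then show ?thesis by (intro exI[of _ n]) (simp add: n_def)
qed

lemma indec_bij_or_nilpotent:
  assumes fl: "finite_len R M" and f: "f \<in> mod_hom R M M" and ind: "indecomposable R M"
  shows "bij_betw f (carrier M) (carrier M) \<or> (\<exists>n. \<forall>x\<in>carrier M. (f ^^ n) x = \<zero>\<^bsub>M\<^esub>)"
proof -
  have M: "left_module R M" by unfold_locales
  obtain n where n: "n > 0" "internal_direct_sum R M (ker M M (f ^^ n)) ((f ^^ n) ` carrier M)"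
    using fitting[OF fl f] by blast
  then have "ker M M (f ^^ n) = {\<zero>\<^bsub>M\<^esub>} \<or> (f ^^ n) ` carrier M = {\<zero>\<^bsub>M\<^esub>}"
    using ind unfolding indecomposable_def by blast
  then show ?thesis
  proof
    assume "(f ^^ n) ` carrier M = {\<zero>\<^bsub>M\<^esub>}"
    then show ?thesis by blast
  next
    assume k: "ker M M (f ^^ n) = {\<zero>\<^bsub>M\<^esub>}"
    note c = hom_closed[OF funpow_hom[OF f]]
    have "f ` carrier M = carrier M"
    proof
      show "f ` carrier M \<subseteq> carrier M" using hom_closed[OF f] by auto
      show "carrier M \<subseteq> f ` carrier M"
      proof
        fix x assume "x \<in> carrier M"
        then obtain k y where "k \<in> ker M M (f ^^ n)" "y \<in> carrier M" "x = k \<oplus>\<^bsub>M\<^esub> (f ^^ n) y"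
          using n unfolding internal_direct_sum_def set_add_def' by blast
        then have x: "x = (f ^^ n) y" "y \<in> carrier M" using k c by auto
        obtain m where "n = Suc m" using n(1) by (cases n) auto
        then have "x = f ((f ^^ m) y)" using x by simp
        then show "x \<in> f ` carrier M" using c x by auto
      qed
    qed
    moreover have "inj_on f (carrier M)"
      unfolding hom_inj_iff[OF M M f]
    proof (intro ballI impI)
      fix x assume x: "x \<in> carrier M" "f x = \<zero>\<^bsub>M\<^esub>"
      obtain m where m: "n = Suc m" using n(1) by (cases n) auto
      have "(f ^^ n) x = (f ^^ m) (f x)" unfolding m funpow_Suc_right by simp
      then have "(f ^^ n) x = \<zero>\<^bsub>M\<^esub>" using x hom_zero[OF M M funpow_hom[OF f]] by simp
      then have "x \<in> ker M M (f ^^ n)" using x(1) unfolding ker_iff by (rule conjI[rotated])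
      then show "x = \<zero>\<^bsub>M\<^esub>" unfolding k by (rule singletonD)
    qed
    ultimately show ?thesis by (simp add: bij_betw_def)
  qed
qed

text \<open>If neither map were bijective, both would be nilpotent. But \<open>g x = 0\<close>
  forces \<open>f x = x\<close>, hence \<open>x = 0\<close> by nilpotency of \<open>f\<close>; so
  \<open>g\<close> is injective and cannot be nilpotent on a nonzero module.\<close>

lemma indec_local:
  assumes fl: "finite_len R M" and f: "f \<in> mod_hom R M M" and g: "g \<in> mod_hom R M M" and ind: "indecomposable R M"
    and fg: "\<And>x. x \<in> carrier M \<Longrightarrow> f x \<oplus>\<^bsub>M\<^esub> g x = x"
  shows "bij_betw f (carrier M) (carrier M) \<or> bij_betw g (carrier M) (carrier M)"
proof (rule ccontr)
  assume neg: "\<not> ?thesis"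
  have M: "left_module R M" by unfold_locales
  obtain n where n: "\<And>x. x \<in> carrier M \<Longrightarrow> (f ^^ n) x = \<zero>\<^bsub>M\<^esub>"
    using indec_bij_or_nilpotent[OF fl f ind] neg by blast
  obtain m where m: "\<And>x. x \<in> carrier M \<Longrightarrow> (g ^^ m) x = \<zero>\<^bsub>M\<^esub>"
    using indec_bij_or_nilpotent[OF fl g ind] neg by blast
  have gz: "x = \<zero>\<^bsub>M\<^esub>" if x: "x \<in> carrier M" "g x = \<zero>\<^bsub>M\<^esub>" for x
  proof -
    have fx: "f x = x" using fg[OF x(1)] x hom_closed[OF f] by simp
    have "(f ^^ k) x = x" for k by (induction k) (simp_all add: fx)
    then show ?thesis using n[OF x(1)] by simp
  qed
  have "x = \<zero>\<^bsub>M\<^esub>" if "x \<in> carrier M" "(g ^^ k) x = \<zero>\<^bsub>M\<^esub>" for x k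
    using that
  proof (induction k)
    case (Suc k)
    then have "(g ^^ k) x = \<zero>\<^bsub>M\<^esub>" using gz hom_closed[OF funpow_hom[OF g]] by simp
    then show ?case using Suc by simp
  qed simp
  then have "carrier M = {\<zero>\<^bsub>M\<^esub>}" using m by blast
  then show False using ind by (simp add: indecomposable_def)
qed

end

text \<open>Isomorphic modules have equal, not just isomorphic, representatives.\<close>

definition rep :: "('a, 'x) ring_scheme \<Rightarrow> ('a, 'm) module \<Rightarrow> ('a, 'a carr) module" where
  "rep R U = (SOME V. fg_module R V \<and> mod_iso R U V)"

lemma fg_left_module: "fg_module R M \<Longrightarrow> left_module R M" by (simp add: fg_module_def)

lemma fg_iso: "fg_module R M \<Longrightarrow> mod_iso R M N \<Longrightarrow> left_module R N \<Longrightarrow> fg_module R N"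
  unfolding fg_module_def using finitely_generated_iso by blast

lemma rep:
  assumes "fg_module R U" shows "fg_module R (rep R U)" "mod_iso R U (rep R U)"
  unfolding rep_def using someI_ex[OF fg_module_in_universe[OF assms]] by auto

lemma rep_cong:
  assumes "left_module R U" "left_module R V" "mod_iso R U V" shows "rep R U = rep R V"
proof -
  have "mod_iso R U W \<longleftrightarrow> mod_iso R V W" for W :: "('a, 'a carr) module"
    using mod_iso_trans[OF assms(3)] mod_iso_trans[OF mod_iso_sym[OF assms(1,3)]] by blast
  then show ?thesis unfolding rep_def by simp
qed

lemma rep_eq_iff:
  assumes "fg_module R U" "fg_module R V" shows "rep R U = rep R V \<longleftrightarrow> mod_iso R U V"
  using rep[OF assms(1)] rep[OF assms(2)] rep_cong[of R U V] mod_iso_trans mod_iso_sym assms fg_left_module by metis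

lemma indecomposable_iso:
  assumes ind: "indecomposable R U" and iso: "mod_iso R U V" and V: "left_module R V"
  shows "indecomposable R V"
proof -
  have U: "left_module R U" using ind by (simp add: indecomposable_def)
  interpret U: left_module R U by fact
  interpret V: left_module R V by fact
  obtain g where g: "g \<in> mod_hom R V U" "bij_betw g (carrier V) (carrier U)"
    using mod_iso_sym[OF U iso] by (auto simp: mod_iso_def)
  have inj: "inj_on g (carrier V)" and im: "g ` carrier V = carrier U" using g(2) by (auto simp: bij_betw_def)
  have z: "W = {\<zero>\<^bsub>V\<^esub>}" if "g ` W = {\<zero>\<^bsub>U\<^esub>}" "submodule W R V" for W
  proof -
    have "x = \<zero>\<^bsub>V\<^esub>" if "x \<in> W" for x
      using \<open>g ` W = {\<zero>\<^bsub>U\<^esub>}\<close> that inj \<open>submodule W R V\<close> hom_inj_iff[OF V U g(1)] by (auto simp: V.submodule_iff)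
    then show ?thesis using that by (auto simp: V.submodule_iff)
  qed
  have "carrier V \<noteq> {\<zero>\<^bsub>V\<^esub>}"
  proof
    assume "carrier V = {\<zero>\<^bsub>V\<^esub>}"
    then have "carrier U = {\<zero>\<^bsub>U\<^esub>}" using im hom_zero[OF V U g(1)] by auto
    then show False using ind by (simp add: indecomposable_def)
  qed
  moreover have "W1 = {\<zero>\<^bsub>V\<^esub>} \<or> W2 = {\<zero>\<^bsub>V\<^esub>}" if W: "internal_direct_sum R V W1 W2" for W1 W2
  proof -
    have s: "submodule W1 R V" "submodule W2 R V" and c: "W1 <+>\<^bsub>V\<^esub> W2 = carrier V" "W1 \<inter> W2 = {\<zero>\<^bsub>V\<^esub>}"
      using W by (auto simp: internal_direct_sum_def)
    have sc: "W1 \<subseteq> carrier V" "W2 \<subseteq> carrier V" using s by (auto simp: V.submodule_iff)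
    have "internal_direct_sum R U (g ` W1) (g ` W2)" unfolding internal_direct_sum_def
    proof (intro conjI image_submodule[OF V U g(1)] s)
      show "g ` W1 <+>\<^bsub>U\<^esub> g ` W2 = carrier U"
      proof -
        have "g ` W1 <+>\<^bsub>U\<^esub> g ` W2 = g ` (W1 <+>\<^bsub>V\<^esub> W2)"
        proof -
          have *: "g (x \<oplus>\<^bsub>V\<^esub> y) = g x \<oplus>\<^bsub>U\<^esub> g y" if "x \<in> W1" "y \<in> W2" for x y
            using that sc hom_add[OF g(1)] by auto
          have "g ` W1 <+>\<^bsub>U\<^esub> g ` W2 = (\<Union>x\<in>W1. \<Union>y\<in>W2. {g x \<oplus>\<^bsub>U\<^esub> g y})" unfolding set_add_def' by simp
          also have "\<dots> = (\<Union>x\<in>W1. \<Union>y\<in>W2. {g (x \<oplus>\<^bsub>V\<^esub> y)})" using * by simp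
          also have "\<dots> = g ` (W1 <+>\<^bsub>V\<^esub> W2)" unfolding set_add_def' by auto
          finally show ?thesis .
        qed
        then show ?thesis using c im by simp
      qed
      show "g ` W1 \<inter> g ` W2 = {\<zero>\<^bsub>U\<^esub>}"
      proof -
        have "g ` W1 \<inter> g ` W2 = g ` (W1 \<inter> W2)" using inj_on_image_Int[OF inj sc] by simp
        then show ?thesis using c hom_zero[OF V U g(1)] by simp
      qed
    qed
    then have "g ` W1 = {\<zero>\<^bsub>U\<^esub>} \<or> g ` W2 = {\<zero>\<^bsub>U\<^esub>}" using ind unfolding indecomposable_def by blast
    then show ?thesis using z s by blast
  qed
  ultimately show ?thesis unfolding indecomposable_def using V by blast
qed

lemma indec_split_bij:
  assumes W: "left_module R W" and U: "left_module R U" and f: "f \<in> mod_hom R W U" and s: "s \<in> mod_hom R U W"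
    and fs: "\<And>x. x \<in> carrier U \<Longrightarrow> f (s x) = x"
    and ind: "indecomposable R W" and nz: "carrier U \<noteq> {\<zero>\<^bsub>U\<^esub>}"
  shows "bij_betw s (carrier U) (carrier W)"
proof -
  interpret W: left_module R W by fact
  interpret U: left_module R U by fact
  have "internal_direct_sum R W (s ` carrier U) (ker W U f)" by (rule split_internal[OF W U f s]) (rule fs)
  then have "s ` carrier U = {\<zero>\<^bsub>W\<^esub>} \<or> ker W U f = {\<zero>\<^bsub>W\<^esub>}" using ind unfolding indecomposable_def by blast
  moreover have "s ` carrier U \<noteq> {\<zero>\<^bsub>W\<^esub>}"
  proof
    assume "s ` carrier U = {\<zero>\<^bsub>W\<^esub>}"
    then have "s x = \<zero>\<^bsub>W\<^esub>" if "x \<in> carrier U" for x using that by blast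
    then have "x = \<zero>\<^bsub>U\<^esub>" if "x \<in> carrier U" for x using fs[OF that] that hom_zero[OF W U f] by metis
    then show False using nz U.M.zero_closed by blast
  qed
  ultimately have k: "ker W U f = {\<zero>\<^bsub>W\<^esub>}" by simp
  have "w \<in> s ` carrier U" if w: "w \<in> carrier W" for w
  proof -
    have "f (w \<ominus>\<^bsub>W\<^esub> s (f w)) = \<zero>\<^bsub>U\<^esub>"
      using w hom_closed[OF f] hom_closed[OF s] fs by (simp add: hom_diff[OF W U f] U.diff_eq_zero_iff)
    then have "w \<ominus>\<^bsub>W\<^esub> s (f w) \<in> ker W U f" using w hom_closed[OF f] hom_closed[OF s] by (simp add: ker_iff)
    then have "w = s (f w)" using k w W.diff_eq_zero_iff hom_closed[OF f] hom_closed[OF s] by simp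
    then show ?thesis using w hom_closed[OF f] by blast
  qed
  then show ?thesis unfolding bij_betw_def using fs hom_closed[OF s] by (auto intro: inj_on_inverseI)
qed

lemma no_summand_of_zero:
  assumes D: "left_module R D" "carrier D = {\<zero>\<^bsub>D\<^esub>}" and d: "is_dsum R D U V" and U: "left_module R U"
  shows "carrier U = {\<zero>\<^bsub>U\<^esub>}"
proof -
  interpret U: left_module R U by fact
  obtain i1 i2 p1 p2 where b: "bip R D U V i1 i2 p1 p2" using d unfolding is_dsum_bip by blast
  note b = bipD[OF b]
  have "x = \<zero>\<^bsub>U\<^esub>" if "x \<in> carrier U" for x
    using b(5,10)[OF that] D(2) hom_zero[OF D(1) U b(3)] by force
  then show ?thesis using U.M.zero_closed by blast
qed

context fl_ring
begin

lemma fg_fl: "fg_module R M \<Longrightarrow> finite_len R M"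
  using left_module.fg_finite_len[OF _ fl] by (auto simp: fg_module_def)

lemma fg_sub: "fg_module R M \<Longrightarrow> submodule U R M \<Longrightarrow> fg_module R (sub M U)"
proof -
  assume M: "fg_module R M" and U: "submodule U R M"
  interpret M: left_module R M using M by (rule fg_left_module)
  have s: "left_module R (sub M U)" by (rule M.sub_left_module[OF U])
  show ?thesis unfolding fg_module_def
    using s left_module.finite_len_fg[OF s M.finite_len_sub[OF fg_fl[OF M] U]] by simp
qed

text \<open>Indecomposable summands are split off one at a time. At first this is only a relation,
  since uniqueness of the multiset is the Krull-Schmidt theorem itself. Entries are the chosen
  representatives, so that multisets can be compared by equality.\<close>

inductive Dec :: "('a, 'a carr) module \<Rightarrow> ('a, 'a carr) module multiset \<Rightarrow> bool" where
  zero: "left_module R X \<Longrightarrow> carrier X = {\<zero>\<^bsub>X\<^esub>} \<Longrightarrow> Dec X {#}"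
| add: "is_dsum R X (U :: ('a, 'a carr) module) Y \<Longrightarrow> fg_module R X \<Longrightarrow> fg_module R U \<Longrightarrow> indecomposable R U \<Longrightarrow> Dec Y m \<Longrightarrow>
     Dec X (add_mset (rep R U) m)"

lemma zero_fg: "left_module R X \<Longrightarrow> carrier X = {\<zero>\<^bsub>X\<^esub>} \<Longrightarrow> fg_module R X"
  unfolding fg_module_def finitely_generated_def
  by (intro conjI exI[of _ "{}"]) (auto simp: left_module.submodule_iff)

lemma Dec_fg: "Dec X m \<Longrightarrow> fg_module R X"
  by (induction rule: Dec.induct) (auto intro: zero_fg)

lemma iso_zero:
  assumes "left_module R X" "carrier X = {\<zero>\<^bsub>X\<^esub>}" "mod_iso R X Y" "left_module R Y"
  shows "carrier Y = {\<zero>\<^bsub>Y\<^esub>}"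
proof -
  obtain f where f: "f \<in> mod_hom R X Y" "bij_betw f (carrier X) (carrier Y)" using assms by (auto simp: mod_iso_def)
  have "carrier Y = f ` carrier X" using f(2) by (simp add: bij_betw_def)
  then show ?thesis using hom_zero[OF assms(1,4) f(1)] assms(2) by simp
qed

lemma Dec_iso:
  assumes "Dec X m" "mod_iso R X X'" "left_module R X'" shows "Dec X' m"
  using assms(1)
proof cases
  case zero
  then show ?thesis using iso_zero[OF zero(2,3) assms(2,3)] assms(3) by (simp add: Dec.zero)
next
  case (add U Y m')
  have "is_dsum R X' U Y"
    using is_dsum_iso[OF fg_left_module[OF add(3)] fg_left_module[OF add(4)] fg_left_module[OF Dec_fg[OF add(6)]]
        add(2) assms(2) mod_iso_refl mod_iso_refl] add Dec_fg fg_left_module by blast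
  then show ?thesis unfolding add(1) using add fg_iso[OF add(3) assms(2,3)] by (intro Dec.add)
qed

lemma Dec_dsum: "Dec X m \<Longrightarrow> Dec Y m' \<Longrightarrow> is_dsum R D X Y \<Longrightarrow> fg_module R D \<Longrightarrow> Dec D (m + m')"
proof (induction arbitrary: D rule: Dec.induct)
  case (zero X)
  note lm = fg_left_module[OF Dec_fg[OF zero(3)]] fg_left_module[OF zero(5)]
  have "mod_iso R Y D" by (rule dsum_zero_iso[OF lm(2) zero(1,2,4) lm(1)])
  then show ?case using Dec_iso[OF zero(3)] lm by simp
next
  case (add X U X1 m)
  note lm = fg_left_module[OF Dec_fg[OF add.prems(1)]] fg_left_module[OF add.prems(3)] fg_left_module[OF add(2)]
     fg_left_module[OF add(3)] fg_left_module[OF Dec_fg[OF add(5)]]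
  obtain L where L: "submodule L R D" "is_dsum R D U (sub D L)" "is_dsum R (sub D L) X1 Y"
    using dsum_assoc[OF lm(2,3,1,4,5) add.prems(2) add(1)] by blast
  have "Dec (sub D L) (m + m')" using add.IH[OF add.prems(1) L(3) fg_sub[OF add.prems(3) L(1)]] .
  then show ?case using Dec.add[OF L(2) add.prems(3) add(3,4)] by simp
qed

text \<open>Induction on the rank of a submodule: a decomposable one splits into two proper
  submodules of smaller rank.\<close>

lemma Dec_exists:
  fixes X :: "('a, 'a carr) module"
  assumes X: "fg_module R X" shows "\<exists>m. Dec X m"
proof -
  interpret X: left_module R X using X by (rule fg_left_module)
  obtain \<rho> :: "'a carr set \<Rightarrow> nat" where r0: "\<forall>U U'. submodule U R X \<and> submodule U' R X \<and> U \<subset> U' \<longrightarrow> \<rho> U < \<rho> U'"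
    using fg_fl[OF X] unfolding finite_len_def by (rule exE)
  have "\<exists>m. Dec (sub X U) m" if "submodule U R X" for U
    using that
  proof (induction "\<rho> U" arbitrary: U rule: less_induct)
    case less
    have lm: "left_module R (sub X U)" by (rule X.sub_left_module[OF less.prems])
    interpret S: left_module R "sub X U" by (rule lm)
    show ?case
    proof (cases "U = {\<zero>\<^bsub>X\<^esub>}")
      case True
      then have "Dec (sub X U) {#}" using lm by (intro Dec.zero) auto
      then show ?thesis by blast
    next
      case nz: False
      show ?thesis
      proof (cases "indecomposable R (sub X U)")
        case True
        have Z: "left_module R (sub X {\<zero>\<^bsub>X\<^esub>})" by (rule X.sub_left_module[OF X.zero_submodule])
        then have "Dec (sub X {\<zero>\<^bsub>X\<^esub>}) {#}" by (intro Dec.zero) auto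
        then have "Dec (sub X U) (add_mset (rep R (sub X U)) {#})"
          using True fg_sub[OF X less.prems] dsum_zero[OF lm Z] by (intro Dec.add) auto
        then show ?thesis by blast
      next
        case False
        then obtain V W where VW: "internal_direct_sum R (sub X U) V W" "V \<noteq> {\<zero>\<^bsub>X\<^esub>}" "W \<noteq> {\<zero>\<^bsub>X\<^esub>}"
          using lm nz unfolding indecomposable_def by auto
        then have s: "submodule V R X" "V \<subseteq> U" "submodule W R X" "W \<subseteq> U" "V \<inter> W = {\<zero>\<^bsub>X\<^esub>}"
          unfolding internal_direct_sum_def X.submodule_sub_iff[OF less.prems] by auto
        have "V \<subset> U" "W \<subset> U" using s VW(2,3) by auto
        then obtain m1 m2 where m: "Dec (sub X V) m1" "Dec (sub X W) m2"
          using less.hyps[of V] less.hyps[of W] r0 s less.prems by metis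
        have "is_dsum R (sub X U) (sub X V) (sub X W)" using internal_dsum[OF lm VW(1)] by simp
        then show ?thesis using Dec_dsum[OF m] fg_sub[OF X less.prems] by blast
      qed
    qed
  qed
  from this[OF X.carrier_submodule] show ?thesis by simp
qed

text \<open>This is the exchange property. The identity of \<open>U\<close> is the sum of two
  endomorphisms, one through the first summand \<open>W\<close> of the given decomposition and one
  through the rest \<open>W'\<close>. By \<open>indec_local\<close> one of them is bijective: either
  \<open>U\<close> is isomorphic to \<open>W\<close>, or \<open>U\<close> splits off from
  \<open>W'\<close> and the induction hypothesis applies there.\<close>

lemma Dec_exch:
  "Dec E m \<Longrightarrow> is_dsum R E U V \<Longrightarrow> indecomposable R U \<Longrightarrow> fg_module R U \<Longrightarrow> fg_module R V \<Longrightarrow>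
   rep R U \<in># m \<and> Dec V (m - {#rep R U#})"
proof (induction arbitrary: V rule: Dec.induct)
  case (zero X)
  then have "carrier U = {\<zero>\<^bsub>U\<^esub>}" using no_summand_of_zero[OF zero(1-3)] fg_left_module by blast
  then show ?case using zero by (simp add: indecomposable_def)
next
  case (add E W W' m')
  have E: "left_module R E" and W: "left_module R W" and W': "left_module R W'" and V: "left_module R V" and U: "left_module R U"
    using add Dec_fg fg_left_module by blast+
  interpret E: left_module R E by fact
  interpret U: left_module R U by fact
  interpret V: left_module R V by fact
  obtain i i2 p p2 where "bip R E U V i i2 p p2" using add.prems(1) unfolding is_dsum_bip by blast
  note bU = this and b = bipD[OF this]
  obtain j j' q q' where "bip R E W W' j j' q q'" using add(1) unfolding is_dsum_bip by blast
  note bW = this and b' = bipD[OF this]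
  have nz: "carrier U \<noteq> {\<zero>\<^bsub>U\<^esub>}" using add.prems by (simp add: indecomposable_def)
  define \<phi> where "\<phi> w = p (j w)" for w
  define \<phi>' where "\<phi>' w = p (j' w)" for w
  define s where "s u = q (i u)" for u
  define s' where "s' u = q' (i u)" for u
  have h: "\<phi> \<in> mod_hom R W U" "\<phi>' \<in> mod_hom R W' U" "s \<in> mod_hom R U W" "s' \<in> mod_hom R U W'"
    unfolding \<phi>_def \<phi>'_def s_def s'_def
    using hom_comp[OF b'(1) b(3)] hom_comp[OF b'(2) b(3)] hom_comp[OF b(1) b'(3)] hom_comp[OF b(1) b'(4)] by auto
  have ids: "bij_betw (\<lambda>x. p (i x)) (carrier U) (carrier U)"
    using b(5) by (auto simp: bij_betw_def intro!: inj_on_inverseI[of _ "\<lambda>x. x"])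
  have sum: "\<phi> (s u) \<oplus>\<^bsub>U\<^esub> \<phi>' (s' u) = u" if u: "u \<in> carrier U" for u
  proof -
    have c: "i u \<in> carrier E" using b u by simp
    have "p (j (q (i u)) \<oplus>\<^bsub>E\<^esub> j' (q' (i u))) = u" unfolding b'(9)[OF c] using b(5) u by simp
    moreover have "p (j (q (i u)) \<oplus>\<^bsub>E\<^esub> j' (q' (i u))) = p (j (q (i u))) \<oplus>\<^bsub>U\<^esub> p (j' (q' (i u)))"
      by (rule hom_add[OF b(3)]) (use c b' in auto)
    ultimately show ?thesis by (simp add: \<phi>_def \<phi>'_def s_def s'_def)
  qed
  have "bij_betw (\<lambda>x. \<phi> (s x)) (carrier U) (carrier U) \<or> bij_betw (\<lambda>x. \<phi>' (s' x)) (carrier U) (carrier U)"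
    by (rule U.indec_local[OF fg_fl[OF add.prems(3)] hom_comp[OF h(3,1)] hom_comp[OF h(4,2)] add.prems(2) sum])
  then show ?case
  proof
    assume bij: "bij_betw (\<lambda>x. \<phi> (s x)) (carrier U) (carrier U)"
    define a where "a = inv_into (carrier U) (\<lambda>x. \<phi> (s x))"
    have a: "a \<in> mod_hom R U U" "\<And>x. x \<in> carrier U \<Longrightarrow> a (\<phi> (s x)) = x"
      using inv_hom[OF U hom_comp[OF h(3,1)] bij] bij inv_into_f_f[of "\<lambda>x. \<phi> (s x)" "carrier U"] by (auto simp: a_def bij_betw_def)
    have sb: "bij_betw s (carrier U) (carrier W)"
      by (rule indec_split_bij[OF W U hom_comp[OF h(1) a(1)] h(3) a(2) add(4) nz])
    have "mod_iso R U W" unfolding mod_iso_def using h(3) sb by blast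
    then have r: "rep R U = rep R W" by (rule rep_cong[OF U W])
    \<comment> \<open>The kernels are copies of \<open>V\<close> and of \<open>W'\<close>, both
      complements of the same copy of \<open>U\<close> in \<open>E\<close>.\<close>
    have "mod_iso R (sub E (ker E U p)) (sub E (ker E W q))"
      using ker_iso[OF E U U W b(1) b(3) b'(3) ids] sb by (simp add: s_def[abs_def])
    then have "mod_iso R V W'" using bip_ker_iso[OF E U V bU]
        mod_iso_sym[OF W' bip_ker_iso[OF E W W' bW]] mod_iso_trans by blast
    then have "Dec V m'" using Dec_iso[OF add(5)] mod_iso_sym[OF V] V by blast
    then show ?case by (simp add: r)
  next
    assume bij: "bij_betw (\<lambda>x. \<phi>' (s' x)) (carrier U) (carrier U)"
    define a where "a = inv_into (carrier U) (\<lambda>x. \<phi>' (s' x))"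
    have a: "a \<in> mod_hom R U U" "\<And>x. x \<in> carrier U \<Longrightarrow> a (\<phi>' (s' x)) = x"
      using inv_hom[OF U hom_comp[OF h(4,2)] bij] bij inv_into_f_f[of "\<lambda>x. \<phi>' (s' x)" "carrier U"] by (auto simp: a_def bij_betw_def)
    let ?f = "\<lambda>w. a (\<phi>' w)"
    have f: "?f \<in> mod_hom R W' U" by (rule hom_comp[OF h(2) a(1)])
    let ?K = "ker W' U ?f"
    have K: "submodule ?K R W'" by (rule ker_submodule[OF W' U f])
    have "is_dsum R W' U (sub W' ?K)"
      by (rule bip_dsum[OF split_bip[OF W' U f h(4)]]) (use a in auto)
    moreover have Kfg: "fg_module R (sub W' ?K)" by (rule fg_sub[OF Dec_fg[OF add(5)] K])
    ultimately have IH: "rep R U \<in># m'" "Dec (sub W' ?K) (m' - {#rep R U#})"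
      using add.IH add.prems by auto
    \<comment> \<open>The kernel \<open>?L\<close> of \<open>?g\<close> is a second complement of
      \<open>U\<close>, so it is isomorphic to \<open>V\<close>. On the other hand it is the direct
      sum of \<open>W\<close> and \<open>?K\<close>, whose decompositions are known.\<close>
    let ?g = "\<lambda>e. ?f (q' e)"
    have g: "?g \<in> mod_hom R E U" by (rule hom_comp[OF b'(4) f])
    let ?L = "ker E U ?g"
    have L: "submodule ?L R E" by (rule ker_submodule[OF E U g])
    have "bij_betw (\<lambda>x. ?g (i x)) (carrier U) (carrier U)"
      using a(2) by (auto simp: bij_betw_def s'_def intro!: inj_on_inverseI[of _ "\<lambda>x. x"])
    then have "mod_iso R (sub E (ker E U p)) (sub E ?L)"
      by (rule ker_iso[OF E U U U b(1) b(3) g ids])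
    then have VL: "mod_iso R V (sub E ?L)" using bip_ker_iso[OF E U V bU] mod_iso_trans by blast
    have "bip R (sub E ?L) W (sub W' ?K) j j' q q'"
    proof (rule bipI)
      show "j \<in> mod_hom R W (sub E ?L)"
        using b' hom_zero[OF W' U f] by (intro hom_into_sub b'(1)) (auto simp: ker_iff)
      show "j' \<in> mod_hom R (sub W' ?K) (sub E ?L)"
        using b' by (intro hom_into_sub hom_restrict b'(2)) (auto simp: ker_iff)
      show "q \<in> mod_hom R (sub E ?L) W" by (intro hom_restrict b'(3)) (auto simp: ker_iff)
      show "q' \<in> mod_hom R (sub E ?L) (sub W' ?K)"
        using b' by (intro hom_into_sub hom_restrict b'(4)) (auto simp: ker_iff)
    qed (use b' in \<open>auto simp: ker_iff\<close>)
    then have "is_dsum R (sub E ?L) W (sub W' ?K)" by (rule bip_dsum)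
    then have "Dec (sub E ?L) (add_mset (rep R W) (m' - {#rep R U#}))"
      using fg_sub[OF add(2) L] add(3,4) IH(2) by (intro Dec.add)
    then have "Dec V (add_mset (rep R W) (m' - {#rep R U#}))" using Dec_iso mod_iso_sym[OF V VL] V by blast
    then show ?case using IH(1) by (simp add: multiset_eq_iff)
  qed
qed

lemma Dec_unique: "Dec X m \<Longrightarrow> Dec X m' \<Longrightarrow> m = m'"
proof (induction arbitrary: m' rule: Dec.induct)
  case (zero X)
  show ?case using zero(3)
  proof cases
    case (add U Y m)
    then have "carrier U = {\<zero>\<^bsub>U\<^esub>}" using no_summand_of_zero[OF zero(1,2)] fg_left_module by blast
    then show ?thesis using add by (simp add: indecomposable_def)
  qed simp
next
  case (add X U Y m)
  have "rep R U \<in># m' \<and> Dec Y (m' - {#rep R U#})"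
    using Dec_exch[OF add.prems add(1,4,3) Dec_fg[OF add(5)]] .
  then show ?case using add.IH by (metis insert_DiffM)
qed

text \<open>By regrouping direct sums, any entry may be made the first one to be split off.\<close>

lemma Dec_mem:
  "Dec Y m \<Longrightarrow> u \<in># m \<Longrightarrow> \<exists>(U :: ('a, 'a carr) module) Y'. indecomposable R U \<and> fg_module R U \<and> rep R U = u \<and> is_dsum R Y U Y' \<and> Dec Y' (m - {#u#})"
proof (induction rule: Dec.induct)
  case (add Y W W1 m)
  show ?case
  proof (cases "u = rep R W")
    case True
    then have "indecomposable R W \<and> fg_module R W \<and> rep R W = u \<and> is_dsum R Y W W1 \<and> Dec W1 (add_mset (rep R W) m - {#u#})"
      using add.hyps by simp
    then show ?thesis by blast
  next
    case False
    then obtain U :: "('a, 'a carr) module" and W2 where U: "indecomposable R U" "fg_module R U" "rep R U = u" "is_dsum R W1 U W2" "Dec W2 (m - {#u#})"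
      using add by auto
    have u: "u \<in># m" using add False by auto
    note lm = fg_left_module[OF add(2)] fg_left_module[OF Dec_fg[OF add(5)]] fg_left_module[OF add(3)] fg_left_module[OF U(2)]
       fg_left_module[OF Dec_fg[OF U(5)]]
    obtain L where L: "submodule L R Y" "is_dsum R Y U (sub Y L)" "is_dsum R (sub Y L) W2 W"
      using dsum_assoc[OF lm is_dsum_comm[OF lm(1) add(1)] U(4)] by blast
    have fL: "fg_module R (sub Y L)" by (rule fg_sub[OF add(2) L(1)])
    have "Dec (sub Y L) (add_mset (rep R W) (m - {#u#}))"
      using Dec.add[OF is_dsum_comm[OF fg_left_module[OF fL] L(3)] fL add(3,4) U(5)] .
    then have "Dec (sub Y L) (add_mset (rep R W) m - {#u#})" using u by (simp add: multiset_eq_iff False)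
    then show ?thesis using U L by blast
  qed
qed simp

lemma Dec_inj: "Dec X m \<Longrightarrow> Dec Y m \<Longrightarrow> mod_iso R X Y"
proof (induction arbitrary: Y rule: Dec.induct)
  case (zero X)
  show ?case using zero(3)
  proof cases
    case z: zero
    have "bij_betw (\<lambda>x. \<zero>\<^bsub>Y\<^esub>) (carrier X) (carrier Y)" using z zero by (simp add: bij_betw_def)
    then show ?thesis unfolding mod_iso_def using zero_hom[OF z(1)] by blast
  qed simp
next
  case (add X U X1 m)
  obtain U' :: "('a, 'a carr) module" and Y' where U: "indecomposable R U'" "fg_module R U'" "rep R U' = rep R U" "is_dsum R Y U' Y'" "Dec Y' m"
    using Dec_mem[OF add.prems, of "rep R U"] by auto
  have "mod_iso R X1 Y'" by (rule add.IH[OF U(5)])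
  moreover have "mod_iso R U U'" using rep_eq_iff[OF add(3) U(2)] U(3) by simp
  ultimately show ?case
    by (rule dsum_unique[OF fg_left_module[OF add(2)] fg_left_module[OF Dec_fg[OF add.prems]] fg_left_module[OF U(2)]
        fg_left_module[OF Dec_fg[OF U(5)]] fg_left_module[OF add(3)] fg_left_module[OF Dec_fg[OF add(5)]] add(1) U(4), rotated])
qed

text \<open>Well defined by the Krull--Schmidt theorem; isomorphism classes are represented by the values of \<open>rep\<close>.\<close>

definition dec :: "('a, 'm) module \<Rightarrow> ('a, 'a carr) module multiset" where
  "dec X = (THE m. Dec (rep R X) m)"

lemma Dec_dec: "fg_module R X \<Longrightarrow> Dec (rep R X) (dec X)"
  unfolding dec_def using Dec_exists[OF rep(1)] Dec_unique by (metis theI')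

lemma dec_iso_iff:
  assumes "fg_module R X" "fg_module R Y" shows "dec X = dec Y \<longleftrightarrow> mod_iso R X Y"
proof
  assume "dec X = dec Y"
  then have "mod_iso R (rep R X) (rep R Y)" using Dec_inj Dec_dec assms by metis
  then show "mod_iso R X Y" using rep assms mod_iso_trans mod_iso_sym fg_left_module by metis
next
  assume "mod_iso R X Y"
  then have "rep R X = rep R Y" using rep_eq_iff assms by blast
  then show "dec X = dec Y" by (simp add: dec_def)
qed

lemma dec_dsum:
  assumes D: "is_dsum R D X Y" "fg_module R D" "fg_module R X" "fg_module R Y"
  shows "dec D = dec X + dec Y"
proof -
  have "is_dsum R (rep R D) (rep R X) (rep R Y)"
    by (rule is_dsum_iso[OF fg_left_module[OF D(2)] fg_left_module[OF D(3)] fg_left_module[OF D(4)] D(1)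
        rep(2)[OF D(2)] rep(2)[OF D(3)] rep(2)[OF D(4)] fg_left_module[OF rep(1)[OF D(3)]] fg_left_module[OF rep(1)[OF D(4)]]])
  then have "Dec (rep R D) (dec X + dec Y)" using Dec_dsum[OF Dec_dec[OF D(3)] Dec_dec[OF D(4)] _ rep(1)[OF D(2)]] by simp
  then show ?thesis using Dec_unique Dec_dec D(2) by blast
qed

lemma dec_zero_iff:
  assumes "fg_module R X" shows "dec X = {#} \<longleftrightarrow> carrier X = {\<zero>\<^bsub>X\<^esub>}"
proof
  assume "dec X = {#}"
  then have "Dec (rep R X) {#}" using Dec_dec[OF assms] by simp
  then have "carrier (rep R X) = {\<zero>\<^bsub>rep R X\<^esub>}" by cases auto
  then show "carrier X = {\<zero>\<^bsub>X\<^esub>}" using iso_zero rep[OF assms] mod_iso_sym assms fg_left_module by metis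
next
  assume "carrier X = {\<zero>\<^bsub>X\<^esub>}"
  then have "carrier (rep R X) = {\<zero>\<^bsub>rep R X\<^esub>}" using iso_zero rep[OF assms] assms fg_left_module by metis
  then have "Dec (rep R X) {#}" using rep[OF assms] fg_left_module by (blast intro: Dec.zero)
  then show "dec X = {#}" using Dec_unique Dec_dec[OF assms] by blast
qed

lemma dec_indec:
  assumes "indecomposable R U" "fg_module R U" shows "dec U = {#rep R U#}"
proof -
  have r: "left_module R (rep R U)" "indecomposable R (rep R U)" "rep R (rep R U) = rep R U"
    using assms rep[OF assms(2)] fg_left_module indecomposable_iso rep_cong by metis+
  interpret r: left_module R "rep R U" by (rule r(1))
  let ?Z = "sub (rep R U) {\<zero>\<^bsub>rep R U\<^esub>}"
  have Z: "left_module R ?Z" by (rule r.sub_left_module[OF r.zero_submodule])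
  then have "Dec ?Z {#}" by (intro Dec.zero) auto
  then have "Dec (rep R U) (add_mset (rep R (rep R U)) {#})"
    using r dsum_zero[OF r(1) Z] rep[OF assms(2)] by (intro Dec.add) auto
  then show ?thesis using Dec_unique Dec_dec[OF assms(2)] r(3) by auto
qed

lemma Dec_elem: "Dec X m \<Longrightarrow> u \<in># m \<Longrightarrow> fg_module R u \<and> indecomposable R u \<and> rep R u = u"
proof (induction rule: Dec.induct)
  case (add X U Y m)
  then show ?case using rep[OF add(3)] fg_left_module indecomposable_iso rep_cong
    by (metis add_mset_remove_trivial_eq insert_noteq_member mset_add add_mset_remove_trivial in_diffD union_single_eq_member)
qed simp

lemma dec_elem:
  assumes "fg_module R X" "u \<in># dec X"
  shows "fg_module R u" "indecomposable R u" "rep R u = u" "dec u = {#u#}"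
  using Dec_elem[OF Dec_dec[OF assms(1)] assms(2)] dec_indec by metis+

lemma dsum_exists:
  assumes "fg_module R X" "fg_module R Y"
  shows "\<exists>D :: ('a, 'a carr) module. fg_module R D \<and> is_dsum R D X Y"
proof -
  have lm: "left_module R X" "left_module R Y" using assms fg_left_module by auto
  note p = prod_module[OF lm]
  have f: "fg_module R (prod_module X Y)" by (rule dsum_fg[OF p assms])
  show ?thesis using rep[OF f] is_dsum_iso[OF p(1) lm p(2) rep(2)[OF f] mod_iso_refl mod_iso_refl lm] by blast
qed

lemma zero_exists: "\<exists>Z :: ('a, 'a carr) module. fg_module R Z \<and> dec Z = {#}"
proof -
  interpret L: left_module R "reg R" by (rule reg_left_module)
  have "fg_module R (sub (reg R) {\<zero>})"
    using L.sub_left_module[OF L.zero_submodule] by (intro zero_fg) auto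
  from rep[OF this] dec_zero_iff[OF this] dec_iso_iff[OF this] show ?thesis by force
qed

text \<open>The condition singles out those values of the type that are indecomposable modules and
  their own representatives; only these occur in decompositions.\<close>

lemma dec_realize:
  "(\<forall>u\<in>#m. fg_module R u \<and> dec u = {#u#}) \<Longrightarrow> \<exists>X :: ('a, 'a carr) module. fg_module R X \<and> dec X = m"
proof (induction m)
  case empty show ?case by (rule zero_exists)
next
  case (add u m)
  then obtain X :: "('a, 'a carr) module" where X: "fg_module R X" "dec X = m" by auto
  obtain D :: "('a, 'a carr) module" where "fg_module R D" "is_dsum R D u X" using dsum_exists[OF _ X(1), of u] add by auto
  then show ?case using dec_dsum[of D u X] X add by auto
qed

end

section \<open>Projective modules\<close>

lemma module_power_simps [simp]:
  "carrier (module_power n M) = (\<Pi>\<^sub>E i\<in>{..<n}. carrier M)"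
  "zero (module_power n M) = (\<lambda>i\<in>{..<n}. \<zero>\<^bsub>M\<^esub>)"
  "add (module_power n M) = (\<lambda>x y. \<lambda>i\<in>{..<n}. x i \<oplus>\<^bsub>M\<^esub> y i)"
  "smult (module_power n M) = (\<lambda>a x. \<lambda>i\<in>{..<n}. a \<odot>\<^bsub>M\<^esub> x i)"
  by (simp_all add: module_power_def)

lemma module_power_left_module:
  assumes M: "left_module R M" shows "left_module R (module_power n M)"
proof -
  interpret M: left_module R M by fact
  show ?thesis
  proof (intro left_module.intro left_module_axioms.intro M.R.ring_axioms abelian_groupI)
    fix x assume x: "x \<in> carrier (module_power n M)"
    then have "(\<lambda>i\<in>{..<n}. \<ominus>\<^bsub>M\<^esub> x i) \<oplus>\<^bsub>module_power n M\<^esub> x = \<zero>\<^bsub>module_power n M\<^esub>"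
      by (auto simp: fun_eq_iff M.M.l_neg PiE_iff)
    moreover have "(\<lambda>i\<in>{..<n}. \<ominus>\<^bsub>M\<^esub> x i) \<in> carrier (module_power n M)" using x by (auto simp: PiE_iff)
    ultimately show "\<exists>y\<in>carrier (module_power n M). y \<oplus>\<^bsub>module_power n M\<^esub> x = \<zero>\<^bsub>module_power n M\<^esub>" by blast
  qed (auto simp: PiE_iff extensional_def fun_eq_iff restrict_def M.M.a_ac M.smult_l_distr M.smult_r_distr M.smult_assoc1)
qed

lemma module_power_0: "carrier (module_power 0 M) = {\<zero>\<^bsub>module_power 0 M\<^esub>}"
  by (auto simp: restrict_def)

lemma module_power_Suc:
  assumes M: "left_module R M" shows "is_dsum R (module_power (Suc n) M) M (module_power n M)"
proof -
  interpret M: left_module R M by fact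
  show ?thesis
    by (rule is_dsumI[of "\<lambda>x. \<lambda>i\<in>{..<Suc n}. if i = n then x else \<zero>\<^bsub>M\<^esub>" _ _ _
          "\<lambda>y. \<lambda>i\<in>{..<Suc n}. if i = n then \<zero>\<^bsub>M\<^esub> else y i" _ "\<lambda>x. x n" "\<lambda>x. restrict x {..<n}"])
      (auto intro!: mod_homI simp: PiE_iff extensional_def fun_eq_iff restrict_def M.smult_zero_r less_Suc_eq split: if_splits)
qed

text \<open>Recursion on the length makes it a plain induction to compare linear combinations formed
  over different rings, as happens when matrices over \<open>S 0\<close> are read over
  \<open>A\<close>.\<close>

fun lin_comb :: "('a, 'm) module \<Rightarrow> nat \<Rightarrow> (nat \<Rightarrow> 'a) \<Rightarrow> (nat \<Rightarrow> 'm) \<Rightarrow> 'm" where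
  "lin_comb M 0 x e = \<zero>\<^bsub>M\<^esub>"
| "lin_comb M (Suc n) x e = lin_comb M n x e \<oplus>\<^bsub>M\<^esub> x n \<odot>\<^bsub>M\<^esub> e n"

definition delta :: "('a, 'x) ring_scheme \<Rightarrow> nat \<Rightarrow> nat \<Rightarrow> nat \<Rightarrow> 'a" where
  "delta R n j = (\<lambda>i\<in>{..<n}. if i = j then \<one>\<^bsub>R\<^esub> else \<zero>\<^bsub>R\<^esub>)"

abbreviation free_mod :: "('a, 'x) ring_scheme \<Rightarrow> nat \<Rightarrow> ('a, nat \<Rightarrow> 'a) module" where
  "free_mod R n \<equiv> module_power n (reg R)"

context left_module
begin

lemma lin_comb_closed: "(\<And>i. i < n \<Longrightarrow> x i \<in> carrier R) \<Longrightarrow> (\<And>i. i < n \<Longrightarrow> e i \<in> carrier M) \<Longrightarrow> lin_comb M n x e \<in> carrier M"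
  by (induction n) auto

lemma lin_comb_hom:
  assumes e: "\<And>i. i < n \<Longrightarrow> e i \<in> carrier M"
  shows "(\<lambda>x. lin_comb M n x e) \<in> mod_hom R (free_mod R n) M"
proof (rule mod_homI)
  fix x assume "x \<in> carrier (free_mod R n)"
  then show "lin_comb M n x e \<in> carrier M" using e by (intro lin_comb_closed) (auto simp: PiE_iff)
next
  fix x y assume xy: "x \<in> carrier (free_mod R n)" "y \<in> carrier (free_mod R n)"
  have "lin_comb M k (x \<oplus>\<^bsub>free_mod R n\<^esub> y) e = lin_comb M k x e \<oplus>\<^bsub>M\<^esub> lin_comb M k y e" if "k \<le> n" for k
    using that
  proof (induction k)
    case (Suc k)
    have c: "lin_comb M k x e \<in> carrier M" "lin_comb M k y e \<in> carrier M" "x k \<in> carrier R" "y k \<in> carrier R" "e k \<in> carrier M"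
      using Suc.prems xy e by (auto intro!: lin_comb_closed simp: PiE_iff)
    have "(x \<oplus>\<^bsub>free_mod R n\<^esub> y) k = x k \<oplus>\<^bsub>R\<^esub> y k" using Suc.prems by simp
    then show ?case using Suc c by (simp add: smult_l_distr M.a_ac del: module_power_simps)
  qed simp
  then show "lin_comb M n (x \<oplus>\<^bsub>free_mod R n\<^esub> y) e = lin_comb M n x e \<oplus>\<^bsub>M\<^esub> lin_comb M n y e" by simp
next
  fix a x assume ax: "a \<in> carrier R" "x \<in> carrier (free_mod R n)"
  have "lin_comb M k (a \<odot>\<^bsub>free_mod R n\<^esub> x) e = a \<odot>\<^bsub>M\<^esub> lin_comb M k x e" if "k \<le> n" for k
    using that
  proof (induction k)
    case 0 show ?case using ax by (simp add: smult_zero_r)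
  next
    case (Suc k)
    have c: "lin_comb M k x e \<in> carrier M" "x k \<in> carrier R" "e k \<in> carrier M"
      using Suc.prems ax e by (auto intro!: lin_comb_closed simp: PiE_iff)
    have "(a \<odot>\<^bsub>free_mod R n\<^esub> x) k = a \<otimes>\<^bsub>R\<^esub> x k" using Suc.prems by simp
    then show ?case using Suc c ax by (simp add: smult_r_distr smult_assoc1 del: module_power_simps)
  qed
  then show "lin_comb M n (a \<odot>\<^bsub>free_mod R n\<^esub> x) e = a \<odot>\<^bsub>M\<^esub> lin_comb M n x e" by simp
qed

lemma lin_comb_delta:
  assumes e: "\<And>i. i < n \<Longrightarrow> e i \<in> carrier M" and j: "j < n"
  shows "lin_comb M n (delta R n j) e = e j"
proof -
  have "lin_comb M k (delta R n j) e = (if j < k then e j else \<zero>\<^bsub>M\<^esub>)" if "k \<le> n" for k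
    using that by (induction k) (use e j in \<open>auto simp: delta_def smult_zero_l less_Suc_eq\<close>)
  then show ?thesis using j by simp
qed

lemma hom_lin_comb:
  assumes N: "left_module R N" and h: "h \<in> mod_hom R M N"
    and "\<And>i. i < n \<Longrightarrow> x i \<in> carrier R" "\<And>i. i < n \<Longrightarrow> e i \<in> carrier M"
  shows "h (lin_comb M n x e) = lin_comb N n x (\<lambda>i. h (e i))"
  using assms(3,4)
proof (induction n)
  case 0 show ?case using hom_zero[OF _ N h] left_module_axioms by simp
next
  case (Suc n)
  then show ?case using mod_homD[OF h] lin_comb_closed[of n x e] by simp
qed

end

context ring
begin

lemma free_left_module: "left_module R (free_mod R n)"
  by (rule module_power_left_module[OF reg_left_module])

text \<open>For \<open>j \<ge> n\<close> the vector is zero, so images of basis vectors can be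
  chosen without a bound on the index.\<close>

lemma delta_closed: "delta R n j \<in> carrier (free_mod R n)"
  by (auto simp: delta_def)

lemma free_lin_comb:
  assumes x: "x \<in> carrier (free_mod R n)" shows "lin_comb (free_mod R n) n x (delta R n) = x"
proof -
  have "lin_comb (free_mod R n) k x (delta R n) = (\<lambda>i\<in>{..<n}. if i < k then x i else \<zero>)" if "k \<le> n" for k
    using that
  proof (induction k)
    case (Suc k)
    then show ?case using x by (auto simp: fun_eq_iff delta_def PiE_iff less_Suc_eq)
  qed (simp add: fun_eq_iff)
  from this[of n] show ?thesis using x by (auto simp: fun_eq_iff PiE_iff extensional_def)
qed

lemma free_hom_eq_lin_comb:
  assumes N: "left_module R N" and h: "h \<in> mod_hom R (free_mod R n) N" and x: "x \<in> carrier (free_mod R n)"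
  shows "h x = lin_comb N n x (\<lambda>i. h (delta R n i))"
proof -
  interpret F: left_module R "free_mod R n" by (rule free_left_module)
  have "h (lin_comb (free_mod R n) n x (delta R n)) = lin_comb N n x (\<lambda>i. h (delta R n i))"
    using x delta_closed by (intro F.hom_lin_comb N h) (auto simp: PiE_iff)
  then show ?thesis by (simp only: free_lin_comb[OF x])
qed

lemma reg_fg: "fg_module R (reg R)"
proof -
  interpret L: left_module R "reg R" by (rule reg_left_module)
  have "U = carrier (reg R)" if U: "submodule U R (reg R)" "{\<one>} \<subseteq> U" for U
  proof -
    have "x \<in> U" if "x \<in> carrier R" for x
      using U that unfolding L.submodule_iff by (metis insert_subset r_one reg_simps(4))
    then show ?thesis using U(1) by (auto simp: L.submodule_iff)
  qed
  then show ?thesis unfolding fg_module_def finitely_generated_def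
    using reg_left_module by (intro conjI exI[of _ "{\<one>}"]) auto
qed

lemma fg_power: "fg_module R M \<Longrightarrow> fg_module R (module_power n M)"
proof (induction n)
  case 0
  have "left_module R (module_power 0 M)" using 0 module_power_left_module by (auto simp: fg_module_def)
  then interpret L: left_module R "module_power 0 M" .
  show ?case using module_power_0[of M] unfolding fg_module_def finitely_generated_def
    by (intro conjI exI[of _ "{}"]) (use L.left_module_axioms in \<open>auto simp: L.submodule_iff simp del: module_power_simps\<close>)
next
  case (Suc n)
  then show ?case using dsum_fg[OF module_power_left_module module_power_Suc] fg_left_module by blast
qed

lemma free_fg: "fg_module R (free_mod R n)" by (rule fg_power[OF reg_fg])

end

text \<open>\<^const>\<open>fg_projective\<close> for a carrier of arbitrary type.\<close>

definition is_proj :: "('a, 'x) ring_scheme \<Rightarrow> ('a, 'p) module \<Rightarrow> bool" where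
  "is_proj R P \<longleftrightarrow> fg_module R P \<and>
     (\<forall>(X :: ('a, 'a carr) module) (Y :: ('a, 'a carr) module) f g.
        fg_module R X \<and> fg_module R Y \<and> f \<in> mod_hom R P Y \<and>
        g \<in> mod_hom R X Y \<and> g ` carrier X = carrier Y \<longrightarrow>
        (\<exists>h\<in>mod_hom R P X. \<forall>p\<in>carrier P. g (h p) = f p))"

lemma is_projI:
  assumes "fg_module R P"
    and "\<And>(X :: ('a, 'a carr) module) (Y :: ('a, 'a carr) module) f g. fg_module R X \<Longrightarrow> fg_module R Y \<Longrightarrow>
      f \<in> mod_hom R P Y \<Longrightarrow> g \<in> mod_hom R X Y \<Longrightarrow> g ` carrier X = carrier Y \<Longrightarrow>
      \<exists>h\<in>mod_hom R P X. \<forall>p\<in>carrier P. g (h p) = f p"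
  shows "is_proj R (P :: ('a, 'p) module)"
  unfolding is_proj_def by (intro conjI allI impI assms(1), elim conjE) (rule assms(2))

lemma is_projD:
  fixes X :: "('a, 'a carr) module" and Y :: "('a, 'a carr) module"
  assumes "is_proj R P" "fg_module R X" "fg_module R Y" "f \<in> mod_hom R P Y" "g \<in> mod_hom R X Y" "g ` carrier X = carrier Y"
  shows "\<exists>h\<in>mod_hom R P X. \<forall>p\<in>carrier P. g (h p) = f p"
  using assms unfolding is_proj_def by (elim conjE allE impE) (intro conjI)

lemma fg_projective_iff: "fg_projective R P \<longleftrightarrow> is_proj R P"
  unfolding fg_projective_def is_proj_def by (rule refl)

lemma is_proj_fg: "is_proj R P \<Longrightarrow> fg_module R P" by (simp add: is_proj_def)

text \<open>The definition tests lifting only against modules of the universe; transport along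
  \<open>rep\<close> extends it to all finitely generated modules.\<close>

lemma proj_lift:
  fixes P :: "('a, 'p) module" and X :: "('a, 'm) module" and Y :: "('a, 'n) module"
  assumes P: "is_proj R P" and X: "fg_module R X" and Y: "fg_module R Y" and f: "f \<in> mod_hom R P Y"
    and g: "g \<in> mod_hom R X Y" "g ` carrier X = carrier Y"
  shows "\<exists>h\<in>mod_hom R P X. \<forall>p\<in>carrier P. g (h p) = f p"
proof -
  note lm = fg_left_module[OF X] fg_left_module[OF Y] fg_left_module[OF is_proj_fg[OF P]]
  obtain \<xi> where x: "\<xi> \<in> mod_hom R X (rep R X)" "bij_betw \<xi> (carrier X) (carrier (rep R X))"
    using rep(2)[OF X] by (auto simp: mod_iso_def)
  obtain \<eta> where y: "\<eta> \<in> mod_hom R Y (rep R Y)" "bij_betw \<eta> (carrier Y) (carrier (rep R Y))"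
    using rep(2)[OF Y] by (auto simp: mod_iso_def)
  define x' where "x' = inv_into (carrier X) \<xi>"
  have x': "x' \<in> mod_hom R (rep R X) X" "\<And>u. u \<in> carrier X \<Longrightarrow> x' (\<xi> u) = u" "x' ` carrier (rep R X) = carrier X"
    using inv_hom[OF lm(1) x] x(2) bij_betw_inv_into[OF x(2)] by (auto simp: x'_def bij_betw_def)
  have g': "(\<lambda>u. \<eta> (g (x' u))) \<in> mod_hom R (rep R X) (rep R Y)" by (rule hom_comp[OF hom_comp[OF x'(1) g(1)] y(1)])
  have f': "(\<lambda>u. \<eta> (f u)) \<in> mod_hom R P (rep R Y)" by (rule hom_comp[OF f y(1)])
  have "(\<lambda>u. \<eta> (g (x' u))) ` carrier (rep R X) = \<eta> ` g ` x' ` carrier (rep R X)" by (simp add: image_image)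
  also have "\<dots> = carrier (rep R Y)" using x'(3) g(2) y(2) by (simp add: bij_betw_def)
  finally obtain h where h: "h \<in> mod_hom R P (rep R X)" "\<forall>p\<in>carrier P. \<eta> (g (x' (h p))) = \<eta> (f p)"
    using is_projD[OF P rep(1)[OF X] rep(1)[OF Y] f' g'] by blast
  have "g (x' (h p)) = f p" if p: "p \<in> carrier P" for p
  proof -
    have "g (x' (h p)) \<in> carrier Y" "f p \<in> carrier Y"
      using p hom_closed[OF h(1)] hom_closed[OF x'(1)] hom_closed[OF g(1)] hom_closed[OF f] by auto
    then show ?thesis using h(2) p y(2) by (auto simp: bij_betw_def inj_on_def)
  qed
  then show ?thesis by (intro bexI[OF _ hom_comp[OF h(1) x'(1)]] ballI)
qed

lemma is_proj_dsum1:
  assumes D: "is_proj R D" and d: "is_dsum R D P Q" and P: "left_module R P"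
  shows "is_proj R P"
proof (rule is_projI)
  show "fg_module R P" by (rule dsum_fg_left[OF is_proj_fg[OF D] d P])
  obtain i1 i2 p1 p2 where b: "bip R D P Q i1 i2 p1 p2" using d unfolding is_dsum_bip by blast
  note b = bipD[OF b]
  fix X :: "('a, 'a carr) module" and Y :: "('a, 'a carr) module" and f g
  assume a: "fg_module R X" "fg_module R Y" "f \<in> mod_hom R P Y" "g \<in> mod_hom R X Y" "g ` carrier X = carrier Y"
  obtain h where h: "h \<in> mod_hom R D X" "\<forall>x\<in>carrier D. g (h x) = f (p1 x)"
    using proj_lift[OF D a(1,2) hom_comp[OF b(3) a(3)] a(4,5)] by blast
  have "g (h (i1 p)) = f p" if "p \<in> carrier P" for p using h b that by simp
  then show "\<exists>h\<in>mod_hom R P X. \<forall>p\<in>carrier P. g (h p) = f p" by (intro bexI[OF _ hom_comp[OF b(1) h(1)]] ballI)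
qed

lemma is_proj_dsum2:
  assumes P: "is_proj R P" and Q: "is_proj R Q" and d: "is_dsum R D P Q" and D: "left_module R D"
  shows "is_proj R D"
proof (rule is_projI)
  show Df: "fg_module R D" by (rule dsum_fg[OF D d is_proj_fg[OF P] is_proj_fg[OF Q]])
  obtain i1 i2 p1 p2 where b: "bip R D P Q i1 i2 p1 p2" using d unfolding is_dsum_bip by blast
  note b = bipD[OF b]
  fix X :: "('a, 'a carr) module" and Y :: "('a, 'a carr) module" and f g
  assume a: "fg_module R X" "fg_module R Y" "f \<in> mod_hom R D Y" "g \<in> mod_hom R X Y" "g ` carrier X = carrier Y"
  note lm = fg_left_module[OF a(1)] fg_left_module[OF a(2)]
  obtain h where h: "h \<in> mod_hom R P X" "\<forall>x\<in>carrier P. g (h x) = f (i1 x)"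
    using proj_lift[OF P a(1,2) hom_comp[OF b(1) a(3)] a(4,5)] by blast
  obtain k where k: "k \<in> mod_hom R Q X" "\<forall>x\<in>carrier Q. g (k x) = f (i2 x)"
    using proj_lift[OF Q a(1,2) hom_comp[OF b(2) a(3)] a(4,5)] by blast
  have "g (h (p1 x) \<oplus>\<^bsub>X\<^esub> k (p2 x)) = f x" if x: "x \<in> carrier D" for x
  proof -
    have "g (h (p1 x) \<oplus>\<^bsub>X\<^esub> k (p2 x)) = f (i1 (p1 x)) \<oplus>\<^bsub>Y\<^esub> f (i2 (p2 x))"
      using x b h k hom_add[OF a(4)] hom_closed[OF h(1)] hom_closed[OF k(1)] by simp
    also have "\<dots> = f (i1 (p1 x) \<oplus>\<^bsub>D\<^esub> i2 (p2 x))" using x b by (intro hom_add[OF a(3), symmetric]) auto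
    finally show ?thesis using b(9)[OF x] by simp
  qed
  then show "\<exists>h\<in>mod_hom R D X. \<forall>p\<in>carrier D. g (h p) = f p"
    by (intro bexI[OF _ hom_plus[OF D lm(1) hom_comp[OF b(3) h(1)] hom_comp[OF b(4) k(1)]]] ballI)
qed

lemma zero_is_proj:
  assumes "fg_module R Z" "carrier Z = {\<zero>\<^bsub>Z\<^esub>}" shows "is_proj R Z"
proof (rule is_projI[OF assms(1)])
  fix X :: "('a, 'a carr) module" and Y :: "('a, 'a carr) module" and f g
  assume a: "fg_module R X" "fg_module R Y" "f \<in> mod_hom R Z Y" "g \<in> mod_hom R X Y"
  note lm = fg_left_module[OF a(1)] fg_left_module[OF a(2)] fg_left_module[OF assms(1)]
  have "g \<zero>\<^bsub>X\<^esub> = f p" if "p \<in> carrier Z" for p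
    using assms(2) hom_zero[OF lm(3,2) a(3)] hom_zero[OF lm(1,2) a(4)] that by simp
  then show "\<exists>h\<in>mod_hom R Z X. \<forall>p\<in>carrier Z. g (h p) = f p"
    by (intro bexI[OF _ zero_hom[OF lm(1)]] ballI)
qed

text \<open>An isomorphic copy is a direct summand with zero complement.\<close>

lemma is_proj_iso:
  assumes P: "is_proj R P" and iso: "mod_iso R P P'" and P': "left_module R P'"
  shows "is_proj R P'"
proof -
  have lm: "left_module R P" using is_proj_fg[OF P] fg_left_module by blast
  interpret P': left_module R P' by fact
  let ?Z = "sub P' {\<zero>\<^bsub>P'\<^esub>}"
  have Z: "left_module R ?Z" by (rule P'.sub_left_module[OF P'.zero_submodule])
  have "is_dsum R P P' ?Z"
    using is_dsum_iso[OF P' P' Z dsum_zero[OF P' Z] mod_iso_sym[OF lm iso] mod_iso_refl mod_iso_refl P' Z] by simp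
  then show ?thesis by (rule is_proj_dsum1[OF P _ P'])
qed

lemma free_is_proj:
  assumes "ring R" shows "is_proj R (free_mod R n)"
proof (rule is_projI)
  interpret ring R by fact
  show "fg_module R (free_mod R n)" by (rule free_fg)
  fix X :: "('a, 'a carr) module" and Y :: "('a, 'a carr) module" and f g
  assume a: "fg_module R X" "fg_module R Y" "f \<in> mod_hom R (free_mod R n) Y" "g \<in> mod_hom R X Y" "g ` carrier X = carrier Y"
  interpret X: left_module R X using a fg_left_module by blast
  interpret Y: left_module R Y using a fg_left_module by blast
  have "\<forall>i. \<exists>x. x \<in> carrier X \<and> g x = f (delta R n i)"
    using a(5) hom_closed[OF a(3) delta_closed] by (metis imageE)
  then obtain e where e: "\<And>i. e i \<in> carrier X" "\<And>i. g (e i) = f (delta R n i)" by metis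
  have "g (lin_comb X n x e) = f x" if x: "x \<in> carrier (free_mod R n)" for x
  proof -
    have "g (lin_comb X n x e) = lin_comb Y n x (\<lambda>i. g (e i))" using x e by (intro X.hom_lin_comb[OF _ a(4)] Y.left_module_axioms) (auto simp: PiE_iff)
    then show ?thesis using e free_hom_eq_lin_comb[OF Y.left_module_axioms a(3) x] by simp
  qed
  then show "\<exists>h\<in>mod_hom R (free_mod R n) X. \<forall>p\<in>carrier (free_mod R n). g (h p) = f p"
    using e by (intro bexI[of _ "\<lambda>x. lin_comb X n x e"] X.lin_comb_hom ballI)
qed

lemma free_epi:
  assumes X: "fg_module R X"
  shows "\<exists>n f. f \<in> mod_hom R (free_mod R n) X \<and> f ` carrier (free_mod R n) = carrier X"
proof -
  interpret X: left_module R X using X fg_left_module by blast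
  have X': "left_module R X" by unfold_locales
  obtain S where S: "finite S" "S \<subseteq> carrier X" "\<And>U. submodule U R X \<Longrightarrow> S \<subseteq> U \<Longrightarrow> U = carrier X"
    using X unfolding fg_module_def finitely_generated_def by blast
  obtain e where e: "bij_betw e {0..<card S} S" using S(1) ex_bij_betw_nat_finite by blast
  let ?n = "card S" and ?F = "free_mod R (card S)"
  have eS: "e i \<in> carrier X" if "i < ?n" for i using e S(2) that by (auto simp: bij_betw_def)
  have h: "(\<lambda>x. lin_comb X ?n x e) \<in> mod_hom R ?F X" using eS by (intro X.lin_comb_hom)
  interpret F: left_module R ?F by (rule X.R.free_left_module)
  have "submodule ((\<lambda>x. lin_comb X ?n x e) ` carrier ?F) R X"
    by (rule image_submodule[OF X.R.free_left_module X' h F.carrier_submodule])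
  moreover have "S \<subseteq> (\<lambda>x. lin_comb X ?n x e) ` carrier ?F"
  proof
    fix s assume "s \<in> S"
    then have "s \<in> e ` {0..<?n}" using e by (simp add: bij_betw_def)
    then obtain j where j: "j < ?n" "s = e j" by auto
    then have "s = lin_comb X ?n (delta R ?n j) e" using X.lin_comb_delta[OF eS j(1)] by simp
    then show "s \<in> (\<lambda>x. lin_comb X ?n x e) ` carrier ?F" using X.R.delta_closed by blast
  qed
  ultimately show ?thesis using S(3) h by blast
qed

lemma dsum_of_epi:
  assumes P: "is_proj R P" and E: "fg_module R E" and h: "h \<in> mod_hom R E P" "h ` carrier E = carrier P"
  shows "is_dsum R E P (sub E (ker E P h))"
proof -
  have Pf: "fg_module R P" using P by (rule is_proj_fg)
  obtain s where s: "s \<in> mod_hom R P E" "\<forall>p\<in>carrier P. h (s p) = p"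
    using proj_lift[OF P E Pf hom_id h] by blast
  show ?thesis by (rule bip_dsum[OF split_bip[OF fg_left_module[OF E] fg_left_module[OF Pf] h(1) s(1)]]) (use s in auto)
qed

context fl_ring
begin

text \<open>The powers of \<open>f\<close> are surjective too, so the kernel in Fitting's
  decomposition must vanish.\<close>

lemma surj_endo_inj:
  assumes M: "fg_module R M" and f: "f \<in> mod_hom R M M" "f ` carrier M = carrier M"
  shows "inj_on f (carrier M)"
proof -
  have lm: "left_module R M" using M fg_left_module by blast
  interpret M: left_module R M by fact
  obtain n where n: "n > 0" "internal_direct_sum R M (ker M M (f ^^ n)) ((f ^^ n) ` carrier M)"
    using M.fitting[OF fg_fl[OF M] f(1)] by blast
  have "(f ^^ k) ` carrier M = carrier M" for k
  proof (induction k)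
    case (Suc k)
    have "(f ^^ Suc k) ` carrier M = f ` (f ^^ k) ` carrier M" by (simp add: image_image)
    then show ?case using Suc f(2) by simp
  qed simp
  then have kk: "ker M M (f ^^ n) \<inter> carrier M = {\<zero>\<^bsub>M\<^esub>}" using n unfolding internal_direct_sum_def by simp
  have k: "x = \<zero>\<^bsub>M\<^esub>" if "x \<in> carrier M" "(f ^^ n) x = \<zero>\<^bsub>M\<^esub>" for x
  proof -
    have "x \<in> ker M M (f ^^ n) \<inter> carrier M" using that by (simp add: ker_iff)
    then show ?thesis unfolding kk by (rule singletonD)
  qed
  show ?thesis unfolding hom_inj_iff[OF lm lm f(1)]
  proof (intro ballI impI)
    fix x assume x: "x \<in> carrier M" "f x = \<zero>\<^bsub>M\<^esub>"
    obtain m where m: "n = Suc m" using n(1) by (cases n) auto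
    have "(f ^^ n) x = (f ^^ m) (f x)" unfolding m funpow_Suc_right by simp
    then have "(f ^^ n) x = \<zero>\<^bsub>M\<^esub>" using x(2) hom_zero[OF lm lm funpow_hom[OF f(1)]] by simp
    then show "x = \<zero>\<^bsub>M\<^esub>" by (rule k[OF x(1)])
  qed
qed

text \<open>A minimal submodule of a projective module that still maps onto \<open>X\<close> is a direct summand, hence a
  projective cover of \<open>X\<close>.\<close>

lemma cover_in:
  assumes P: "is_proj R P" and X: "fg_module R X" and f: "f \<in> mod_hom R P X" "f ` carrier P = carrier X"
  shows "\<exists>U e. submodule U R P \<and> f ` U = carrier X \<and> superfluous R (sub P U) (ker (sub P U) X f) \<and>
     e \<in> mod_hom R P (sub P U) \<and> (\<forall>u\<in>U. e u = u)"
proof -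
  have Pf: "fg_module R P" and Pl: "left_module R P" and Xl: "left_module R X"
    using is_proj_fg[OF P] X fg_left_module by blast+
  interpret P: left_module R P by fact
  interpret X: left_module R X by fact
  let ?S = "{U. submodule U R P \<and> f ` U = carrier X}"
  have "?S \<noteq> {}" using P.carrier_submodule f(2) by blast
  then have "\<exists>U\<in>?S. \<forall>V\<in>?S. V \<subseteq> U \<longrightarrow> V = U" by (rule P.finite_len_min[OF fg_fl[OF Pf]]) simp
  then obtain U where U0: "U \<in> ?S" "\<forall>V\<in>?S. V \<subseteq> U \<longrightarrow> V = U" by (elim bexE) (rule that)
  have U: "submodule U R P" "f ` U = carrier X" using U0(1) by auto
  have min: "V = U" if "submodule V R P" "f ` V = carrier X" "V \<subseteq> U" for V using U0(2) that by simp
  have Uc: "U \<subseteq> carrier P" using U by (simp add: P.submodule_iff)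
  have Ul: "left_module R (sub P U)" by (rule P.sub_left_module[OF U(1)])
  interpret U: left_module R "sub P U" by (rule Ul)
  have Ufg: "fg_module R (sub P U)" by (rule fg_sub[OF Pf U(1)])
  have fU: "f \<in> mod_hom R (sub P U) X" by (rule hom_restrict[OF f(1) Uc])
  obtain h where h: "h \<in> mod_hom R P (sub P U)" "\<forall>p\<in>carrier P. f (h p) = f p"
    using proj_lift[OF P Ufg X f(1) fU] U(2) by auto
  have hP: "h \<in> mod_hom R P P" by (rule hom_from_sub[OF h(1) Uc])
  have hUU: "h \<in> mod_hom R (sub P U) (sub P U)" by (rule hom_restrict[OF h(1) Uc])
  \<comment> \<open>The image of \<open>U\<close> under \<open>h\<close> still maps onto
    \<open>X\<close>, so it is all of \<open>U\<close> by minimality. Hence \<open>h\<close> is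
    bijective on \<open>U\<close>, and \<open>h\<close> followed by the inverse of this bijection
    retracts \<open>P\<close> onto \<open>U\<close>.\<close>
  have "h ` U = U"
  proof (rule min)
    show "submodule (h ` U) R P" by (rule image_submodule[OF Pl Pl hP U(1)])
    show "h ` U \<subseteq> U" using hom_closed[OF h(1)] Uc by auto
    have "f ` h ` U = f ` U" unfolding image_image using h(2) Uc by (intro image_cong) auto
    then show "f ` h ` U = carrier X" using U(2) by simp
  qed
  then have bij: "bij_betw h (carrier (sub P U)) (carrier (sub P U))"
    using surj_endo_inj[OF Ufg hUU] by (simp add: bij_betw_def)
  define k where "k = inv_into (carrier (sub P U)) h"
  have k: "k \<in> mod_hom R (sub P U) (sub P U)" "\<And>u. u \<in> U \<Longrightarrow> k (h u) = u"
    using inv_hom[OF Ul hUU bij] bij by (auto simp: k_def bij_betw_def)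
  have "superfluous R (sub P U) (ker (sub P U) X f)"
    unfolding superfluous_def
  proof (intro conjI allI impI)
    show "submodule (ker (sub P U) X f) R (sub P U)" by (rule ker_submodule[OF Ul Xl fU])
    fix V assume V0: "submodule V R (sub P U) \<and> V <+>\<^bsub>sub P U\<^esub> ker (sub P U) X f = carrier (sub P U)"
    note V = V0[THEN conjunct1] V0[THEN conjunct2]
    have V': "submodule V R P" "V \<subseteq> U" using V(1) P.submodule_sub_iff[OF U(1)] by auto
    have "x \<in> f ` V" if x: "x \<in> carrier X" for x
    proof -
      obtain u where u: "u \<in> U" "x = f u" using x U(2) by auto
      then have "u \<in> V <+>\<^bsub>sub P U\<^esub> ker (sub P U) X f" unfolding V(2) by simp
      then obtain v w where vw: "v \<in> V" "w \<in> ker (sub P U) X f" "u = v \<oplus>\<^bsub>P\<^esub> w"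
        unfolding set_add_def' by auto
      have "v \<in> carrier P" "w \<in> carrier P" "f w = \<zero>\<^bsub>X\<^esub>" using vw V' Uc by (auto simp: ker_iff)
      then have "x = f v" using u vw hom_add[OF f(1)] hom_closed[OF f(1)] by simp
      then show ?thesis using vw by auto
    qed
    moreover have "f ` V \<subseteq> carrier X" using V' Uc hom_closed[OF f(1)] by auto
    ultimately have "V = U" using V' by (intro min) auto
    then show "V = carrier (sub P U)" by simp
  qed
  moreover have "(\<lambda>x. k (h x)) \<in> mod_hom R P (sub P U)" by (rule hom_comp[OF h(1) k(1)])
  ultimately show ?thesis using U k(2) by (intro exI[of _ U] exI[of _ "\<lambda>x. k (h x)"]) simp
qed

lemma retract_proj:
  assumes P: "is_proj R P" and U: "submodule U R P" and e: "e \<in> mod_hom R P (sub P U)" "\<forall>u\<in>U. e u = u"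
  shows "is_proj R (sub P U)"
proof -
  have Pl: "left_module R P" using is_proj_fg[OF P] fg_left_module by blast
  have Ul: "left_module R (sub P U)" by (rule left_module.sub_left_module[OF Pl U])
  have "is_dsum R P (sub P U) (sub P (ker P (sub P U) e))"
    by (rule bip_dsum[OF split_bip[OF Pl Ul e(1) incl_hom[OF U Pl]]]) (use e(2) in auto)
  then show ?thesis by (rule is_proj_dsum1[OF P _ Ul])
qed

lemma cover_exists:
  fixes X :: "('a, 'a carr) module"
  assumes X: "fg_module R X" shows "\<exists>P f. projective_cover R P f X"
proof -
  obtain n f where f: "f \<in> mod_hom R (free_mod R n) X" "f ` carrier (free_mod R n) = carrier X"
    using free_epi[OF X] by blast
  let ?F = "rep R (free_mod R n)"
  obtain g where g: "g \<in> mod_hom R ?F (free_mod R n)" "bij_betw g (carrier ?F) (carrier (free_mod R n))"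
    using mod_iso_sym[OF free_left_module rep(2)[OF free_fg]] unfolding mod_iso_def by blast
  have P: "is_proj R ?F" by (rule is_proj_iso[OF free_is_proj[OF ring_axioms] rep(2)[OF free_fg] fg_left_module[OF rep(1)[OF free_fg]]])
  have h: "(\<lambda>x. f (g x)) \<in> mod_hom R ?F X" by (rule hom_comp[OF g(1) f(1)])
  have "(\<lambda>x. f (g x)) ` carrier ?F = f ` g ` carrier ?F" by (simp only: image_image)
  then have "(\<lambda>x. f (g x)) ` carrier ?F = carrier X" using g(2) f(2) by (simp only: bij_betw_def)
  from cover_in[OF P X h this] obtain U e where U: "submodule U R ?F" "(\<lambda>x. f (g x)) ` U = carrier X"
      "superfluous R (sub ?F U) (ker (sub ?F U) X (\<lambda>x. f (g x)))" "e \<in> mod_hom R ?F (sub ?F U)" "\<forall>u\<in>U. e u = u" by blast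
  have "U \<subseteq> carrier ?F" using U(1) left_module.submodule_iff[OF fg_left_module[OF is_proj_fg[OF P]]] by auto
  then have "projective_cover R (sub ?F U) (\<lambda>x. f (g x)) X"
    unfolding projective_cover_def fg_projective_iff
    using retract_proj[OF P U(1,4,5)] hom_restrict[OF h] U(2,3) by auto
  then show ?thesis by blast
qed

lemma syzygyE:
  fixes X :: "('a, 'a carr) module"
  assumes "fg_module R X"
  shows "\<exists>P f. projective_cover R P f X \<and> syzygy R X = sub P (ker P X f)"
proof -
  have "\<exists>c. (case c of (P, f) \<Rightarrow> projective_cover R P f X)" using cover_exists[OF assms] by auto
  then have *: "case (SOME (P, f). projective_cover R P f X) of (P, f) \<Rightarrow> projective_cover R P f X" by (rule someI_ex)
  obtain P f where Pf: "(SOME (P, f). projective_cover R P f X) = (P, f)" by fastforce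
  then show ?thesis using * unfolding syzygy_def by (intro exI[of _ P] exI[of _ f]) simp
qed

end

section \<open>Stable decompositions and syzygies\<close>

lemma iso_ker_comp:
  assumes "left_module R X" "left_module R Y" "f \<in> mod_hom R P X" "g \<in> mod_hom R X Y" "inj_on g (carrier X)"
  shows "ker P Y (\<lambda>x. g (f x)) = ker P X f"
proof -
  have "g (f x) = \<zero>\<^bsub>Y\<^esub> \<longleftrightarrow> f x = \<zero>\<^bsub>X\<^esub>" if "x \<in> carrier P" for x
    using hom_closed[OF assms(3) that] assms(5) hom_inj_iff[OF assms(1,2,4)] hom_zero[OF assms(1,2,4)] by auto
  then show ?thesis unfolding a_kernel_def' by blast
qed

context fl_ring
begin

lemma dec_of_epi:
  assumes "is_proj R P" "fg_module R E" "h \<in> mod_hom R E P" "h ` carrier E = carrier P"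
  shows "dec E = dec P + dec (sub E (ker E P h))"
proof (rule dec_dsum[OF dsum_of_epi[OF assms] assms(2) is_proj_fg[OF assms(1)]])
  show "fg_module R (sub E (ker E P h))"
    by (intro fg_sub ker_submodule assms fg_left_module[OF assms(2)] fg_left_module[OF is_proj_fg[OF assms(1)]])
qed

section \<open>Pullbacks and Schanuel's lemma\<close>

definition pullback :: "('a, 'p) module \<Rightarrow> ('a, 'q) module \<Rightarrow> ('p \<Rightarrow> 'x) \<Rightarrow> ('q \<Rightarrow> 'x) \<Rightarrow> ('a, 'p \<times> 'q) module" where
  "pullback P Q f g = sub (prod_module P Q) {z \<in> carrier P \<times> carrier Q. f (fst z) = g (snd z)}"

lemma pullback_fg:
  assumes P: "fg_module R P" and Q: "fg_module R Q" and X: "left_module R X" and f: "f \<in> mod_hom R P X" and g: "g \<in> mod_hom R Q X"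
  shows "fg_module R (pullback P Q f g)"
proof -
  note lm = fg_left_module[OF P] fg_left_module[OF Q]
  interpret PQ: left_module R "prod_module P Q" by (rule prod_module(1)[OF lm])
  show ?thesis unfolding pullback_def
  proof (rule fg_sub[OF dsum_fg[OF prod_module[OF lm] P Q]])
    show "submodule {z \<in> carrier P \<times> carrier Q. f (fst z) = g (snd z)} R (prod_module P Q)"
      unfolding PQ.submodule_iff using mod_homD[OF f] mod_homD[OF g] hom_zero[OF lm(1) X f] hom_zero[OF lm(2) X g]
        left_module.smult_closed[OF lm(1)] left_module.smult_closed[OF lm(2)] left_moduleD(2)[OF lm(1)] left_moduleD(2)[OF lm(2)]
      by (auto simp: prod_module_def abelian_monoid.zero_closed[OF abelian_group.axioms(1)] abelian_monoid.a_closed[OF abelian_group.axioms(1)])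
  qed
qed

text \<open>The first projection maps the pullback onto the projective module \<open>P\<close> and
  therefore splits; its kernel is a copy of the kernel of \<open>g\<close>.\<close>

lemma pullback_dec:
  assumes P: "is_proj R P" and Q: "fg_module R Q" and X: "left_module R X" and f: "f \<in> mod_hom R P X"
    and g: "g \<in> mod_hom R Q X" "g ` carrier Q = carrier X"
  shows "dec (pullback P Q f g) = dec P + dec (sub Q (ker Q X g))"
proof -
  have Pf: "fg_module R P" using P is_proj_fg by blast
  note lm = fg_left_module[OF Pf] fg_left_module[OF Q]
  interpret P: left_module R P by (rule lm)
  let ?E = "pullback P Q f g"
  have E: "fg_module R ?E" by (rule pullback_fg[OF Pf Q X f g(1)])
  have h: "fst \<in> mod_hom R ?E P" by (rule mod_homI) (auto simp: pullback_def prod_module_def)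
  have "x \<in> fst ` carrier ?E" if "x \<in> carrier P" for x
  proof -
    have "f x \<in> g ` carrier Q" using hom_closed[OF f that] g(2) by simp
    then obtain y where "y \<in> carrier Q" "f x = g y" by auto
    then have "(x, y) \<in> carrier ?E" using that by (simp add: pullback_def)
    then show ?thesis by force
  qed
  then have hs: "fst ` carrier ?E = carrier P" by (auto simp: pullback_def)
  let ?K = "sub ?E (ker ?E P fst)" and ?L = "sub Q (ker Q X g)"
  have c: "ker ?E P fst = {\<zero>\<^bsub>P\<^esub>} \<times> ker Q X g"
    using hom_zero[OF lm(1) X f] by (auto simp: pullback_def ker_iff)
  have Kf: "fg_module R ?K" by (rule fg_sub[OF E ker_submodule[OF fg_left_module[OF E] lm(1) h]])
  have Lf: "fg_module R ?L" by (rule fg_sub[OF Q ker_submodule[OF lm(2) X g(1)]])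
  have h2: "snd \<in> mod_hom R ?E Q" by (rule mod_homI) (auto simp: pullback_def prod_module_def)
  have "snd \<in> mod_hom R ?K ?L"
  proof (intro hom_into_sub hom_restrict[OF h2])
    show "ker ?E P fst \<subseteq> carrier ?E" by (auto simp: ker_iff)
    show "snd ` carrier ?K \<subseteq> ker Q X g" using c by force
  qed
  moreover have "bij_betw snd (ker ?E P fst) (ker Q X g)" unfolding c by (auto simp: bij_betw_def inj_on_def)
  then have "bij_betw snd (carrier ?K) (carrier ?L)" by simp
  ultimately have "mod_iso R ?K ?L" unfolding mod_iso_def by (intro bexI)
  then have "dec ?K = dec ?L" using dec_iso_iff[OF Kf Lf] by simp
  then show ?thesis using dec_of_epi[OF P E h hs] by simp
qed

lemma pullback_swap:
  assumes P: "fg_module R P" and Q: "fg_module R Q" and X: "left_module R X" and f: "f \<in> mod_hom R P X" and g: "g \<in> mod_hom R Q X"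
  shows "dec (pullback P Q f g) = dec (pullback Q P g f)"
proof (subst dec_iso_iff)
  let ?E = "pullback P Q f g" and ?F = "pullback Q P g f"
  have "prod.swap \<in> mod_hom R ?E ?F" by (rule mod_homI) (auto simp: pullback_def prod_module_def)
  moreover have "bij_betw prod.swap (carrier ?E) (carrier ?F)"
    by (rule bij_betwI[of _ _ _ prod.swap]) (auto simp: pullback_def)
  ultimately show "mod_iso R ?E ?F" unfolding mod_iso_def by (intro bexI)
qed (use pullback_fg assms in blast)+

text \<open>Both sides decompose the pullback of \<open>f\<close> and \<open>g\<close>, once along
  each projection.\<close>

lemma schanuel:
  assumes P: "is_proj R P" and Q: "is_proj R Q" and X: "left_module R X"
    and f: "f \<in> mod_hom R P X" "f ` carrier P = carrier X" and g: "g \<in> mod_hom R Q X" "g ` carrier Q = carrier X"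
  shows "dec (sub P (ker P X f)) + dec Q = dec (sub Q (ker Q X g)) + dec P"
  using pullback_dec[OF P is_proj_fg[OF Q] X f(1) g] pullback_dec[OF Q is_proj_fg[OF P] X g(1) f]
    pullback_swap[OF is_proj_fg[OF P] is_proj_fg[OF Q] X f(1) g(1)] by (simp add: add.commute)

text \<open>\<open>stable_dec X\<close> is the class of \<open>X\<close> up to projective summands and \<open>syz\<close> the operator induced by \<open>\<Omega>\<close> on such
  classes; finite projective dimension means that a power of \<open>syz\<close> kills the class.\<close>

definition stable_dec :: "('a, 'm) module \<Rightarrow> ('a, 'a carr) module multiset" where
  "stable_dec X = filter_mset (\<lambda>U. \<not> is_proj R U) (dec X)"

definition syz_class :: "('a, 'm) module \<Rightarrow> ('a, 'a carr) module multiset" where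
  "syz_class X = stable_dec (syzygy R (rep R X))"

definition syz :: "('a, 'a carr) module multiset \<Rightarrow> ('a, 'a carr) module multiset" where
  "syz m = (\<Sum>U\<in>#m. syz_class U)"

lemma syz_simps [simp]: "syz {#} = {#}" "syz (m + m') = syz m + syz m'" "syz (add_mset U m) = syz_class U + syz m"
  by (simp_all add: syz_def)

lemma stable_dec_dsum:
  assumes "is_dsum R D X Y" "fg_module R D" "fg_module R X" "fg_module R Y" shows "stable_dec D = stable_dec X + stable_dec Y"
  using dec_dsum[OF assms] by (simp add: stable_dec_def)

lemma Dec_proj: "Dec X m \<Longrightarrow> is_proj R X \<longleftrightarrow> (\<forall>u\<in>#m. is_proj R u)"
proof (induction rule: Dec.induct)
  case (zero X) then show ?case using zero_is_proj[OF zero_fg[OF zero]] by simp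
next
  case (add X U Y m)
  note lm = fg_left_module[OF add(2)] fg_left_module[OF add(3)] fg_left_module[OF Dec_fg[OF add(5)]]
  have "is_proj R U \<longleftrightarrow> is_proj R (rep R U)"
    using is_proj_iso rep[OF add(3)] fg_left_module mod_iso_sym lm by metis
  moreover have "is_proj R X \<longleftrightarrow> is_proj R U \<and> is_proj R Y"
    using is_proj_dsum1[OF _ add(1) lm(2)] is_proj_dsum1[OF _ is_dsum_comm[OF lm(1) add(1)] lm(3)]
      is_proj_dsum2[OF _ _ add(1) lm(1)] by blast
  ultimately show ?case using add.IH by auto
qed

lemma is_proj_cong: "left_module R X \<Longrightarrow> left_module R Y \<Longrightarrow> mod_iso R X Y \<Longrightarrow> is_proj R X \<longleftrightarrow> is_proj R Y"
  using is_proj_iso mod_iso_sym by metis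

lemma is_proj_iff: "fg_module R X \<Longrightarrow> is_proj R X \<longleftrightarrow> (\<forall>u\<in>#dec X. is_proj R u)"
  using Dec_proj[OF Dec_dec] is_proj_cong[OF _ _ rep(2)] fg_left_module rep(1) by metis

lemma is_proj_stable_dec: "fg_module R X \<Longrightarrow> is_proj R X \<longleftrightarrow> stable_dec X = {#}"
  by (simp add: is_proj_iff stable_dec_def flip: set_mset_eq_empty_iff) blast

lemma stable_dec_proj [simp]: "is_proj R P \<Longrightarrow> stable_dec P = {#}" using is_proj_stable_dec is_proj_fg by blast

lemma ker_fg:
  assumes "fg_module R P" "left_module R X" "f \<in> mod_hom R P X" shows "fg_module R (sub P (ker P X f))"
  by (intro fg_sub ker_submodule assms fg_left_module[OF assms(1)])

text \<open>By Schanuel's lemma the kernels of two projective presentations differ only by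
  projective summands, which \<open>stable_dec\<close> discards. So free presentations may replace
  the chosen minimal covers in all computations with \<open>syz\<close>.\<close>

lemma cover_stable_dec:
  fixes X :: "('a, 'a carr) module"
  assumes X: "fg_module R X" and P: "is_proj R P" and f: "f \<in> mod_hom R P X" "f ` carrier P = carrier X"
  shows "stable_dec (sub P (ker P X f)) = stable_dec (syzygy R X)"
proof -
  obtain Q g where Q: "projective_cover R Q g X" "syzygy R X = sub Q (ker Q X g)" using syzygyE[OF X] by blast
  then have Q': "is_proj R Q" "g \<in> mod_hom R Q X" "g ` carrier Q = carrier X"
    by (auto simp: projective_cover_def fg_projective_iff)
  have "dec (sub P (ker P X f)) + dec Q = dec (sub Q (ker Q X g)) + dec P"
    by (rule schanuel[OF P Q'(1) fg_left_module[OF X] f Q'(2,3)])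
  then have "stable_dec (sub P (ker P X f)) + stable_dec Q = stable_dec (sub Q (ker Q X g)) + stable_dec P"
    unfolding stable_dec_def filter_union_mset[symmetric] by simp
  then show ?thesis using P Q' Q by simp
qed

lemma ker_syz_class:
  assumes X: "fg_module R X" and P: "is_proj R P" and f: "f \<in> mod_hom R P X" "f ` carrier P = carrier X"
  shows "stable_dec (sub P (ker P X f)) = syz_class X"
proof -
  obtain g where g: "g \<in> mod_hom R X (rep R X)" "bij_betw g (carrier X) (carrier (rep R X))"
    using rep(2)[OF X] by (auto simp: mod_iso_def)
  note lm = fg_left_module[OF X] fg_left_module[OF rep(1)[OF X]]
  have "(\<lambda>x. g (f x)) ` carrier P = g ` f ` carrier P" by (simp add: image_image)
  then have s: "(\<lambda>x. g (f x)) ` carrier P = carrier (rep R X)" using f(2) g(2) by (simp add: bij_betw_def)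
  have "ker P (rep R X) (\<lambda>x. g (f x)) = ker P X f"
    using iso_ker_comp[OF lm f(1) g(1)] g(2) by (simp add: bij_betw_def)
  then show ?thesis using cover_stable_dec[OF rep(1)[OF X] P hom_comp[OF f(1) g(1)] s] by (simp add: syz_class_def)
qed

lemma syzygy_syz_class:
  fixes X :: "('a, 'a carr) module"
  assumes X: "fg_module R X" shows "stable_dec (syzygy R X) = syz_class X" "fg_module R (syzygy R X)"
proof -
  obtain Q g where Q: "projective_cover R Q g X" "syzygy R X = sub Q (ker Q X g)" using syzygyE[OF X] by blast
  then have Q': "is_proj R Q" "g \<in> mod_hom R Q X" "g ` carrier Q = carrier X"
    by (auto simp: projective_cover_def fg_projective_iff)
  show "stable_dec (syzygy R X) = syz_class X" unfolding Q(2) by (rule ker_syz_class[OF X Q'])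
  show "fg_module R (syzygy R X)" unfolding Q(2) by (rule ker_fg[OF is_proj_fg[OF Q'(1)] fg_left_module[OF X] Q'(2)])
qed

lemma proj_epi:
  assumes X: "fg_module R X"
  shows "\<exists>n f. is_proj R (free_mod R n) \<and> f \<in> mod_hom R (free_mod R n) X \<and> f ` carrier (free_mod R n) = carrier X"
  using free_epi[OF X] free_is_proj[OF ring_axioms] by blast

lemma syz_class_proj: "is_proj R P \<Longrightarrow> syz_class P = {#}"
proof -
  assume P: "is_proj R P"
  have lm: "left_module R P" using is_proj_fg[OF P] fg_left_module by blast
  interpret left_module R P by fact
  have "stable_dec (sub P (ker P P (\<lambda>x. x))) = syz_class P" by (rule ker_syz_class[OF is_proj_fg[OF P] P hom_id]) simp
  moreover have "ker P P (\<lambda>x. x) = {\<zero>\<^bsub>P\<^esub>}" by (auto simp: ker_iff)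
  moreover have "dec (sub P {\<zero>\<^bsub>P\<^esub>}) = {#}"
    using dec_zero_iff[OF fg_sub[OF is_proj_fg[OF P] zero_submodule]] by simp
  ultimately show ?thesis by (simp add: stable_dec_def)
qed

text \<open>Two projective presentations add up to one of the direct sum, and its kernel is the
  direct sum of their kernels.\<close>

lemma syz_class_dsum:
  assumes d: "is_dsum R D X Y" and D: "fg_module R D" and X: "fg_module R X" and Y: "fg_module R Y"
  shows "syz_class D = syz_class X + syz_class Y"
proof -
  note lm = fg_left_module[OF D] fg_left_module[OF X] fg_left_module[OF Y]
  obtain n f where f: "is_proj R (free_mod R n)" "f \<in> mod_hom R (free_mod R n) X" "f ` carrier (free_mod R n) = carrier X"
    using proj_epi[OF X] by blast
  obtain m g where g: "is_proj R (free_mod R m)" "g \<in> mod_hom R (free_mod R m) Y" "g ` carrier (free_mod R m) = carrier Y"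
    using proj_epi[OF Y] by blast
  let ?P = "free_mod R n" and ?Q = "free_mod R m"
  obtain W :: "('a, 'a carr) module" where W0: "fg_module R W" "is_dsum R W ?P ?Q"
    using dsum_exists[OF is_proj_fg[OF f(1)] is_proj_fg[OF g(1)]] by blast
  note pm = fg_left_module[OF W0(1)] W0(2)
  obtain i1 i2 p1 p2 where b: "bip R W ?P ?Q i1 i2 p1 p2" using pm(2) unfolding is_dsum_bip by blast
  obtain j1 j2 q1 q2 where b': "bip R D X Y j1 j2 q1 q2" using d unfolding is_dsum_bip by blast
  note b = bipD[OF b] and b' = bipD[OF b']
  interpret D: left_module R D by (rule lm)
  interpret W: left_module R W by (rule pm(1))
  have W: "is_proj R W" by (rule is_proj_dsum2[OF f(1) g(1) pm(2,1)])
  define h where "h z = j1 (f (p1 z)) \<oplus>\<^bsub>D\<^esub> j2 (g (p2 z))" for z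
  have h: "h \<in> mod_hom R W D" unfolding h_def
    by (rule hom_plus[OF pm(1) lm(1) hom_comp[OF hom_comp[OF b(3) f(2)] b'(1)] hom_comp[OF hom_comp[OF b(4) g(2)] b'(2)]])
  note c = hom_closed[OF f(2)] hom_closed[OF g(2)] b(10-13) b'(10-13)
  have q: "q1 (h z) = f (p1 z)" "q2 (h z) = g (p2 z)" if "z \<in> carrier W" for z
  proof -
    interpret X: left_module R X by (rule lm)
    interpret Y: left_module R Y by (rule lm)
    have cc: "f (p1 z) \<in> carrier X" "g (p2 z) \<in> carrier Y" by (rule hom_closed[OF f(2) b(12)[OF that]], rule hom_closed[OF g(2) b(13)[OF that]])
    show "q1 (h z) = f (p1 z)" "q2 (h z) = g (p2 z)"
      using cc b' hom_add[OF b'(3)] hom_add[OF b'(4)] by (simp_all add: h_def)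
  qed
  have hs: "h ` carrier W = carrier D"
  proof
    show "h ` carrier W \<subseteq> carrier D" using hom_closed[OF h] by blast
    show "carrier D \<subseteq> h ` carrier W"
    proof
      fix e assume e: "e \<in> carrier D"
      have "q1 e \<in> f ` carrier ?P" "q2 e \<in> g ` carrier ?Q" unfolding f(3) g(3) by (rule b'(12)[OF e], rule b'(13)[OF e])
      then obtain x y where xy: "x \<in> carrier ?P" "q1 e = f x" "y \<in> carrier ?Q" "q2 e = g y" by (elim imageE) (rule that)
      let ?z = "i1 x \<oplus>\<^bsub>W\<^esub> i2 y"
      interpret P: left_module R ?P by (rule free_left_module)
      interpret Q: left_module R ?Q by (rule free_left_module)
      have ic: "i1 x \<in> carrier W" "i2 y \<in> carrier W" by (rule b(10)[OF xy(1)], rule b(11)[OF xy(3)])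
      have z: "?z \<in> carrier W" using ic by (rule W.M.a_closed)
      have "p1 ?z = x" "p2 ?z = y"
        unfolding hom_add[OF b(3) ic] hom_add[OF b(4) ic] using b(5-8) xy P.M.r_zero Q.M.l_zero by (simp_all del: module_power_simps)
      then have "h ?z = e" unfolding h_def using b'(9)[OF e] xy by simp
      then show "e \<in> h ` carrier W" using z by blast
    qed
  qed
  let ?K = "ker W D h" and ?L = "sub ?P (ker ?P X f)" and ?N = "sub ?Q (ker ?Q Y g)"
  have hz: "h z = \<zero>\<^bsub>D\<^esub> \<longleftrightarrow> f (p1 z) = \<zero>\<^bsub>X\<^esub> \<and> g (p2 z) = \<zero>\<^bsub>Y\<^esub>" if "z \<in> carrier W" for z
    using q[OF that] hom_zero[OF lm(1,2) b'(3)] hom_zero[OF lm(1,3) b'(4)] hom_zero[OF lm(2,1) b'(1)] hom_zero[OF lm(3,1) b'(2)]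
    by (auto simp: h_def)
  have K: "submodule ?K R W" by (rule ker_submodule[OF pm(1) lm(1) h])
  have "bip R (sub W ?K) ?L ?N i1 i2 p1 p2"
  proof (rule bipI)
    show "i1 \<in> mod_hom R ?L (sub W ?K)"
      using b c hz hom_zero[OF free_left_module lm(3) g(2)] by (intro hom_into_sub hom_restrict b(1)) (auto simp: ker_iff simp del: module_power_simps)
    show "i2 \<in> mod_hom R ?N (sub W ?K)"
      using b c hz hom_zero[OF free_left_module lm(2) f(2)] by (intro hom_into_sub hom_restrict b(2)) (auto simp: ker_iff simp del: module_power_simps)
    show "p1 \<in> mod_hom R (sub W ?K) ?L"
      using b c hz by (intro hom_into_sub hom_restrict b(3)) (auto simp: ker_iff simp del: module_power_simps)
    show "p2 \<in> mod_hom R (sub W ?K) ?N"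
      using b c hz by (intro hom_into_sub hom_restrict b(4)) (auto simp: ker_iff simp del: module_power_simps)
  qed (use b in \<open>auto simp: ker_iff simp del: module_power_simps\<close>)
  then have "is_dsum R (sub W ?K) ?L ?N" by (rule bip_dsum)
  then have "stable_dec (sub W ?K) = stable_dec ?L + stable_dec ?N"
    using ker_fg[OF is_proj_fg[OF f(1)] lm(2) f(2)] ker_fg[OF is_proj_fg[OF g(1)] lm(3) g(2)] ker_fg[OF is_proj_fg[OF W] lm(1) h]
    by (intro stable_dec_dsum)
  then show ?thesis using ker_syz_class[OF X f] ker_syz_class[OF Y g] ker_syz_class[OF D W h hs] by simp
qed

lemma syz_class_rep: "fg_module R X \<Longrightarrow> syz_class (rep R X) = syz_class X"
  using rep_cong[of R X "rep R X"] rep fg_left_module unfolding syz_class_def by metis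

lemma Dec_syz_class: "Dec X m \<Longrightarrow> syz_class X = syz (filter_mset (\<lambda>U. \<not> is_proj R U) m)"
proof (induction rule: Dec.induct)
  case (zero X)
  then have "is_proj R X" using zero_is_proj[OF zero_fg[OF zero]] by simp
  then show ?case by (simp add: syz_class_proj)
next
  case (add X U Y m)
  have "syz_class X = syz_class U + syz_class Y" by (rule syz_class_dsum[OF add(1,2,3) Dec_fg[OF add(5)]])
  then show ?case using add.IH syz_class_rep[OF add(3)] syz_class_proj[of "rep R U"] by simp
qed

lemma syz_class_syz: "fg_module R X \<Longrightarrow> syz_class X = syz (stable_dec X)"
  using Dec_syz_class[OF Dec_dec] syz_class_rep unfolding stable_dec_def by metis

lemma stable_dec_ker:
  assumes "fg_module R X" "is_proj R P" "f \<in> mod_hom R P X" "f ` carrier P = carrier X"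
  shows "stable_dec (sub P (ker P X f)) = syz (stable_dec X)"
  using ker_syz_class[OF assms] syz_class_syz[OF assms(1)] by simp

lemma syzygy_syz:
  fixes X :: "('a, 'a carr) module"
  assumes "fg_module R X" shows "stable_dec (syzygy R X) = syz (stable_dec X)"
  using syzygy_syz_class[OF assms] syz_class_syz[OF assms] by simp

lemma syzygy_pow:
  fixes X :: "('a, 'a carr) module"
  assumes "fg_module R X" shows "fg_module R ((syzygy R ^^ n) X)" "stable_dec ((syzygy R ^^ n) X) = (syz ^^ n) (stable_dec X)"
proof -
  have "fg_module R ((syzygy R ^^ n) X) \<and> stable_dec ((syzygy R ^^ n) X) = (syz ^^ n) (stable_dec X)"
  proof (induction n)
    case (Suc n)
    then show ?case using syzygy_syz_class(2)[of "(syzygy R ^^ n) X"] syzygy_syz[of "(syzygy R ^^ n) X"] by simp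
  qed (simp add: assms)
  then show "fg_module R ((syzygy R ^^ n) X)" "stable_dec ((syzygy R ^^ n) X) = (syz ^^ n) (stable_dec X)" by auto
qed

lemma syz_pow_add: "(syz ^^ n) (a + b) = (syz ^^ n) a + (syz ^^ n) b"
  by (induction n) auto

lemma syz_pow_zero [simp]: "(syz ^^ n) {#} = {#}" by (induction n) auto

lemma dec_power: "fg_module R N \<Longrightarrow> dec (module_power n N) = repeat_mset n (dec N)"
proof (induction n)
  case 0
  then show ?case using dec_zero_iff[OF fg_power[of N 0]] module_power_0[of N] by simp
next
  case (Suc n)
  then show ?case using dec_dsum[OF module_power_Suc fg_power] fg_left_module fg_power by force
qed

lemma in_add_dec:
  fixes N :: "('a, 'm) module" and X :: "('a, 'n) module"
  assumes N: "fg_module R N" and X: "left_module R X" and a: "in_add R N X"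
  shows "fg_module R X \<and> set_mset (dec X) \<subseteq> set_mset (dec N)"
proof -
  obtain n U V where UV: "internal_direct_sum R (module_power n N) U V" "mod_iso R X (sub (module_power n N) U)"
    using a unfolding in_add_def by blast
  let ?M = "module_power n N"
  have M: "fg_module R ?M" by (rule fg_power[OF N])
  have s: "submodule U R ?M" "submodule V R ?M" using UV unfolding internal_direct_sum_def by auto
  have f: "fg_module R (sub ?M U)" "fg_module R (sub ?M V)" using fg_sub[OF M] s by auto
  have Xf: "fg_module R X" by (rule fg_iso[OF f(1) mod_iso_sym[OF X UV(2)] X])
  have "dec ?M = dec (sub ?M U) + dec (sub ?M V)" by (rule dec_dsum[OF internal_dsum[OF fg_left_module[OF M] UV(1)] M f])
  then have "dec X \<subseteq># dec ?M" using dec_iso_iff[OF Xf f(1)] UV(2) by simp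
  then have le: "dec X \<subseteq># repeat_mset n (dec N)" by (simp only: dec_power[OF N])
  have "u \<in># dec N" if "u \<in># dec X" for u
  proof -
    have "u \<in># repeat_mset n (dec N)" using le that by (rule mset_subset_eqD)
    then have "0 < n * count (dec N) u" by (simp only: count_repeat_mset count_greater_zero_iff[symmetric])
    then show ?thesis by simp
  qed
  then show ?thesis using Xf by blast
qed

lemma dec_in_add:
  fixes N :: "('a, 'm) module" and X :: "('a, 'n) module"
  assumes N: "fg_module R N" and X: "fg_module R X" and s: "set_mset (dec X) \<subseteq> set_mset (dec N)"
  shows "in_add R N X"
proof -
  \<comment> \<open>The size of \<open>dec X\<close> bounds every multiplicity in it, so this many
    copies of \<open>N\<close> suffice.\<close>
  let ?n = "size (dec X)" let ?M = "module_power ?n N"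
  have M: "fg_module R ?M" by (rule fg_power[OF N])
  have le: "dec X \<subseteq># dec ?M" unfolding dec_power[OF N]
  proof (rule mset_subset_eqI)
    fix u
    show "count (dec X) u \<le> count (repeat_mset ?n (dec N)) u"
    proof (cases "u \<in># dec X")
      case True
      then have "u \<in># dec N" using s by blast
      then have "1 \<le> count (dec N) u" by simp
      then have "?n * 1 \<le> ?n * count (dec N) u" by (rule mult_le_mono2)
      then have "count (dec X) u \<le> ?n * count (dec N) u"
        using count_le_size[of "dec X" u] by (simp only: mult_1_right)
      then show ?thesis by (simp only: count_repeat_mset)
    qed (simp add: not_in_iff)
  qed
  have "\<forall>u\<in>#dec ?M - dec X. fg_module R u \<and> dec u = {#u#}" using dec_elem[OF M] in_diffD by metis
  then obtain Y :: "('a, 'a carr) module" where Y: "fg_module R Y" "dec Y = dec ?M - dec X" using dec_realize by blast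
  obtain D :: "('a, 'a carr) module" where D: "fg_module R D" "is_dsum R D X Y" using dsum_exists[OF X Y(1)] by blast
  have "dec D = dec ?M" using dec_dsum[OF D(2,1) X Y(1)] Y(2) le by simp
  then have "mod_iso R D ?M" using dec_iso_iff[OF D(1) M] by simp
  then have "is_dsum R ?M X Y"
    by (rule is_dsum_iso[OF fg_left_module[OF D(1)] fg_left_module[OF X] fg_left_module[OF Y(1)] D(2) _ mod_iso_refl mod_iso_refl
          fg_left_module[OF X] fg_left_module[OF Y(1)]])
  then obtain i1 i2 p1 p2 where b: "bip R ?M X Y i1 i2 p1 p2" unfolding is_dsum_bip by blast
  note b = bipD[OF b]
  have "internal_direct_sum R ?M (i1 ` carrier X) (ker ?M X p1)"
    by (rule split_internal[OF fg_left_module[OF M] fg_left_module[OF X] b(3,1)]) (rule b(5))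
  moreover have "i1 \<in> mod_hom R X (sub ?M (i1 ` carrier X))" by (rule hom_into_sub[OF b(1)]) simp
  moreover have "bij_betw i1 (carrier X) (i1 ` carrier X)" using b(5) by (auto simp: bij_betw_def intro: inj_on_inverseI)
  ultimately show ?thesis unfolding in_add_def mod_iso_def
    by (intro exI[of _ ?n] exI[of _ "i1 ` carrier X"] exI[of _ "ker ?M X p1"] conjI bexI[of _ i1]) simp_all
qed

end

section \<open>Short exact sequences\<close>

definition ses :: "('a, 'x) ring_scheme \<Rightarrow> ('a, 'm) module \<Rightarrow> ('a, 'n) module \<Rightarrow> ('a, 'k) module \<Rightarrow> bool" where
  "ses R X Y Z \<longleftrightarrow> (\<exists>f\<in>mod_hom R X Y. \<exists>g\<in>mod_hom R Y Z. inj_on f (carrier X) \<and>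
     g ` carrier Y = carrier Z \<and> f ` carrier X = ker Y Z g)"

lemma sesI:
  assumes "f \<in> mod_hom R X Y" "g \<in> mod_hom R Y Z" "inj_on f (carrier X)" "g ` carrier Y = carrier Z" "f ` carrier X = ker Y Z g"
  shows "ses R X Y Z"
  unfolding ses_def using assms by blast

lemma sesE:
  assumes "ses R X Y Z"
  obtains f g where "f \<in> mod_hom R X Y" "g \<in> mod_hom R Y Z" "inj_on f (carrier X)" "g ` carrier Y = carrier Z" "f ` carrier X = ker Y Z g"
  using assms unfolding ses_def by (elim bexE conjE) (rule that)

lemma ses_iso:
  assumes X: "left_module R X" and Y: "left_module R Y" and Z: "left_module R Z" and Z': "left_module R Z'"
    and ex: "ses R X Y Z" and i: "mod_iso R X X'" "mod_iso R Y Y'" "mod_iso R Z Z'"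
  shows "ses R X' Y' Z'"
proof -
  obtain f g where e: "f \<in> mod_hom R X Y" "g \<in> mod_hom R Y Z" "inj_on f (carrier X)" "g ` carrier Y = carrier Z" "f ` carrier X = ker Y Z g"
    by (rule sesE[OF ex])
  obtain \<xi> where x: "\<xi> \<in> mod_hom R X X'" "bij_betw \<xi> (carrier X) (carrier X')" using i by (auto simp: mod_iso_def)
  obtain \<eta> where y: "\<eta> \<in> mod_hom R Y Y'" "bij_betw \<eta> (carrier Y) (carrier Y')" using i by (auto simp: mod_iso_def)
  obtain \<zeta> where z: "\<zeta> \<in> mod_hom R Z Z'" "bij_betw \<zeta> (carrier Z) (carrier Z')" using i by (auto simp: mod_iso_def)
  let ?x = "inv_into (carrier X) \<xi>" and ?y = "inv_into (carrier Y) \<eta>"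
  have x': "?x \<in> mod_hom R X' X" "bij_betw ?x (carrier X') (carrier X)" using inv_hom[OF X x] bij_betw_inv_into[OF x(2)] by auto
  have y': "?y \<in> mod_hom R Y' Y" "bij_betw ?y (carrier Y') (carrier Y)" using inv_hom[OF Y y] bij_betw_inv_into[OF y(2)] by auto
  have yy: "?y (\<eta> v) = v" if "v \<in> carrier Y" for v using y(2) that by (simp add: bij_betw_def)
  have yy': "\<eta> (?y v) = v" "?y v \<in> carrier Y" if "v \<in> carrier Y'" for v
    using y(2) that by (simp_all add: bij_betw_def f_inv_into_f inv_into_into)
  show ?thesis
  proof (rule sesI)
    show "(\<lambda>v. \<eta> (f (?x v))) \<in> mod_hom R X' Y'" by (rule hom_comp[OF hom_comp[OF x'(1) e(1)] y(1)])
    show "(\<lambda>v. \<zeta> (g (?y v))) \<in> mod_hom R Y' Z'" by (rule hom_comp[OF hom_comp[OF y'(1) e(2)] z(1)])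
    have "inj_on (\<eta> \<circ> (f \<circ> ?x)) (carrier X')"
    proof (intro comp_inj_on)
      show "inj_on ?x (carrier X')" using x'(2) by (simp add: bij_betw_def)
      show "inj_on f (?x ` carrier X')" using x'(2) e(3) by (simp add: bij_betw_def)
      have "(f \<circ> ?x) ` carrier X' = f ` carrier X" using x'(2) by (simp only: image_comp[symmetric] bij_betw_def)
      also have "\<dots> \<subseteq> carrier Y" using hom_closed[OF e(1)] by blast
      finally show "inj_on \<eta> ((f \<circ> ?x) ` carrier X')" using y(2) unfolding bij_betw_def by (blast intro: inj_on_subset)
    qed
    then show "inj_on (\<lambda>v. \<eta> (f (?x v))) (carrier X')" by (simp add: comp_def)
    have "(\<lambda>v. \<zeta> (g (?y v))) ` carrier Y' = \<zeta> ` g ` ?y ` carrier Y'" by (simp only: image_image)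
    then show "(\<lambda>v. \<zeta> (g (?y v))) ` carrier Y' = carrier Z'" using y'(2) e(4) z(2) by (simp add: bij_betw_def)
    have k: "\<zeta> (g (?y v)) = \<zero>\<^bsub>Z'\<^esub> \<longleftrightarrow> g (?y v) = \<zero>\<^bsub>Z\<^esub>" if "v \<in> carrier Y'" for v
      using hom_closed[OF e(2) yy'(2)[OF that]] z hom_inj_iff[OF Z Z' z(1)] hom_zero[OF Z Z' z(1)] by (auto simp: bij_betw_def)
    have "(\<lambda>v. \<eta> (f (?x v))) ` carrier X' = \<eta> ` f ` ?x ` carrier X'" by (simp only: image_image)
    also have "\<dots> = \<eta> ` ker Y Z g" using x'(2) e(5) by (simp add: bij_betw_def)
    also have "\<dots> = ker Y' Z' (\<lambda>v. \<zeta> (g (?y v)))"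
    proof
      show "\<eta> ` ker Y Z g \<subseteq> ker Y' Z' (\<lambda>v. \<zeta> (g (?y v)))"
        using hom_closed[OF y(1)] yy hom_zero[OF Z Z' z(1)] by (auto simp: ker_iff)
      show "ker Y' Z' (\<lambda>v. \<zeta> (g (?y v))) \<subseteq> \<eta> ` ker Y Z g"
      proof
        fix v assume v: "v \<in> ker Y' Z' (\<lambda>v. \<zeta> (g (?y v)))"
        then have "v \<in> carrier Y'" "\<zeta> (g (?y v)) = \<zero>\<^bsub>Z'\<^esub>" by (auto simp: ker_iff)
        then have "?y v \<in> ker Y Z g" "v = \<eta> (?y v)" using k yy' by (auto simp: ker_iff)
        then show "v \<in> \<eta> ` ker Y Z g" by blast
      qed
    qed
    finally show "(\<lambda>v. \<eta> (f (?x v))) ` carrier X' = ker Y' Z' (\<lambda>v. \<zeta> (g (?y v)))" .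
  qed
qed

lemma ses_ker:
  assumes X: "left_module R X" and Y: "left_module R Y" and g: "g \<in> mod_hom R X Y" "g ` carrier X = carrier Y"
  shows "ses R (sub X (ker X Y g)) X Y"
  by (rule sesI[OF incl_hom[OF ker_submodule[OF X Y g(1)] X] g(1) _ g(2)]) auto

text \<open>Operations on cosets collect all elements congruent to a result on members, which avoids
  choosing representatives.\<close>

definition quot_module :: "('a, 'm) module \<Rightarrow> 'm set \<Rightarrow> ('a, 'm set) module" where
  "quot_module M U = \<lparr>carrier = (\<lambda>x. {y \<in> carrier M. y \<ominus>\<^bsub>M\<^esub> x \<in> U}) ` carrier M, monoid.mult = (\<lambda>x y. undefined), one = undefined,
     zero = U, add = (\<lambda>c d. {y \<in> carrier M. \<exists>u\<in>c. \<exists>v\<in>d. y \<ominus>\<^bsub>M\<^esub> (u \<oplus>\<^bsub>M\<^esub> v) \<in> U}),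
     smult = (\<lambda>a c. {y \<in> carrier M. \<exists>u\<in>c. y \<ominus>\<^bsub>M\<^esub> (a \<odot>\<^bsub>M\<^esub> u) \<in> U})\<rparr>"

lemma quot_module:
  assumes M: "left_module R M" and U: "submodule U R M"
  shows "left_module R (quot_module M U) \<and> (\<exists>q\<in>mod_hom R M (quot_module M U). q ` carrier M = carrier (quot_module M U) \<and> ker M (quot_module M U) q = U)"
proof -
  interpret M: left_module R M by fact
  have Uc: "U \<subseteq> carrier M" and U0: "\<zero>\<^bsub>M\<^esub> \<in> U" and Ua: "\<And>x y. x \<in> U \<Longrightarrow> y \<in> U \<Longrightarrow> x \<oplus>\<^bsub>M\<^esub> y \<in> U"
    and Us: "\<And>a x. a \<in> carrier R \<Longrightarrow> x \<in> U \<Longrightarrow> a \<odot>\<^bsub>M\<^esub> x \<in> U" using U by (auto simp: M.submodule_iff)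
  define q where "q x = {y \<in> carrier M. y \<ominus>\<^bsub>M\<^esub> x \<in> U}" for x
  have refl: "x \<ominus>\<^bsub>M\<^esub> x \<in> U" if "x \<in> carrier M" for x using that U0 M.diff_eq_zero_iff[of x x] by simp
  have sym: "y \<ominus>\<^bsub>M\<^esub> x \<in> U" if "x \<ominus>\<^bsub>M\<^esub> y \<in> U" "x \<in> carrier M" "y \<in> carrier M" for x y
  proof -
    have "y \<ominus>\<^bsub>M\<^esub> x = \<ominus>\<^bsub>M\<^esub> (x \<ominus>\<^bsub>M\<^esub> y)" using that by (simp add: M.M.minus_eq M.M.minus_add M.M.a_comm)
    then show ?thesis using M.submodule_minus[OF U that(1)] by simp
  qed
  have trans: "x \<ominus>\<^bsub>M\<^esub> z \<in> U" if "x \<ominus>\<^bsub>M\<^esub> y \<in> U" "y \<ominus>\<^bsub>M\<^esub> z \<in> U" "x \<in> carrier M" "y \<in> carrier M" "z \<in> carrier M" for x y z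
  proof -
    have "x \<ominus>\<^bsub>M\<^esub> z = (x \<ominus>\<^bsub>M\<^esub> y) \<oplus>\<^bsub>M\<^esub> (y \<ominus>\<^bsub>M\<^esub> z)"
      using that by (simp add: M.M.minus_eq M.M.a_assoc M.M.r_neg1 M.M.r_neg2)
    then show ?thesis using Ua that by simp
  qed
  have qeq: "q x = q y \<longleftrightarrow> x \<ominus>\<^bsub>M\<^esub> y \<in> U" if "x \<in> carrier M" "y \<in> carrier M" for x y
  proof
    assume "q x = q y"
    then show "x \<ominus>\<^bsub>M\<^esub> y \<in> U" using that refl[of x] by (auto simp: q_def)
  next
    assume *: "x \<ominus>\<^bsub>M\<^esub> y \<in> U"
    show "q x = q y" unfolding q_def using trans[OF _ *] trans[OF _ sym[OF *]] that by auto
  qed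
  have addU: "(x \<oplus>\<^bsub>M\<^esub> y) \<ominus>\<^bsub>M\<^esub> (x' \<oplus>\<^bsub>M\<^esub> y') \<in> U" if "x \<ominus>\<^bsub>M\<^esub> x' \<in> U" "y \<ominus>\<^bsub>M\<^esub> y' \<in> U"
    "x \<in> carrier M" "y \<in> carrier M" "x' \<in> carrier M" "y' \<in> carrier M" for x y x' y'
  proof -
    have "(x \<oplus>\<^bsub>M\<^esub> y) \<ominus>\<^bsub>M\<^esub> (x' \<oplus>\<^bsub>M\<^esub> y') = (x \<ominus>\<^bsub>M\<^esub> x') \<oplus>\<^bsub>M\<^esub> (y \<ominus>\<^bsub>M\<^esub> y')"
      using that by (simp add: M.M.minus_eq M.M.minus_add M.M.a_ac)
    then show ?thesis using Ua that by simp
  qed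
  have smU: "(a \<odot>\<^bsub>M\<^esub> x) \<ominus>\<^bsub>M\<^esub> (a \<odot>\<^bsub>M\<^esub> x') \<in> U" if "x \<ominus>\<^bsub>M\<^esub> x' \<in> U" "x \<in> carrier M" "x' \<in> carrier M" "a \<in> carrier R" for a x x'
  proof -
    have "(a \<odot>\<^bsub>M\<^esub> x) \<ominus>\<^bsub>M\<^esub> (a \<odot>\<^bsub>M\<^esub> x') = a \<odot>\<^bsub>M\<^esub> (x \<ominus>\<^bsub>M\<^esub> x')"
      using that by (simp add: M.M.minus_eq M.smult_r_distr M.smult_minus_r)
    then show ?thesis using Us that by simp
  qed
  let ?Q = "quot_module M U"
  have c: "carrier ?Q = q ` carrier M" by (simp add: quot_module_def q_def)
  have mz: "x \<ominus>\<^bsub>M\<^esub> \<zero>\<^bsub>M\<^esub> = x" if "x \<in> carrier M" for x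
    using that M.diff_eq_iff[of x "\<zero>\<^bsub>M\<^esub>" x] by simp
  have z: "\<zero>\<^bsub>?Q\<^esub> = q \<zero>\<^bsub>M\<^esub>" using Uc mz by (auto simp: quot_module_def q_def)
  have a: "q x \<oplus>\<^bsub>?Q\<^esub> q y = q (x \<oplus>\<^bsub>M\<^esub> y)" if xy: "x \<in> carrier M" "y \<in> carrier M" for x y
  proof
    show "q x \<oplus>\<^bsub>?Q\<^esub> q y \<subseteq> q (x \<oplus>\<^bsub>M\<^esub> y)"
      using trans[OF _ addU] xy by (auto simp: quot_module_def q_def)
    have "x \<in> q x" "y \<in> q y" using refl xy by (auto simp: q_def)
    then show "q (x \<oplus>\<^bsub>M\<^esub> y) \<subseteq> q x \<oplus>\<^bsub>?Q\<^esub> q y" by (auto simp: quot_module_def q_def)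
  qed
  have s: "b \<odot>\<^bsub>?Q\<^esub> q x = q (b \<odot>\<^bsub>M\<^esub> x)" if xy: "x \<in> carrier M" "b \<in> carrier R" for x b
  proof
    show "b \<odot>\<^bsub>?Q\<^esub> q x \<subseteq> q (b \<odot>\<^bsub>M\<^esub> x)"
      using trans[OF _ smU] xy by (auto simp: quot_module_def q_def)
    have "x \<in> q x" using refl xy by (auto simp: q_def)
    then show "q (b \<odot>\<^bsub>M\<^esub> x) \<subseteq> b \<odot>\<^bsub>?Q\<^esub> q x" by (auto simp: quot_module_def q_def)
  qed
  have "abelian_group ?Q"
  proof (rule abelian_groupI)
    fix x assume "x \<in> carrier ?Q"
    then obtain u where u: "u \<in> carrier M" "x = q u" using c by auto
    then have "q (\<ominus>\<^bsub>M\<^esub> u) \<oplus>\<^bsub>?Q\<^esub> x = \<zero>\<^bsub>?Q\<^esub>" by (simp add: a z M.M.l_neg)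
    then show "\<exists>y\<in>carrier ?Q. y \<oplus>\<^bsub>?Q\<^esub> x = \<zero>\<^bsub>?Q\<^esub>" using u c by auto
  qed (auto simp: c z a M.M.a_ac)
  then have "left_module R ?Q"
    by (intro left_module.intro left_module_axioms.intro M.R.ring_axioms)
      (auto simp: c a s M.smult_l_distr M.smult_r_distr M.smult_assoc1)
  moreover have "q \<in> mod_hom R M ?Q" by (rule mod_homI) (auto simp: c a s)
  moreover have "ker M ?Q q = U" using Uc by (auto simp: ker_iff z qeq mz)
  ultimately show ?thesis using c by blast
qed

lemma hom_factor:
  assumes M: "left_module R M" and D: "left_module R D" and E: "left_module R E"
    and d: "d \<in> mod_hom R M D" "d ` carrier M = carrier D"
    and e: "e \<in> mod_hom R M E" and k: "\<And>w. w \<in> carrier M \<Longrightarrow> d w = \<zero>\<^bsub>D\<^esub> \<Longrightarrow> e w = \<zero>\<^bsub>E\<^esub>"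
  shows "\<exists>g. g \<in> mod_hom R D E \<and> (\<forall>v\<in>carrier M. g (d v) = e v)"
proof -
  interpret D: left_module R D by fact
  interpret E: left_module R E by fact
  interpret M: left_module R M by fact
  have wd: "e v = e w" if "v \<in> carrier M" "w \<in> carrier M" "d v = d w" for v w
  proof -
    have "d (v \<ominus>\<^bsub>M\<^esub> w) = \<zero>\<^bsub>D\<^esub>"
      using hom_diff[OF M D d(1), of v w] hom_closed[OF d(1), of w] that D.diff_eq_zero_iff by simp
    then have "e (v \<ominus>\<^bsub>M\<^esub> w) = \<zero>\<^bsub>E\<^esub>" using k that by simp
    then show ?thesis using hom_diff[OF M E e, of v w] hom_closed[OF e] that E.diff_eq_zero_iff by simp
  qed
  define r where "r = inv_into (carrier M) d"
  have r: "r x \<in> carrier M" "d (r x) = x" if "x \<in> carrier D" for x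
    using that d(2) by (auto simp: r_def inv_into_into f_inv_into_f)
  have g: "e (r (d v)) = e v" if "v \<in> carrier M" for v
    using wd[OF r(1) that r(2)] hom_closed[OF d(1)] that by simp
  have "(\<lambda>x. e (r x)) \<in> mod_hom R D E"
  proof (rule mod_homI)
    show "e (r x) \<in> carrier E" if "x \<in> carrier D" for x using r that hom_closed[OF e] by simp
    fix x y assume xy: "x \<in> carrier D" "y \<in> carrier D"
    have "d (r x \<oplus>\<^bsub>M\<^esub> r y) = x \<oplus>\<^bsub>D\<^esub> y" using hom_add[OF d(1), of "r x" "r y"] r xy by simp
    then show "e (r (x \<oplus>\<^bsub>D\<^esub> y)) = e (r x) \<oplus>\<^bsub>E\<^esub> e (r y)"
      using g[of "r x \<oplus>\<^bsub>M\<^esub> r y"] hom_add[OF e, of "r x" "r y"] r xy by simp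
  next
    fix s x assume sx: "s \<in> carrier R" "x \<in> carrier D"
    have "d (s \<odot>\<^bsub>M\<^esub> r x) = s \<odot>\<^bsub>D\<^esub> x" using hom_smult[OF d(1), of s "r x"] r sx by simp
    then show "e (r (s \<odot>\<^bsub>D\<^esub> x)) = s \<odot>\<^bsub>E\<^esub> e (r x)"
      using g[of "s \<odot>\<^bsub>M\<^esub> r x"] hom_smult[OF e, of s "r x"] r sx by simp
  qed
  then show ?thesis using g by blast
qed

text \<open>The third isomorphism theorem as an exact sequence.\<close>

lemma ses_third:
  assumes Y: "left_module R Y" and V: "submodule V R Y" and UV: "U \<subseteq> V"
    and X: "left_module R X" and C: "left_module R C" and Z: "left_module R Z"
    and a: "a \<in> mod_hom R (sub Y V) X" "a ` V = carrier X" "ker (sub Y V) X a = U"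
    and b: "b \<in> mod_hom R Y C" "b ` carrier Y = carrier C" "ker Y C b = U"
    and c: "c \<in> mod_hom R Y Z" "c ` carrier Y = carrier Z" "ker Y Z c = V"
  shows "ses R X C Z"
proof -
  interpret Y: left_module R Y by fact
  interpret C: left_module R C by fact
  interpret X: left_module R X by fact
  interpret Z: left_module R Z by fact
  have Vc: "V \<subseteq> carrier Y" using V by (simp add: Y.submodule_iff)
  have Vl: "left_module R (sub Y V)" by (rule Y.sub_left_module[OF V])
  have aU: "a v = \<zero>\<^bsub>X\<^esub> \<longleftrightarrow> v \<in> U" if "v \<in> V" for v using a(3) that by (auto simp: ker_iff)
  have bU: "b v = \<zero>\<^bsub>C\<^esub> \<longleftrightarrow> v \<in> U" if "v \<in> carrier Y" for v using b(3) that by (auto simp: ker_iff)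
  have cV: "c v = \<zero>\<^bsub>Z\<^esub> \<longleftrightarrow> v \<in> V" if "v \<in> carrier Y" for v using c(3) that by (auto simp: ker_iff)
  have "\<exists>f. f \<in> mod_hom R X C \<and> (\<forall>v\<in>carrier (sub Y V). f (a v) = b v)"
  proof (rule hom_factor[OF Vl X C a(1) _ hom_restrict[OF b(1) Vc]])
    show "a ` carrier (sub Y V) = carrier X" using a(2) by simp
    fix w assume w: "w \<in> carrier (sub Y V)" "a w = \<zero>\<^bsub>X\<^esub>"
    then have "w \<in> U" using aU by simp
    moreover have "w \<in> carrier Y" using w(1) Vc by auto
    ultimately show "b w = \<zero>\<^bsub>C\<^esub>" using bU by blast
  qed
  then obtain f where f: "f \<in> mod_hom R X C" "\<And>v. v \<in> V \<Longrightarrow> f (a v) = b v" by auto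
  have "\<exists>g. g \<in> mod_hom R C Z \<and> (\<forall>v\<in>carrier Y. g (b v) = c v)"
  proof (rule hom_factor[OF Y C Z b(1,2) c(1)])
    fix w assume "w \<in> carrier Y" "b w = \<zero>\<^bsub>C\<^esub>"
    then show "c w = \<zero>\<^bsub>Z\<^esub>" using bU[of w] cV[of w] UV by blast
  qed
  then obtain g where g: "g \<in> mod_hom R C Z" "\<And>v. v \<in> carrier Y \<Longrightarrow> g (b v) = c v" by blast
  show ?thesis
  proof (rule sesI[OF f(1) g(1)])
    show "inj_on f (carrier X)" unfolding hom_inj_iff[OF X C f(1)]
    proof (intro ballI impI)
      fix x assume x: "x \<in> carrier X" "f x = \<zero>\<^bsub>C\<^esub>"
      then obtain v where v: "v \<in> V" "x = a v" using a(2) by blast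
      then show "x = \<zero>\<^bsub>X\<^esub>" using x f(2) aU bU Vc by auto
    qed
    have "g ` b ` carrier Y = c ` carrier Y" unfolding image_image using g(2) by (intro image_cong) auto
    then show "g ` carrier C = carrier Z" using b(2) c(2) by simp
    have 1: "f ` carrier X = b ` V" unfolding a(2)[symmetric] image_image using f(2) by (intro image_cong) auto
    have "b ` V = ker C Z g"
    proof
      show "b ` V \<subseteq> ker C Z g" using Vc hom_closed[OF b(1)] g(2) cV by (auto simp: ker_iff)
      show "ker C Z g \<subseteq> b ` V"
      proof
        fix x assume "x \<in> ker C Z g"
        then have x: "x \<in> carrier C" "g x = \<zero>\<^bsub>Z\<^esub>" by (auto simp: ker_iff)
        then obtain y where y: "y \<in> carrier Y" "x = b y" using b(2) by blast
        then show "x \<in> b ` V" using x g(2) cV by auto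
      qed
    qed
    then show "f ` carrier X = ker C Z g" using 1 by simp
  qed
qed

context fl_ring
begin

lemma quotient_exists:
  assumes M: "fg_module R M" and U: "submodule U R M"
  shows "\<exists>Q :: ('a, 'a carr) module. fg_module R Q \<and> (\<exists>q\<in>mod_hom R M Q. q ` carrier M = carrier Q \<and> ker M Q q = U)"
proof -
  have lm: "left_module R M" by (rule fg_left_module[OF M])
  let ?Q = "quot_module M U"
  obtain q where q: "left_module R ?Q" "q \<in> mod_hom R M ?Q" "q ` carrier M = carrier ?Q" "ker M ?Q q = U"
    using quot_module[OF lm U] by blast
  have Q: "fg_module R ?Q" using fg_image[OF lm q(1,2,3)] M q(1) by (simp add: fg_module_def)
  obtain g where g: "g \<in> mod_hom R ?Q (rep R ?Q)" "bij_betw g (carrier ?Q) (carrier (rep R ?Q))"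
    using rep(2)[OF Q] by (auto simp: mod_iso_def)
  have "(\<lambda>x. g (q x)) ` carrier M = g ` q ` carrier M" by (simp only: image_image)
  then have "(\<lambda>x. g (q x)) ` carrier M = carrier (rep R ?Q)" using q g by (simp add: bij_betw_def)
  moreover have "ker M (rep R ?Q) (\<lambda>x. g (q x)) = U"
    using iso_ker_comp[OF q(1) fg_left_module[OF rep(1)[OF Q]] q(2) g(1)] g(2) q(4) by (simp add: bij_betw_def)
  ultimately show ?thesis using rep(1)[OF Q] hom_comp[OF q(2) g(1)] by blast
qed

text \<open>Short exact sequences, known only up to projective summands of their terms.\<close>

definition stable_ses where
  "stable_ses a b c \<longleftrightarrow> (\<exists>(X :: ('a, 'a carr) module) (Y :: ('a, 'a carr) module) (Z :: ('a, 'a carr) module).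
     fg_module R X \<and> fg_module R Y \<and> fg_module R Z \<and> ses R X Y Z \<and> stable_dec X = a \<and> stable_dec Y = b \<and> stable_dec Z = c)"

lemma stable_dec_cong: "fg_module R X \<Longrightarrow> fg_module R Y \<Longrightarrow> mod_iso R X Y \<Longrightarrow> stable_dec X = stable_dec Y"
  unfolding stable_dec_def using dec_iso_iff by metis

lemma SExI:
  assumes X: "fg_module R X" and Y: "fg_module R Y" and Z: "fg_module R Z" and "ses R X Y Z"
  shows "stable_ses (stable_dec X) (stable_dec Y) (stable_dec Z)"
  unfolding stable_ses_def
proof (intro exI conjI)
  show "fg_module R (rep R X)" "fg_module R (rep R Y)" "fg_module R (rep R Z)" using assms rep by blast+
  show "ses R (rep R X) (rep R Y) (rep R Z)"
    by (rule ses_iso[OF fg_left_module[OF X] fg_left_module[OF Y] fg_left_module[OF Z] fg_left_module[OF rep(1)[OF Z]]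
          assms(4) rep(2)[OF X] rep(2)[OF Y] rep(2)[OF Z]])
  show "stable_dec (rep R X) = stable_dec X" using stable_dec_cong[OF X rep(1)[OF X] rep(2)[OF X]] by simp
  show "stable_dec (rep R Y) = stable_dec Y" using stable_dec_cong[OF Y rep(1)[OF Y] rep(2)[OF Y]] by simp
  show "stable_dec (rep R Z) = stable_dec Z" using stable_dec_cong[OF Z rep(1)[OF Z] rep(2)[OF Z]] by simp
qed

text \<open>The horseshoe lemma.\<close>

lemma stable_ses_syz:
  assumes "stable_ses a b c" shows "stable_ses (syz a) (syz b) (syz c)"
proof -
  obtain X :: "('a, 'a carr) module" and Y :: "('a, 'a carr) module" and Z :: "('a, 'a carr) module" where
    X: "fg_module R X" and Y: "fg_module R Y" and Z: "fg_module R Z" and ex: "ses R X Y Z" and abc: "stable_dec X = a" "stable_dec Y = b" "stable_dec Z = c"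
    using assms unfolding stable_ses_def by blast
  obtain f g where e: "f \<in> mod_hom R X Y" "g \<in> mod_hom R Y Z" "inj_on f (carrier X)" "g ` carrier Y = carrier Z" "f ` carrier X = ker Y Z g"
    by (rule sesE[OF ex])
  obtain n \<alpha> where al: "is_proj R (free_mod R n)" "\<alpha> \<in> mod_hom R (free_mod R n) X" "\<alpha> ` carrier (free_mod R n) = carrier X"
    using proj_epi[OF X] by blast
  obtain m \<beta> where be: "is_proj R (free_mod R m)" "\<beta> \<in> mod_hom R (free_mod R m) Z" "\<beta> ` carrier (free_mod R m) = carrier Z"
    using proj_epi[OF Z] by blast
  let ?P = "free_mod R n" and ?Q = "free_mod R m"
  obtain W :: "('a, 'a carr) module" where W0: "fg_module R W" "is_dsum R W ?P ?Q"
    using dsum_exists[OF is_proj_fg[OF al(1)] is_proj_fg[OF be(1)]] by blast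
  note lm = fg_left_module[OF X] fg_left_module[OF Y] fg_left_module[OF Z]
  have Wl: "left_module R W" by (rule fg_left_module[OF W0(1)])
  obtain i1 i2 p1 p2 where b: "bip R W ?P ?Q i1 i2 p1 p2" using W0(2) unfolding is_dsum_bip by blast
  note b = bipD[OF b]
  obtain \<gamma> where ga: "\<gamma> \<in> mod_hom R ?Q Y" "\<forall>p\<in>carrier ?Q. g (\<gamma> p) = \<beta> p"
    using proj_lift[OF be(1) Y Z be(2) e(2,4)] by blast
  interpret X: left_module R X by (rule lm)
  interpret Y: left_module R Y by (rule lm)
  interpret Z: left_module R Z by (rule lm)
  interpret W: left_module R W by (rule Wl)
  have W: "is_proj R W" by (rule is_proj_dsum2[OF al(1) be(1) W0(2) Wl])
  define h where "h z = f (\<alpha> (p1 z)) \<oplus>\<^bsub>Y\<^esub> \<gamma> (p2 z)" for z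
  have h1: "(\<lambda>z. f (\<alpha> (p1 z))) \<in> mod_hom R W Y" by (rule hom_comp[OF hom_comp[OF b(3) al(2)] e(1)])
  have h2: "(\<lambda>z. \<gamma> (p2 z)) \<in> mod_hom R W Y" by (rule hom_comp[OF b(4) ga(1)])
  have h: "h \<in> mod_hom R W Y" unfolding h_def by (rule hom_plus[OF Wl lm(2) h1 h2])
  have gf: "g (f x) = \<zero>\<^bsub>Z\<^esub>" if "x \<in> carrier X" for x
  proof -
    have "f x \<in> ker Y Z g" using that e(5) by blast
    then show ?thesis by (simp add: ker_iff)
  qed
  have gh: "g (h z) = \<beta> (p2 z)" if z: "z \<in> carrier W" for z
  proof -
    have "g (h z) = g (f (\<alpha> (p1 z))) \<oplus>\<^bsub>Z\<^esub> g (\<gamma> (p2 z))"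
      unfolding h_def by (rule hom_add[OF e(2) hom_closed[OF h1 z] hom_closed[OF h2 z]])
    also have "\<dots> = \<beta> (p2 z)"
      using gf[OF hom_closed[OF al(2) b(12)[OF z]]] ga(2) b(13)[OF z] hom_closed[OF be(2) b(13)[OF z]] by (simp del: module_power_simps)
    finally show ?thesis .
  qed
  \<comment> \<open>Prescribing the second coordinate as well yields at once the surjectivity of
    \<open>h\<close> and, for \<open>y\<close> zero, that of the induced map between the
    kernels.\<close>
  have key: "\<exists>z\<in>carrier W. h z = y \<and> p2 z = q" if y: "y \<in> carrier Y" "q \<in> carrier ?Q" "g y = \<beta> q" for y q
  proof -
    have yq: "y \<ominus>\<^bsub>Y\<^esub> \<gamma> q \<in> ker Y Z g"
      using y ga(2) hom_closed[OF ga(1) y(2)] hom_diff[OF lm(2,3) e(2) y(1) hom_closed[OF ga(1) y(2)]]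
        Z.diff_eq_zero_iff hom_closed[OF be(2) y(2)] by (simp add: ker_iff del: module_power_simps)
    then obtain x where x: "x \<in> carrier X" "y \<ominus>\<^bsub>Y\<^esub> \<gamma> q = f x" using e(5) by blast
    obtain p where p: "p \<in> carrier ?P" "x = \<alpha> p" using x al(3) by blast
    let ?z = "i1 p \<oplus>\<^bsub>W\<^esub> i2 q"
    interpret P: left_module R ?P by (rule free_left_module)
    interpret Q: left_module R ?Q by (rule free_left_module)
    have ic: "i1 p \<in> carrier W" "i2 q \<in> carrier W" by (rule b(10)[OF p(1)], rule b(11)[OF y(2)])
    have z: "?z \<in> carrier W" using ic by (rule W.M.a_closed)
    have pz: "p1 ?z = p" "p2 ?z = q"
      unfolding hom_add[OF b(3) ic] hom_add[OF b(4) ic] using b(5-8) p y P.M.r_zero Q.M.l_zero by (simp_all del: module_power_simps)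
    have "h ?z = (y \<ominus>\<^bsub>Y\<^esub> \<gamma> q) \<oplus>\<^bsub>Y\<^esub> \<gamma> q" unfolding h_def pz x(2) p(2) ..
    then have "h ?z = y" using Y.diff_add_cancel[OF y(1) hom_closed[OF ga(1) y(2)]] by simp
    then show ?thesis using z pz by blast
  qed
  have hs: "h ` carrier W = carrier Y"
  proof
    show "h ` carrier W \<subseteq> carrier Y" using hom_closed[OF h] by blast
    show "carrier Y \<subseteq> h ` carrier W"
    proof
      fix y assume y: "y \<in> carrier Y"
      then have "g y \<in> \<beta> ` carrier ?Q" unfolding be(3) by (rule hom_closed[OF e(2)])
      then obtain q where "q \<in> carrier ?Q" "g y = \<beta> q" by blast
      then show "y \<in> h ` carrier W" using key[OF y] by blast
    qed
  qed
  let ?KX = "sub ?P (ker ?P X \<alpha>)" and ?KY = "sub W (ker W Y h)" and ?KZ = "sub ?Q (ker ?Q Z \<beta>)"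
  have Ks: "submodule (ker ?P X \<alpha>) R ?P" "submodule (ker ?Q Z \<beta>) R ?Q" "submodule (ker W Y h) R W"
    using ker_submodule[OF free_left_module lm(1) al(2)] ker_submodule[OF free_left_module lm(3) be(2)] ker_submodule[OF Wl lm(2) h] by auto
  have hi: "h (i1 p) = f (\<alpha> p)" if p: "p \<in> carrier ?P" for p
    unfolding h_def b(5)[OF p] b(6)[OF p] using hom_zero[OF free_left_module lm(2) ga(1)] hom_closed[OF e(1) hom_closed[OF al(2) p]]
    by (simp del: module_power_simps)
  have pz: "p1 z = \<zero>\<^bsub>?P\<^esub> \<Longrightarrow> p2 z = \<zero>\<^bsub>?Q\<^esub> \<Longrightarrow> z \<in> carrier W \<Longrightarrow> z = \<zero>\<^bsub>W\<^esub>" for z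
    using b(9)[of z] hom_zero[OF free_left_module Wl b(1)] hom_zero[OF free_left_module Wl b(2)] by (simp del: module_power_simps)
  have "ses R ?KX ?KY ?KZ"
  proof (rule sesI)
    show "i1 \<in> mod_hom R ?KX ?KY"
    proof (intro hom_into_sub hom_restrict[OF b(1)])
      show "ker ?P X \<alpha> \<subseteq> carrier ?P" by (auto simp: ker_iff simp del: module_power_simps)
      show "i1 ` carrier ?KX \<subseteq> ker W Y h"
      proof
        fix z assume "z \<in> i1 ` carrier ?KX"
        then obtain p where p: "p \<in> carrier ?P" "\<alpha> p = \<zero>\<^bsub>X\<^esub>" "z = i1 p" by (auto simp: ker_iff simp del: module_power_simps)
        then show "z \<in> ker W Y h" using hi[OF p(1)] b(10)[OF p(1)] hom_zero[OF lm(1,2) e(1)] by (simp add: ker_iff)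
      qed
    qed
    show "inj_on i1 (carrier ?KX)"
      by (rule inj_on_inverseI[of _ p1]) (use b(5) in \<open>auto simp: ker_iff simp del: module_power_simps\<close>)
    show p2: "p2 \<in> mod_hom R ?KY ?KZ"
    proof (intro hom_into_sub hom_restrict[OF b(4)])
      show "ker W Y h \<subseteq> carrier W" by (auto simp: ker_iff)
      show "p2 ` carrier ?KY \<subseteq> ker ?Q Z \<beta>"
      proof
        fix q assume "q \<in> p2 ` carrier ?KY"
        then obtain z where z: "z \<in> carrier W" "h z = \<zero>\<^bsub>Y\<^esub>" "q = p2 z" by (auto simp: ker_iff)
        then show "q \<in> ker ?Q Z \<beta>" using gh[OF z(1)] hom_zero[OF lm(2,3) e(2)] b(13)[OF z(1)] by (simp add: ker_iff del: module_power_simps)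
      qed
    qed
    show "p2 ` carrier ?KY = carrier ?KZ"
    proof
      show "p2 ` carrier ?KY \<subseteq> carrier ?KZ" using hom_closed[OF p2] by blast
      show "carrier ?KZ \<subseteq> p2 ` carrier ?KY"
      proof
        fix q assume "q \<in> carrier ?KZ"
        then have q: "q \<in> carrier ?Q" "\<beta> q = \<zero>\<^bsub>Z\<^esub>" by (auto simp: ker_iff simp del: module_power_simps)
        then obtain z where "z \<in> carrier W" "h z = \<zero>\<^bsub>Y\<^esub>" "p2 z = q"
          using key[of "\<zero>\<^bsub>Y\<^esub>" q] hom_zero[OF lm(2,3) e(2)] by auto
        then show "q \<in> p2 ` carrier ?KY" by (auto simp: ker_iff)
      qed
    qed
    show "i1 ` carrier ?KX = ker ?KY ?KZ p2"
    proof
      show "i1 ` carrier ?KX \<subseteq> ker ?KY ?KZ p2"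
      proof
        fix z assume "z \<in> i1 ` carrier ?KX"
        then obtain p where p: "p \<in> carrier ?P" "\<alpha> p = \<zero>\<^bsub>X\<^esub>" "z = i1 p" by (auto simp: ker_iff simp del: module_power_simps)
        then show "z \<in> ker ?KY ?KZ p2" using hi[OF p(1)] b(10)[OF p(1)] b(6)[OF p(1)] hom_zero[OF lm(1,2) e(1)] by (simp add: ker_iff del: module_power_simps)
      qed
      show "ker ?KY ?KZ p2 \<subseteq> i1 ` carrier ?KX"
      proof
        fix z assume "z \<in> ker ?KY ?KZ p2"
        then have z: "z \<in> carrier W" "h z = \<zero>\<^bsub>Y\<^esub>" "p2 z = \<zero>\<^bsub>?Q\<^esub>" by (auto simp: ker_iff simp del: module_power_simps)
        have pc: "p1 z \<in> carrier ?P" by (rule b(12)[OF z(1)])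
        have zi: "z = i1 (p1 z)" using b(9)[OF z(1)] z(3) hom_zero[OF free_left_module Wl b(2)] b(10)[OF pc] by (simp del: module_power_simps)
        then have "f (\<alpha> (p1 z)) = \<zero>\<^bsub>Y\<^esub>" using hi[OF pc] z(2) by simp
        then have "\<alpha> (p1 z) = \<zero>\<^bsub>X\<^esub>" using e(3) hom_inj_iff[OF lm(1,2) e(1)] hom_closed[OF al(2) pc] by blast
        then have "p1 z \<in> carrier ?KX" using pc by (simp add: ker_iff del: module_power_simps)
        then show "z \<in> i1 ` carrier ?KX" using zi by blast
      qed
    qed
  qed
  then have "stable_ses (stable_dec ?KX) (stable_dec ?KY) (stable_dec ?KZ)"
    by (rule SExI[OF ker_fg[OF is_proj_fg[OF al(1)] lm(1) al(2)] ker_fg[OF W0(1) lm(2) h] ker_fg[OF is_proj_fg[OF be(1)] lm(3) be(2)]])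
  then show ?thesis using stable_dec_ker[OF X al] stable_dec_ker[OF Y W h hs] stable_dec_ker[OF Z be] abc by simp
qed

lemma stable_ses_syz_pow: "stable_ses a b c \<Longrightarrow> stable_ses ((syz ^^ n) a) ((syz ^^ n) b) ((syz ^^ n) c)"
  by (induction n) (auto intro: stable_ses_syz)

lemma pullback_snd:
  assumes P: "fg_module R P" and Q: "fg_module R Q" and X: "left_module R X" and f: "f \<in> mod_hom R P X" and g: "g \<in> mod_hom R Q X"
  shows "snd \<in> mod_hom R (pullback P Q f g) Q"
    and "f ` carrier P = carrier X \<Longrightarrow> snd ` carrier (pullback P Q f g) = carrier Q"
    and "mod_iso R (sub P (ker P X f)) (sub (pullback P Q f g) (ker (pullback P Q f g) Q snd))"
proof -
  let ?E = "pullback P Q f g"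
  note lm = fg_left_module[OF P] fg_left_module[OF Q]
  interpret Q: left_module R Q by (rule lm)
  interpret X: left_module R X by (rule X)
  show h: "snd \<in> mod_hom R ?E Q" by (rule mod_homI) (auto simp: pullback_def prod_module_def)
  show "snd ` carrier ?E = carrier Q" if "f ` carrier P = carrier X"
  proof -
    have "y \<in> snd ` carrier ?E" if y: "y \<in> carrier Q" for y
    proof -
      have "g y \<in> f ` carrier P" unfolding \<open>f ` carrier P = carrier X\<close> by (rule hom_closed[OF g y])
      then obtain x where "x \<in> carrier P" "g y = f x" by blast
      then have "(x, y) \<in> carrier ?E" using y by (simp add: pullback_def)
      then show ?thesis by force
    qed
    then show ?thesis by (auto simp: pullback_def)
  qed
  have K: "ker ?E Q snd = (\<lambda>x. (x, \<zero>\<^bsub>Q\<^esub>)) ` ker P X f"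
    using hom_zero[OF lm(2) X g] Q.M.zero_closed by (auto simp: ker_iff pullback_def)
  show "mod_iso R (sub P (ker P X f)) (sub ?E (ker ?E Q snd))" unfolding mod_iso_def K
  proof (intro bexI)
    show "bij_betw (\<lambda>x. (x, \<zero>\<^bsub>Q\<^esub>)) (carrier (sub P (ker P X f))) (carrier (sub ?E ((\<lambda>x. (x, \<zero>\<^bsub>Q\<^esub>)) ` ker P X f)))"
      by (auto simp: bij_betw_def inj_on_def)
    show "(\<lambda>x. (x, \<zero>\<^bsub>Q\<^esub>)) \<in> mod_hom R (sub P (ker P X f)) (sub ?E ((\<lambda>x. (x, \<zero>\<^bsub>Q\<^esub>)) ` ker P X f))"
      by (intro mod_homI) (auto simp: pullback_def prod_module_def Q.smult_zero_r)
  qed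
qed

lemma stable_ses_rotate:
  assumes X: "fg_module R X" and Y: "fg_module R Y" and Z: "fg_module R Z" and ex: "ses R X Y Z"
  shows "stable_ses (syz (stable_dec Z)) (stable_dec X) (stable_dec Y)"
proof -
  obtain f g where e: "f \<in> mod_hom R X Y" "g \<in> mod_hom R Y Z" "inj_on f (carrier X)" "g ` carrier Y = carrier Z" "f ` carrier X = ker Y Z g"
    by (rule sesE[OF ex])
  obtain m \<beta> where be: "is_proj R (free_mod R m)" "\<beta> \<in> mod_hom R (free_mod R m) Z" "\<beta> ` carrier (free_mod R m) = carrier Z"
    using proj_epi[OF Z] by blast
  let ?Q = "free_mod R m"
  have Qf: "fg_module R ?Q" by (rule is_proj_fg[OF be(1)])
  note lm = fg_left_module[OF X] fg_left_module[OF Y] fg_left_module[OF Z] fg_left_module[OF Qf]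
  interpret Z: left_module R Z by (rule lm)
  interpret Y: left_module R Y by (rule lm)
  interpret X: left_module R X by (rule lm)
  text \<open>The pullback of \<open>Y \<rightarrow> Z \<leftarrow> ?Q\<close> is both an extension of \<open>Y\<close> by the syzygy of \<open>Z\<close> and, as \<open>?Q\<close> is
    projective, the direct sum of \<open>X\<close> and \<open>?Q\<close>.\<close>
  let ?E = "pullback ?Q Y \<beta> g"
  have E: "fg_module R ?E" by (rule pullback_fg[OF Qf Y lm(3) be(2) e(2)])
  have "dec ?E = dec ?Q + dec (sub Y (ker Y Z g))" by (rule pullback_dec[OF be(1) Y lm(3) be(2) e(2,4)])
  moreover have "mod_iso R X (sub Y (ker Y Z g))" unfolding mod_iso_def
    using e by (intro bexI[OF _ hom_into_sub[OF e(1)]]) (auto simp: bij_betw_def)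
  then have "dec X = dec (sub Y (ker Y Z g))" using dec_iso_iff[OF X ker_fg[OF Y lm(3) e(2)]] by simp
  ultimately have sE: "stable_dec ?E = stable_dec X" using be(1) is_proj_stable_dec[OF Qf] by (simp add: stable_dec_def)
  note sn = pullback_snd[OF Qf Y lm(3) be(2) e(2)]
  have h: "snd \<in> mod_hom R ?E Y" and hs: "snd ` carrier ?E = carrier Y" by (rule sn(1), rule sn(2)[OF be(3)])
  let ?K = "ker ?E Y snd"
  have "mod_iso R (sub ?Q (ker ?Q Z \<beta>)) (sub ?E ?K)" by (rule sn(3))
  then have "stable_dec (sub ?E ?K) = syz (stable_dec Z)"
    using stable_dec_cong[OF ker_fg[OF Qf lm(3) be(2)] ker_fg[OF E lm(2) h]] stable_dec_ker[OF Z be] by simp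
  then show ?thesis
    using SExI[OF ker_fg[OF E lm(2) h] E Y ses_ker[OF fg_left_module[OF E] lm(2) h hs]] sE by simp
qed

end

section \<open>The Igusa--Todorov bound\<close>

text \<open>An ascending chain of subspaces of a finite-dimensional rational vector space is stationary.\<close>

lemma subspace_chain_stationary:
  fixes H :: "nat \<Rightarrow> ('u \<Rightarrow> rat) set"
  assumes "finite F" and zero: "\<And>n. (\<lambda>x. 0) \<in> H n"
    and lin: "\<And>n c e k. c \<in> H n \<Longrightarrow> e \<in> H n \<Longrightarrow> (\<lambda>x. c x + k * e x) \<in> H n"
    and mono: "\<And>n m. n \<le> m \<Longrightarrow> H n \<subseteq> H m"
  shows "\<exists>N. \<forall>n. \<forall>c\<in>H n. (\<forall>x. x \<notin> F \<longrightarrow> c x = 0) \<longrightarrow> c \<in> H N"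
  using assms(1)
proof (induction F)
  case empty
  have "c \<in> H 0" if "\<forall>x. x \<notin> {} \<longrightarrow> c x = 0" for c
  proof -
    have "c = (\<lambda>x. 0)" using that by auto
    then show ?thesis using zero by simp
  qed
  then show ?case by blast
next
  case (insert x F)
  then obtain N0 where N0: "\<And>n c. c \<in> H n \<Longrightarrow> (\<forall>y. y \<notin> F \<longrightarrow> c y = 0) \<Longrightarrow> c \<in> H N0" by blast
  show ?case
  proof (cases "\<exists>n. \<exists>e\<in>H n. (\<forall>y. y \<notin> insert x F \<longrightarrow> e y = 0) \<and> e x \<noteq> 0")
    case True
    then obtain n1 e where e: "e \<in> H n1" "\<And>y. y \<notin> insert x F \<Longrightarrow> e y = 0" "e x \<noteq> 0" by blast
    have "c \<in> H (max N0 n1)" if c: "c \<in> H n" "\<forall>y. y \<notin> insert x F \<longrightarrow> c y = 0" for n c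
    proof -
      \<comment> \<open>The pivot \<open>e\<close> clears the coordinate \<open>x\<close> of
        \<open>c\<close>, so the induction hypothesis applies to the remainder. In the other case
        all vectors in question vanish at \<open>x\<close> and nothing has to be cleared.\<close>
      define c' where "c' y = c y + (- c x / e x) * e y" for y
      have "c \<in> H (max n n1)" "e \<in> H (max n n1)" using mono[of n "max n n1"] mono[of n1 "max n n1"] c e by auto
      then have "c' \<in> H (max n n1)" unfolding c'_def[abs_def] by (rule lin)
      moreover have "c' y = 0" if "y \<notin> F" for y
        using c(2) e(2,3) that by (cases "y = x") (simp_all add: c'_def)
      then have "\<forall>y. y \<notin> F \<longrightarrow> c' y = 0" by blast
      ultimately have "c' \<in> H N0" by (rule N0)
      then have "c' \<in> H (max N0 n1)" "e \<in> H (max N0 n1)" using mono[of N0 "max N0 n1"] mono[of n1 "max N0 n1"] e by auto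
      then have "(\<lambda>y. c' y + (c x / e x) * e y) \<in> H (max N0 n1)" by (rule lin)
      moreover have "(\<lambda>y. c' y + (c x / e x) * e y) = c" by (auto simp: c'_def)
      ultimately show ?thesis by simp
    qed
    then show ?thesis by blast
  next
    case False
    have "c \<in> H N0" if c: "c \<in> H n" "\<forall>y. y \<notin> insert x F \<longrightarrow> c y = 0" for n c
    proof (rule N0[OF c(1)])
      have "c x = 0" using False c by blast
      then show "\<forall>y. y \<notin> F \<longrightarrow> c y = 0" using c(2) by auto
    qed
    then show ?thesis by blast
  qed
qed

text \<open>The identity of \<open>A\<close> is added to the injection. Together with the
  counterpart for the surjection this pads exact sequences with projective summands.\<close>

lemma ses_add_left:
  assumes X: "left_module R X" "left_module R Y" "left_module R Z" "left_module R A" "left_module R X'" "left_module R Y'"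
    and ex: "ses R X Y Z" and d: "is_dsum R X' X A" "is_dsum R Y' Y A"
  shows "ses R X' Y' Z"
proof -
  obtain f g where e: "f \<in> mod_hom R X Y" "g \<in> mod_hom R Y Z" "inj_on f (carrier X)" "g ` carrier Y = carrier Z" "f ` carrier X = ker Y Z g"
    by (rule sesE[OF ex])
  obtain i1 i2 p1 p2 where b: "bip R X' X A i1 i2 p1 p2" using d(1) unfolding is_dsum_bip by blast
  obtain j1 j2 q1 q2 where b': "bip R Y' Y A j1 j2 q1 q2" using d(2) unfolding is_dsum_bip by blast
  note b = bipD[OF b] and b' = bipD[OF b']
  interpret Y': left_module R Y' by fact
  interpret Y: left_module R Y by fact
  interpret A: left_module R A by fact
  interpret X': left_module R X' by fact
  define h where "h z = j1 (f (p1 z)) \<oplus>\<^bsub>Y'\<^esub> j2 (p2 z)" for z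
  have h: "h \<in> mod_hom R X' Y'" unfolding h_def
    by (rule hom_plus[OF X(5,6) hom_comp[OF hom_comp[OF b(3) e(1)] b'(1)] hom_comp[OF b(4) b'(2)]])
  have q: "q1 (h z) = f (p1 z)" "q2 (h z) = p2 z" if "z \<in> carrier X'" for z
  proof -
    have c: "f (p1 z) \<in> carrier Y" "p2 z \<in> carrier A" using that b hom_closed[OF e(1)] by auto
    show "q1 (h z) = f (p1 z)" "q2 (h z) = p2 z"
      using c b' hom_add[OF b'(3)] hom_add[OF b'(4)] by (simp_all add: h_def)
  qed
  have k: "h (i1 x \<oplus>\<^bsub>X'\<^esub> i2 a) = j1 (f x) \<oplus>\<^bsub>Y'\<^esub> j2 a" if "x \<in> carrier X" "a \<in> carrier A" for x a
  proof -
    interpret X: left_module R X by (rule X(1))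
    have "p1 (i1 x \<oplus>\<^bsub>X'\<^esub> i2 a) = x" "p2 (i1 x \<oplus>\<^bsub>X'\<^esub> i2 a) = a"
      using that b hom_add[OF b(3)] hom_add[OF b(4)] by simp_all
    then show ?thesis by (simp add: h_def)
  qed
  show ?thesis
  proof (rule sesI[OF h hom_comp[OF b'(3) e(2)]])
    show "inj_on h (carrier X')"
    proof (rule inj_onI)
      fix x y assume xy: "x \<in> carrier X'" "y \<in> carrier X'" "h x = h y"
      then have "f (p1 x) = f (p1 y)" "p2 x = p2 y" using q by metis+
      then have "p1 x = p1 y" "p2 x = p2 y" using e(3) b(12) xy by (auto dest: inj_onD)
      then show "x = y" using b(9) xy by metis
    qed
    have "q1 ` carrier Y' = carrier Y"
    proof
      show "q1 ` carrier Y' \<subseteq> carrier Y" using b'(12) by blast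
      show "carrier Y \<subseteq> q1 ` carrier Y'" using b'(5,10) by (metis imageI subsetI)
    qed
    moreover have "(\<lambda>x. g (q1 x)) ` carrier Y' = g ` q1 ` carrier Y'" by (simp only: image_image)
    ultimately show "(\<lambda>x. g (q1 x)) ` carrier Y' = carrier Z" using e(4) by simp
    show "h ` carrier X' = ker Y' Z (\<lambda>x. g (q1 x))"
    proof
      show "h ` carrier X' \<subseteq> ker Y' Z (\<lambda>x. g (q1 x))"
      proof
        fix y assume "y \<in> h ` carrier X'"
        then obtain x where x: "x \<in> carrier X'" "y = h x" by blast
        have "f (p1 x) \<in> ker Y Z g" using e(5) b(12)[OF x(1)] by blast
        then show "y \<in> ker Y' Z (\<lambda>x. g (q1 x))" using x q hom_closed[OF h] by (simp add: ker_iff)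
      qed
      show "ker Y' Z (\<lambda>x. g (q1 x)) \<subseteq> h ` carrier X'"
      proof
        fix y assume "y \<in> ker Y' Z (\<lambda>x. g (q1 x))"
        then have y: "y \<in> carrier Y'" "g (q1 y) = \<zero>\<^bsub>Z\<^esub>" by (auto simp: ker_iff)
        then have "q1 y \<in> f ` carrier X" using e(5) b'(12) by (simp add: ker_iff)
        then obtain x where x: "x \<in> carrier X" "q1 y = f x" by blast
        have "h (i1 x \<oplus>\<^bsub>X'\<^esub> i2 (q2 y)) = y" using k[OF x(1) b'(13)[OF y(1)]] b'(9)[OF y(1)] x(2) by simp
        moreover have "i1 x \<oplus>\<^bsub>X'\<^esub> i2 (q2 y) \<in> carrier X'" using x(1) b(10,11) b'(13)[OF y(1)] by simp
        ultimately show "y \<in> h ` carrier X'" by (metis imageI)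
      qed
    qed
  qed
qed

lemma ses_add_right:
  assumes X: "left_module R X" "left_module R Y" "left_module R Z" "left_module R A" "left_module R Z'" "left_module R Y'"
    and ex: "ses R X Y Z" and d: "is_dsum R Z' Z A" "is_dsum R Y' Y A"
  shows "ses R X Y' Z'"
proof -
  obtain f g where e: "f \<in> mod_hom R X Y" "g \<in> mod_hom R Y Z" "inj_on f (carrier X)" "g ` carrier Y = carrier Z" "f ` carrier X = ker Y Z g"
    by (rule sesE[OF ex])
  obtain i1 i2 p1 p2 where b: "bip R Z' Z A i1 i2 p1 p2" using d(1) unfolding is_dsum_bip by blast
  obtain j1 j2 q1 q2 where b': "bip R Y' Y A j1 j2 q1 q2" using d(2) unfolding is_dsum_bip by blast
  note b = bipD[OF b] and b' = bipD[OF b']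
  interpret Y': left_module R Y' by fact
  interpret Y: left_module R Y by fact
  interpret Z: left_module R Z by fact
  interpret A: left_module R A by fact
  interpret Z': left_module R Z' by fact
  define h where "h z = i1 (g (q1 z)) \<oplus>\<^bsub>Z'\<^esub> i2 (q2 z)" for z
  have h: "h \<in> mod_hom R Y' Z'" unfolding h_def
    by (rule hom_plus[OF X(6,5) hom_comp[OF hom_comp[OF b'(3) e(2)] b(1)] hom_comp[OF b'(4) b(2)]])
  have q: "p1 (h z) = g (q1 z)" "p2 (h z) = q2 z" if "z \<in> carrier Y'" for z
  proof -
    have c: "g (q1 z) \<in> carrier Z" "q2 z \<in> carrier A" using that b' hom_closed[OF e(2)] by auto
    show "p1 (h z) = g (q1 z)" "p2 (h z) = q2 z"
      using c b hom_add[OF b(3)] hom_add[OF b(4)] by (simp_all add: h_def)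
  qed
  have k: "h (j1 y \<oplus>\<^bsub>Y'\<^esub> j2 a) = i1 (g y) \<oplus>\<^bsub>Z'\<^esub> i2 a" if "y \<in> carrier Y" "a \<in> carrier A" for y a
  proof -
    have "q1 (j1 y \<oplus>\<^bsub>Y'\<^esub> j2 a) = y" "q2 (j1 y \<oplus>\<^bsub>Y'\<^esub> j2 a) = a"
      using that b' hom_add[OF b'(3)] hom_add[OF b'(4)] by simp_all
    then show ?thesis by (simp add: h_def)
  qed
  show ?thesis
  proof (rule sesI[OF hom_comp[OF e(1) b'(1)] h])
    show "inj_on (\<lambda>x. j1 (f x)) (carrier X)"
    proof (rule inj_onI)
      fix x y assume xy: "x \<in> carrier X" "y \<in> carrier X" "j1 (f x) = j1 (f y)"
      then have "f x = f y" using b'(5) hom_closed[OF e(1)] by metis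
      then show "x = y" using e(3) xy by (auto dest: inj_onD)
    qed
    show "h ` carrier Y' = carrier Z'"
    proof
      show "h ` carrier Y' \<subseteq> carrier Z'" using hom_closed[OF h] by blast
      show "carrier Z' \<subseteq> h ` carrier Y'"
      proof
        fix z assume z: "z \<in> carrier Z'"
        then obtain y where y: "y \<in> carrier Y" "p1 z = g y" using e(4) b(12)[OF z] by (metis imageE)
        have "h (j1 y \<oplus>\<^bsub>Y'\<^esub> j2 (p2 z)) = z" using k[OF y(1) b(13)[OF z]] b(9)[OF z] y(2) by simp
        moreover have "j1 y \<oplus>\<^bsub>Y'\<^esub> j2 (p2 z) \<in> carrier Y'" using y(1) b'(10,11) b(13)[OF z] by simp
        ultimately show "z \<in> h ` carrier Y'" by (metis imageI)
      qed
    qed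
    show "(\<lambda>x. j1 (f x)) ` carrier X = ker Y' Z' h"
    proof
      show "(\<lambda>x. j1 (f x)) ` carrier X \<subseteq> ker Y' Z' h"
      proof
        fix y assume "y \<in> (\<lambda>x. j1 (f x)) ` carrier X"
        then obtain x where x: "x \<in> carrier X" "y = j1 (f x)" by blast
        have fx: "f x \<in> carrier Y" "g (f x) = \<zero>\<^bsub>Z\<^esub>" using e(5) x(1) by (auto simp: ker_iff)
        have "h y = \<zero>\<^bsub>Z'\<^esub>" unfolding h_def x(2) b'(5)[OF fx(1)] b'(6)[OF fx(1)] fx(2)
          using hom_zero[OF X(3,5) b(1)] hom_zero[OF X(4,5) b(2)] by simp
        then show "y \<in> ker Y' Z' h" using x b'(10)[OF fx(1)] by (simp add: ker_iff)
      qed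
      show "ker Y' Z' h \<subseteq> (\<lambda>x. j1 (f x)) ` carrier X"
      proof
        fix y assume "y \<in> ker Y' Z' h"
        then have y: "y \<in> carrier Y'" "h y = \<zero>\<^bsub>Z'\<^esub>" by (auto simp: ker_iff)
        then have z: "g (q1 y) = \<zero>\<^bsub>Z\<^esub>" "q2 y = \<zero>\<^bsub>A\<^esub>"
          using q[OF y(1)] hom_zero[OF X(5,3) b(3)] hom_zero[OF X(5,4) b(4)] by auto
        then have "q1 y \<in> f ` carrier X" using e(5) b'(12)[OF y(1)] by (simp add: ker_iff)
        then obtain x where x: "x \<in> carrier X" "q1 y = f x" by blast
        have "y = j1 (f x)" using b'(9)[OF y(1)] z(2) x(2) hom_zero[OF X(4,6) b'(2)] b'(10)[OF b'(12)[OF y(1)]] by simp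
        then show "y \<in> (\<lambda>x. j1 (f x)) ` carrier X" using x(1) by blast
      qed
    qed
  qed
qed

section \<open>Finite projective dimension in exact sequences, and powers of the syzygy
  operator\<close>

context fl_ring
begin

definition finpd :: "('a, 'a carr) module multiset \<Rightarrow> bool" where
  "finpd c \<longleftrightarrow> (\<exists>p. (syz ^^ p) c = {#})"

lemma syz_pow_mono: "(syz ^^ p) c = {#} \<Longrightarrow> p \<le> q \<Longrightarrow> (syz ^^ q) c = {#}"
proof -
  assume "(syz ^^ p) c = {#}" "p \<le> q"
  moreover have "syz ^^ q = syz ^^ (q - p) \<circ> syz ^^ p" using \<open>p \<le> q\<close> by (simp add: funpow_add[symmetric])
  ultimately show ?thesis by simp
qed

lemma finpd_pow: "finpd c \<Longrightarrow> finpd ((syz ^^ n) c)"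
proof -
  assume "finpd c"
  then obtain p where "(syz ^^ p) c = {#}" by (auto simp: finpd_def)
  then have "(syz ^^ (p + n)) c = {#}" by (rule syz_pow_mono) simp
  then show ?thesis unfolding finpd_def funpow_add by auto
qed

text \<open>A sequence with projective last term splits.\<close>

lemma stable_ses_proj_right:
  assumes "stable_ses a b {#}" shows "a = b"
proof -
  obtain X :: "('a, 'a carr) module" and Y :: "('a, 'a carr) module" and Z :: "('a, 'a carr) module" where
    X: "fg_module R X" and Y: "fg_module R Y" and Z: "fg_module R Z" and ex: "ses R X Y Z" and abc: "stable_dec X = a" "stable_dec Y = b" "stable_dec Z = {#}"
    using assms unfolding stable_ses_def by blast
  obtain f g where e: "f \<in> mod_hom R X Y" "g \<in> mod_hom R Y Z" "inj_on f (carrier X)" "g ` carrier Y = carrier Z" "f ` carrier X = ker Y Z g"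
    by (rule sesE[OF ex])
  have Zp: "is_proj R Z" using abc is_proj_stable_dec[OF Z] by simp
  have K: "fg_module R (sub Y (ker Y Z g))" by (rule ker_fg[OF Y fg_left_module[OF Z] e(2)])
  have "mod_iso R X (sub Y (ker Y Z g))" unfolding mod_iso_def
    using e by (intro bexI[OF _ hom_into_sub[OF e(1)]]) (auto simp: bij_betw_def)
  then have "stable_dec X = stable_dec (sub Y (ker Y Z g))" by (rule stable_dec_cong[OF X K])
  moreover have "stable_dec Y = stable_dec Z + stable_dec (sub Y (ker Y Z g))" by (rule stable_dec_dsum[OF dsum_of_epi[OF Zp Y e(2,4)] Y Z K])
  ultimately show ?thesis using abc by simp
qed

text \<open>As the middle term is projective, the first term is a syzygy of the last one, and here
  it is projective too.\<close>

lemma stable_ses_proj_left: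
  assumes "stable_ses {#} {#} c" shows "syz c = {#}"
proof -
  obtain X :: "('a, 'a carr) module" and Y :: "('a, 'a carr) module" and Z :: "('a, 'a carr) module" where
    X: "fg_module R X" and Y: "fg_module R Y" and Z: "fg_module R Z" and ex: "ses R X Y Z" and abc: "stable_dec X = {#}" "stable_dec Y = {#}" "stable_dec Z = c"
    using assms unfolding stable_ses_def by blast
  obtain f g where e: "f \<in> mod_hom R X Y" "g \<in> mod_hom R Y Z" "inj_on f (carrier X)" "g ` carrier Y = carrier Z" "f ` carrier X = ker Y Z g"
    by (rule sesE[OF ex])
  have Yp: "is_proj R Y" using abc is_proj_stable_dec[OF Y] by simp
  have K: "fg_module R (sub Y (ker Y Z g))" by (rule ker_fg[OF Y fg_left_module[OF Z] e(2)])
  have "mod_iso R X (sub Y (ker Y Z g))" unfolding mod_iso_def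
    using e by (intro bexI[OF _ hom_into_sub[OF e(1)]]) (auto simp: bij_betw_def)
  then have "stable_dec X = stable_dec (sub Y (ker Y Z g))" by (rule stable_dec_cong[OF X K])
  then show ?thesis using stable_dec_ker[OF Z Yp e(2,4)] abc by simp
qed

lemma stable_ses_pd_right:
  assumes "stable_ses a b c" "(syz ^^ d) a = {#}" "(syz ^^ d) b = {#}" shows "(syz ^^ Suc d) c = {#}"
  using stable_ses_proj_left[of "(syz ^^ d) c"] stable_ses_syz_pow[OF assms(1), of d] assms by simp

text \<open>After enough syzygies both outer classes vanish; a sequence with projective last term
  splits, so the middle class vanishes as well.\<close>

lemma stable_ses_finpd_mid:
  assumes "stable_ses a b c" "finpd a" "finpd c" shows "finpd b"
proof -
  obtain p q where pq: "(syz ^^ p) a = {#}" "(syz ^^ q) c = {#}" using assms by (auto simp: finpd_def)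
  have z: "(syz ^^ max p q) a = {#}" "(syz ^^ max p q) c = {#}" using syz_pow_mono pq by auto
  have "(syz ^^ max p q) a = (syz ^^ max p q) b" using stable_ses_syz_pow[OF assms(1), of "max p q"] z by (intro stable_ses_proj_right) simp
  then show ?thesis using z unfolding finpd_def by metis
qed

lemma finpd_add: "finpd (a + b) \<Longrightarrow> finpd a"
  unfolding finpd_def by (auto simp: syz_pow_add)

text \<open>By additivity, powers of \<open>syz\<close> act on multiplicities as matrices with
  natural entries, whose columns are the images of single classes.\<close>

lemma count_syz_pow:
  assumes F: "finite F" and a: "set_mset a \<subseteq> F"
  shows "count ((syz ^^ n) a) v = (\<Sum>U\<in>F. count a U * count ((syz ^^ n) {#U#}) v)"
  using a
proof (induction a)
  case empty then show ?case by simp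
next
  case (add u a)
  have "(syz ^^ n) (add_mset u a) = (syz ^^ n) {#u#} + (syz ^^ n) a" using syz_pow_add[of n "{#u#}" a] by simp
  then have "count ((syz ^^ n) (add_mset u a)) v = count ((syz ^^ n) {#u#}) v + (\<Sum>U\<in>F. count a U * count ((syz ^^ n) {#U#}) v)"
    using add by simp
  also have "count ((syz ^^ n) {#u#}) v = (\<Sum>U\<in>F. if U = u then count ((syz ^^ n) {#U#}) v else 0)"
    using add F by (simp add: sum.delta)
  finally show ?case by (simp add: sum.distrib[symmetric] distrib_right) (intro sum.cong, auto)
qed

text \<open>Two classes agree after \<open>n\<close> syzygies exactly when the difference of their
  multiplicities lies in the kernel of the \<open>n\<close>-th power of the matrix. Over the
  rationals these kernels ascend, and on vectors supported in the finite set \<open>F\<close> they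
  become stationary. The resulting \<open>N\<close> is the uniform bound that the Igusa-Todorov
  function provides.\<close>

lemma syz_pow_injective_bound:
  assumes F: "finite F"
  shows "\<exists>N. \<forall>n a b. set_mset a \<subseteq> F \<longrightarrow> set_mset b \<subseteq> F \<longrightarrow> (syz ^^ n) a = (syz ^^ n) b \<longrightarrow> (syz ^^ N) a = (syz ^^ N) b"
proof -
  define H :: "nat \<Rightarrow> (('a, 'a carr) module \<Rightarrow> rat) set" where
    "H n = {c. \<forall>v. (\<Sum>U\<in>F. c U * of_nat (count ((syz ^^ n) {#U#}) v)) = 0}" for n
  have "\<exists>N. \<forall>n. \<forall>c\<in>H n. (\<forall>x. x \<notin> F \<longrightarrow> c x = 0) \<longrightarrow> c \<in> H N"
  proof (rule subspace_chain_stationary[OF F])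
    show "(\<lambda>x. 0) \<in> H n" for n by (simp add: H_def)
    show "(\<lambda>x. c x + k * e x) \<in> H n" if "c \<in> H n" "e \<in> H n" for n c e k
      using that by (simp add: H_def distrib_right sum.distrib mult.assoc sum_distrib_left[symmetric])
    have step: "H n \<subseteq> H (Suc n)" for n
    proof
      fix c assume c: "c \<in> H n"
      \<comment> \<open>The classes that occur after \<open>n\<close> syzygies are the index set for
        multiplying the \<open>n\<close>-th power of the matrix by one more factor.\<close>
      define W where "W = (\<Union>U\<in>F. set_mset ((syz ^^ n) {#U#}))"
      have W: "finite W" using F by (simp add: W_def)
      have *: "count ((syz ^^ Suc n) {#U#}) v = (\<Sum>w\<in>W. count ((syz ^^ n) {#U#}) w * count (syz {#w#}) v)" if "U \<in> F" for U v
        using count_syz_pow[OF W, of "(syz ^^ n) {#U#}" 1 v] that by (auto simp: W_def)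
      have "(\<Sum>U\<in>F. c U * of_nat (count ((syz ^^ Suc n) {#U#}) v)) = 0" for v
      proof -
        have "(\<Sum>U\<in>F. c U * of_nat (count ((syz ^^ Suc n) {#U#}) v))
            = (\<Sum>U\<in>F. \<Sum>w\<in>W. (c U * of_nat (count ((syz ^^ n) {#U#}) w)) * of_nat (count (syz {#w#}) v))"
          by (intro sum.cong refl) (simp only: * of_nat_sum of_nat_mult sum_distrib_left mult.assoc)
        also have "\<dots> = (\<Sum>w\<in>W. (\<Sum>U\<in>F. c U * of_nat (count ((syz ^^ n) {#U#}) w)) * of_nat (count (syz {#w#}) v))"
          by (subst sum.swap) (simp only: sum_distrib_right)
        also have "\<dots> = 0" using c by (simp add: H_def)
        finally show ?thesis .
      qed
      then show "c \<in> H (Suc n)" by (simp add: H_def)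
    qed
    show "H n \<subseteq> H m" if "n \<le> m" for n m using that by (rule lift_Suc_mono_le[of H, rotated]) (rule step)
  qed
  then obtain N where N: "\<And>n c. c \<in> H n \<Longrightarrow> (\<forall>x. x \<notin> F \<longrightarrow> c x = 0) \<Longrightarrow> c \<in> H N" by blast
  have eq: "(syz ^^ n) a = (syz ^^ n) b \<longleftrightarrow> (\<lambda>U. of_nat (count a U) - of_nat (count b U)) \<in> H n"
    if "set_mset a \<subseteq> F" "set_mset b \<subseteq> F" for n a b
  proof -
    have "(\<lambda>U. of_nat (count a U) - of_nat (count b U)) \<in> H n \<longleftrightarrow>
        (\<forall>v. (of_nat (count ((syz ^^ n) a) v) :: rat) = of_nat (count ((syz ^^ n) b) v))"
      by (simp add: H_def count_syz_pow[OF F that(1)] count_syz_pow[OF F that(2)] left_diff_distrib sum_subtractf)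
    then show ?thesis by (simp add: multiset_eq_iff)
  qed
  show ?thesis
  proof (intro exI[of _ N] allI impI)
    fix n a b assume ab: "set_mset a \<subseteq> F" "set_mset b \<subseteq> F" "(syz ^^ n) a = (syz ^^ n) b"
    then have "(\<lambda>U. of_nat (count a U) - of_nat (count b U)) \<in> H n" using eq by blast
    then have "(\<lambda>U. of_nat (count a U) - of_nat (count b U)) \<in> H N"
    proof (rule N, intro allI impI)
      fix x assume "x \<notin> F"
      then have "x \<notin># a" "x \<notin># b" using ab by auto
      then show "(of_nat (count a x) - of_nat (count b x) :: rat) = 0" by (simp add: not_in_iff)
    qed
    then show "(syz ^^ N) a = (syz ^^ N) b" using eq ab by blast
  qed
qed

end

context fl_ring
begin

text \<open>\<open>fincone X h\<close>: the endomorphism \<open>h\<close> is the first component of a monomorphism \<open>X \<rightarrow> X \<oplus> Q\<close> with \<open>Q\<close> projective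
  and a cokernel of finite projective dimension. This property passes to composites, and applied to \<open>h = 0\<close> it says
  that \<open>X\<close> has finite projective dimension; so it also controls nilpotent endomorphisms.\<close>

definition fincone :: "('a, 'a carr) module \<Rightarrow> ('a carr \<Rightarrow> 'a carr) \<Rightarrow> bool" where
  "fincone X h \<longleftrightarrow> (\<exists>(Q :: ('a, 'a carr) module) (Y :: ('a, 'a carr) module) (Z :: ('a, 'a carr) module) i1 i2 p1 p2 u g.
     is_proj R Q \<and> fg_module R Y \<and> fg_module R Z \<and> bip R Y X Q i1 i2 p1 p2 \<and> u \<in> mod_hom R X Y \<and> g \<in> mod_hom R Y Z \<and>
     inj_on u (carrier X) \<and> g ` carrier Y = carrier Z \<and> u ` carrier X = ker Y Z g \<and> (\<forall>x\<in>carrier X. p1 (u x) = h x) \<and> finpd (stable_dec Z))"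

lemma finconeI:
  fixes Q Y Z :: "('a, 'a carr) module"
  assumes "is_proj R Q" "fg_module R Y" "fg_module R Z" "bip R Y X Q i1 i2 p1 p2" "u \<in> mod_hom R X Y" "g \<in> mod_hom R Y Z"
    "inj_on u (carrier X)" "g ` carrier Y = carrier Z" "u ` carrier X = ker Y Z g" "\<And>x. x \<in> carrier X \<Longrightarrow> p1 (u x) = h x" "finpd (stable_dec Z)"
  shows "fincone X h"
  unfolding fincone_def
  by (rule exI[of _ Q], rule exI[of _ Y], rule exI[of _ Z], rule exI[of _ i1], rule exI[of _ i2], rule exI[of _ p1],
      rule exI[of _ p2], rule exI[of _ u], rule exI[of _ g]) (intro conjI ballI assms)

lemma finconeE:
  assumes "fincone X h"
  obtains Q Y Z :: "('a, 'a carr) module" and i1 i2 p1 p2 u g where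
    "is_proj R Q" "fg_module R Y" "fg_module R Z" "bip R Y X Q i1 i2 p1 p2" "u \<in> mod_hom R X Y" "g \<in> mod_hom R Y Z"
    "inj_on u (carrier X)" "g ` carrier Y = carrier Z" "u ` carrier X = ker Y Z g" "\<forall>x\<in>carrier X. p1 (u x) = h x" "finpd (stable_dec Z)"
  using assms unfolding fincone_def by (elim exE conjE) (rule that)

text \<open>Follow the monomorphism \<open>X -> X + Q1\<close> by the second one with the identity
  of \<open>Q1\<close> added, \<open>X + Q1 -> X + Q2 + Q1\<close>. The cokernel \<open>C\<close> of
  the composite is an extension of \<open>Z2\<close> by \<open>Z1\<close>, and finite projective
  dimension passes to the middle term.\<close>

lemma fincone_comp:
  assumes X: "fg_module R X" and h1: "fincone X h1" and h2: "fincone X h2"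
  shows "fincone X (\<lambda>x. h2 (h1 x))"
proof -
  obtain Q1 Y1 Z1 :: "('a, 'a carr) module" and i1 i2 p1 p2 u1 g1 where 1:
     "is_proj R Q1" "fg_module R Y1" "fg_module R Z1" "bip R Y1 X Q1 i1 i2 p1 p2" "u1 \<in> mod_hom R X Y1" "g1 \<in> mod_hom R Y1 Z1"
     "inj_on u1 (carrier X)" "g1 ` carrier Y1 = carrier Z1" "u1 ` carrier X = ker Y1 Z1 g1" "\<forall>x\<in>carrier X. p1 (u1 x) = h1 x" "finpd (stable_dec Z1)"
    by (rule finconeE[OF h1])
  obtain Q2 Y2 Z2 :: "('a, 'a carr) module" and j1 j2 q1 q2 u2 g2 where 2:
     "is_proj R Q2" "fg_module R Y2" "fg_module R Z2" "bip R Y2 X Q2 j1 j2 q1 q2" "u2 \<in> mod_hom R X Y2" "g2 \<in> mod_hom R Y2 Z2"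
     "inj_on u2 (carrier X)" "g2 ` carrier Y2 = carrier Z2" "u2 ` carrier X = ker Y2 Z2 g2" "\<forall>x\<in>carrier X. q1 (u2 x) = h2 x" "finpd (stable_dec Z2)"
    by (rule finconeE[OF h2])
  note b1 = bipD[OF 1(4)] and b2 = bipD[OF 2(4)]
  have Q1: "fg_module R Q1" and Q2: "fg_module R Q2" using 1 2 is_proj_fg by auto
  obtain Y3 :: "('a, 'a carr) module" where Y3: "fg_module R Y3" "is_dsum R Y3 Y2 Q1" using dsum_exists[OF 2(2) Q1] by blast
  obtain k1 k2 s1 s2 where "bip R Y3 Y2 Q1 k1 k2 s1 s2" using Y3(2) unfolding is_dsum_bip by blast
  note b3 = bipD[OF this]
  note lm = fg_left_module[OF X] fg_left_module[OF 1(2)] fg_left_module[OF 2(2)] fg_left_module[OF Y3(1)]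
    fg_left_module[OF 1(3)] fg_left_module[OF 2(3)] fg_left_module[OF Q1] fg_left_module[OF Q2]
  interpret X: left_module R X by (rule lm)
  interpret Y1: left_module R Y1 by (rule lm)
  interpret Y2: left_module R Y2 by (rule lm)
  interpret Y3: left_module R Y3 by (rule lm)
  interpret Q1: left_module R Q1 by (rule lm)
  define v where "v y = k1 (u2 (p1 y)) \<oplus>\<^bsub>Y3\<^esub> k2 (p2 y)" for y
  have v: "v \<in> mod_hom R Y1 Y3" unfolding v_def
    by (rule hom_plus[OF lm(2,4) hom_comp[OF hom_comp[OF b1(3) 2(5)] b3(1)] hom_comp[OF b1(4) b3(2)]])
  have sv: "s1 (v y) = u2 (p1 y)" "s2 (v y) = p2 y" if "y \<in> carrier Y1" for y
  proof -
    have c: "u2 (p1 y) \<in> carrier Y2" "p2 y \<in> carrier Q1" using that b1 hom_closed[OF 2(5)] by auto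
    show "s1 (v y) = u2 (p1 y)" "s2 (v y) = p2 y"
      using c b3 hom_add[OF b3(3)] hom_add[OF b3(4)] by (simp_all add: v_def)
  qed
  have vinj: "inj_on v (carrier Y1)"
  proof (rule inj_onI)
    fix x y assume xy: "x \<in> carrier Y1" "y \<in> carrier Y1" "v x = v y"
    then have "u2 (p1 x) = u2 (p1 y)" "p2 x = p2 y" using sv by metis+
    then have "p1 x = p1 y" "p2 x = p2 y" using 2(7) b1(12) xy by (auto dest: inj_onD)
    then show "x = y" using b1(9) xy by metis
  qed
  define w where "w x = v (u1 x)" for x
  have w: "w \<in> mod_hom R X Y3" unfolding w_def by (rule hom_comp[OF 1(5) v])
  have winj: "inj_on w (carrier X)"
  proof (rule inj_onI)
    fix x y assume xy: "x \<in> carrier X" "y \<in> carrier X" "w x = w y"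
    have "u1 x = u1 y"
      by (rule inj_onD[OF vinj]) (use xy hom_closed[OF 1(5)] in \<open>auto simp: w_def\<close>)
    then show "x = y" using xy by (auto dest: inj_onD[OF 1(7)])
  qed
  let ?p = "\<lambda>y. q1 (s1 y)" and ?s = "\<lambda>x. k1 (j1 x)"
  have p: "?p \<in> mod_hom R Y3 X" by (rule hom_comp[OF b3(3) b2(3)])
  have s: "?s \<in> mod_hom R X Y3" by (rule hom_comp[OF b2(1) b3(1)])
  have ps: "?p (?s x) = x" if "x \<in> carrier X" for x using that b2 b3 by simp
  let ?Q = "sub Y3 (ker Y3 X ?p)"
  have bip3: "bip R Y3 X ?Q ?s (\<lambda>x. x) ?p (\<lambda>d. d \<ominus>\<^bsub>Y3\<^esub> ?s (?p d))"
    by (rule split_bip[OF lm(4,1) p s]) (rule ps)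
  have Qf: "fg_module R ?Q" by (rule ker_fg[OF Y3(1) lm(1) p])
  \<comment> \<open>Projectivity of the complement \<open>?Q\<close> is read off by counting:
    \<open>Y3\<close> has the same nonprojective summands as \<open>X\<close>.\<close>
  have "stable_dec Y3 = stable_dec X + stable_dec ?Q" by (rule stable_dec_dsum[OF bip_dsum[OF bip3] Y3(1) X Qf])
  moreover have "stable_dec Y3 = stable_dec Y2 + stable_dec Q1" by (rule stable_dec_dsum[OF Y3(2) Y3(1) 2(2) Q1])
  moreover have "stable_dec Y2 = stable_dec X + stable_dec Q2" by (rule stable_dec_dsum[OF bip_dsum[OF 2(4)] 2(2) X Q2])
  ultimately have "stable_dec ?Q = {#}" using 1(1) 2(1) by simp
  then have Qp: "is_proj R ?Q" using is_proj_stable_dec[OF Qf] by simp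
  have pw: "?p (w x) = h2 (h1 x)" if x: "x \<in> carrier X" for x
  proof -
    have c: "u1 x \<in> carrier Y1" "p1 (u1 x) \<in> carrier X" using x hom_closed[OF 1(5)] b1 by auto
    then have "?p (w x) = h2 (p1 (u1 x))" using sv(1) 2(10) by (simp add: w_def)
    then show ?thesis using 1(10) x by simp
  qed
  let ?U = "w ` carrier X"
  have U: "submodule ?U R Y3" by (rule image_submodule[OF lm(1,4) w X.carrier_submodule])
  obtain C :: "('a, 'a carr) module" and b where C: "fg_module R C" "b \<in> mod_hom R Y3 C" "b ` carrier Y3 = carrier C" "ker Y3 C b = ?U"
    using quotient_exists[OF Y3(1) U] by blast
  let ?c = "\<lambda>y. g2 (s1 y)"
  have c: "?c \<in> mod_hom R Y3 Z2" by (rule hom_comp[OF b3(3) 2(6)])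
  let ?V = "ker Y3 Z2 ?c"
  have V: "submodule ?V R Y3" by (rule ker_submodule[OF lm(4,6) c])
  \<comment> \<open>In the chain from \<open>?U\<close> over \<open>?V\<close> to \<open>Y3\<close>,
    the quotient of \<open>?V\<close> by \<open>?U\<close> is \<open>Z1\<close>, transported along
    \<open>v\<close>, and the quotient of \<open>Y3\<close> by \<open>?V\<close> is
    \<open>Z2\<close>.\<close>
  have vV: "v ` carrier Y1 = ?V"
  proof
    show "v ` carrier Y1 \<subseteq> ?V"
    proof
      fix z assume "z \<in> v ` carrier Y1"
      then obtain y where y: "y \<in> carrier Y1" "z = v y" by blast
      have "u2 (p1 y) \<in> ker Y2 Z2 g2" using 2(9) b1(12)[OF y(1)] by blast
      then show "z \<in> ?V" using y sv(1) hom_closed[OF v] by (simp add: ker_iff)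
    qed
    show "?V \<subseteq> v ` carrier Y1"
    proof
      fix z assume "z \<in> ?V"
      then have z: "z \<in> carrier Y3" "g2 (s1 z) = \<zero>\<^bsub>Z2\<^esub>" by (auto simp: ker_iff)
      then have "s1 z \<in> u2 ` carrier X" using 2(9) b3(12) by (simp add: ker_iff)
      then obtain x where x: "x \<in> carrier X" "s1 z = u2 x" by blast
      let ?y = "i1 x \<oplus>\<^bsub>Y1\<^esub> i2 (s2 z)"
      have y: "?y \<in> carrier Y1" using x b1(10,11) b3(13)[OF z(1)] by simp
      have "p1 ?y = x" "p2 ?y = s2 z" using x b1 b3(13)[OF z(1)] hom_add[OF b1(3)] hom_add[OF b1(4)] by simp_all
      then have "v ?y = z" unfolding v_def using x(2) b3(9)[OF z(1)] by simp
      then show "z \<in> v ` carrier Y1" using y by (metis imageI)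
    qed
  qed
  let ?vi = "inv_into (carrier Y1) v"
  have vh: "v \<in> mod_hom R Y1 (sub Y3 ?V)" by (rule hom_into_sub[OF v]) (simp add: vV)
  have vb: "bij_betw v (carrier Y1) (carrier (sub Y3 ?V))" using vinj vV by (simp add: bij_betw_def)
  have vi: "?vi \<in> mod_hom R (sub Y3 ?V) Y1" by (rule inv_hom[OF lm(2) vh vb])
  have viv: "?vi (v y) = y" if "y \<in> carrier Y1" for y using that vinj by simp
  let ?a = "\<lambda>z. g1 (?vi z)"
  have a: "?a \<in> mod_hom R (sub Y3 ?V) Z1" by (rule hom_comp[OF vi 1(6)])
  have av: "?a (v y) = g1 y" if "y \<in> carrier Y1" for y using viv[OF that] by simp
  have "ses R Z1 C Z2"
  proof (rule ses_third[OF lm(4) V _ lm(5) fg_left_module[OF C(1)] lm(6) a _ _ C(2-4) c])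
    show "?U \<subseteq> ?V" using hom_closed[OF 1(5)] by (auto simp: w_def vV[symmetric])
    show "?a ` ?V = carrier Z1"
    proof -
      have "?a ` ?V = g1 ` carrier Y1" unfolding vV[symmetric] image_image using av by (intro image_cong) auto
      then show ?thesis using 1(8) by simp
    qed
    show "ker (sub Y3 ?V) Z1 ?a = ?U"
    proof
      show "ker (sub Y3 ?V) Z1 ?a \<subseteq> ?U"
      proof
        fix z assume "z \<in> ker (sub Y3 ?V) Z1 ?a"
        from this[unfolded ker_iff[of z "sub Y3 ?V"]] have z: "z \<in> ?V" "?a z = \<zero>\<^bsub>Z1\<^esub>" by simp_all
        then obtain y where y: "y \<in> carrier Y1" "z = v y" unfolding vV[symmetric] by blast
        then have "y \<in> u1 ` carrier X" using z(2) av 1(9) by (simp add: ker_iff)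
        then show "z \<in> ?U" using y by (auto simp: w_def)
      qed
      show "?U \<subseteq> ker (sub Y3 ?V) Z1 ?a"
      proof
        fix z assume "z \<in> ?U"
        then obtain x where x: "x \<in> carrier X" "z = v (u1 x)" by (auto simp: w_def)
        have y: "u1 x \<in> ker Y1 Z1 g1" using 1(9) x by blast
        then have "z \<in> ?V" "?a z = \<zero>\<^bsub>Z1\<^esub>" using x av[of "u1 x"] unfolding vV[symmetric] by (auto simp: ker_iff)
        then show "z \<in> ker (sub Y3 ?V) Z1 ?a" by (subst ker_iff) simp
      qed
    qed
    have "s1 ` carrier Y3 = carrier Y2"
    proof
      show "s1 ` carrier Y3 \<subseteq> carrier Y2" using b3(12) by blast
      show "carrier Y2 \<subseteq> s1 ` carrier Y3" using b3(5,10) by (metis imageI subsetI)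
    qed
    moreover have "?c ` carrier Y3 = g2 ` s1 ` carrier Y3" by (simp only: image_image)
    ultimately show "?c ` carrier Y3 = carrier Z2" using 2(8) by simp
  qed simp
  then have "finpd (stable_dec C)" using stable_ses_finpd_mid[OF SExI[OF 1(3) C(1) 2(3)] 1(11) 2(11)] by simp
  then show ?thesis
    using finconeI[OF Qp Y3(1) C(1) bip3 w C(2) winj C(3) C(4)[symmetric] _ \<open>finpd (stable_dec C)\<close>, of "\<lambda>x. h2 (h1 x)"] pw by blast
qed

lemma fincone_pow:
  assumes X: "fg_module R X" and h: "fincone X h" shows "n > 0 \<Longrightarrow> fincone X (h ^^ n)"
proof (induction n)
  case (Suc n)
  show ?case
  proof (cases "n = 0")
    case True then show ?thesis using h by simp
  next
    case False
    then have "fincone X (\<lambda>x. h ((h ^^ n) x))" using Suc fincone_comp[OF X _ h] by simp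
    then show ?thesis by (simp add: comp_def)
  qed
qed simp

text \<open>Fitting's lemma for the first component \<open>f\<close> of \<open>u\<close> splits
  \<open>X\<close> into \<open>K\<close>, on which \<open>f\<close> is nilpotent, and
  \<open>W\<close>, which \<open>f\<close> maps onto itself. The part \<open>W\<close> cancels,
  leaving an exact sequence from \<open>K\<close> to \<open>Z\<close> whose middle term is
  \<open>K\<close> plus \<open>Q\<close>. Moreover \<open>K\<close> has finite projective dimension:
  the image of \<open>f ^^ n\<close> is \<open>W\<close>, so the projection onto \<open>K\<close>
  along \<open>W\<close> factors through the cokernel attached to \<open>f ^^ n\<close> and makes
  \<open>K\<close> a direct summand of it.\<close>

lemma nilpotent_part:
  assumes X: "fg_module R (X :: ('a, 'a carr) module)" and Y: "fg_module R (Y :: ('a, 'a carr) module)"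
    and Z: "fg_module R (Z :: ('a, 'a carr) module)" and Q: "is_proj R (Q :: ('a, 'a carr) module)"
    and bip: "bip R Y X Q i1 i2 p1 p2" and ses: "ses R X Y Z" and Zf: "finpd (stable_dec Z)"
  shows "\<exists>a. a \<subseteq># stable_dec X \<and> finpd a \<and> stable_ses a a (stable_dec Z)"
proof -
  obtain u g where e: "u \<in> mod_hom R X Y" "g \<in> mod_hom R Y Z" "inj_on u (carrier X)" "g ` carrier Y = carrier Z" "u ` carrier X = ker Y Z g"
    by (rule sesE[OF ses])
  note b = bipD[OF bip]
  define f where "f x = p1 (u x)" for x
  have f: "f \<in> mod_hom R X X" unfolding f_def by (rule hom_comp[OF e(1) b(3)])
  have Qf: "fg_module R Q" using Q is_proj_fg by blast
  note lm = fg_left_module[OF X] fg_left_module[OF Y] fg_left_module[OF Z] fg_left_module[OF Qf]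
  interpret X: left_module R X by (rule lm)
  interpret Y: left_module R Y by (rule lm)
  interpret Z: left_module R Z by (rule lm)
  have fin: "fincone X f" by (rule finconeI[OF Q Y Z bip e]) (simp_all add: f_def Zf)
  obtain n where n: "n > 0" "internal_direct_sum R X (ker X X (f ^^ n)) ((f ^^ n) ` carrier X)"
    using X.fitting[OF fg_fl[OF X] f] by blast
  let ?K = "ker X X (f ^^ n)" and ?W = "(f ^^ n) ` carrier X"
  have K: "submodule ?K R X" and W: "submodule ?W R X" and KW: "?K <+>\<^bsub>X\<^esub> ?W = carrier X" "?K \<inter> ?W = {\<zero>\<^bsub>X\<^esub>}"
    using n unfolding internal_direct_sum_def by auto
  have fn: "(f ^^ m) \<in> mod_hom R X X" for m by (rule funpow_hom[OF f])
  note fc = hom_closed[OF f] and fnc = hom_closed[OF fn]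
  have Kf: "fg_module R (sub X ?K)" and Wf: "fg_module R (sub X ?W)" by (rule fg_sub[OF X K], rule fg_sub[OF X W])
  have Kc: "?K \<subseteq> carrier X" and Wc: "?W \<subseteq> carrier X" using K W by (simp_all add: X.submodule_iff)
  have dXK: "is_dsum R X (sub X ?K) (sub X ?W)" by (rule internal_dsum[OF lm(1) n(2)])
  have sX: "stable_dec X = stable_dec (sub X ?K) + stable_dec (sub X ?W)" by (rule stable_dec_dsum[OF dXK X Kf Wf])
  have decomp: "\<exists>k w. k \<in> ?K \<and> w \<in> carrier X \<and> x = k \<oplus>\<^bsub>X\<^esub> (f ^^ n) w" if "x \<in> carrier X" for x
    using that KW(1) unfolding set_add_def' by blast
  have fnf: "(f ^^ n) (f x) = f ((f ^^ n) x)" for x by (rule funpow_swap1[symmetric])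
  have fK: "f x \<in> ?K" if "x \<in> ?K" for x
  proof -
    have x: "x \<in> carrier X" "(f ^^ n) x = \<zero>\<^bsub>X\<^esub>" using that by (simp_all add: ker_iff)
    have "f \<zero>\<^bsub>X\<^esub> = \<zero>\<^bsub>X\<^esub>" by (rule hom_zero[OF lm(1,1) f])
    then show ?thesis using x fc by (simp add: ker_iff fnf)
  qed
  have Wsurj: "\<exists>w'\<in>?W. f w' = w" if wW: "w \<in> ?W" for w
  proof -
    obtain x where x: "x \<in> carrier X" "w = (f ^^ n) x" using wW by blast
    obtain k y where ky: "k \<in> ?K" "y \<in> carrier X" "x = k \<oplus>\<^bsub>X\<^esub> (f ^^ n) y" using decomp[OF x(1)] by blast
    have kc: "k \<in> carrier X" "(f ^^ n) k = \<zero>\<^bsub>X\<^esub>" using ky(1) by (simp_all add: ker_iff)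
    have "w = (f ^^ n) k \<oplus>\<^bsub>X\<^esub> (f ^^ n) ((f ^^ n) y)"
      unfolding x(2) ky(3) by (rule hom_add[OF fn kc(1) fnc[OF ky(2)]])
    also have "\<dots> = (f ^^ n) ((f ^^ n) y)" using kc fnc[OF fnc[OF ky(2)]] by simp
    finally have w1: "w = (f ^^ n) ((f ^^ n) y)" .
    obtain m where m: "n = Suc m" using n(1) by (cases n) auto
    have "w = f ((f ^^ m) ((f ^^ n) y))" using w1 unfolding m by simp
    moreover have "(f ^^ m) ((f ^^ n) y) = (f ^^ n) ((f ^^ m) y)" by (metis add.commute comp_apply funpow_add)
    ultimately show ?thesis using fnc[OF ky(2), of m] by (metis imageI)
  qed
  have inK: "x \<in> ?K" if x: "x \<in> carrier X" "f x \<in> ?K" for x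
  proof -
    have "f ((f ^^ n) x) = \<zero>\<^bsub>X\<^esub>" using x(2) by (simp add: ker_iff fnf)
    obtain m where m: "n = Suc m" using n(1) by (cases n) auto
    have "(f ^^ n) ((f ^^ n) x) = (f ^^ m) (f ((f ^^ n) x))" unfolding m funpow_Suc_right by simp
    also have "\<dots> = \<zero>\<^bsub>X\<^esub>" using \<open>f ((f ^^ n) x) = \<zero>\<^bsub>X\<^esub>\<close> hom_zero[OF lm(1,1) fn] by simp
    finally have "(f ^^ n) x \<in> ?K" using fnc[OF x(1)] by (simp add: ker_iff)
    then have "(f ^^ n) x \<in> ?K \<inter> ?W" using x(1) by blast
    then have "(f ^^ n) x = \<zero>\<^bsub>X\<^esub>" unfolding KW(2) by (rule singletonD)
    then show ?thesis using x(1) by (simp add: ker_iff)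
  qed
  have finK: "finpd (stable_dec (sub X ?K))"
  proof -
    have "fincone X (f ^^ n)" by (rule fincone_pow[OF X fin n(1)])
    then obtain Q' Y' Z' :: "('a, 'a carr) module" and j1 j2 q1 q2 u' g' where 1:
       "is_proj R Q'" "fg_module R Y'" "fg_module R Z'" "bip R Y' X Q' j1 j2 q1 q2" "u' \<in> mod_hom R X Y'" "g' \<in> mod_hom R Y' Z'"
       "inj_on u' (carrier X)" "g' ` carrier Y' = carrier Z'" "u' ` carrier X = ker Y' Z' g'" "\<forall>x\<in>carrier X. q1 (u' x) = (f ^^ n) x" "finpd (stable_dec Z')"
      by (rule finconeE)
    note b1 = bipD[OF 1(4)]
    obtain k1 s1 where bk0: "k1 \<in> mod_hom R (sub X ?K) X" "s1 \<in> mod_hom R X (sub X ?K)"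
        "\<And>k. k \<in> ?K \<Longrightarrow> s1 (k1 k) = k" "\<And>w. w \<in> ?W \<Longrightarrow> s1 w = \<zero>\<^bsub>X\<^esub>"
    proof -
      \<comment> \<open>The projection onto \<open>?K\<close> along \<open>?W\<close>;
        \<open>THE\<close> is well defined because the two intersect in zero.\<close>
      define r where "r x = (THE k. k \<in> ?K \<and> (\<exists>w\<in>?W. x = k \<oplus>\<^bsub>X\<^esub> w))" for x
      have un: "k = k'" if kk: "k \<in> ?K" "k' \<in> ?K" "w \<in> ?W" "w' \<in> ?W" "k \<oplus>\<^bsub>X\<^esub> w = k' \<oplus>\<^bsub>X\<^esub> w'" for k k' w w'
      proof -
        have c: "k \<in> carrier X" "k' \<in> carrier X" "w \<in> carrier X" "w' \<in> carrier X" using kk Kc Wc by auto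
        have "k \<ominus>\<^bsub>X\<^esub> k' = w' \<ominus>\<^bsub>X\<^esub> w"
        proof -
          have "k = (k' \<oplus>\<^bsub>X\<^esub> w') \<ominus>\<^bsub>X\<^esub> w" using X.add_diff_cancel[OF c(1,3)] kk(5) by simp
          then have "k = (w' \<ominus>\<^bsub>X\<^esub> w) \<oplus>\<^bsub>X\<^esub> k'" using c by (simp add: X.M.minus_eq X.M.a_ac)
          then show ?thesis using X.diff_eq_iff[of k k' "w' \<ominus>\<^bsub>X\<^esub> w"] c by simp
        qed
        then have "k \<ominus>\<^bsub>X\<^esub> k' \<in> ?K \<inter> ?W" using X.submodule_diff[OF K kk(1,2)] X.submodule_diff[OF W kk(4,3)] by simp
        then have "k \<ominus>\<^bsub>X\<^esub> k' = \<zero>\<^bsub>X\<^esub>" unfolding KW(2) by (rule singletonD)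
        then show ?thesis using X.diff_eq_zero_iff c by blast
      qed
      have r: "r (k \<oplus>\<^bsub>X\<^esub> w) = k" if "k \<in> ?K" "w \<in> ?W" for k w
        unfolding r_def by (rule the_equality) (use that un in blast)+
      have K0: "\<zero>\<^bsub>X\<^esub> \<in> ?K" "\<zero>\<^bsub>X\<^esub> \<in> ?W" using K W by (simp_all add: X.submodule_iff)
      have "r \<in> mod_hom R X (sub X ?K)"
      proof (rule mod_homI)
        fix x assume "x \<in> carrier X"
        then obtain k w where "k \<in> ?K" "w \<in> ?W" "x = k \<oplus>\<^bsub>X\<^esub> w" using decomp by blast
        then show "r x \<in> carrier (sub X ?K)" using r by simp
      next
        fix x y assume "x \<in> carrier X" "y \<in> carrier X"
        then obtain k w k' w' where *: "k \<in> ?K" "w \<in> ?W" "x = k \<oplus>\<^bsub>X\<^esub> w" "k' \<in> ?K" "w' \<in> ?W" "y = k' \<oplus>\<^bsub>X\<^esub> w'"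
          using decomp[of x] decomp[of y] by blast
        have c: "k \<in> carrier X" "k' \<in> carrier X" "w \<in> carrier X" "w' \<in> carrier X" using * Kc Wc by auto
        have "x \<oplus>\<^bsub>X\<^esub> y = (k \<oplus>\<^bsub>X\<^esub> k') \<oplus>\<^bsub>X\<^esub> (w \<oplus>\<^bsub>X\<^esub> w')" using * c by (simp add: X.M.a_ac)
        moreover have "k \<oplus>\<^bsub>X\<^esub> k' \<in> ?K" "w \<oplus>\<^bsub>X\<^esub> w' \<in> ?W" using * K W unfolding X.submodule_iff by blast+
        ultimately have "r (x \<oplus>\<^bsub>X\<^esub> y) = k \<oplus>\<^bsub>X\<^esub> k'" using r by simp
        then show "r (x \<oplus>\<^bsub>X\<^esub> y) = r x \<oplus>\<^bsub>sub X ?K\<^esub> r y" using r * by simp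
      next
        fix a x assume ax: "a \<in> carrier R" "x \<in> carrier X"
        then obtain k w where *: "k \<in> ?K" "w \<in> ?W" "x = k \<oplus>\<^bsub>X\<^esub> w" using decomp[of x] by blast
        have c: "k \<in> carrier X" "w \<in> carrier X" using * Kc Wc by auto
        have "a \<odot>\<^bsub>X\<^esub> x = a \<odot>\<^bsub>X\<^esub> k \<oplus>\<^bsub>X\<^esub> a \<odot>\<^bsub>X\<^esub> w" using * c ax by (simp add: X.smult_r_distr)
        moreover have "a \<odot>\<^bsub>X\<^esub> k \<in> ?K" "a \<odot>\<^bsub>X\<^esub> w \<in> ?W" using * ax K W unfolding X.submodule_iff by blast+
        ultimately have "r (a \<odot>\<^bsub>X\<^esub> x) = a \<odot>\<^bsub>X\<^esub> k" using r by simp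
        then show "r (a \<odot>\<^bsub>X\<^esub> x) = a \<odot>\<^bsub>sub X ?K\<^esub> r x" using r * by simp
      qed
      moreover have "r k = k" if "k \<in> ?K" for k using r[OF that K0(2)] that Kc by auto
      moreover have "r w = \<zero>\<^bsub>X\<^esub>" if "w \<in> ?W" for w using r[OF K0(1) that] that Wc by auto
      ultimately show ?thesis using that incl_hom[OF K lm(1)] by blast
    qed
    \<comment> \<open>The image of \<open>u'\<close> is sent by \<open>q1\<close> into
      \<open>?W\<close>, which \<open>s1\<close> kills. So the map descends to \<open>Z'\<close> and
      makes \<open>?K\<close> a retract of it.\<close>
    have km: "\<exists>\<kappa>. \<kappa> \<in> mod_hom R Z' (sub X ?K) \<and> (\<forall>y\<in>carrier Y'. \<kappa> (g' y) = s1 (q1 y))"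
    proof (rule hom_factor[OF fg_left_module[OF 1(2)] fg_left_module[OF 1(3)] fg_left_module[OF Kf] 1(6,8) hom_comp[OF b1(3) bk0(2)]])
      fix y assume y: "y \<in> carrier Y'" "g' y = \<zero>\<^bsub>Z'\<^esub>"
      then have "y \<in> u' ` carrier X" using 1(9) by (simp add: ker_iff)
      then obtain x where x: "x \<in> carrier X" "y = u' x" by blast
      then show "s1 (q1 y) = \<zero>\<^bsub>sub X ?K\<^esub>" using 1(10) bk0(4) by simp
    qed
    then obtain \<kappa> where \<kappa>: "\<kappa> \<in> mod_hom R Z' (sub X ?K)" "\<And>y. y \<in> carrier Y' \<Longrightarrow> \<kappa> (g' y) = s1 (q1 y)" by blast
    have s: "(\<lambda>k. g' (j1 (k1 k))) \<in> mod_hom R (sub X ?K) Z'" by (rule hom_comp[OF hom_comp[OF bk0(1) b1(1)] 1(6)])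
    have ks: "\<kappa> (g' (j1 (k1 k))) = k" if "k \<in> carrier (sub X ?K)" for k
    proof -
      have "k1 k \<in> carrier X" using hom_closed[OF bk0(1) that] .
      then show ?thesis using \<kappa>(2) b1(5,10) bk0(3) that by simp
    qed
    have "bip R Z' (sub X ?K) (sub Z' (ker Z' (sub X ?K) \<kappa>)) (\<lambda>k. g' (j1 (k1 k))) (\<lambda>x. x) \<kappa> (\<lambda>d. d \<ominus>\<^bsub>Z'\<^esub> g' (j1 (k1 (\<kappa> d))))"
      by (rule split_bip[OF fg_left_module[OF 1(3)] fg_left_module[OF Kf] \<kappa>(1) s]) (rule ks)
    then have "stable_dec Z' = stable_dec (sub X ?K) + stable_dec (sub Z' (ker Z' (sub X ?K) \<kappa>))"
      by (rule stable_dec_dsum[OF bip_dsum 1(3) Kf ker_fg[OF 1(3) fg_left_module[OF Kf] \<kappa>(1)]])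
    then show ?thesis using 1(11) finpd_add by metis
  qed
  \<comment> \<open>This is what remains of \<open>Y\<close> once \<open>?W\<close> is cancelled, a
    direct sum of copies of \<open>?K\<close> and \<open>Q\<close>.\<close>
  let ?E = "{y \<in> carrier Y. p1 y \<in> ?K}"
  have E: "submodule ?E R Y" by (rule preimage_submodule[OF lm(2,1) b(3) K])
  have Ef: "fg_module R (sub Y ?E)" by (rule fg_sub[OF Y E])
  have "bip R (sub Y ?E) (sub X ?K) Q i1 i2 p1 p2"
  proof (rule bipI)
    show "i1 \<in> mod_hom R (sub X ?K) (sub Y ?E)"
      by (intro hom_into_sub hom_restrict[OF b(1) Kc]) (use b Kc in auto)
    show "i2 \<in> mod_hom R Q (sub Y ?E)"
      by (intro hom_into_sub b(2)) (use b K in \<open>auto simp: X.submodule_iff\<close>)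
    show "p1 \<in> mod_hom R (sub Y ?E) (sub X ?K)"
      by (intro hom_into_sub hom_restrict[OF b(3)]) auto
    show "p2 \<in> mod_hom R (sub Y ?E) Q" by (intro hom_restrict[OF b(4)]) auto
    show "i1 (p1 y) \<oplus>\<^bsub>sub Y ?E\<^esub> i2 (p2 y) = y" if "y \<in> carrier (sub Y ?E)" for y using that b(9)[of y] by simp
  qed (use b Kc in auto)
  then have sE: "stable_dec (sub Y ?E) = stable_dec (sub X ?K)"
    using stable_dec_dsum[OF bip_dsum Ef Kf Qf] Q by simp
  have "ses R (sub X ?K) (sub Y ?E) Z"
  proof (rule sesI)
    show "u \<in> mod_hom R (sub X ?K) (sub Y ?E)"
    proof (intro hom_into_sub hom_restrict[OF e(1) Kc])
      show "u ` carrier (sub X ?K) \<subseteq> ?E" using fK Kc hom_closed[OF e(1)] by (auto simp: f_def)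
    qed
    show "g \<in> mod_hom R (sub Y ?E) Z" by (rule hom_restrict[OF e(2)]) auto
    show "inj_on u (carrier (sub X ?K))" using inj_on_subset[OF e(3) Kc] by simp
    show "g ` carrier (sub Y ?E) = carrier Z"
    proof
      show "g ` carrier (sub Y ?E) \<subseteq> carrier Z" using hom_closed[OF e(2)] by auto
      show "carrier Z \<subseteq> g ` carrier (sub Y ?E)"
      proof
        fix z assume "z \<in> carrier Z"
        then obtain y where y: "y \<in> carrier Y" "z = g y" using e(4) by blast
        \<comment> \<open>Subtracting \<open>u w'\<close> from \<open>y\<close> does not change the
          image in \<open>Z\<close>. As \<open>f\<close> maps \<open>?W\<close> onto itself,
          \<open>w'\<close> can be chosen so that the first coordinate ends up in
          \<open>?K\<close>.\<close>
        obtain k x where kx: "k \<in> ?K" "x \<in> carrier X" "p1 y = k \<oplus>\<^bsub>X\<^esub> (f ^^ n) x" using decomp[OF b(12)[OF y(1)]] by blast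
        obtain w' where w': "w' \<in> ?W" "f w' = (f ^^ n) x" using Wsurj kx(2) by blast
        have w'c: "w' \<in> carrier X" using w' Wc by blast
        have uc: "u w' \<in> carrier Y" by (rule hom_closed[OF e(1) w'c])
        have kc: "k \<in> carrier X" using kx Kc by blast
        have "p1 (y \<ominus>\<^bsub>Y\<^esub> u w') = p1 y \<ominus>\<^bsub>X\<^esub> f w'" unfolding f_def by (rule hom_diff[OF lm(2,1) b(3) y(1) uc])
        also have "\<dots> = k" unfolding kx(3) w'(2) using X.add_diff_cancel[OF kc fnc[OF kx(2)]] .
        finally have "y \<ominus>\<^bsub>Y\<^esub> u w' \<in> ?E" using kx(1) y uc by simp
        moreover have "g (u w') = \<zero>\<^bsub>Z\<^esub>"
        proof -
          have "u w' \<in> ker Y Z g" using e(5) w'c by blast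
          then show ?thesis by (simp add: ker_iff)
        qed
        then have "g (y \<ominus>\<^bsub>Y\<^esub> u w') = z"
          using hom_diff[OF lm(2,3) e(2) y(1) uc] y hom_closed[OF e(2) y(1)] Z.diff_eq_iff[of z "\<zero>\<^bsub>Z\<^esub>" z] by simp
        ultimately show "z \<in> g ` carrier (sub Y ?E)" by force
      qed
    qed
    show "u ` carrier (sub X ?K) = ker (sub Y ?E) Z g"
    proof
      show "u ` carrier (sub X ?K) \<subseteq> ker (sub Y ?E) Z g"
      proof
        fix y assume "y \<in> u ` carrier (sub X ?K)"
        then obtain x where x: "x \<in> ?K" "y = u x" by auto
        have "u x \<in> ker Y Z g" using e(5) x Kc by blast
        then show "y \<in> ker (sub Y ?E) Z g" using x fK by (simp add: ker_iff f_def)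
      qed
      show "ker (sub Y ?E) Z g \<subseteq> u ` carrier (sub X ?K)"
      proof
        fix y assume "y \<in> ker (sub Y ?E) Z g"
        then have y: "y \<in> carrier Y" "p1 y \<in> ?K" "y \<in> ker Y Z g" by (simp_all add: ker_iff)
        then obtain x where x: "x \<in> carrier X" "y = u x" using e(5) by blast
        then have "x \<in> ?K" using inK y(2) by (simp add: f_def)
        then show "y \<in> u ` carrier (sub X ?K)" using x by simp
      qed
    qed
  qed
  then have "stable_ses (stable_dec (sub X ?K)) (stable_dec (sub X ?K)) (stable_dec Z)" using SExI[OF Kf Ef Z] sE by simp
  then show ?thesis using finK sX by (intro exI[of _ "stable_dec (sub X ?K)"]) simp
qed

text \<open>Equality of the classes of \<open>X\<close> and \<open>Y\<close> gives an isomorphism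
  only after projective summands have been added. With \<open>P\<close> and \<open>Q\<close> the
  projective parts of \<open>X\<close> and \<open>Y\<close>, the padded sequence has the terms
  \<open>X + Q\<close>, \<open>Y + Q + P\<close> and \<open>Z + P\<close>, and its middle term is
  isomorphic to the first one plus \<open>Q\<close>.\<close>

lemma stable_ses_nilpotent_part:
  assumes "stable_ses a a c" "finpd c"
  shows "\<exists>a'. a' \<subseteq># a \<and> finpd a' \<and> stable_ses a' a' c"
proof -
  obtain X :: "('a, 'a carr) module" and Y :: "('a, 'a carr) module" and Z :: "('a, 'a carr) module" where
    X: "fg_module R X" and Y: "fg_module R Y" and Z: "fg_module R Z" and ses: "ses R X Y Z" and abc: "stable_dec X = a" "stable_dec Y = a" "stable_dec Z = c"
    using assms unfolding stable_ses_def by blast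
  define pX where "pX = filter_mset (is_proj R) (dec X)"
  define pY where "pY = filter_mset (is_proj R) (dec Y)"
  have dX: "dec X = a + pX" and dY: "dec Y = a + pY"
    using abc multiset_partition[of "dec X" "is_proj R"] multiset_partition[of "dec Y" "is_proj R"]
    by (simp_all add: stable_dec_def pX_def pY_def add.commute)
  have ex: "\<exists>Q :: ('a, 'a carr) module. is_proj R Q \<and> dec Q = filter_mset (is_proj R) (dec M)" if M: "fg_module R M" for M :: "('a, 'a carr) module"
  proof -
    have "\<forall>u\<in>#filter_mset (is_proj R) (dec M). fg_module R u \<and> dec u = {#u#}" using dec_elem[OF M] by auto
    then obtain Q :: "('a, 'a carr) module" where Q: "fg_module R Q" "dec Q = filter_mset (is_proj R) (dec M)"
      using dec_realize by blast
    then have "is_proj R Q" unfolding is_proj_iff[OF Q(1)] by simp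
    then show ?thesis using Q by blast
  qed
  obtain P :: "('a, 'a carr) module" where P: "is_proj R P" "dec P = pX" using ex[OF X] by (auto simp: pX_def)
  obtain Q :: "('a, 'a carr) module" where Q: "is_proj R Q" "dec Q = pY" using ex[OF Y] by (auto simp: pY_def)
  have Pf: "fg_module R P" and Qf: "fg_module R Q" using P Q is_proj_fg by auto
  obtain X1 :: "('a, 'a carr) module" where X1: "fg_module R X1" "is_dsum R X1 X Q" using dsum_exists[OF X Qf] by blast
  obtain Y0 :: "('a, 'a carr) module" where Y0: "fg_module R Y0" "is_dsum R Y0 Y Q" using dsum_exists[OF Y Qf] by blast
  obtain Y1 :: "('a, 'a carr) module" where Y1: "fg_module R Y1" "is_dsum R Y1 Y0 P" using dsum_exists[OF Y0(1) Pf] by blast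
  obtain Z1 :: "('a, 'a carr) module" where Z1: "fg_module R Z1" "is_dsum R Z1 Z P" using dsum_exists[OF Z Pf] by blast
  obtain D :: "('a, 'a carr) module" where D: "fg_module R D" "is_dsum R D X1 Q" using dsum_exists[OF X1(1) Qf] by blast
  note l = fg_left_module
  have "ses R X1 Y0 Z" by (rule ses_add_left[OF l[OF X] l[OF Y] l[OF Z] l[OF Qf] l[OF X1(1)] l[OF Y0(1)] ses X1(2) Y0(2)])
  then have s1: "ses R X1 Y1 Z1" by (rule ses_add_right[OF l[OF X1(1)] l[OF Y0(1)] l[OF Z] l[OF Pf] l[OF Z1(1)] l[OF Y1(1)] _ Z1(2) Y1(2)])
  have "dec D = dec Y1"
    using dec_dsum[OF D(2,1) X1(1) Qf] dec_dsum[OF X1(2,1) X Qf] dec_dsum[OF Y1(2,1) Y0(1) Pf] dec_dsum[OF Y0(2,1) Y Qf] dX dY P(2) Q(2)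
    by (simp add: ac_simps)
  then have "mod_iso R D Y1" using dec_iso_iff[OF D(1) Y1(1)] by simp
  then have "is_dsum R Y1 X1 Q"
    by (rule is_dsum_iso[OF l[OF D(1)] l[OF X1(1)] l[OF Qf] D(2) _ mod_iso_refl mod_iso_refl l[OF X1(1)] l[OF Qf]])
  then obtain i1 i2 p1 p2 where b: "bip R Y1 X1 Q i1 i2 p1 p2" unfolding is_dsum_bip by blast
  have sZ: "stable_dec Z1 = c" and sX: "stable_dec X1 = a"
    using stable_dec_dsum[OF Z1(2,1) Z Pf] stable_dec_dsum[OF X1(2,1) X Qf] P(1) Q(1) abc by simp_all
  show ?thesis using nilpotent_part[OF X1(1) Y1(1) Z1(1) Q(1) b s1] sZ sX assms(2) by simp
qed

text \<open>At an exponent that kills \<open>c\<close> the classes of \<open>a\<close> and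
  \<open>b\<close> agree; hence they agree already after \<open>N\<close> syzygies. The sequence
  obtained there has equal classes in its first two places, and by the nilpotent part these may be
  replaced by a class of finite projective dimension. Its summands lie in the finite set
  \<open>G\<close>, so \<open>D\<close> syzygies kill it; the last term costs one more, which gives
  \<open>N + Suc D\<close>.\<close>

theorem igusa_todorov:
  assumes F: "finite F"
  shows "\<exists>d. \<forall>a b c. set_mset a \<subseteq> F \<longrightarrow> set_mset b \<subseteq> F \<longrightarrow> stable_ses a b c \<longrightarrow> finpd c \<longrightarrow> (syz ^^ d) c = {#}"
proof -
  obtain N where N: "\<And>n a b. set_mset a \<subseteq> F \<Longrightarrow> set_mset b \<subseteq> F \<Longrightarrow> (syz ^^ n) a = (syz ^^ n) b \<Longrightarrow> (syz ^^ N) a = (syz ^^ N) b"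
    using syz_pow_injective_bound[OF F] by blast
  define G where "G = (\<Union>U\<in>F. set_mset ((syz ^^ N) {#U#}))"
  have G: "finite G" using F by (simp add: G_def)
  \<comment> \<open>For \<open>U\<close> of infinite projective dimension the value is arbitrary. It
    can only enlarge \<open>D\<close>, whose defining property is claimed for the other classes
    alone. The 0 inserted below covers an empty \<open>G\<close>.\<close>
  define p where "p U = (SOME p. (syz ^^ p) {#U#} = {#})" for U
  define D where "D = Max (insert 0 (p ` G))"
  have D: "(syz ^^ D) {#U#} = {#}" if "U \<in> G" "finpd {#U#}" for U
  proof -
    have "(syz ^^ p U) {#U#} = {#}" using that(2) unfolding finpd_def p_def by (rule someI_ex)
    then show ?thesis by (rule syz_pow_mono) (use G that in \<open>auto simp: D_def\<close>)
  qed
  have Dm: "(syz ^^ D) a = {#}" if "set_mset a \<subseteq> G" "finpd a" for a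
    using that
  proof (induction a)
    case (add u a)
    have eq: "add_mset u a = {#u#} + a" by simp
    have "finpd {#u#}" "finpd a" using add.prems(2) finpd_add[of "{#u#}" a] finpd_add[of a "{#u#}"] by (simp_all add: add.commute)
    then show ?case unfolding eq syz_pow_add using add D by simp
  qed simp
  show ?thesis
  proof (intro exI[of _ "N + Suc D"] allI impI)
    fix a b c assume *: "set_mset a \<subseteq> F" "set_mset b \<subseteq> F" "stable_ses a b c" "finpd c"
    obtain q where q: "(syz ^^ q) c = {#}" using *(4) by (auto simp: finpd_def)
    have "(syz ^^ q) a = (syz ^^ q) b" using stable_ses_syz_pow[OF *(3), of q] q stable_ses_proj_right by simp
    then have ab: "(syz ^^ N) a = (syz ^^ N) b" by (rule N[OF *(1,2)])
    then have "stable_ses ((syz ^^ N) a) ((syz ^^ N) a) ((syz ^^ N) c)" using stable_ses_syz_pow[OF *(3), of N] by simp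
    then obtain a' where a': "a' \<subseteq># (syz ^^ N) a" "finpd a'" "stable_ses a' a' ((syz ^^ N) c)"
      using stable_ses_nilpotent_part finpd_pow[OF *(4)] by blast
    have "set_mset ((syz ^^ N) a) \<subseteq> G"
    proof
      fix v assume "v \<in># (syz ^^ N) a"
      then have "count ((syz ^^ N) a) v \<noteq> 0" by simp
      then have "(\<Sum>U\<in>F. count a U * count ((syz ^^ N) {#U#}) v) \<noteq> 0" by (subst count_syz_pow[OF F *(1), of N v, symmetric])
      then obtain U where "U \<in> F" "count a U * count ((syz ^^ N) {#U#}) v \<noteq> 0"
        by (rule sum.not_neutral_contains_not_neutral)
      then show "v \<in> G" by (auto simp: G_def)
    qed
    then have "(syz ^^ D) a' = {#}" using Dm a'(1,2) set_mset_mono by blast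
    then have "(syz ^^ Suc D) ((syz ^^ N) c) = {#}" using stable_ses_pd_right[OF a'(3)] by blast
    then show "(syz ^^ (N + Suc D)) c = {#}" by (simp only: add.commute[of N] funpow_add comp_apply)
  qed
qed

end

section \<open>Finitistic dimension\<close>

lemma ker_sub_codomain: "ker P (sub X U) f = ker P X f" by (auto simp: ker_iff)

context fl_ring
begin

text \<open>The kernel at place \<open>i\<close> of any projective resolution represents the syzygy
  of order \<open>i + 1\<close> up to projective summands.\<close>

lemma finpd_if_proj_dim:
  fixes X :: "('a, 'a carr) module"
  assumes X: "fg_module R X" and pd: "proj_dim R X < \<infinity>"
  shows "finpd (stable_dec X)"
proof -
  let ?S = "{n. \<exists>P d \<epsilon>. projective_resolution R P d \<epsilon> X \<and> (\<forall>i>n. carrier (P i) = {\<zero>\<^bsub>P i\<^esub>})}"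
  have ne: "?S \<noteq> {}"
  proof
    assume "?S = {}"
    then have "proj_dim R X = (INF n\<in>{}. enat n)" unfolding proj_dim_def by (simp only:)
    then show False using pd by (simp add: top_enat_def)
  qed
  obtain n where "n \<in> ?S" using ne[unfolded ex_in_conv[symmetric]] by (rule exE)
  then obtain P d \<epsilon> where r: "projective_resolution R P d \<epsilon> X" and z: "\<forall>i>n. carrier (P i) = {\<zero>\<^bsub>P i\<^esub>}"
    unfolding mem_Collect_eq by (elim exE conjE) (rule that)
  have P: "is_proj R (P i)" for i using r by (simp add: projective_resolution_def fg_projective_iff)
  have e: "\<epsilon> \<in> mod_hom R (P 0) X" "\<epsilon> ` carrier (P 0) = carrier X" and d: "\<And>i. d i \<in> mod_hom R (P (Suc i)) (P i)"
    and d0: "d 0 ` carrier (P (Suc 0)) = ker (P 0) X \<epsilon>"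
    and ds: "\<And>i. d (Suc i) ` carrier (P (Suc (Suc i))) = ker (P (Suc i)) (P i) (d i)"
    using r unfolding projective_resolution_def by auto
  have Pf: "fg_module R (P i)" for i by (rule is_proj_fg[OF P])
  have Pl: "left_module R (P i)" for i by (rule fg_left_module[OF Pf])
  define K where "K i = (case i of 0 \<Rightarrow> ker (P 0) X \<epsilon> | Suc j \<Rightarrow> ker (P (Suc j)) (P j) (d j))" for i
  have im: "d i ` carrier (P (Suc i)) = K i" for i by (cases i) (simp_all add: K_def d0 ds)
  have Ks: "submodule (K i) R (P i)" for i
    using ker_submodule[OF Pl fg_left_module[OF X] e(1)] ker_submodule[OF Pl Pl d] by (cases i) (simp_all add: K_def)
  have "stable_dec (sub (P i) (K i)) = (syz ^^ Suc i) (stable_dec X)" for i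
  proof (induction i)
    case 0
    show ?case using stable_dec_ker[OF X P e] by (simp add: K_def)
  next
    case (Suc i)
    have h: "d i \<in> mod_hom R (P (Suc i)) (sub (P i) (K i))" using im by (intro hom_into_sub d) simp
    have "stable_dec (sub (P (Suc i)) (ker (P (Suc i)) (sub (P i) (K i)) (d i))) = syz (stable_dec (sub (P i) (K i)))"
      by (rule stable_dec_ker[OF fg_sub[OF Pf Ks] P h]) (simp add: im)
    then show ?case using Suc by (simp add: ker_sub_codomain K_def)
  qed
  \<comment> \<open>Being the image of the zero module at place \<open>n + 1\<close>, the kernel
    vanishes. The exponent obtained is \<open>Suc n\<close>; only finiteness is claimed
    here.\<close>
  moreover have "K n = {\<zero>\<^bsub>P n\<^esub>}"
    using im[of n] z hom_zero[OF Pl Pl d[of n]] by simp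
  then have "dec (sub (P n) (K n)) = {#}" using dec_zero_iff[OF fg_sub[OF Pf Ks[of n]]] by simp
  ultimately have "(syz ^^ Suc n) (stable_dec X) = {#}" by (metis stable_dec_def filter_empty_mset)
  then show ?thesis unfolding finpd_def by blast
qed

text \<open>The resolution is the minimal one, built from the covers that \<open>syzygy\<close>
  chooses. The hypothesis only says that the \<open>n\<close>-th syzygy is projective; minimality
  turns this into the vanishing of all later terms.\<close>

lemma proj_dim_le:
  fixes X :: "('a, 'a carr) module"
  assumes X: "fg_module R X" and pd: "(syz ^^ n) (stable_dec X) = {#}"
  shows "proj_dim R X \<le> enat n"
proof -
  define W where "W i = (syzygy R ^^ i) X" for i
  have Wf: "fg_module R (W i)" for i unfolding W_def by (rule syzygy_pow(1)[OF X])
  have Wl: "left_module R (W i)" for i by (rule fg_left_module[OF Wf])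
  have "\<forall>i. \<exists>P f. projective_cover R P f (W i) \<and> W (Suc i) = sub P (ker P (W i) f)"
    using syzygyE[OF Wf] by (simp add: W_def)
  then obtain P f where pc: "\<And>i. projective_cover R (P i) (f i) (W i)" and WS: "\<And>i. W (Suc i) = sub (P i) (ker (P i) (W i) (f i))"
    by metis
  have P: "is_proj R (P i)" and f: "f i \<in> mod_hom R (P i) (W i)" "f i ` carrier (P i) = carrier (W i)"
    and sf: "superfluous R (P i) (ker (P i) (W i) (f i))" for i
    using pc[of i] unfolding projective_cover_def fg_projective_iff by auto
  have Pl: "left_module R (P i)" for i by (rule fg_left_module[OF is_proj_fg[OF P]])
  have res: "projective_resolution R P (\<lambda>i. f (Suc i)) (f 0) X"
    unfolding projective_resolution_def fg_projective_iff
  proof (intro conjI allI)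
    show "is_proj R (P i)" for i by (rule P)
    show "f 0 \<in> mod_hom R (P 0) X" "f 0 ` carrier (P 0) = carrier X" using f[of 0] by (simp_all add: W_def)
    show "f (Suc i) \<in> mod_hom R (P (Suc i)) (P i)" for i
      using f(1)[of "Suc i"] unfolding WS by (rule hom_from_sub) (auto simp: ker_iff)
    show "f (Suc 0) ` carrier (P (Suc 0)) = ker (P 0) X (f 0)"
      using f(2)[of "Suc 0"] unfolding WS[of 0] by (simp add: W_def)
    show "f (Suc (Suc i)) ` carrier (P (Suc (Suc i))) = ker (P (Suc i)) (P i) (f (Suc i))" for i
      using f(2)[of "Suc (Suc i)"] unfolding WS[of "Suc i"] by (simp add: WS[of i] ker_sub_codomain)
  qed
  have z0: "carrier (W (Suc n)) = {\<zero>\<^bsub>W (Suc n)\<^esub>}"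
  proof -
    interpret P: left_module R "P n" by (rule Pl)
    have "stable_dec (W n) = {#}" using syzygy_pow(2)[OF X, of n] pd by (simp add: W_def)
    then have Wp: "is_proj R (W n)" using is_proj_stable_dec[OF Wf] by simp
    obtain s where s: "s \<in> mod_hom R (W n) (P n)" "\<forall>w\<in>carrier (W n). f n (s w) = w"
      using proj_lift[OF Wp is_proj_fg[OF P] Wf hom_id f] by blast
    have "internal_direct_sum R (P n) (s ` carrier (W n)) (ker (P n) (W n) (f n))"
      by (rule split_internal[OF Pl Wl f(1) s(1)]) (use s(2) in blast)
    then have i: "submodule (s ` carrier (W n)) R (P n)" "s ` carrier (W n) <+>\<^bsub>P n\<^esub> ker (P n) (W n) (f n) = carrier (P n)"
       "s ` carrier (W n) \<inter> ker (P n) (W n) (f n) = {\<zero>\<^bsub>P n\<^esub>}" unfolding internal_direct_sum_def by auto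
    then have "s ` carrier (W n) = carrier (P n)" using sf[of n] unfolding superfluous_def by blast
    then have "ker (P n) (W n) (f n) = {\<zero>\<^bsub>P n\<^esub>}" using i(3) by (auto simp: ker_iff)
    then show ?thesis by (simp add: WS)
  qed
  have zs: "carrier (P i) = {\<zero>\<^bsub>P i\<^esub>}" if "carrier (W i) = {\<zero>\<^bsub>W i\<^esub>}" for i
  proof -
    interpret P: left_module R "P i" by (rule Pl)
    have "ker (P i) (W i) (f i) = carrier (P i)" using that hom_closed[OF f(1)] by (auto simp: ker_iff)
    then have "superfluous R (P i) (carrier (P i))" using sf[of i] by simp
    moreover have "{\<zero>\<^bsub>P i\<^esub>} <+>\<^bsub>P i\<^esub> carrier (P i) = carrier (P i)"
      unfolding set_add_def' by auto
    ultimately show ?thesis unfolding superfluous_def using P.zero_submodule by blast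
  qed
  have Wz: "carrier (W (Suc n + k)) = {\<zero>\<^bsub>W (Suc n + k)\<^esub>}" for k
  proof (induction k)
    case 0 show ?case using z0 by simp
  next
    case (Suc k)
    have "submodule (ker (P (Suc n + k)) (W (Suc n + k)) (f (Suc n + k))) R (P (Suc n + k))" by (rule ker_submodule[OF Pl Wl f(1)])
    then have "ker (P (Suc n + k)) (W (Suc n + k)) (f (Suc n + k)) = {\<zero>\<^bsub>P (Suc n + k)\<^esub>}"
      using zs[OF Suc] left_module.submodule_iff[OF Pl] by auto
    then show ?case by (simp add: WS)
  qed
  have "carrier (P i) = {\<zero>\<^bsub>P i\<^esub>}" if i: "i > n" for i
  proof -
    obtain k where "i = Suc n + k" using less_imp_Suc_add[OF i] by auto
    then show ?thesis using zs Wz by simp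
  qed
  then show ?thesis unfolding proj_dim_def by (intro INF_lower) (use res in blast)
qed

lemma finitistic_dim_finite:
  assumes "\<And>X :: ('a, 'a carr) module. fg_module R X \<Longrightarrow> finpd (stable_dec X) \<Longrightarrow> (syz ^^ d) (stable_dec X) = {#}"
  shows "finitistic_dim R < \<infinity>"
proof -
  have "finitistic_dim R \<le> enat d" unfolding finitistic_dim_def
  proof (rule SUP_least)
    fix X :: "('a, 'a carr) module" assume "X \<in> {M. fg_module R M \<and> proj_dim R M < \<infinity>}"
    then show "proj_dim R X \<le> enat d" using proj_dim_le assms finpd_if_proj_dim by simp
  qed
  then show ?thesis using enat_ord_simps(4) le_less_trans by blast
qed

end

section \<open>Restriction of scalars\<close>

lemma restrict_scalars_simps [simp]:
  "carrier (restrict_scalars \<phi> M) = carrier M" "zero (restrict_scalars \<phi> M) = zero M"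
  "add (restrict_scalars \<phi> M) = add M" "smult (restrict_scalars \<phi> M) = (\<lambda>b x. \<phi> b \<odot>\<^bsub>M\<^esub> x)"
  by (simp_all add: restrict_scalars_def)

lemma abelian_group_cong:
  assumes "abelian_group M" "carrier M' = carrier M" "zero M' = zero M" "add M' = add M"
  shows "abelian_group M'"
proof -
  interpret M: abelian_group M by fact
  show ?thesis
  proof (rule abelian_groupI)
    fix x assume "x \<in> carrier M'"
    then show "\<exists>y\<in>carrier M'. y \<oplus>\<^bsub>M'\<^esub> x = \<zero>\<^bsub>M'\<^esub>" using assms M.l_neg[of x] by (auto intro!: bexI[of _ "\<ominus>\<^bsub>M\<^esub> x"])
  qed (auto simp: assms M.a_ac)
qed

lemma restrict_left_module:
  assumes M: "left_module C M" and B: "ring B" and h: "\<phi> \<in> ring_hom B C"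
  shows "left_module B (restrict_scalars \<phi> M)"
proof -
  interpret M: left_module C M by fact
  have "abelian_group (restrict_scalars \<phi> M)" by (rule abelian_group_cong[OF M.M.abelian_group_axioms]) simp_all
  then show ?thesis
    using ring_hom_memE[OF h] by (intro left_module.intro left_module_axioms.intro B)
      (auto simp: M.smult_l_distr M.smult_r_distr M.smult_assoc1)
qed

lemma restrict_hom:
  assumes "f \<in> mod_hom C X Y" "\<phi> \<in> ring_hom B C"
  shows "f \<in> mod_hom B (restrict_scalars \<phi> X) (restrict_scalars \<phi> Y)"
  using mod_homD[OF assms(1)] ring_hom_memE(1)[OF assms(2)] by (intro mod_homI) auto

text \<open>Module records do not store their ring, so restriction along an inclusion of rings
  leaves the record unchanged, and an \<open>A\<close>-module literally is a
  \<open>B\<close>-module.\<close>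

lemma restrict_id: "restrict_scalars (\<lambda>x. x) M = (M :: ('a, 'm) module)"
  by (simp add: restrict_scalars_def)

lemma restrict_dsum:
  assumes "is_dsum C D X Y" "\<phi> \<in> ring_hom B C"
  shows "is_dsum B (restrict_scalars \<phi> D) (restrict_scalars \<phi> X) (restrict_scalars \<phi> Y)"
proof -
  obtain i1 i2 p1 p2 where "bip C D X Y i1 i2 p1 p2" using assms(1) unfolding is_dsum_bip by blast
  note b = bipD[OF this]
  have "bip B (restrict_scalars \<phi> D) (restrict_scalars \<phi> X) (restrict_scalars \<phi> Y) i1 i2 p1 p2"
    by (rule bipI) (use b restrict_hom[OF _ assms(2)] in auto)
  then show ?thesis by (rule bip_dsum)
qed

lemma restrict_iso:
  "mod_iso C X Y \<Longrightarrow> \<phi> \<in> ring_hom B C \<Longrightarrow> mod_iso B (restrict_scalars \<phi> X) (restrict_scalars \<phi> Y)"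
  unfolding mod_iso_def using restrict_hom by fastforce

locale restriction = B: fl_ring B + C: fl_ring C
  for B :: "('b, 'x) ring_scheme" and C :: "('c, 'y) ring_scheme" and \<phi> :: "'b \<Rightarrow> 'c" +
  assumes hom: "\<phi> \<in> ring_hom B C" and fg: "fg_module B (restrict_scalars \<phi> (reg C))"
begin

abbreviation res :: "('c, 'm) module \<Rightarrow> ('b, 'm) module" where "res \<equiv> restrict_scalars \<phi>"

lemma res_left_module: "left_module C X \<Longrightarrow> left_module B (res X)"
  by (rule restrict_left_module[OF _ B.ring_axioms hom])

text \<open>Products \<open>t s\<close> of generators \<open>t\<close> of \<open>C\<close> over
  \<open>B\<close> and \<open>s\<close> of \<open>X\<close> over \<open>C\<close> generate
  \<open>X\<close> over \<open>B\<close>.\<close>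

lemma res_fg:
  assumes X: "fg_module C X" shows "fg_module B (res X)"
proof -
  have Xl: "left_module C X" by (rule fg_left_module[OF X])
  interpret X: left_module C X by fact
  have Rl: "left_module B (res X)" by (rule res_left_module[OF Xl])
  interpret R: left_module B "res X" by fact
  interpret G: left_module B "res (reg C)" by (rule fg_left_module[OF fg])
  obtain S where S: "finite S" "S \<subseteq> carrier X" "\<And>U. submodule U C X \<Longrightarrow> S \<subseteq> U \<Longrightarrow> U = carrier X"
    using X unfolding fg_module_def finitely_generated_def by blast
  obtain T where T: "finite T" "T \<subseteq> carrier C" "\<And>U. submodule U B (res (reg C)) \<Longrightarrow> T \<subseteq> U \<Longrightarrow> U = carrier C"
    using fg unfolding fg_module_def finitely_generated_def by auto
  let ?G = "(\<lambda>(t, s). t \<odot>\<^bsub>X\<^esub> s) ` (T \<times> S)"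
  note h = ring_hom_memE[OF hom]
  have "U = carrier (res X)" if U: "submodule U B (res X)" "?G \<subseteq> U" for U
  proof -
    have U': "U \<subseteq> carrier X" "\<zero>\<^bsub>X\<^esub> \<in> U" "\<And>x y. x \<in> U \<Longrightarrow> y \<in> U \<Longrightarrow> x \<oplus>\<^bsub>X\<^esub> y \<in> U"
      "\<And>b x. b \<in> carrier B \<Longrightarrow> x \<in> U \<Longrightarrow> \<phi> b \<odot>\<^bsub>X\<^esub> x \<in> U"
      using U(1) by (auto simp: R.submodule_iff)
    have 1: "c \<odot>\<^bsub>X\<^esub> s \<in> U" if s: "s \<in> S" and c: "c \<in> carrier C" for c s
    proof -
      have sc: "s \<in> carrier X" using s S by auto
      have "submodule {c \<in> carrier C. c \<odot>\<^bsub>X\<^esub> s \<in> U} B (res (reg C))"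
        unfolding G.submodule_iff using U' sc h by (auto simp: X.smult_zero_l X.smult_l_distr X.smult_assoc1)
      then have "{c \<in> carrier C. c \<odot>\<^bsub>X\<^esub> s \<in> U} = carrier C" by (rule T(3)) (use T(2) U(2) s in auto)
      then show ?thesis using c by blast
    qed
    have "submodule {x \<in> carrier X. \<forall>c\<in>carrier C. c \<odot>\<^bsub>X\<^esub> x \<in> U} C X"
      unfolding X.submodule_iff using U' by (auto simp: X.smult_zero_r X.smult_r_distr X.smult_assoc1[symmetric])
    then have "{x \<in> carrier X. \<forall>c\<in>carrier C. c \<odot>\<^bsub>X\<^esub> x \<in> U} = carrier X" by (rule S(3)) (use S(2) 1 in auto)
    then have "\<one>\<^bsub>C\<^esub> \<odot>\<^bsub>X\<^esub> x \<in> U" if "x \<in> carrier X" for x using that by blast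
    then show ?thesis using U' by auto
  qed
  moreover have "?G \<subseteq> carrier (res X)" using S T by auto
  moreover have "finite ?G" using S T by auto
  ultimately have "finitely_generated B (res X)" unfolding finitely_generated_def by blast
  then show ?thesis using Rl by (simp add: fg_module_def)
qed

text \<open>Indecomposability may be lost under restriction, so only the sets of occurring summands
  are compared.\<close>

lemma Dec_support:
  "C.Dec X m \<Longrightarrow> set_mset (B.dec (res X)) \<subseteq> (\<Union>u\<in>set_mset m. set_mset (B.dec (res u)))"
proof (induction rule: C.Dec.induct)
  case (zero X)
  have "fg_module B (res X)" by (rule res_fg[OF C.zero_fg[OF zero]])
  then show ?case using B.dec_zero_iff zero(2) by fastforce
next
  case (add X U Y m)
  have "is_dsum B (res X) (res U) (res Y)" by (rule restrict_dsum[OF add(1) hom])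
  then have 1: "B.dec (res X) = B.dec (res U) + B.dec (res Y)"
    by (rule B.dec_dsum[OF _ res_fg[OF add(2)] res_fg[OF add(3)] res_fg[OF C.Dec_fg[OF add(5)]]])
  have "mod_iso B (res U) (res (rep C U))" by (rule restrict_iso[OF rep(2)[OF add(3)] hom])
  then have "B.dec (res U) = B.dec (res (rep C U))" using B.dec_iso_iff[OF res_fg[OF add(3)] res_fg[OF rep(1)[OF add(3)]]] by simp
  then show ?case using 1 add.IH by auto
qed

lemma dec_support:
  assumes X: "fg_module C X"
  shows "set_mset (B.dec (res X)) \<subseteq> (\<Union>u\<in>set_mset (C.dec X). set_mset (B.dec (res u)))"
proof -
  have "mod_iso B (res X) (res (rep C X))" by (rule restrict_iso[OF rep(2)[OF X] hom])
  then have "B.dec (res X) = B.dec (res (rep C X))" using B.dec_iso_iff[OF res_fg[OF X] res_fg[OF rep(1)[OF X]]] by simp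
  then show ?thesis using Dec_support[OF C.Dec_dec[OF X]] by simp
qed

text \<open>Already \<open>n = 0\<close> works: every restricted \<open>C\<close>-module is built
  from the summands of the finitely many restricted indecomposables.\<close>

lemma rep_finite_syzygy_finite:
  assumes "representation_finite C" shows "syzygy_finite_over B \<phi> C"
proof -
  obtain \<M> :: "('c, 'c carr) module set" where M: "finite \<M>"
    "\<And>X :: ('c, 'c carr) module. fg_module C X \<Longrightarrow> indecomposable C X \<Longrightarrow> \<exists>Y\<in>\<M>. mod_iso C X Y"
    using assms unfolding representation_finite_def by blast
  \<comment> \<open>The members of \<open>\<M>\<close> are only known to be structures isomorphic to
    modules, so a genuine finitely generated module is chosen for each of them where one
    exists.\<close>
  define G where "G Y = (SOME u :: ('c, 'c carr) module. fg_module C u \<and> mod_iso C u Y)" for Y :: "('c, 'c carr) module"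
  have G: "fg_module C (G Y) \<and> mod_iso C (G Y) Y" if "fg_module C u" "mod_iso C u Y" for u Y :: "('c, 'c carr) module"
    unfolding G_def by (rule someI[of _ u]) (use that in simp)
  define E where "E = (\<Union>Y\<in>{Y\<in>\<M>. fg_module C (G Y)}. set_mset (B.dec (res (G Y))))"
  have E: "finite E" using M(1) by (simp add: E_def)
  have Ee: "fg_module B u \<and> B.dec u = {#u#}" if uE: "u \<in> E" for u
  proof -
    obtain Y where "Y \<in> \<M>" "fg_module C (G Y)" "u \<in># B.dec (res (G Y))" using uE by (auto simp: E_def)
    then show ?thesis using B.dec_elem[OF res_fg] by blast
  qed
  then obtain N :: "('b, 'b carr) module" where N: "fg_module B N" "B.dec N = mset_set E"
    using B.dec_realize[of "mset_set E"] E by auto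
  have "in_add B N (res X)" if X: "fg_module C X" for X :: "('c, 'b carr) module"
  proof (rule B.dec_in_add[OF N(1) res_fg[OF X]])
    have "set_mset (B.dec (res u)) \<subseteq> E" if u: "u \<in># C.dec X" for u
    proof -
      have uf: "fg_module C u" "indecomposable C u" using C.dec_elem[OF X u] by auto
      obtain Y where Y: "Y \<in> \<M>" "mod_iso C u Y" using M(2)[OF uf] by blast
      have GY: "fg_module C (G Y)" "mod_iso C (G Y) Y" using G[OF uf(1) Y(2)] by auto
      have "mod_iso C u (G Y)" using mod_iso_trans[OF Y(2) mod_iso_sym[OF fg_left_module[OF GY(1)] GY(2)]] .
      then have "mod_iso B (res u) (res (G Y))" by (rule restrict_iso[OF _ hom])
      then have "B.dec (res u) = B.dec (res (G Y))" using B.dec_iso_iff[OF res_fg[OF uf(1)] res_fg[OF GY(1)]] by simp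
      then show ?thesis using Y(1) GY by (auto simp: E_def)
    qed
    then have "(\<Union>u\<in>set_mset (C.dec X). set_mset (B.dec (res u))) \<subseteq> E" by (rule UN_least)
    moreover have "set_mset (B.dec N) = E" using N(2) E by simp
    ultimately show "set_mset (B.dec (res X)) \<subseteq> set_mset (B.dec N)" using dec_support[OF X] by (simp only: subset_trans)
  qed
  then show ?thesis unfolding syzygy_finite_over_def using N(1) by (intro exI[of _ 0] exI[of _ N]) simp
qed

lemma syzygy_finite_support:
  assumes "syzygy_finite_over B \<phi> C"
  shows "\<exists>n F. finite F \<and> (\<forall>X :: ('c, 'b carr) module. fg_module C X \<longrightarrow> set_mset ((B.syz ^^ n) (B.stable_dec (res X))) \<subseteq> F)"
proof -
  obtain n and N :: "('b, 'b carr) module" where N: "fg_module B N"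
     "\<And>X :: ('c, 'b carr) module. fg_module C X \<Longrightarrow> in_add B N ((syzygy B ^^ n) (res X))"
    using assms unfolding syzygy_finite_over_def by blast
  have "set_mset ((B.syz ^^ n) (B.stable_dec (res X))) \<subseteq> set_mset (B.dec N)" if X: "fg_module C X" for X :: "('c, 'b carr) module"
  proof -
    note s = B.syzygy_pow[OF res_fg[OF X], of n]
    have "set_mset (B.dec ((syzygy B ^^ n) (res X))) \<subseteq> set_mset (B.dec N)"
      using B.in_add_dec[OF N(1) fg_left_module[OF s(1)] N(2)[OF X]] by blast
    moreover have "set_mset (B.stable_dec ((syzygy B ^^ n) (res X))) \<subseteq> set_mset (B.dec ((syzygy B ^^ n) (res X)))"
      by (auto simp: B.stable_dec_def)
    ultimately show ?thesis unfolding s(2) by blast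
  qed
  then show ?thesis by (intro exI[of _ n] exI[of _ "set_mset (B.dec N)"]) simp
qed

end

context ring
begin

lemma rad_submodule: "submodule (jacobson_radical R) R (reg R)"
proof -
  interpret L: left_module R "reg R" by (rule reg_left_module)
  have "submodule (\<Inter>(insert (carrier R) {I. maximal_left_ideal I R})) R (reg R)"
    using L.carrier_submodule by (intro L.Inter_submodule) (auto simp: maximal_left_ideal_iff)
  then show ?thesis by (simp add: jacobson_radical_def)
qed

text \<open>For a maximal left ideal \<open>m\<close> that does not contain \<open>b\<close>, the
  elements \<open>y\<close> with \<open>y b\<close> in \<open>m\<close> form a maximal left ideal
  again, and \<open>x\<close> lies in every maximal left ideal.\<close>

lemma rad_right:
  assumes x: "x \<in> jacobson_radical R" and b: "b \<in> carrier R" shows "x \<otimes> b \<in> jacobson_radical R"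
proof -
  interpret L: left_module R "reg R" by (rule reg_left_module)
  have xc: "x \<in> carrier R" using x by (simp add: jacobson_radical_def)
  have "x \<otimes> b \<in> m" if m: "maximal_left_ideal m R" for m
  proof (cases "b \<in> m")
    case True
    then show ?thesis using m xc unfolding maximal_left_ideal_iff L.submodule_iff by auto
  next
    case False
    have ms: "submodule m R (reg R)" using m by (simp add: maximal_left_ideal_iff)
    then have mc: "m \<subseteq> carrier R" by (simp add: L.submodule_iff)
    let ?n = "{y \<in> carrier R. y \<otimes> b \<in> m}"
    have ns: "submodule ?n R (reg R)" using ms b unfolding L.submodule_iff by (auto simp: l_distr m_assoc)
    have "maximal_left_ideal ?n R" unfolding maximal_left_ideal_iff
    proof (intro conjI ns allI impI)
      show "\<one> \<notin> ?n" using False b by simp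
      fix J assume J: "submodule J R (reg R)" "?n \<subseteq> J" "\<one> \<notin> J"
      show "J = ?n"
      proof (rule ccontr)
        assume "J \<noteq> ?n"
        then obtain y where y: "y \<in> J" "y \<notin> ?n" using J(2) by blast
        have yc: "y \<in> carrier R" using y J(1) by (auto simp: L.submodule_iff)
        have "y \<otimes> b \<notin> m" using y yc by simp
        then obtain c \<mu> where c: "c \<in> carrier R" "\<mu> \<in> m" "\<one> = c \<otimes> (y \<otimes> b) \<oplus> \<mu>"
          using maximal_left_ideal_inv[OF m, of "y \<otimes> b"] yc b by blast
        have \<mu>c: "\<mu> \<in> carrier R" using c mc by auto
        have "b = b \<otimes> \<one>" using b by simp
        also have "\<dots> = b \<otimes> (c \<otimes> (y \<otimes> b)) \<oplus> b \<otimes> \<mu>" unfolding c(3) using b c yc \<mu>c by (simp add: r_distr)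
        \<comment> \<open>By this equation \<open>\<one> \<ominus> b c y\<close> multiplies
          \<open>b\<close> into \<open>m\<close>, so it lies in \<open>?n\<close> and hence in
          \<open>J\<close>. Since \<open>b c y\<close> lies in \<open>J\<close> as well,
          \<open>J\<close> would contain \<open>\<one>\<close>.\<close>
        finally have be: "b = (b \<otimes> c \<otimes> y) \<otimes> b \<oplus> b \<otimes> \<mu>" using b c yc \<mu>c by (simp add: m_assoc)
        let ?z = "b \<otimes> c \<otimes> y"
        have zc: "?z \<in> carrier R" using b c yc by simp
        have "(\<one> \<ominus> ?z) \<otimes> b = b \<ominus> ?z \<otimes> b" using zc b by (simp add: minus_eq l_distr l_minus)
        also have "\<dots> = b \<otimes> \<mu>"
        proof -
          have "b \<ominus>\<^bsub>reg R\<^esub> ?z \<otimes> b = b \<otimes> \<mu>"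
            using L.diff_eq_iff[of b "?z \<otimes> b" "b \<otimes> \<mu>"] be zc b \<mu>c by (simp add: a_comm)
          moreover have "b \<ominus>\<^bsub>reg R\<^esub> ?z \<otimes> b = b \<ominus> ?z \<otimes> b" using zc b by (simp add: a_minus_def a_inv_reg)
          ultimately show ?thesis by simp
        qed
        also have "\<dots> \<in> m" using ms b c(2) by (auto simp: L.submodule_iff)
        finally have "\<one> \<ominus> ?z \<in> J" using J(2) zc by auto
        moreover have "?z \<in> J" using J(1) y b c unfolding L.submodule_iff by auto
        ultimately have "(\<one> \<ominus> ?z) \<oplus> ?z \<in> J" using J(1) by (auto simp: L.submodule_iff)
        then show False using J(3) zc by (simp add: minus_eq a_assoc l_neg)
      qed
    qed
    then have "x \<in> ?n" using x unfolding jacobson_radical_def by blast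
    then show ?thesis by simp
  qed
  then show ?thesis using xc b by (simp add: jacobson_radical_def)
qed

text \<open>Let \<open>m\<close> be a maximal left ideal and \<open>V\<close> the set of elements of
  \<open>U\<close> whose coordinate \<open>i\<close> lies in \<open>m\<close>. If \<open>x i\<close>
  were outside \<open>m\<close>, it would have a left inverse modulo \<open>m\<close>, and every
  \<open>u\<close> in \<open>U\<close> could be moved into \<open>V\<close> by subtracting a
  multiple of \<open>x\<close>. Then \<open>V\<close> and \<open>K\<close> together would give
  \<open>U\<close>, so \<open>V\<close> would be all of \<open>U\<close>, although \<open>x\<close>
  is not in \<open>V\<close>.\<close>

lemma superfluous_rad:
  assumes U: "submodule U R (free_mod R n)" and s: "superfluous R (sub (free_mod R n) U) K"
    and x: "x \<in> K" and i: "i < n"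
  shows "x i \<in> jacobson_radical R"
proof -
  let ?F = "free_mod R n"
  interpret L: left_module R "reg R" by (rule reg_left_module)
  interpret F: left_module R ?F by (rule free_left_module)
  interpret U: left_module R "sub ?F U" by (rule F.sub_left_module[OF U])
  have Uc: "U \<subseteq> carrier ?F" using U by (simp only: F.submodule_iff)
  have Kc: "K \<subseteq> U" and K: "submodule K R (sub ?F U)" using s U.submodule_iff[of K] unfolding superfluous_def by auto
  have xc: "y i \<in> carrier R" if "y \<in> U" for y using that Uc i by (auto simp: PiE_iff)
  have xU: "x \<in> U" using x Kc by blast
  have "x i \<in> m" if m: "maximal_left_ideal m R" for m
  proof (rule ccontr)
    assume nm: "x i \<notin> m"
    have ms: "submodule m R (reg R)" using m by (simp add: maximal_left_ideal_iff)
    let ?V = "{u \<in> U. u i \<in> m}"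
    have V: "submodule ?V R (sub ?F U)"
      unfolding U.submodule_iff using ms i U.submodule_iff[of U] U F.submodule_iff[of U] unfolding L.submodule_iff by auto
    obtain c \<mu> where c: "c \<in> carrier R" "\<mu> \<in> m" "\<one> = c \<otimes> x i \<oplus> \<mu>"
      by (rule maximal_left_ideal_inv[OF m xc[OF xU] nm])
    have \<mu>c: "\<mu> \<in> carrier R" using c ms by (auto simp: L.submodule_iff)
    have "u \<in> ?V <+>\<^bsub>sub ?F U\<^esub> K" if u: "u \<in> U" for u
    proof -
      let ?r = "u i \<otimes> c"
      have rc: "?r \<in> carrier R" using xc[OF u] c by simp
      have k: "?r \<odot>\<^bsub>sub ?F U\<^esub> x \<in> K" using K x rc unfolding U.submodule_iff by blast
      have kU: "?r \<odot>\<^bsub>sub ?F U\<^esub> x \<in> U" using k Kc by blast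
      let ?v = "u \<ominus>\<^bsub>sub ?F U\<^esub> (?r \<odot>\<^bsub>sub ?F U\<^esub> x)"
      have vU: "?v \<in> U" using U.diff_closed[of u "?r \<odot>\<^bsub>sub ?F U\<^esub> x"] u kU by (simp del: module_power_simps)
      have uv: "u = ?v \<oplus>\<^bsub>sub ?F U\<^esub> (?r \<odot>\<^bsub>sub ?F U\<^esub> x)" using U.diff_add_cancel[of u "?r \<odot>\<^bsub>sub ?F U\<^esub> x"] u kU by (simp del: module_power_simps)
      have ui: "u i = ?v i \<oplus> ?r \<otimes> x i" using arg_cong[OF uv, of "\<lambda>f. f i"] i by simp
      have "u i = u i \<otimes> (c \<otimes> x i \<oplus> \<mu>)" unfolding c(3)[symmetric] using xc[OF u] by simp
      also have "\<dots> = u i \<otimes> \<mu> \<oplus> ?r \<otimes> x i" using xc[OF u] xc[OF xU] c \<mu>c by (simp add: r_distr m_assoc a_comm)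
      finally have "?v i \<oplus> ?r \<otimes> x i = u i \<otimes> \<mu> \<oplus> ?r \<otimes> x i" using ui by simp
      then have "?v i = u i \<otimes> \<mu>" using xc[OF vU] xc[OF u] xc[OF xU] rc \<mu>c by (simp del: module_power_simps)
      moreover have "u i \<otimes> \<mu> \<in> m" using ms c xc[OF u] by (auto simp: L.submodule_iff)
      ultimately have "?v \<in> ?V" using vU by (simp del: module_power_simps)
      then show ?thesis unfolding set_add_def' using uv k by blast
    qed
    moreover have "?V <+>\<^bsub>sub ?F U\<^esub> K \<subseteq> U" using U.sum_submodule[OF V K] U.submodule_iff[of "?V <+>\<^bsub>sub ?F U\<^esub> K"] by simp
    ultimately have "?V <+>\<^bsub>sub ?F U\<^esub> K = carrier (sub ?F U)" by auto
    then have "?V = carrier (sub ?F U)" using s V unfolding superfluous_def by blast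
    then show False using xU nm by auto
  qed
  then show ?thesis using xc[OF xU] by (simp add: jacobson_radical_def)
qed

end

section \<open>Quotient rings and modules over them\<close>

lemma quot_surj: "ideal I C \<Longrightarrow> (\<lambda>c. I +>\<^bsub>C\<^esub> c) ` carrier C = carrier (C Quot I)"
  by (auto simp: FactRing_def A_RCOSETS_def')

lemma quot_eq_zero:
  assumes "ideal I C" "c \<in> carrier C" shows "I +>\<^bsub>C\<^esub> c = \<zero>\<^bsub>C Quot I\<^esub> \<longleftrightarrow> c \<in> I"
proof -
  interpret ideal I C by fact
  show ?thesis using assms(2) a_rcos_const a_rcos_self by (auto simp: FactRing_def)
qed

text \<open>Taking preimages is a strictly monotone map from the left ideals of the quotient to
  those of \<open>C\<close>.\<close>

lemma quot_finite_len:
  assumes I: "ideal I C" and C: "finite_len C (reg C)"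
  shows "fl_ring (C Quot I)"
proof -
  interpret I: ideal I C by fact
  interpret Q: ring "C Quot I" by (rule I.quotient_is_ring)
  interpret QL: left_module "C Quot I" "reg (C Quot I)" by (rule Q.reg_left_module)
  interpret CL: left_module C "reg C" by (rule I.reg_left_module)
  let ?\<pi> = "\<lambda>c. I +>\<^bsub>C\<^esub> c"
  have h: "?\<pi> \<in> ring_hom C (C Quot I)" by (rule I.rcos_ring_hom)
  note h' = ring_hom_memE[OF h]
  note s = quot_surj[OF I]
  have z: "?\<pi> \<zero>\<^bsub>C\<^esub> = \<zero>\<^bsub>C Quot I\<^esub>" using quot_eq_zero[OF I, of "\<zero>\<^bsub>C\<^esub>"] by simp
  have "finite_len (C Quot I) (reg (C Quot I))"
  proof (rule finite_len_embed[OF C])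
    fix U assume "submodule U (C Quot I) (reg (C Quot I))"
    then show "submodule {c \<in> carrier C. ?\<pi> c \<in> U} C (reg C)"
      unfolding QL.submodule_iff CL.submodule_iff using h' z by auto
  next
    fix U V assume U: "submodule U (C Quot I) (reg (C Quot I))" and V: "submodule V (C Quot I) (reg (C Quot I))" and UV: "U \<subset> V"
    then obtain v where v: "v \<in> V" "v \<notin> U" by blast
    then have "v \<in> carrier (C Quot I)" using V by (auto simp: QL.submodule_iff)
    then obtain c where "c \<in> carrier C" "v = ?\<pi> c" using s by blast
    then show "{c \<in> carrier C. ?\<pi> c \<in> U} \<subset> {c \<in> carrier C. ?\<pi> c \<in> V}" using UV v by blast
  qed
  then show ?thesis by unfold_locales
qed

text \<open>The additive structure is kept and only the action is redefined through preimages under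
  \<open>\<pi>\<close>. Elements that \<open>\<pi>\<close> kills act as zero, so the choice of
  preimage does not matter.\<close>

lemma descend_module:
  fixes Z :: "('c, 'm) module" and \<pi> :: "'c \<Rightarrow> 'd" and D :: "('d, 'y) ring_scheme"
  assumes Z: "left_module C Z" and D: "ring D" and h: "\<pi> \<in> ring_hom C D" and s: "\<pi> ` carrier C = carrier D"
    and k: "\<And>c z. c \<in> carrier C \<Longrightarrow> \<pi> c = \<zero>\<^bsub>D\<^esub> \<Longrightarrow> z \<in> carrier Z \<Longrightarrow> c \<odot>\<^bsub>Z\<^esub> z = \<zero>\<^bsub>Z\<^esub>"
  shows "\<exists>X :: ('d, 'm) module. left_module D X \<and> carrier X = carrier Z \<and> zero X = zero Z \<and> add X = add Z \<and>
     (\<forall>c\<in>carrier C. \<forall>z\<in>carrier Z. \<pi> c \<odot>\<^bsub>X\<^esub> z = c \<odot>\<^bsub>Z\<^esub> z)"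
proof -
  interpret Z: left_module C Z by fact
  note h' = ring_hom_memE[OF h]
  define r where "r = inv_into (carrier C) \<pi>"
  have r: "r d \<in> carrier C" "\<pi> (r d) = d" if "d \<in> carrier D" for d
    using that s by (auto simp: r_def inv_into_into f_inv_into_f)
  have eq: "c \<odot>\<^bsub>Z\<^esub> z = c' \<odot>\<^bsub>Z\<^esub> z" if c: "c \<in> carrier C" "c' \<in> carrier C" "\<pi> c = \<pi> c'" "z \<in> carrier Z" for c c' z
  proof -
    have "\<pi> c = \<pi> (c \<ominus>\<^bsub>C\<^esub> c') \<oplus>\<^bsub>D\<^esub> \<pi> c'"
      using h'(3)[of "c \<ominus>\<^bsub>C\<^esub> c'" c'] c by (simp add: Z.R.minus_eq Z.R.a_assoc Z.R.l_neg)
    moreover have "\<pi> (c \<ominus>\<^bsub>C\<^esub> c') \<in> carrier D" "\<pi> c' \<in> carrier D" using h'(1) c by auto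
    ultimately have "\<pi> (c \<ominus>\<^bsub>C\<^esub> c') = \<zero>\<^bsub>D\<^esub>" using c(3)
      by (metis D abelian_group.r_neg1 abelian_monoid.a_comm abelian_group.axioms(1) abelian_group.a_inv_closed abelian_group.l_neg ring.is_abelian_group)
    then have "(c \<ominus>\<^bsub>C\<^esub> c') \<odot>\<^bsub>Z\<^esub> z = \<zero>\<^bsub>Z\<^esub>" using k c by simp
    then have "c \<odot>\<^bsub>Z\<^esub> z \<ominus>\<^bsub>Z\<^esub> c' \<odot>\<^bsub>Z\<^esub> z = \<zero>\<^bsub>Z\<^esub>"
      using c by (simp add: Z.R.minus_eq Z.M.minus_eq Z.smult_l_distr Z.smult_minus_l)
    then show ?thesis using Z.diff_eq_zero_iff c by simp
  qed
  define X :: "('d, 'm) module" where "X = \<lparr>carrier = carrier Z, monoid.mult = (\<lambda>x y. undefined), one = undefined,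
     zero = zero Z, add = add Z, smult = (\<lambda>d z. r d \<odot>\<^bsub>Z\<^esub> z)\<rparr>"
  have X: "carrier X = carrier Z" "zero X = zero Z" "add X = add Z" "\<And>d z. d \<odot>\<^bsub>X\<^esub> z = r d \<odot>\<^bsub>Z\<^esub> z" by (simp_all add: X_def)
  have "left_module D X"
  proof (intro left_module.intro left_module_axioms.intro D abelian_group_cong[OF Z.M.abelian_group_axioms X(1-3)])
    interpret D: ring D by fact
    fix a b x y assume ab: "a \<in> carrier D" "b \<in> carrier D" and x: "x \<in> carrier X"
    have "r (a \<oplus>\<^bsub>D\<^esub> b) \<odot>\<^bsub>Z\<^esub> x = (r a \<oplus>\<^bsub>C\<^esub> r b) \<odot>\<^bsub>Z\<^esub> x" using ab x r h' by (intro eq) (auto simp: X)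
    then show "(a \<oplus>\<^bsub>D\<^esub> b) \<odot>\<^bsub>X\<^esub> x = a \<odot>\<^bsub>X\<^esub> x \<oplus>\<^bsub>X\<^esub> b \<odot>\<^bsub>X\<^esub> x" using ab x r by (simp add: X Z.smult_l_distr)
    have "r (a \<otimes>\<^bsub>D\<^esub> b) \<odot>\<^bsub>Z\<^esub> x = (r a \<otimes>\<^bsub>C\<^esub> r b) \<odot>\<^bsub>Z\<^esub> x" using ab x r h' by (intro eq) (auto simp: X)
    then show "(a \<otimes>\<^bsub>D\<^esub> b) \<odot>\<^bsub>X\<^esub> x = a \<odot>\<^bsub>X\<^esub> (b \<odot>\<^bsub>X\<^esub> x)" using ab x r by (simp add: X Z.smult_assoc1)
  next
    interpret D: ring D by fact
    fix x assume x: "x \<in> carrier X"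
    have "r \<one>\<^bsub>D\<^esub> \<odot>\<^bsub>Z\<^esub> x = \<one>\<^bsub>C\<^esub> \<odot>\<^bsub>Z\<^esub> x" using x r h' by (intro eq) (auto simp: X)
    then show "\<one>\<^bsub>D\<^esub> \<odot>\<^bsub>X\<^esub> x = x" using x by (simp add: X)
  qed (use r Z.smult_r_distr in \<open>auto simp: X\<close>)
  moreover have "\<pi> c \<odot>\<^bsub>X\<^esub> z = c \<odot>\<^bsub>Z\<^esub> z" if "c \<in> carrier C" "z \<in> carrier Z" for c z
    unfolding X(4) using that r h'(1) by (intro eq) auto
  ultimately show ?thesis using X(1-3) by blast
qed

section \<open>Towers of subalgebras\<close>

context artin_algebra
begin

abbreviation SA :: "'a set \<Rightarrow> ('r, 'a) module" where "SA U \<equiv> A\<lparr>carrier := U\<rparr>"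

lemma alg_left_module: "left_module R A"
  by (intro left_module.intro left_module_axioms.intro)
    (auto simp: smult_l_distr smult_r_distr smult_assoc1 intro: R.ring_axioms abelian_group_axioms)

lemma alg_finite_len: "finite_len R A"
  by (rule left_module.fg_finite_len[OF alg_left_module R.artinian_finite_len[OF artinian_base] finitely_generated])

lemma subalgebraD:
  assumes "unital_subalgebra R A U"
  shows "U \<subseteq> carrier A" "\<zero>\<^bsub>A\<^esub> \<in> U" "\<one>\<^bsub>A\<^esub> \<in> U" "\<And>x y. x \<in> U \<Longrightarrow> y \<in> U \<Longrightarrow> x \<oplus>\<^bsub>A\<^esub> y \<in> U"
    "\<And>x y. x \<in> U \<Longrightarrow> y \<in> U \<Longrightarrow> x \<otimes>\<^bsub>A\<^esub> y \<in> U" "\<And>r x. r \<in> carrier R \<Longrightarrow> x \<in> U \<Longrightarrow> r \<odot>\<^bsub>A\<^esub> x \<in> U"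
    "ring (SA U)"
proof -
  interpret L: left_module R A by (rule alg_left_module)
  have s: "subring U A" and m: "submodule U R A" using assms by (auto simp: unital_subalgebra_def)
  show "U \<subseteq> carrier A" "\<zero>\<^bsub>A\<^esub> \<in> U" "\<And>x y. x \<in> U \<Longrightarrow> y \<in> U \<Longrightarrow> x \<oplus>\<^bsub>A\<^esub> y \<in> U"
    "\<And>r x. r \<in> carrier R \<Longrightarrow> x \<in> U \<Longrightarrow> r \<odot>\<^bsub>A\<^esub> x \<in> U" using m by (auto simp: L.submodule_iff)
  show "\<one>\<^bsub>A\<^esub> \<in> U" "\<And>x y. x \<in> U \<Longrightarrow> y \<in> U \<Longrightarrow> x \<otimes>\<^bsub>A\<^esub> y \<in> U" using subringE[OF s] by auto
  show "ring (SA U)" by (rule A.subring_is_ring[OF s])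
qed

text \<open>\<open>R\<close> acts through the subalgebra.\<close>

lemma stable_submodule:
  assumes U: "unital_subalgebra R A U" and V: "V \<subseteq> carrier A" "\<zero>\<^bsub>A\<^esub> \<in> V" "\<And>x y. x \<in> V \<Longrightarrow> y \<in> V \<Longrightarrow> x \<oplus>\<^bsub>A\<^esub> y \<in> V"
    "\<And>b x. b \<in> U \<Longrightarrow> x \<in> V \<Longrightarrow> b \<otimes>\<^bsub>A\<^esub> x \<in> V"
  shows "submodule V R A"
proof -
  interpret L: left_module R A by (rule alg_left_module)
  have "r \<odot>\<^bsub>A\<^esub> x \<in> V" if "r \<in> carrier R" "x \<in> V" for r x
  proof -
    have xc: "x \<in> carrier A" using that V by auto
    have "(r \<odot>\<^bsub>A\<^esub> \<one>\<^bsub>A\<^esub>) \<otimes>\<^bsub>A\<^esub> x = r \<odot>\<^bsub>A\<^esub> (\<one>\<^bsub>A\<^esub> \<otimes>\<^bsub>A\<^esub> x)" using that xc by (intro smult_assoc_l) auto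
    then have "r \<odot>\<^bsub>A\<^esub> x = (r \<odot>\<^bsub>A\<^esub> \<one>\<^bsub>A\<^esub>) \<otimes>\<^bsub>A\<^esub> x" using xc by simp
    then show ?thesis using V(4)[OF _ that(2)] subalgebraD(6)[OF U that(1) subalgebraD(3)[OF U]] by simp
  qed
  then show ?thesis using V by (simp add: L.submodule_iff)
qed

lemma sub_id_hom: "U \<subseteq> W \<Longrightarrow> (\<lambda>x. x) \<in> ring_hom (SA U) (SA W)"
  by (intro ring_hom_memI) auto

lemma reg_sub_left_module:
  assumes U: "unital_subalgebra R A U" and W: "unital_subalgebra R A W" and UW: "U \<subseteq> W"
  shows "left_module (SA U) (reg (SA W))"
  using restrict_left_module[OF ring.reg_left_module[OF subalgebraD(7)[OF W]] subalgebraD(7)[OF U] sub_id_hom[OF UW]]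
  by (simp only: restrict_id)

text \<open>Submodules over the subalgebra are also \<open>R\<close>-submodules of \<open>A\<close>,
  and \<open>A\<close> has finite length over the artinian base ring.\<close>

lemma reg_sub_finite_len:
  assumes U: "unital_subalgebra R A U" and W: "unital_subalgebra R A W" and UW: "U \<subseteq> W"
  shows "finite_len (SA U) (reg (SA W))"
proof (rule finite_len_embed[OF alg_finite_len, of _ _ "\<lambda>V. V"])
  interpret M: left_module "SA U" "reg (SA W)" by (rule reg_sub_left_module[OF assms])
  fix V assume V: "submodule V (SA U) (reg (SA W))"
  show "submodule V R A"
    by (rule stable_submodule[OF U]) (use V subalgebraD(1)[OF W] in \<open>auto simp: M.submodule_iff\<close>)
qed

lemma sub_fl:
  assumes "unital_subalgebra R A U" shows "fl_ring (SA U)"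
proof -
  interpret ring "SA U" by (rule subalgebraD(7)[OF assms])
  show ?thesis by unfold_locales (rule reg_sub_finite_len[OF assms assms order_refl])
qed

lemma reg_sub_fg:
  assumes U: "unital_subalgebra R A U" and W: "unital_subalgebra R A W" and UW: "U \<subseteq> W"
  shows "fg_module (SA U) (reg (SA W))"
  unfolding fg_module_def
  using reg_sub_left_module[OF assms] left_module.finite_len_fg[OF reg_sub_left_module[OF assms] reg_sub_finite_len[OF assms]] by simp

lemma sub_restriction:
  assumes U: "unital_subalgebra R A U" and W: "unital_subalgebra R A W" and UW: "U \<subseteq> W"
  shows "restriction (SA U) (SA W) (\<lambda>x. x)"
  by (intro restriction.intro restriction_axioms.intro sub_fl U W sub_id_hom UW) (simp only: restrict_id reg_sub_fg[OF assms])

lemma quot_restriction: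
  assumes U: "unital_subalgebra R A U" and W: "unital_subalgebra R A W" and UW: "U \<subseteq> W" and I: "ideal I (SA W)"
  shows "restriction (SA U) (SA W Quot I) (\<lambda>b. I +>\<^bsub>A\<^esub> b)"
proof -
  interpret W: fl_ring "SA W" by (rule sub_fl[OF W])
  interpret I: ideal I "SA W" by fact
  \<comment> \<open>Cosets only involve addition, which \<open>A\<close> and its subalgebras
    share.\<close>
  have c: "I +>\<^bsub>A\<^esub> b = I +>\<^bsub>SA W\<^esub> b" for b by (simp add: a_r_coset_def r_coset_def)
  have h: "(\<lambda>b. I +>\<^bsub>A\<^esub> b) \<in> ring_hom (SA W) (SA W Quot I)" unfolding c by (rule I.rcos_ring_hom)
  have hU: "(\<lambda>b. I +>\<^bsub>A\<^esub> b) \<in> ring_hom (SA U) (SA W Quot I)"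
  proof (rule ring_hom_memI)
    fix x y assume "x \<in> carrier (SA U)" "y \<in> carrier (SA U)"
    then have xy: "x \<in> carrier (SA W)" "y \<in> carrier (SA W)" using UW by auto
    show "I +>\<^bsub>A\<^esub> x \<in> carrier (SA W Quot I)" by (rule ring_hom_memE(1)[OF h xy(1)])
    show "I +>\<^bsub>A\<^esub> (x \<otimes>\<^bsub>SA U\<^esub> y) = (I +>\<^bsub>A\<^esub> x) \<otimes>\<^bsub>SA W Quot I\<^esub> (I +>\<^bsub>A\<^esub> y)"
      using ring_hom_memE(2)[OF h xy] by simp
    show "I +>\<^bsub>A\<^esub> (x \<oplus>\<^bsub>SA U\<^esub> y) = (I +>\<^bsub>A\<^esub> x) \<oplus>\<^bsub>SA W Quot I\<^esub> (I +>\<^bsub>A\<^esub> y)"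
      using ring_hom_memE(3)[OF h xy] by simp
  next
    show "I +>\<^bsub>A\<^esub> \<one>\<^bsub>SA U\<^esub> = \<one>\<^bsub>SA W Quot I\<^esub>" using ring_hom_memE(4)[OF h] by simp
  qed
  have Q: "fl_ring (SA W Quot I)" by (rule quot_finite_len[OF I W.fl])
  interpret Q: fl_ring "SA W Quot I" by (rule Q)
  have L: "left_module (SA U) (restrict_scalars (\<lambda>b. I +>\<^bsub>A\<^esub> b) (reg (SA W Quot I)))"
    by (rule restrict_left_module[OF Q.reg_left_module subalgebraD(7)[OF U] hU])
  have "(\<lambda>b. I +>\<^bsub>A\<^esub> b) \<in> mod_hom (SA U) (reg (SA W)) (restrict_scalars (\<lambda>b. I +>\<^bsub>A\<^esub> b) (reg (SA W Quot I)))"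
    using ring_hom_memE[OF h] UW by (intro mod_homI) auto
  moreover have "(\<lambda>b. I +>\<^bsub>A\<^esub> b) ` carrier (reg (SA W)) = carrier (restrict_scalars (\<lambda>b. I +>\<^bsub>A\<^esub> b) (reg (SA W Quot I)))"
    using quot_surj[OF I] by (simp add: c)
  ultimately have "fg_module (SA U) (restrict_scalars (\<lambda>b. I +>\<^bsub>A\<^esub> b) (reg (SA W Quot I)))"
    using fg_image[OF reg_sub_left_module[OF U W UW] L] reg_sub_fg[OF U W UW] L by (simp add: fg_module_def)
  then show ?thesis by (intro restriction.intro restriction_axioms.intro sub_fl U Q hU)
qed

end

text \<open>A submodule \<open>L\<close> of a free module is a syzygy of the quotient up to
  projective summands, so Schanuel's lemma places its summands among those of \<open>N\<close> and
  of the regular module. Projective summands are recorded by \<open>dec\<close> instead of being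
  discarded, because an \<open>A\<close>-projective module need not be projective over a
  subalgebra.\<close>

lemma (in fl_ring) one_syzygy_finite_support:
  assumes "one_syzygy_finite R"
  shows "\<exists>F. finite F \<and> F \<subseteq> {u. fg_module R u} \<and> (\<forall>n L. submodule L R (free_mod R n) \<longrightarrow> set_mset (dec (sub (free_mod R n) L)) \<subseteq> F)"
proof -
  obtain N :: "('a, 'a carr) module" where N: "fg_module R N" "\<And>X :: ('a, 'a carr) module. fg_module R X \<Longrightarrow> in_add R N (syzygy R X)"
    using assms unfolding one_syzygy_finite_def by blast
  let ?F = "set_mset (dec N) \<union> set_mset (dec (reg R))"
  have "set_mset (dec (sub (free_mod R n) L)) \<subseteq> ?F" if L: "submodule L R (free_mod R n)" for n L
  proof -
    let ?G = "free_mod R n"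
    obtain Q :: "('a, 'a carr) module" and q where Q: "fg_module R Q" "q \<in> mod_hom R ?G Q" "q ` carrier ?G = carrier Q" "ker ?G Q q = L"
      using quotient_exists[OF free_fg L] by blast
    obtain P f where P: "projective_cover R P f Q" "syzygy R Q = sub P (ker P Q f)" using syzygyE[OF Q(1)] by blast
    then have P': "is_proj R P" "f \<in> mod_hom R P Q" "f ` carrier P = carrier Q"
      by (auto simp: projective_cover_def fg_projective_iff)
    have "dec (sub ?G (ker ?G Q q)) + dec P = dec (sub P (ker P Q f)) + dec ?G"
      by (rule schanuel[OF free_is_proj[OF ring_axioms] P'(1) fg_left_module[OF Q(1)] Q(2,3) P'(2,3)])
    then have e: "dec (sub ?G L) + dec P = dec (syzygy R Q) + repeat_mset n (dec (reg R))"
      unfolding Q(4) P(2) dec_power[OF reg_fg] .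
    have "set_mset (dec (syzygy R Q)) \<subseteq> set_mset (dec N)"
      using in_add_dec[OF N(1) fg_left_module[OF syzygy_syz_class(2)[OF Q(1)]] N(2)[OF Q(1)]] by blast
    moreover have "set_mset (repeat_mset n (dec (reg R))) \<subseteq> set_mset (dec (reg R))"
    proof
      fix u assume "u \<in># repeat_mset n (dec (reg R))"
      then have "0 < count (repeat_mset n (dec (reg R))) u" by (simp only: count_greater_zero_iff)
      then show "u \<in># dec (reg R)" by simp
    qed
    moreover have "set_mset (dec (sub ?G L)) \<subseteq> set_mset (dec (sub ?G L) + dec P)" by simp
    ultimately show ?thesis unfolding e by (simp only: set_mset_union) blast
  qed
  moreover have "?F \<subseteq> {u. fg_module R u}" using dec_elem(1)[OF N(1)] dec_elem(1)[OF reg_fg] by blast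
  ultimately show ?thesis by (intro exI[of _ ?F]) simp
qed

locale radical_tower = artin_algebra R A for R :: "('r, 'x) ring_scheme" and A :: "('r, 'a) module" +
  fixes S :: "nat \<Rightarrow> 'a set" and s :: nat
  assumes s: "s \<ge> 1"
    and subalg: "\<And>i. i \<le> s \<Longrightarrow> unital_subalgebra R A (S i)"
    and step: "\<And>i. 1 \<le> i \<Longrightarrow> i \<le> s \<Longrightarrow> S (i - 1) \<subseteq> S i"
    and top: "S s = carrier A"
    and rad: "\<And>i. 1 \<le> i \<Longrightarrow> i \<le> s \<Longrightarrow>
          left_ideal (jacobson_radical (A\<lparr>carrier := S (i - 1)\<rparr>)) (A\<lparr>carrier := S i\<rparr>)"
begin

lemma S_mono: "i \<le> k \<Longrightarrow> k \<le> s \<Longrightarrow> S i \<subseteq> S k"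
proof (induction k rule: dec_induct)
  case (step k)
  then show ?case using radical_tower.step[OF radical_tower_axioms, of "Suc k"] by auto
qed simp

lemma rad_props:
  assumes i: "i \<le> s"
  defines "J \<equiv> jacobson_radical (SA (S i))"
  shows "J \<subseteq> S i" "\<zero>\<^bsub>A\<^esub> \<in> J" "\<And>x y. x \<in> J \<Longrightarrow> y \<in> J \<Longrightarrow> x \<oplus>\<^bsub>A\<^esub> y \<in> J"
    "\<And>x b. x \<in> J \<Longrightarrow> b \<in> S i \<Longrightarrow> x \<otimes>\<^bsub>A\<^esub> b \<in> J" "\<And>a x. a \<in> S i \<Longrightarrow> x \<in> J \<Longrightarrow> a \<otimes>\<^bsub>A\<^esub> x \<in> J"
    "\<And>a x. Suc i \<le> s \<Longrightarrow> a \<in> S (Suc i) \<Longrightarrow> x \<in> J \<Longrightarrow> a \<otimes>\<^bsub>A\<^esub> x \<in> J"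
proof -
  interpret B: ring "SA (S i)" by (rule subalgebraD(7)[OF subalg[OF i]])
  interpret L: left_module "SA (S i)" "reg (SA (S i))" by (rule B.reg_left_module)
  show "J \<subseteq> S i" "\<zero>\<^bsub>A\<^esub> \<in> J" "\<And>x y. x \<in> J \<Longrightarrow> y \<in> J \<Longrightarrow> x \<oplus>\<^bsub>A\<^esub> y \<in> J"
    "\<And>a x. a \<in> S i \<Longrightarrow> x \<in> J \<Longrightarrow> a \<otimes>\<^bsub>A\<^esub> x \<in> J"
    using B.rad_submodule unfolding L.submodule_iff J_def by auto
  show "\<And>x b. x \<in> J \<Longrightarrow> b \<in> S i \<Longrightarrow> x \<otimes>\<^bsub>A\<^esub> b \<in> J" using B.rad_right by (auto simp: J_def)
  show "\<And>a x. Suc i \<le> s \<Longrightarrow> a \<in> S (Suc i) \<Longrightarrow> x \<in> J \<Longrightarrow> a \<otimes>\<^bsub>A\<^esub> x \<in> J"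
    using rad[of "Suc i"] by (auto simp: left_ideal_def J_def)
qed

text \<open>For \<open>k > 0\<close> the leftmost factor is the radical of
  \<open>S (i + k - 1)\<close>, a left ideal of \<open>S (i + k)\<close>, and the rightmost is the
  radical of \<open>S i\<close>, a two-sided ideal there. So each new factor on the left raises the
  ring that acts from the left by one level.\<close>

lemma rad_product_props:
  "i + k \<le> s \<Longrightarrow> rad_product A S i k \<subseteq> S i \<and> \<zero>\<^bsub>A\<^esub> \<in> rad_product A S i k \<and>
    (\<forall>x\<in>rad_product A S i k. \<forall>y\<in>rad_product A S i k. x \<oplus>\<^bsub>A\<^esub> y \<in> rad_product A S i k) \<and>
    (\<forall>a\<in>S (i + k). \<forall>x\<in>rad_product A S i k. a \<otimes>\<^bsub>A\<^esub> x \<in> rad_product A S i k) \<and>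
    (\<forall>x\<in>rad_product A S i k. \<forall>a\<in>S i. x \<otimes>\<^bsub>A\<^esub> a \<in> rad_product A S i k)"
proof (induction k)
  case 0
  then show ?case using subalgebraD[OF subalg[of i]] by auto
next
  case (Suc k)
  show ?case
  \<comment> \<open>The empty product is \<open>S i\<close> itself, so an ideal product is formed
    only from the second radical onwards.\<close>
  proof (cases k)
    case 0
    then show ?thesis using rad_props[of i] Suc.prems by auto
  next
    case (Suc k')
    let ?J = "jacobson_radical (SA (S (i + k)))" and ?P = "rad_product A S i k"
    have eq: "rad_product A S i (Suc k) = ideal_prod A ?J ?P" using Suc by simp
    have IH: "?P \<subseteq> S i" "\<zero>\<^bsub>A\<^esub> \<in> ?P" "\<And>x y. x \<in> ?P \<Longrightarrow> y \<in> ?P \<Longrightarrow> x \<oplus>\<^bsub>A\<^esub> y \<in> ?P"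
      "\<And>a x. a \<in> S (i + k) \<Longrightarrow> x \<in> ?P \<Longrightarrow> a \<otimes>\<^bsub>A\<^esub> x \<in> ?P" "\<And>x a. x \<in> ?P \<Longrightarrow> a \<in> S i \<Longrightarrow> x \<otimes>\<^bsub>A\<^esub> a \<in> ?P"
      using Suc.IH Suc.prems by auto
    have ik: "i + k \<le> s" "Suc (i + k) \<le> s" using Suc.prems by auto
    note J = rad_props[OF ik(1)]
    have Jc: "?J \<subseteq> carrier A" using J(1) subalgebraD(1)[OF subalg[OF ik(1)]] by auto
    have Pc: "?P \<subseteq> carrier A" using IH(1) subalgebraD(1)[OF subalg[of i]] ik by auto
    have Sc: "S (Suc (i + k)) \<subseteq> carrier A" "S i \<subseteq> carrier A" using subalgebraD(1)[OF subalg] ik by auto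
    have QP: "x \<in> ?P" if "x \<in> ideal_prod A ?J ?P" for x
      using that by (induction rule: ideal_prod.induct) (use IH(3,4) J(1) in auto)
    have z: "\<zero>\<^bsub>A\<^esub> \<in> ideal_prod A ?J ?P" using ideal_prod.prod[of "\<zero>\<^bsub>A\<^esub>" ?J "\<zero>\<^bsub>A\<^esub>" ?P A] J(2) IH(2) by simp
    have l: "a \<otimes>\<^bsub>A\<^esub> x \<in> ideal_prod A ?J ?P" if a: "a \<in> S (Suc (i + k))" and x: "x \<in> ideal_prod A ?J ?P" for a x
      using x
    proof (induction rule: ideal_prod.induct)
      case (prod u v)
      have "a \<otimes>\<^bsub>A\<^esub> (u \<otimes>\<^bsub>A\<^esub> v) = (a \<otimes>\<^bsub>A\<^esub> u) \<otimes>\<^bsub>A\<^esub> v" using prod a Jc Pc Sc by (intro A.m_assoc[symmetric]) auto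
      then show ?case using ideal_prod.prod[OF J(6)[OF ik(2) a prod(1)] prod(2)] by simp
    next
      case (sum u v)
      have "u \<in> carrier A" "v \<in> carrier A" using QP sum Pc by auto
      then have "a \<otimes>\<^bsub>A\<^esub> (u \<oplus>\<^bsub>A\<^esub> v) = (a \<otimes>\<^bsub>A\<^esub> u) \<oplus>\<^bsub>A\<^esub> (a \<otimes>\<^bsub>A\<^esub> v)" using a Sc by (intro A.r_distr) auto
      then show ?case using ideal_prod.sum[OF sum.IH] by simp
    qed
    have r: "x \<otimes>\<^bsub>A\<^esub> a \<in> ideal_prod A ?J ?P" if a: "a \<in> S i" and x: "x \<in> ideal_prod A ?J ?P" for a x
      using x
    proof (induction rule: ideal_prod.induct)
      case (prod u v)
      have "(u \<otimes>\<^bsub>A\<^esub> v) \<otimes>\<^bsub>A\<^esub> a = u \<otimes>\<^bsub>A\<^esub> (v \<otimes>\<^bsub>A\<^esub> a)" using prod a Jc Pc Sc by (intro A.m_assoc) auto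
      then show ?case using ideal_prod.prod[OF prod(1) IH(5)[OF prod(2) a], of A] by simp
    next
      case (sum u v)
      have "u \<in> carrier A" "v \<in> carrier A" using QP sum Pc by auto
      then have "(u \<oplus>\<^bsub>A\<^esub> v) \<otimes>\<^bsub>A\<^esub> a = (u \<otimes>\<^bsub>A\<^esub> a) \<oplus>\<^bsub>A\<^esub> (v \<otimes>\<^bsub>A\<^esub> a)" using a Sc by (intro A.l_distr) auto
      then show ?case using ideal_prod.sum[OF sum.IH] by simp
    qed
    show ?thesis unfolding eq using QP IH(1) z ideal_prod.sum l r by auto
  qed
qed

text \<open>The number \<open>s - j\<close> of factors takes the stability on the left up to
  \<open>S s\<close>, which is \<open>A\<close>; in particular the product is stable under
  \<open>S j\<close> on both sides.\<close>

lemma rad_product_ideal: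
  assumes j: "j \<le> s" shows "ideal (rad_product A S j (s - j)) (SA (S j))"
proof -
  let ?I = "rad_product A S j (s - j)"
  interpret C: ring "SA (S j)" by (rule subalgebraD(7)[OF subalg[OF j]])
  interpret L: left_module "SA (S j)" "reg (SA (S j))" by (rule C.reg_left_module)
  have p: "?I \<subseteq> S j" "\<zero>\<^bsub>A\<^esub> \<in> ?I" "\<And>x y. x \<in> ?I \<Longrightarrow> y \<in> ?I \<Longrightarrow> x \<oplus>\<^bsub>A\<^esub> y \<in> ?I"
    "\<And>a x. a \<in> carrier A \<Longrightarrow> x \<in> ?I \<Longrightarrow> a \<otimes>\<^bsub>A\<^esub> x \<in> ?I" "\<And>x a. x \<in> ?I \<Longrightarrow> a \<in> S j \<Longrightarrow> x \<otimes>\<^bsub>A\<^esub> a \<in> ?I"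
    using rad_product_props[of j "s - j"] j top by auto
  have "submodule ?I (SA (S j)) (reg (SA (S j)))"
    using p subalgebraD(1)[OF subalg[OF j]] by (auto simp: L.submodule_iff)
  then have l: "left_ideal ?I (SA (S j))" by (simp add: C.left_ideal_iff)
  then interpret additive_subgroup ?I "SA (S j)" by (simp add: left_ideal_def)
  show ?thesis
    by (intro idealI C.ring_axioms a_subgroup) (use l p(5) in \<open>auto simp: left_ideal_def\<close>)
qed

lemma free_sub_eq: "sub (free_mod (SA U) n) K = sub (free_mod A n) K"
  by (simp add: module_power_def reg_def)

text \<open>Second syzygies over \<open>S 0\<close> are \<open>S 1\<close>-modules: inside a minimal resolution by summands of free modules they
  are cut out of \<open>rad(S 0)\<^sup>n\<close> by equations that are linear over \<open>A\<close>.\<close>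

lemma second_syzygy:
  fixes X :: "('a, 'a carr) module"
  assumes X: "fg_module (SA (S 0)) X"
  shows "\<exists>n K. K \<subseteq> carrier (free_mod (SA (S 0)) n) \<and> submodule K (SA (S 0)) (free_mod (SA (S 0)) n) \<and>
     (\<forall>a\<in>S 1. \<forall>x\<in>K. a \<odot>\<^bsub>free_mod A n\<^esub> x \<in> K) \<and> fg_module (SA (S 0)) (sub (free_mod A n) K) \<and>
     fl_ring.stable_dec (SA (S 0)) (sub (free_mod A n) K) = fl_ring.syz (SA (S 0)) (fl_ring.syz (SA (S 0)) (fl_ring.stable_dec (SA (S 0)) X))"
proof -
  let ?B = "SA (S 0)"
  interpret B: fl_ring ?B by (rule sub_fl[OF subalg]) simp
  \<comment> \<open>Minimal covers are taken as summands \<open>U\<close> of free modules that are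
    images of idempotents \<open>e\<close>, so that membership in \<open>U\<close> becomes the
    equation \<open>e x = x\<close>.\<close>
  have cover: "\<exists>n U f e. submodule U ?B (free_mod ?B n) \<and> f \<in> mod_hom ?B (free_mod ?B n) Y \<and> f ` U = carrier Y \<and>
      superfluous ?B (sub (free_mod ?B n) U) (ker (sub (free_mod ?B n) U) Y f) \<and>
      e \<in> mod_hom ?B (free_mod ?B n) (sub (free_mod ?B n) U) \<and> (\<forall>u\<in>U. e u = u) \<and> is_proj ?B (sub (free_mod ?B n) U)"
    if Y: "fg_module ?B Y" for Y :: "('a, 'q) module"
  proof -
    obtain n f where f: "is_proj ?B (free_mod ?B n)" "f \<in> mod_hom ?B (free_mod ?B n) Y" "f ` carrier (free_mod ?B n) = carrier Y"
      using B.proj_epi[OF Y] by blast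
    obtain U e where U: "submodule U ?B (free_mod ?B n)" "f ` U = carrier Y" "superfluous ?B (sub (free_mod ?B n) U) (ker (sub (free_mod ?B n) U) Y f)"
      "e \<in> mod_hom ?B (free_mod ?B n) (sub (free_mod ?B n) U)" "\<forall>u\<in>U. e u = u"
      using B.cover_in[OF f(1) Y f(2,3)] by blast
    then show ?thesis using B.retract_proj[OF f(1) U(1,4,5)] f(2) by blast
  qed
  obtain m U0 f0 e0 where c0: "submodule U0 ?B (free_mod ?B m)" "f0 \<in> mod_hom ?B (free_mod ?B m) X" "f0 ` U0 = carrier X"
      "is_proj ?B (sub (free_mod ?B m) U0)" using cover[OF X] by blast
  let ?G = "free_mod ?B m"
  interpret F0: left_module ?B ?G by (rule B.free_left_module)
  have U0c: "U0 \<subseteq> carrier ?G" using c0(1) by (simp only: F0.submodule_iff)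
  have h0: "f0 \<in> mod_hom ?B (sub ?G U0) X" by (rule hom_restrict[OF c0(2) U0c])
  let ?L = "ker (sub ?G U0) X f0"
  have K0: "submodule ?L ?B (sub ?G U0)" by (rule ker_submodule[OF F0.sub_left_module[OF c0(1)] fg_left_module[OF X] h0])
  then have K0s: "submodule ?L ?B ?G" using F0.submodule_sub_iff[OF c0(1)] by blast
  define Y where "Y = sub ?G ?L"
  have Yeq: "Y = sub (sub ?G U0) ?L" by (simp add: Y_def)
  have Yf: "fg_module ?B Y" unfolding Y_def by (rule B.fg_sub[OF B.free_fg K0s])
  have sY: "B.stable_dec Y = B.syz (B.stable_dec X)" unfolding Yeq
    by (rule B.stable_dec_ker[OF X c0(4) h0]) (simp add: c0(3))
  obtain n U f e where c: "submodule U ?B (free_mod ?B n)" "f \<in> mod_hom ?B (free_mod ?B n) Y" "f ` U = carrier Y"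
      "superfluous ?B (sub (free_mod ?B n) U) (ker (sub (free_mod ?B n) U) Y f)"
      "e \<in> mod_hom ?B (free_mod ?B n) (sub (free_mod ?B n) U)" "\<forall>u\<in>U. e u = u" "is_proj ?B (sub (free_mod ?B n) U)"
    using cover[OF Yf] by blast
  let ?F = "free_mod ?B n"
  interpret F: left_module ?B ?F by (rule B.free_left_module)
  have Uc: "U \<subseteq> carrier ?F" using c(1) by (simp only: F.submodule_iff)
  have h: "f \<in> mod_hom ?B (sub ?F U) Y" by (rule hom_restrict[OF c(2) Uc])
  let ?K = "ker (sub ?F U) Y f"
  have K: "submodule ?K ?B (sub ?F U)" by (rule ker_submodule[OF F.sub_left_module[OF c(1)] fg_left_module[OF Yf] h])
  then have Ks: "submodule ?K ?B ?F" using F.submodule_sub_iff[OF c(1)] by blast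
  have Kc: "?K \<subseteq> carrier ?F" using Ks by (simp only: F.submodule_iff)
  have eq: "sub (free_mod A n) ?K = sub ?F ?K" by (rule free_sub_eq[symmetric])
  have eq': "sub (free_mod A n) ?K = sub (sub ?F U) ?K" unfolding eq by simp
  have Kf: "fg_module ?B (sub (free_mod A n) ?K)" unfolding eq by (rule B.fg_sub[OF B.free_fg Ks])
  have sK: "B.stable_dec (sub (free_mod A n) ?K) = B.syz (B.syz (B.stable_dec X))"
    unfolding eq' sY[symmetric] by (rule B.stable_dec_ker[OF Yf c(7) h]) (simp add: c(3))
  interpret FA: left_module A "free_mod A n" by (rule A.free_left_module)
  interpret FA0: left_module A "free_mod A m" by (rule A.free_left_module)
  have Bc: "S 0 \<subseteq> carrier A" using subalgebraD(1)[OF subalg[of 0]] by simp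
  have FFA: "carrier (free_mod ?B k) \<subseteq> carrier (free_mod A k)" for k using Bc by (auto simp: PiE_iff)
  have lceq: "lin_comb (free_mod ?B k) l x v = lin_comb (free_mod A k) l x v" for k l x v
    by (induction l) (simp_all add: restrict_def)
  have deq: "delta ?B n = delta A n" by (intro ext) (simp add: delta_def)
  have eF: "e \<in> mod_hom ?B ?F ?F" by (rule hom_from_sub[OF c(5) Uc])
  have K0c: "?L \<subseteq> carrier ?G" using K0s by (simp only: F0.submodule_iff)
  have fF: "f \<in> mod_hom ?B ?F ?G" by (rule hom_from_sub[OF c(2)[unfolded Y_def] K0c])
  \<comment> \<open>\<open>e'\<close> and \<open>f'\<close> have the same matrices as
    \<open>e\<close> and \<open>f\<close>, now read over \<open>A\<close>. They agree with them on
    vectors with entries in \<open>S 0\<close> and are linear over \<open>A\<close>.\<close>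
  define e' where "e' x = lin_comb (free_mod A n) n x (\<lambda>i. e (delta A n i))" for x
  define f' where "f' x = lin_comb (free_mod A m) n x (\<lambda>i. f (delta A n i))" for x
  have dc: "delta A n i \<in> carrier ?F" for i unfolding deq[symmetric] by (rule B.delta_closed)
  have e': "e' \<in> mod_hom A (free_mod A n) (free_mod A n)" unfolding e'_def
    using FFA hom_closed[OF eF dc] by (intro FA.lin_comb_hom) blast
  have f': "f' \<in> mod_hom A (free_mod A n) (free_mod A m)" unfolding f'_def
    using FFA hom_closed[OF fF dc] by (intro FA0.lin_comb_hom) blast
  have ee: "e x = e' x" if "x \<in> carrier ?F" for x
    using B.free_hom_eq_lin_comb[OF B.free_left_module eF that] by (simp only: e'_def lceq deq)
  have ff: "f x = f' x" if "x \<in> carrier ?F" for x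
    using B.free_hom_eq_lin_comb[OF B.free_left_module fF that] by (simp only: f'_def lceq deq)
  have zY: "\<zero>\<^bsub>Y\<^esub> = \<zero>\<^bsub>free_mod A m\<^esub>" by (simp add: Y_def)
  have stable: "a \<odot>\<^bsub>free_mod A n\<^esub> x \<in> ?K" if a: "a \<in> S 1" and x: "x \<in> ?K" for a x
  proof -
    have xF: "x \<in> carrier ?F" and xU: "x \<in> U" and fx: "f x = \<zero>\<^bsub>Y\<^esub>" using x Kc by (auto simp: ker_iff simp del: module_power_simps)
    have ac: "a \<in> carrier A" using a subalgebraD(1)[OF subalg[OF s]] by auto
    have xA: "x \<in> carrier (free_mod A n)" using xF FFA by blast
    let ?y = "a \<odot>\<^bsub>free_mod A n\<^esub> x"
    have yc: "?y \<in> carrier ?F"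
    proof -
      have "a \<otimes>\<^bsub>A\<^esub> x i \<in> S 0" if i: "i < n" for i
      proof -
        have "x i \<in> jacobson_radical ?B" by (rule B.superfluous_rad[OF c(1,4) x i])
        then have "a \<otimes>\<^bsub>A\<^esub> x i \<in> jacobson_radical ?B" using rad_props(6)[of 0 a "x i"] a s by simp
        then show ?thesis using rad_props(1)[of 0] by auto
      qed
      then show ?thesis by auto
    qed
    have "e ?y = e' ?y" by (rule ee[OF yc])
    also have "\<dots> = a \<odot>\<^bsub>free_mod A n\<^esub> e' x" by (rule hom_smult[OF e' ac xA])
    also have "e' x = x" using ee[OF xF] c(6) xU by simp
    finally have ey: "e ?y = ?y" .
    have "e ?y \<in> carrier (sub ?F U)" by (rule hom_closed[OF c(5) yc])
    then have yU: "?y \<in> U" unfolding ey by (simp del: module_power_simps)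
    have "f ?y = f' ?y" by (rule ff[OF yc])
    also have "\<dots> = a \<odot>\<^bsub>free_mod A m\<^esub> f' x" by (rule hom_smult[OF f' ac xA])
    also have "f' x = \<zero>\<^bsub>free_mod A m\<^esub>" using ff[OF xF] fx zY by simp
    also have "a \<odot>\<^bsub>free_mod A m\<^esub> \<zero>\<^bsub>free_mod A m\<^esub> = \<zero>\<^bsub>Y\<^esub>" unfolding zY by (rule FA0.smult_zero_r[OF ac])
    finally show ?thesis using yU by (simp add: ker_iff del: module_power_simps)
  qed
  show ?thesis
    by (rule exI[of _ n], rule exI[of _ ?K]) (intro conjI ballI Kc Ks stable Kf sK)
qed

end

text \<open>The additive span \<open>I K\<close> of all products. Negatives come from scalar
  multiplication once \<open>I\<close> is a left ideal.\<close>

inductive_set action_span :: "('a, 'm) module \<Rightarrow> 'a set \<Rightarrow> 'm set \<Rightarrow> 'm set"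
  for M :: "('a, 'm) module" and I :: "'a set" and K :: "'m set" where
  zero: "\<zero>\<^bsub>M\<^esub> \<in> action_span M I K"
| gen: "a \<in> I \<Longrightarrow> x \<in> K \<Longrightarrow> a \<odot>\<^bsub>M\<^esub> x \<in> action_span M I K"
| add: "x \<in> action_span M I K \<Longrightarrow> y \<in> action_span M I K \<Longrightarrow> x \<oplus>\<^bsub>M\<^esub> y \<in> action_span M I K"

lemma action_span_subset:
  assumes "\<zero>\<^bsub>M\<^esub> \<in> K" "\<And>x y. x \<in> K \<Longrightarrow> y \<in> K \<Longrightarrow> x \<oplus>\<^bsub>M\<^esub> y \<in> K" "\<And>a x. a \<in> I \<Longrightarrow> x \<in> K \<Longrightarrow> a \<odot>\<^bsub>M\<^esub> x \<in> K"
  shows "action_span M I K \<subseteq> K"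
proof
  fix x assume "x \<in> action_span M I K"
  then show "x \<in> K" by induction (use assms in auto)
qed

text \<open>Scalars are absorbed into \<open>I\<close> from the left, so \<open>K\<close> may be a
  mere subset. In the application \<open>K\<close> is stable only under a subalgebra of the ring
  that acts on \<open>I K\<close>.\<close>

lemma (in left_module) action_span_submodule:
  assumes I: "I \<subseteq> carrier R" "\<And>r a. r \<in> carrier R \<Longrightarrow> a \<in> I \<Longrightarrow> r \<otimes>\<^bsub>R\<^esub> a \<in> I" and K: "K \<subseteq> carrier M"
  shows "submodule (action_span M I K) R M"
proof -
  have c: "x \<in> carrier M" if "x \<in> action_span M I K" for x
    using that by induction (use I K in auto)
  have "r \<odot>\<^bsub>M\<^esub> x \<in> action_span M I K" if r: "r \<in> carrier R" and x: "x \<in> action_span M I K" for r x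
    using x
  proof induction
    case zero then show ?case using r by (simp add: smult_zero_r action_span.zero)
  next
    case (gen a x)
    have "(r \<otimes>\<^bsub>R\<^esub> a) \<odot>\<^bsub>M\<^esub> x = r \<odot>\<^bsub>M\<^esub> (a \<odot>\<^bsub>M\<^esub> x)" using gen r I K by (intro smult_assoc1) auto
    then show ?case using action_span.gen[OF I(2)[OF r gen(1)] gen(2), of M] by simp
  next
    case (add x y)
    have "r \<odot>\<^bsub>M\<^esub> (x \<oplus>\<^bsub>M\<^esub> y) = r \<odot>\<^bsub>M\<^esub> x \<oplus>\<^bsub>M\<^esub> r \<odot>\<^bsub>M\<^esub> y" by (rule smult_r_distr[OF r c[OF add(1)] c[OF add(2)]])
    then show ?case using action_span.add[OF add.IH] by simp
  qed
  then show ?thesis unfolding submodule_iff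
    by (intro conjI ballI subsetI c action_span.zero action_span.add) assumption+
qed

context fl_ring
begin

lemma syz_pow_support: "set_mset ((syz ^^ n) m) \<subseteq> (\<Union>u\<in>set_mset m. set_mset ((syz ^^ n) {#u#}))"
proof (induction m)
  case (add u m)
  have "(syz ^^ n) (add_mset u m) = (syz ^^ n) {#u#} + (syz ^^ n) m" by (simp only: syz_pow_add[symmetric] add_mset_add_single[of u m] add.commute)
  then show ?case using add by auto
qed simp

text \<open>The Igusa-Todorov bound is applied to the given sequence after \<open>n\<close> further
  syzygies. Then the entries of the middle class come from \<open>n\<close>-th syzygies of classes
  in \<open>F\<close> and, as \<open>syz\<close> commutes with its powers, those of the first class
  from first syzygies of classes in \<open>F'\<close>. In the bound \<open>d + n + 2\<close> the
  last summand accounts for the two syzygies already present in the last term.\<close>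

lemma finitistic_dim_bound:
  assumes F: "finite F" "finite F'"
    and ex: "\<And>X :: ('a, 'a carr) module. fg_module R X \<Longrightarrow>
      \<exists>l z. set_mset l \<subseteq> F \<and> set_mset ((syz ^^ n) z) \<subseteq> F' \<and> stable_ses (syz z) l (syz (syz (stable_dec X)))"
  shows "finitistic_dim R < \<infinity>"
proof -
  let ?F = "(\<Union>u\<in>F. set_mset ((syz ^^ n) {#u#})) \<union> (\<Union>u\<in>F'. set_mset ((syz ^^ 1) {#u#}))"
  have "finite ?F" using F by simp
  then obtain d where d: "\<And>a b c. set_mset a \<subseteq> ?F \<Longrightarrow> set_mset b \<subseteq> ?F \<Longrightarrow> stable_ses a b c \<Longrightarrow> finpd c \<Longrightarrow> (syz ^^ d) c = {#}"
    using igusa_todorov by metis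
  have "(syz ^^ (d + n + 2)) (stable_dec X) = {#}" if X: "fg_module R X" and pd: "finpd (stable_dec X)" for X :: "('a, 'a carr) module"
  proof -
    obtain l z where lz: "set_mset l \<subseteq> F" "set_mset ((syz ^^ n) z) \<subseteq> F'" "stable_ses (syz z) l (syz (syz (stable_dec X)))"
      using ex[OF X] by blast
    have sw: "(syz ^^ n) (syz z) = (syz ^^ 1) ((syz ^^ n) z)" by (simp add: funpow_swap1)
    have x: "(syz ^^ n) (syz (syz (stable_dec X))) = (syz ^^ (n + 2)) (stable_dec X)" by (simp add: funpow_add funpow_swap1)
    have "(syz ^^ d) ((syz ^^ n) (syz (syz (stable_dec X)))) = {#}"
    proof (rule d[OF _ _ stable_ses_syz_pow[OF lz(3)]])
      have "set_mset ((syz ^^ 1) ((syz ^^ n) z)) \<subseteq> (\<Union>u\<in>set_mset ((syz ^^ n) z). set_mset ((syz ^^ 1) {#u#}))" by (rule syz_pow_support)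
      also have "\<dots> \<subseteq> ?F" using lz(2) by blast
      finally show "set_mset ((syz ^^ n) (syz z)) \<subseteq> ?F" unfolding sw .
      have "set_mset ((syz ^^ n) l) \<subseteq> (\<Union>u\<in>set_mset l. set_mset ((syz ^^ n) {#u#}))" by (rule syz_pow_support)
      also have "\<dots> \<subseteq> ?F" using lz(1) by blast
      finally show "set_mset ((syz ^^ n) l) \<subseteq> ?F" .
      show "finpd ((syz ^^ n) (syz (syz (stable_dec X))))" unfolding x by (rule finpd_pow[OF pd])
    qed
    then show ?thesis unfolding x by (simp only: funpow_add[of d "n + 2"] add.assoc comp_apply)
  qed
  then show ?thesis by (rule finitistic_dim_finite)
qed

end

text \<open>For \<open>K \<le> A\<^sup>n\<close> closed under \<open>C\<close> and a left ideal \<open>I\<close> of \<open>A\<close> that is an ideal of \<open>C\<close>, the module \<open>I K\<close> is a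
  submodule of \<open>A\<^sup>n\<close> over \<open>A\<close>, hence a first syzygy over \<open>A\<close>, whereas \<open>K / I K\<close> is a module over \<open>C / I\<close>.\<close>

context radical_tower
begin

lemma exact_sequence:
  assumes j: "j \<le> 1" and X: "fg_module (SA (S 0)) (X :: ('a, 'a carr) module)"
  defines "I \<equiv> rad_product A S j (s - j)"
  shows "\<exists>n L (Z :: ('a set, 'a carr) module). submodule L A (free_mod A n) \<and> fg_module (SA (S j) Quot I) Z \<and>
    fl_ring.stable_ses (SA (S 0)) (fl_ring.syz (SA (S 0)) (fl_ring.stable_dec (SA (S 0)) (restrict_scalars (\<lambda>b. I +>\<^bsub>A\<^esub> b) Z)))
      (fl_ring.stable_dec (SA (S 0)) (sub (free_mod A n) L)) (fl_ring.syz (SA (S 0)) (fl_ring.syz (SA (S 0)) (fl_ring.stable_dec (SA (S 0)) X)))"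
proof -
  let ?B = "SA (S 0)" and ?C = "SA (S j)"
  have js: "j \<le> s" using j s by simp
  have sa: "unital_subalgebra R A (S 0)" "unital_subalgebra R A (S j)" using subalg js by auto
  have S0j: "S 0 \<subseteq> S j" and Sj1: "S j \<subseteq> S 1" and SjA: "S j \<subseteq> carrier A"
    using S_mono[of 0 j] S_mono[of j 1] S_mono[of j s] js j s top by auto
  have II: "ideal I ?C" unfolding I_def by (rule rad_product_ideal[OF js])
  have Ip: "I \<subseteq> S j" "\<And>r a. r \<in> carrier A \<Longrightarrow> a \<in> I \<Longrightarrow> r \<otimes>\<^bsub>A\<^esub> a \<in> I"
    using rad_product_props[of j "s - j"] js top by (auto simp: I_def)
  have AA: "unital_subalgebra R A (carrier A)" using subalg[of s] top by simp
  interpret B: fl_ring ?B by (rule sub_fl[OF sa(1)])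
  interpret C: fl_ring ?C by (rule sub_fl[OF sa(2)])
  interpret A': fl_ring A using sub_fl[OF AA] by simp
  have rBA: "restriction ?B A (\<lambda>x. x)" and rCA: "restriction ?C A (\<lambda>x. x)"
    using sub_restriction[OF sa(1) AA] sub_restriction[OF sa(2) AA SjA] S0j SjA by auto
  have rBC: "restriction ?B ?C (\<lambda>x. x)" by (rule sub_restriction[OF sa S0j])
  have rQ: "restriction ?B (?C Quot I) (\<lambda>b. I +>\<^bsub>A\<^esub> b)" by (rule quot_restriction[OF sa S0j II])
  note res = restriction.res_fg[OF rBA, unfolded restrict_id] restriction.res_fg[OF rCA, unfolded restrict_id]
    restriction.res_fg[OF rBC, unfolded restrict_id]
  obtain n K where K: "submodule K ?B (free_mod ?B n)" "\<And>a x. a \<in> S 1 \<Longrightarrow> x \<in> K \<Longrightarrow> a \<odot>\<^bsub>free_mod A n\<^esub> x \<in> K"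
    "fg_module ?B (sub (free_mod A n) K)" "B.stable_dec (sub (free_mod A n) K) = B.syz (B.syz (B.stable_dec X))"
    using second_syzygy[OF X] by blast
  define G where "G = free_mod A n"
  have Gf: "fg_module A G" unfolding G_def by (rule A.free_fg)
  have GC: "fg_module ?C G" by (rule res(2)[OF Gf])
  interpret G: left_module A G by (rule fg_left_module[OF Gf])
  interpret GC: left_module ?C G by (rule fg_left_module[OF GC])
  interpret FB: left_module ?B "free_mod ?B n" by (rule B.free_left_module)
  have Gz: "\<zero>\<^bsub>free_mod ?B n\<^esub> = \<zero>\<^bsub>G\<^esub>" "add (free_mod ?B n) = add G" by (simp_all add: G_def)
  have Gc: "carrier (free_mod ?B n) \<subseteq> carrier G" using S0j SjA by (auto simp: G_def PiE_iff)
  have Kp: "K \<subseteq> carrier G" "\<zero>\<^bsub>G\<^esub> \<in> K" "\<And>x y. x \<in> K \<Longrightarrow> y \<in> K \<Longrightarrow> x \<oplus>\<^bsub>G\<^esub> y \<in> K"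
    using K(1) Gc unfolding FB.submodule_iff Gz by blast+
  have Ks: "a \<odot>\<^bsub>G\<^esub> x \<in> K" if "a \<in> S j" "x \<in> K" for a x using K(2)[of a x] that Sj1 by (auto simp: G_def simp del: module_power_simps)
  have KC: "submodule K ?C G" unfolding GC.submodule_iff using Kp Ks by simp
  define M where "M = sub G K"
  have MC: "fg_module ?C M" unfolding M_def by (rule C.fg_sub[OF GC KC])
  have MB: "fg_module ?B M" by (rule res(3)[OF MC])
  have Ms: "B.stable_dec M = B.syz (B.syz (B.stable_dec X))" unfolding M_def G_def by (rule K(4))
  interpret M: left_module ?C M by (rule fg_left_module[OF MC])
  define L where "L = action_span G I K"
  \<comment> \<open>As the product of radicals is a left ideal of \<open>A\<close>, this is a
    submodule over \<open>A\<close>, although \<open>K\<close> is only known to be stable under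
    \<open>S 1\<close>.\<close>
  have LA: "submodule L A G" unfolding L_def using Ip SjA Kp(1) by (intro G.action_span_submodule) auto
  have LK: "L \<subseteq> K" unfolding L_def using Kp Ks Ip(1) by (intro action_span_subset) auto
  have Lf: "fg_module ?B (sub G L)" by (rule res(1)[OF A'.fg_sub[OF Gf LA]])
  have LC: "submodule L ?C M" unfolding M_def GC.submodule_sub_iff[OF KC] GC.submodule_iff
    using LA LK SjA unfolding G.submodule_iff by auto
  obtain Q :: "('a, 'a carr) module" and q where Q: "fg_module ?C Q" "q \<in> mod_hom ?C M Q" "q ` carrier M = carrier Q" "ker M Q q = L"
    using C.quotient_exists[OF MC LC] by blast
  interpret Q: left_module ?C Q by (rule fg_left_module[OF Q(1)])
  have QB: "fg_module ?B Q" by (rule res(3)[OF Q(1)])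
  \<comment> \<open>The products of \<open>I\<close> with \<open>K\<close> lie in \<open>L\<close>
    by construction, so \<open>I\<close> annihilates the quotient.\<close>
  have kill: "c \<odot>\<^bsub>Q\<^esub> z = \<zero>\<^bsub>Q\<^esub>" if c: "c \<in> I" and z: "z \<in> carrier Q" for c z
  proof -
    obtain x where x: "x \<in> K" "z = q x" using z Q(3) by (auto simp: M_def)
    have "c \<odot>\<^bsub>M\<^esub> x \<in> L" using action_span.gen[OF c x(1), of G] by (simp add: L_def M_def)
    then have "q (c \<odot>\<^bsub>M\<^esub> x) = \<zero>\<^bsub>Q\<^esub>" unfolding Q(4)[symmetric] by (simp add: ker_iff)
    then show ?thesis using hom_smult[OF Q(2), of c x] c x Ip(1) by (auto simp: M_def)
  qed
  have co: "I +>\<^bsub>A\<^esub> b = I +>\<^bsub>?C\<^esub> b" for b by (simp add: a_r_coset_def r_coset_def)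
  interpret I: ideal I ?C by (rule II)
  have "\<exists>Z :: ('a set, 'a carr) module. left_module (?C Quot I) Z \<and> carrier Z = carrier Q \<and> zero Z = zero Q \<and> add Z = add Q \<and>
     (\<forall>c\<in>carrier ?C. \<forall>z\<in>carrier Q. (I +>\<^bsub>?C\<^esub> c) \<odot>\<^bsub>Z\<^esub> z = c \<odot>\<^bsub>Q\<^esub> z)"
  proof (rule descend_module[OF fg_left_module[OF Q(1)] I.quotient_is_ring I.rcos_ring_hom quot_surj[OF II]])
    fix c z assume "c \<in> carrier ?C" "I +>\<^bsub>?C\<^esub> c = \<zero>\<^bsub>?C Quot I\<^esub>" "z \<in> carrier Q"
    then show "c \<odot>\<^bsub>Q\<^esub> z = \<zero>\<^bsub>Q\<^esub>" using kill quot_eq_zero[OF II] by blast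
  qed
  then obtain Z :: "('a set, 'a carr) module" where Z: "left_module (?C Quot I) Z" "carrier Z = carrier Q" "zero Z = zero Q" "add Z = add Q"
     "\<And>c z. c \<in> carrier ?C \<Longrightarrow> z \<in> carrier Q \<Longrightarrow> (I +>\<^bsub>?C\<^esub> c) \<odot>\<^bsub>Z\<^esub> z = c \<odot>\<^bsub>Q\<^esub> z" by blast
  interpret Z: left_module "?C Quot I" Z by (rule Z(1))
  \<comment> \<open>Submodules of \<open>Z\<close> are submodules of \<open>Q\<close>, so generators
    of \<open>Q\<close> also generate \<open>Z\<close>.\<close>
  have "submodule U ?C Q" if U: "submodule U (?C Quot I) Z" for U
    unfolding Q.submodule_iff
  proof (intro conjI ballI)
    note u = U[unfolded Z.submodule_iff Z(2-4)]
    show "U \<subseteq> carrier Q" "\<zero>\<^bsub>Q\<^esub> \<in> U" using u by blast+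
    show "x \<oplus>\<^bsub>Q\<^esub> y \<in> U" if "x \<in> U" "y \<in> U" for x y using u that by blast
    fix c x assume c: "c \<in> carrier ?C" "x \<in> U"
    have "I +>\<^bsub>?C\<^esub> c \<in> carrier (?C Quot I)" using quot_surj[OF II] c(1) by blast
    then have "(I +>\<^bsub>?C\<^esub> c) \<odot>\<^bsub>Z\<^esub> x \<in> U" using u c(2) by blast
    then show "c \<odot>\<^bsub>Q\<^esub> x \<in> U" using Z(5)[OF c(1), of x] c(2) u by auto
  qed
  moreover obtain T where "finite T" "T \<subseteq> carrier Q" "\<And>U. submodule U ?C Q \<Longrightarrow> T \<subseteq> U \<Longrightarrow> U = carrier Q"
    using Q(1) unfolding fg_module_def finitely_generated_def by blast
  ultimately have Zf: "fg_module (?C Quot I) Z" unfolding fg_module_def finitely_generated_def Z(2) using Z(1) by blast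
  let ?Z = "restrict_scalars (\<lambda>b. I +>\<^bsub>A\<^esub> b) Z"
  have ZB: "fg_module ?B ?Z" by (rule restriction.res_fg[OF rQ Zf])
  have "mod_iso ?B Q ?Z" unfolding mod_iso_def
  proof (rule bexI)
    show "bij_betw (\<lambda>x. x) (carrier Q) (carrier ?Z)" using Z(2) by (simp add: bij_betw_def)
    show "(\<lambda>x. x) \<in> mod_hom ?B Q ?Z" by (rule mod_homI) (use Z S0j co in auto)
  qed
  then have sQ: "B.stable_dec ?Z = B.stable_dec Q" using B.stable_dec_cong[OF QB ZB] by simp
  have "ses ?B (sub G L) M Q"
  proof (rule sesI)
    show "(\<lambda>x. x) \<in> mod_hom ?B (sub G L) M" unfolding M_def by (rule mod_homI) (use LK in auto)
    show "q \<in> mod_hom ?B M Q" using restrict_hom[OF Q(2) sub_id_hom[OF S0j]] by (simp only: restrict_id)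
    show "q ` carrier M = carrier Q" by (rule Q(3))
  qed (simp_all add: Q(4))
  then have "B.stable_ses (B.syz (B.stable_dec Q)) (B.stable_dec (sub G L)) (B.stable_dec M)" by (rule B.stable_ses_rotate[OF Lf MB QB])
  then have "B.stable_ses (B.syz (B.stable_dec ?Z)) (B.stable_dec (sub (free_mod A n) L)) (B.syz (B.syz (B.stable_dec X)))" unfolding sQ Ms G_def .
  then show ?thesis using LA Zf unfolding G_def by blast
qed

text \<open>The case \<open>j = 0\<close> is condition (1) and the case \<open>j = 1\<close> is
  condition (2). One sequence serves both, since the second syzygies in question are stable under
  \<open>S 1\<close> and hence under \<open>S j\<close>.\<close>

theorem finitistic_dim_tower:
  assumes j: "j \<le> 1" and A1: "one_syzygy_finite A"
    and Q: "syzygy_finite_over (SA (S 0)) (\<lambda>b. rad_product A S j (s - j) +>\<^bsub>A\<^esub> b) (SA (S j) Quot rad_product A S j (s - j))"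
  shows "finitistic_dim (SA (S 0)) < \<infinity>"
proof -
  let ?B = "SA (S 0)" and ?C = "SA (S j)" and ?I = "rad_product A S j (s - j)"
  have js: "j \<le> s" using j s by simp
  have sa: "unital_subalgebra R A (S 0)" "unital_subalgebra R A (S j)" "unital_subalgebra R A (carrier A)"
    using subalg[of 0] subalg[of j] subalg[of s] js top by auto
  have S0: "S 0 \<subseteq> S j" "S 0 \<subseteq> carrier A" using S_mono[of 0 j] S_mono[of 0 s] js top by auto
  interpret B: fl_ring ?B by (rule sub_fl[OF sa(1)])
  interpret A': fl_ring A using sub_fl[OF sa(3)] by simp
  have rBA: "restriction ?B A (\<lambda>x. x)" using sub_restriction[OF sa(1,3) S0(2)] by simp
  have rQ: "restriction ?B (?C Quot ?I) (\<lambda>b. ?I +>\<^bsub>A\<^esub> b)" by (rule quot_restriction[OF sa(1,2) S0(1) rad_product_ideal[OF js]])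
  obtain F where F: "finite F" "\<And>n L. submodule L A (free_mod A n) \<Longrightarrow> set_mset (A'.dec (sub (free_mod A n) L)) \<subseteq> F"
    using A'.one_syzygy_finite_support[OF A1] by blast
  obtain k F' where F': "finite F'" "\<And>Z :: ('a set, 'a carr) module. fg_module (?C Quot ?I) Z \<Longrightarrow>
      set_mset ((B.syz ^^ k) (B.stable_dec (restrict_scalars (\<lambda>b. ?I +>\<^bsub>A\<^esub> b) Z))) \<subseteq> F'"
    using restriction.syzygy_finite_support[OF rQ Q] by blast
  \<comment> \<open>The finite set for the middle term consists of the \<open>B\<close>-summands of
    those finitely many indecomposable \<open>A\<close>-modules that occur in submodules of free
    \<open>A\<close>-modules.\<close>
  let ?F = "\<Union>u\<in>F. set_mset (B.dec u)"
  show ?thesis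
  proof (rule B.finitistic_dim_bound[of ?F F' k])
    show "finite ?F" using F(1) by simp
    fix X :: "('a, 'a carr) module" assume "fg_module ?B X"
    from exact_sequence[OF j this] obtain n L and Z :: "('a set, 'a carr) module" where
      L: "submodule L A (free_mod A n)" and Z: "fg_module (?C Quot ?I) Z" and
      e: "B.stable_ses (B.syz (B.stable_dec (restrict_scalars (\<lambda>b. ?I +>\<^bsub>A\<^esub> b) Z))) (B.stable_dec (sub (free_mod A n) L)) (B.syz (B.syz (B.stable_dec X)))"
      by blast
    have "set_mset (B.stable_dec (sub (free_mod A n) L)) \<subseteq> set_mset (B.dec (sub (free_mod A n) L))" by (auto simp: B.stable_dec_def)
    also have "\<dots> \<subseteq> (\<Union>u\<in>set_mset (A'.dec (sub (free_mod A n) L)). set_mset (B.dec u))"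
      using restriction.dec_support[OF rBA A'.fg_sub[OF A.free_fg L]] by (simp only: restrict_id)
    also have "\<dots> \<subseteq> ?F" using F(2)[OF L] by blast
    finally show "\<exists>l z. set_mset l \<subseteq> ?F \<and> set_mset ((B.syz ^^ k) z) \<subseteq> F' \<and> B.stable_ses (B.syz z) l (B.syz (B.syz (B.stable_dec X)))"
      using F'(2)[OF Z] e by (intro exI conjI)
  qed (rule F'(1))
qed

lemma rep_finite_tower:
  assumes j: "j \<le> 1" and "representation_finite (SA (S j) Quot rad_product A S j (s - j))"
  shows "syzygy_finite_over (SA (S 0)) (\<lambda>b. rad_product A S j (s - j) +>\<^bsub>A\<^esub> b) (SA (S j) Quot rad_product A S j (s - j))"
proof -
  have js: "j \<le> s" using j s by simp
  show ?thesis
    using subalg[of 0] subalg[of j] S_mono[of 0 j] js rad_product_ideal[OF js]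
    by (intro restriction.rep_finite_syzygy_finite[OF quot_restriction assms(2)]) auto
qed

end

theorem proposition1p3:
  fixes R :: "('r, 'x) ring_scheme" and A :: "('r, 'a) module"
    and S :: "nat \<Rightarrow> 'a set" and s :: nat
  defines "B \<equiv> A\<lparr>carrier := S 0\<rparr>"
    and "A1 \<equiv> A\<lparr>carrier := S 1\<rparr>"
    and "I \<equiv> rad_product A S 0 s"
    and "J \<equiv> rad_product A S 1 (s - 1)"
  assumes "artin_algebra R A"
    and "s \<ge> 1"
    and "\<And>i. i \<le> s \<Longrightarrow> unital_subalgebra R A (S i)"
    and "\<And>i. 1 \<le> i \<Longrightarrow> i \<le> s \<Longrightarrow> S (i - 1) \<subseteq> S i"
    and "S s = carrier A"
    and "\<And>i. 1 \<le> i \<Longrightarrow> i \<le> s \<Longrightarrow>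
          left_ideal (jacobson_radical (A\<lparr>carrier := S (i - 1)\<rparr>)) (A\<lparr>carrier := S i\<rparr>)"
    and "one_syzygy_finite A"
  shows "(syzygy_finite_over B (\<lambda>b. I +>\<^bsub>A\<^esub> b) (B Quot I) \<or>
          syzygy_finite_over B (\<lambda>b. J +>\<^bsub>A\<^esub> b) (A1 Quot J) \<longrightarrow> finitistic_dim B < \<infinity>) \<and>
         (representation_finite (B Quot I) \<longrightarrow>
          syzygy_finite_over B (\<lambda>b. I +>\<^bsub>A\<^esub> b) (B Quot I)) \<and>
         (representation_finite (A1 Quot J) \<longrightarrow>
          syzygy_finite_over B (\<lambda>b. J +>\<^bsub>A\<^esub> b) (A1 Quot J))"
proof -
  interpret radical_tower R A S s
    by (intro radical_tower.intro radical_tower_axioms.intro) (fact assms)+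
  \<comment> \<open>For \<open>s = 1\<close> the ideal \<open>J\<close> is an empty product, that is
    all of \<open>S 1\<close>; this is the instance \<open>j = 1\<close> with no radical
    factor.\<close>
  show ?thesis
    using finitistic_dim_tower[of 0] finitistic_dim_tower[of 1] rep_finite_tower[of 0] rep_finite_tower[of 1] assms(11)
    unfolding B_def A1_def I_def J_def by auto
qed

end
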